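(* Let $d\ge m_1\ge m_2\ge\dots\ge m_9\ge 0$ be integers with $\max(m_i)\le 8$. Let $\mathcal{L}=\mathcal{L}_{3,d}(m_1,\dots,m_9)$ be the linear system of surfaces of degree $d$ in $\mathbb{P}^3$ with multiplicity at least $m_i$ at $p_i$, where $p_1,\dots,p_9\in\mathbb{P}^3$ are points in general position, and let $Q$ be the unique quadric surface through $p_1,\dots,p_9$. Then the Laface-Ugaglia Conjecture is true for $\mathcal{L}$. That is, if $\mathcal{L}$ is Cremona reduced, then: (1) if $q(\mathcal{L})\le 0$, then $\dim(\mathcal{L})=\dim(\mathcal{L}-Q)$; (2) if $q(\mathcal{L})>0$, then $\mathcal{L}$ is linearly non-special.
   Context: We work over the complex numbers. Dimensions are affine (vector space) dimensions. For $\mathcal{L}=\mathcal{L}_{3,d}(m_1,\dots,m_9)$ with $d\ge m_1\ge\dots\ge m_9\ge0$: - $\mathcal{L}$ is Cremona reduced if $m_1+m_2+m_3+m_4\le 2d$. - $q(\mathcal{L})=\chi(\mathcal{L}|_Q)=(d+1)^2-\sum_{i=1}^9\binom{m_i+1}{2}$. - $\mathcal{L}-Q$ is the residual system $\mathcal{L}_{3,d-2}(m_1-1,\dots,m_9-1)$ with respect to $Q$, based at the same points (a multiplicity $-1$ imposes no condition; the system is zero if $d<2$). - $\operatorname{vdim}(\mathcal{L})=\chi(\mathcal{L})=\binom{d+3}{3}-\sum_{i=1}^9\binom{m_i+2}{3}$. - A Cremona reduced system $\mathcal{L}$ is linearly non-special if its dimension equals its linear expected dimension (the expected dimension corrected by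 the contributions of the linear cycles in the base locus; for Cremona reduced systems in $\mathbb{P}^3$ only lines through pairs of points contribute), i.e. if $$\dim(\mathcal{L})=\max\Big(0,\ \chi(\mathcal{L})+\sum_{i<j,\ m_i+m_j-d\ge 2}\binom{m_i+m_j-d+1}{3}\Big).$$ *)

theory Defs
  imports "HOL-Analysis.Analysis" "HOL-Library.Poly_Mapping"
begin

text \<open>
  Polynomials with complex coefficients in variables \<open>'v\<close>, as finitely supported maps from
  exponent vectors to coefficients.
\<close>

type_synonym 'v cpoly = "('v \<Rightarrow>\<^sub>0 nat) \<Rightarrow>\<^sub>0 complex"

definition cpoly_scale :: "complex \<Rightarrow> 'v cpoly \<Rightarrow> 'v cpoly" where
  "cpoly_scale c F = Poly_Mapping.single 0 c * F"

global_interpretation cpoly: vector_space cpoly_scale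
  defines cpoly_span = cpoly.span
    and cpoly_dim = cpoly.dim
  by standard
    (simp_all add: cpoly_scale_def distrib_left distrib_right single_add mult_single
      flip: mult.assoc)

definition poly_eval :: "('v \<Rightarrow> complex) \<Rightarrow> 'v cpoly \<Rightarrow> complex" where
  "poly_eval x F =
    (\<Sum>\<alpha>\<in>Poly_Mapping.keys F. Poly_Mapping.lookup F \<alpha> * (\<Prod>v\<in>Poly_Mapping.keys \<alpha>. x v ^ Poly_Mapping.lookup \<alpha> v))"

text \<open>
  Exponent vectors are subtracted with truncation, but the terms in which this matters
  (those not containing \<open>v\<close>) get coefficient 0.
\<close>

definition partial_deriv :: "'v \<Rightarrow> 'v cpoly \<Rightarrow> 'v cpoly" where
  "partial_deriv v F =
    (\<Sum>\<alpha>\<in>Poly_Mapping.keys F. Poly_Mapping.single (\<alpha> - Poly_Mapping.single v 1)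
                      (of_nat (Poly_Mapping.lookup \<alpha> v) * Poly_Mapping.lookup F \<alpha>))"

definition homogeneous :: "int \<Rightarrow> 'v::finite cpoly \<Rightarrow> bool" where
  "homogeneous d F \<longleftrightarrow> (\<forall>\<alpha>\<in>Poly_Mapping.keys F. int (\<Sum>v\<in>UNIV. Poly_Mapping.lookup \<alpha> v) = d)"

text \<open>
  \<open>vanishes_to_order m F x\<close>: all partial derivatives of \<open>F\<close> of order less than \<open>m\<close> vanish
  at \<open>x\<close> (no condition if \<open>m \<le> 0\<close>). For a form \<open>F\<close> in four variables and a vector \<open>x \<noteq> 0\<close>
  this says that the surface \<open>F = 0\<close> in \<open>\<bbbP>\<^sup>3\<close> has multiplicity at least \<open>m\<close> at the point
  with homogeneous coordinates \<open>x\<close>; it does not depend on the choice of \<open>x\<close>.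
\<close>

definition vanishes_to_order :: "int \<Rightarrow> 4 cpoly \<Rightarrow> complex ^ 4 \<Rightarrow> bool" where
  "vanishes_to_order m F x \<longleftrightarrow>
    (\<forall>vs. int (length vs) < m \<longrightarrow> poly_eval (\<lambda>v. x $ v) (fold partial_deriv vs F) = 0)"

text \<open>
  The system \<open>\<L>\<^bsub>3,d\<^esub>(m\<^sub>1,\<dots>,m\<^sub>9)\<close> based at \<open>p\<^sub>1,\<dots>,p\<^sub>9\<close>, as the vector space of all forms
  (including 0) satisfying the conditions. Multiplicities and points are indexed by
  \<open>1,\<dots>,9\<close>; values at other indices are ignored. For \<open>d < 0\<close> the system is \<open>{0}\<close>.
\<close>

definition linear_system :: "int \<Rightarrow> (nat \<Rightarrow> int) \<Rightarrow> (nat \<Rightarrow> complex ^ 4) \<Rightarrow> 4 cpoly set" where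
  "linear_system d m p =
    {F. homogeneous d F \<and> (\<forall>i\<in>{1..9}. vanishes_to_order (m i) F (p i))}"

definition residual_system :: "int \<Rightarrow> (nat \<Rightarrow> int) \<Rightarrow> (nat \<Rightarrow> complex ^ 4) \<Rightarrow> 4 cpoly set" where
  "residual_system d m p = linear_system (d - 2) (\<lambda>i. m i - 1) p"

definition is_unique_quadric_through :: "4 cpoly \<Rightarrow> (nat \<Rightarrow> complex ^ 4) \<Rightarrow> bool" where
  "is_unique_quadric_through Q p \<longleftrightarrow>
    Q \<noteq> 0 \<and> linear_system 2 (\<lambda>_. 1) p = cpoly_span {Q}"

definition cremona_reduced :: "int \<Rightarrow> (nat \<Rightarrow> int) \<Rightarrow> bool" where
  "cremona_reduced d m \<longleftrightarrow> m 1 + m 2 + m 3 + m 4 \<le> 2 * d"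

text \<open>
  The numerical invariants are only used for \<open>d \<ge> 0\<close> and \<open>m i \<ge> 0\<close>, where \<open>nat\<close> does not
  truncate.
\<close>

definition q_char :: "int \<Rightarrow> (nat \<Rightarrow> int) \<Rightarrow> int" where
  "q_char d m = (d + 1)\<^sup>2 - (\<Sum>i=1..9. int (nat (m i + 1) choose 2))"

definition euler_char :: "int \<Rightarrow> (nat \<Rightarrow> int) \<Rightarrow> int" where
  "euler_char d m = int (nat (d + 3) choose 3) - (\<Sum>i=1..9. int (nat (m i + 2) choose 3))"

definition linear_expected_dim :: "int \<Rightarrow> (nat \<Rightarrow> int) \<Rightarrow> int" where
  "linear_expected_dim d m =
    max 0 (euler_char d m +
      (\<Sum>(i, j) \<in> {(i, j). i \<in> {1..9} \<and> j \<in> {1..9} \<and> i < j \<and> m i + m j - d \<ge> 2}.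
        int (nat (m i + m j - d + 1) choose 3)))"

definition linearly_nonspecial :: "int \<Rightarrow> (nat \<Rightarrow> int) \<Rightarrow> (nat \<Rightarrow> complex ^ 4) \<Rightarrow> bool" where
  "linearly_nonspecial d m p \<longleftrightarrow>
    int (cpoly_dim (linear_system d m p)) = linear_expected_dim d m"

text \<open>
  \<open>P\<close> holds for nine points of \<open>\<bbbP>\<^sup>3\<close> in general position, i.e. on a nonempty Zariski open
  subset of \<open>(\<bbbP>\<^sup>3)\<^sup>9\<close>. Points are given by nonzero vectors of homogeneous coordinates. Since
  every nonempty open set contains a nonempty basic one, the open set is taken to be the locus
  where a nonzero multihomogeneous polynomial \<open>G\<close> (of degree \<open>e i\<close> in the coordinates of the
  \<open>i\<close>-th point) does not vanish; the variable \<open>(i, v)\<close> is the coordinate \<open>v\<close> of point \<open>i\<close>.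
\<close>

definition for_general_points :: "((nat \<Rightarrow> complex ^ 4) \<Rightarrow> bool) \<Rightarrow> bool" where
  "for_general_points P \<longleftrightarrow>
    (\<exists>(G :: (nat \<times> 4) cpoly) (e :: nat \<Rightarrow> nat).
      G \<noteq> 0 \<and>
      (\<forall>\<alpha>\<in>Poly_Mapping.keys G. Poly_Mapping.keys \<alpha> \<subseteq> {1..9} \<times> UNIV \<and>
        (\<forall>i\<in>{1..9}. (\<Sum>v\<in>UNIV. Poly_Mapping.lookup \<alpha> (i, v)) = e i)) \<and>
      (\<forall>p. (\<forall>i\<in>{1..9}. p i \<noteq> 0) \<and> poly_eval (\<lambda>(i, v). p i $ v) G \<noteq> 0 \<longrightarrow> P p))"

end

theory Submission
  imports Defs "HOL-Computational_Algebra.Polynomial"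
begin

text \<open>For the points \<open>(1, x, y, x y)\<close> of a smooth quadric \<open>Q\<close>, forms of degree \<open>d\<close> restrict to polynomials with
  monomials \<open>x^a y^b\<close>, \<open>0 \<le> a, b \<le> d\<close>. If the system of restrictions has the dimension
  \<open>max 0 q\<close> expected on \<open>Q\<close>, then \<open>dim \<L> \<le> dim (\<L> - Q) + max 0 q\<close>, and this can be iterated until a
  multiplicity equals the degree (then \<open>\<L> - Q\<close> is zero) or only three multiplicities are positive (then
  \<open>\<L>\<close> is spanned by monomials). By semicontinuity the upper bounds carry over to general points.
  In the other direction, \<open>\<L> - Q\<close> embeds into \<open>\<L>\<close>, and counting conditions, less the redundant ones
  along the lines through the first point, shows that the linear expected dimension is a lower bound.
  The two bounds agree if \<open>q \<ge> 0\<close>, since then also \<open>q (\<L> - Q) \<ge> 0\<close>.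

  The dimension of the restricted systems is found by toric degeneration: if half planes successively cut
  the square of monomials into nine pieces, and the conditions of the \<open>i\<close>-th point are independent on the
  \<open>i\<close>-th piece, then the nine points jointly impose independent conditions, or else exclude every nonzero
  form if the pieces exhaust the square. As the multiplicities are at most 8, finitely many such dissections
  cover all Cremona reduced cases.\<close>

text \<open>Points in general position carry their quadric along when they move. Upper bounds are
  therefore computed on one fixed quadric and reach general points only through semicontinuity,
  whereas the lower bounds are proved off the quadric from the start. For \<open>q < 0\<close> there
  is no closed formula for the dimension. The induction on the degree hence carries an unspecified
  number \<open>u\<close> that bounds the dimension from both sides, and identifies it with the
  formula \<open>ell\<close> only when \<open>q \<ge> 0\<close>. The bound 8 enters only through the
  systems on the quadric. From degree 17 on one dissection suffices, because 9 * 36 = 18 * 18; case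
  distinctions are confined to degrees up to 16. There the list of dissections stays short by two
  monotonicities: independent conditions stay independent for smaller multiplicities and larger
  degrees, and a system without nonzero forms stays so for larger multiplicities and smaller
  degrees.\<close>

section \<open>Injectivity of interpolation matrices\<close>

text \<open>Fraction-free Gaussian elimination: injectivity at \<open>p0\<close> is witnessed by a product of pivots, which
  lies in the graded family \<open>H\<close> generated by the entries.\<close>

lemma elimination:
  fixes H :: "'e::comm_monoid_add \<Rightarrow> ('p \<Rightarrow> complex) set"
    and a :: "'r \<Rightarrow> 'k \<Rightarrow> 'p \<Rightarrow> complex"
  assumes H_one: "(\<lambda>_. 1) \<in> H 0"
    and H_mult: "\<And>f g e e'. f \<in> H e \<Longrightarrow> g \<in> H e' \<Longrightarrow> (\<lambda>p. f p * g p) \<in> H (e + e')"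
    and H_diff: "\<And>f g e. f \<in> H e \<Longrightarrow> g \<in> H e \<Longrightarrow> (\<lambda>p. f p - g p) \<in> H e"
    and "finite K"
    and "\<And>r k. r \<in> R \<Longrightarrow> k \<in> K \<Longrightarrow> a r k \<in> H (e r)"
    and "\<And>c. (\<forall>r\<in>R. (\<Sum>k\<in>K. c k * a r k p0) = 0) \<Longrightarrow> \<forall>k\<in>K. c k = 0"
  shows "\<exists>g d. g \<in> H d \<and> g p0 \<noteq> 0 \<and>
    (\<forall>p. g p \<noteq> 0 \<longrightarrow> (\<forall>c. (\<forall>r\<in>R. (\<Sum>k\<in>K. c k * a r k p) = 0) \<longrightarrow> (\<forall>k\<in>K. c k = 0)))"
  using assms(4-)
proof (induction K arbitrary: a e rule: finite_induct)
  case empty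
  show ?case using H_one by (intro exI[of _ "\<lambda>_. 1"] exI[of _ 0]) auto
next
  case (insert k0 K a e)
  \<comment> \<open>A pivot exists: if column \<open>k0\<close> vanished at \<open>p0\<close>, its
    unit vector would be a nonzero kernel vector.\<close>
  obtain r0 where r0: "r0 \<in> R" "a r0 k0 p0 \<noteq> 0"
  proof (rule ccontr)
    assume "\<not> thesis"
    then have z: "\<forall>r\<in>R. a r k0 p0 = 0" using that by blast
    have "\<forall>k\<in>insert k0 K. (if k = k0 then 1 else 0 :: complex) = 0"
    proof (rule insert.prems(2), intro ballI)
      fix r assume r: "r \<in> R"
      have "(\<Sum>k\<in>K. (if k = k0 then 1 else 0) * a r k p0) = 0"
        using insert.hyps by (intro sum.neutral) auto
      then show "(\<Sum>k\<in>insert k0 K. (if k = k0 then 1 else 0) * a r k p0) = 0"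
        using insert.hyps z r by simp
    qed
    then show False by simp
  qed
  \<comment> \<open>Cross multiplication instead of division by the pivot keeps the entries in
    \<open>H\<close> and row \<open>r\<close> homogeneous, of degree
    \<open>e r0 + e r\<close>.\<close>
  define a' where "a' = (\<lambda>r k p. a r0 k0 p * a r k p - a r k0 p * a r0 k p)"
  have key: "(\<Sum>k\<in>K. c k * a' r k p) =
      a r0 k0 p * (\<Sum>k\<in>K. c k * a r k p) - a r k0 p * (\<Sum>k\<in>K. c k * a r0 k p)" for c r p
    unfolding a'_def by (simp add: sum_distrib_left sum_subtractf algebra_simps)
  have H': "a' r k \<in> H (e r0 + e r)" if "r \<in> R" "k \<in> K" for r k
  proof -
    have "(\<lambda>p. a r k0 p * a r0 k p) \<in> H (e r + e r0)"
      using that r0 insert.prems(1) by (intro H_mult) auto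
    moreover have "(\<lambda>p. a r0 k0 p * a r k p) \<in> H (e r0 + e r)"
      using that r0 insert.prems(1) by (intro H_mult) auto
    ultimately show ?thesis unfolding a'_def by (intro H_diff) (simp_all add: add.commute)
  qed
  have inj': "\<forall>k\<in>K. c k = 0" if c: "\<forall>r\<in>R. (\<Sum>k\<in>K. c k * a' r k p0) = 0" for c
  proof -
    \<comment> \<open>A kernel vector of the reduced system extends to one of the full system; its
      entry at \<open>k0\<close> is read off from row \<open>r0\<close>.\<close>
    define c' where "c' = c(k0 := - (\<Sum>k\<in>K. c k * a r0 k p0) / a r0 k0 p0)"
    have eq: "(\<Sum>k\<in>K. c' k * a r k p0) = (\<Sum>k\<in>K. c k * a r k p0)" for r
      using insert.hyps by (intro sum.cong) (auto simp: c'_def)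
    have "\<forall>k\<in>insert k0 K. c' k = 0"
    proof (rule insert.prems(2), intro ballI)
      fix r assume r: "r \<in> R"
      have "a r0 k0 p0 * (\<Sum>k\<in>insert k0 K. c' k * a r k p0) = (\<Sum>k\<in>K. c k * a' r k p0)"
        using r0 insert.hyps by (simp add: key eq distrib_left) (simp add: c'_def)
      then show "(\<Sum>k\<in>insert k0 K. c' k * a r k p0) = 0" using r c r0 by simp
    qed
    then show ?thesis using insert.hyps by (auto simp: c'_def split: if_splits)
  qed
  obtain g d where g: "g \<in> H d" "g p0 \<noteq> 0" and
    gi: "\<And>p c. g p \<noteq> 0 \<Longrightarrow> (\<forall>r\<in>R. (\<Sum>k\<in>K. c k * a' r k p) = 0) \<Longrightarrow> (\<forall>k\<in>K. c k = 0)"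
    using insert.IH[of a' "\<lambda>r. e r0 + e r", OF H' inj'] by blast
  show ?case
  proof (intro exI[of _ "\<lambda>p. a r0 k0 p * g p"] exI[of _ "e r0 + d"] conjI allI impI)
    show "(\<lambda>p. a r0 k0 p * g p) \<in> H (e r0 + d)" using g r0 insert.prems(1) by (intro H_mult) auto
    show "a r0 k0 p0 * g p0 \<noteq> 0" using g r0 by simp
    fix p c assume nz: "a r0 k0 p * g p \<noteq> 0" and c: "\<forall>r\<in>R. (\<Sum>k\<in>insert k0 K. c k * a r k p) = 0"
    have s: "(\<Sum>k\<in>K. c k * a r k p) = - (c k0 * a r k0 p)" if "r \<in> R" for r
      using c that insert.hyps by (auto simp: add_eq_0_iff)
    have "\<forall>r\<in>R. (\<Sum>k\<in>K. c k * a' r k p) = 0" using s r0 by (simp add: key)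
    then have 1: "\<forall>k\<in>K. c k = 0" using gi nz by auto
    then have "c k0 * a r0 k0 p = 0" using s[OF r0(1)] by simp
    then show "\<forall>k\<in>insert k0 K. c k = 0" using 1 nz by auto
  qed
qed

text \<open>The half line is completed by \<open>None\<close> as the point at infinity. Functions
  that converge to their value there form a ring, so \<open>elimination\<close> applies with a
  trivial grading, and the product of pivots stays nonzero near infinity.\<close>

lemma injective_limit:
  fixes a :: "'r \<Rightarrow> 'k \<Rightarrow> real \<Rightarrow> complex"
  assumes "finite K"
    and "\<And>r k. r \<in> R \<Longrightarrow> k \<in> K \<Longrightarrow> (a r k \<longlongrightarrow> b r k) at_top"
    and "\<And>c. (\<forall>r\<in>R. (\<Sum>k\<in>K. c k * b r k) = 0) \<Longrightarrow> \<forall>k\<in>K. c k = 0"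
  shows "\<exists>t. \<forall>c. (\<forall>r\<in>R. (\<Sum>k\<in>K. c k * a r k t) = 0) \<longrightarrow> (\<forall>k\<in>K. c k = 0)"
proof -
  define H :: "nat \<Rightarrow> (real option \<Rightarrow> complex) set"
    where "H = (\<lambda>_. {f. ((\<lambda>t. f (Some t)) \<longlongrightarrow> f None) at_top})"
  have "\<exists>g d. g \<in> H d \<and> g None \<noteq> 0 \<and>
    (\<forall>p. g p \<noteq> 0 \<longrightarrow> (\<forall>c. (\<forall>r\<in>R. (\<Sum>k\<in>K. c k * case_option (b r k) (a r k) p) = 0) \<longrightarrow> (\<forall>k\<in>K. c k = 0)))"
    by (rule elimination[where H = H and e = "\<lambda>_. 0"])
      (use assms in \<open>auto simp: H_def intro!: tendsto_intros\<close>)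
  then obtain g d where g: "g \<in> H d" "g None \<noteq> 0" and
    gi: "\<And>p. g p \<noteq> 0 \<Longrightarrow> (\<forall>c. (\<forall>r\<in>R. (\<Sum>k\<in>K. c k * case_option (b r k) (a r k) p) = 0) \<longrightarrow> (\<forall>k\<in>K. c k = 0))"
    by blast
  have "\<forall>\<^sub>F t in at_top. g (Some t) \<noteq> 0"
    using g tendsto_imp_eventually_ne[of "\<lambda>t. g (Some t)" "g None" at_top 0] by (auto simp: H_def)
  then obtain t where "g (Some t) \<noteq> 0" using eventually_happens'[OF trivial_limit_at_top_linorder] by blast
  from gi[OF this] show ?thesis by auto
qed

text \<open>Asking only for polynomiality along every complex line spares a representing polynomial:
  the class is visibly closed under ring operations, and two nonvanishing loci still meet.\<close>

definition line_poly :: "(('i \<Rightarrow> complex) \<Rightarrow> complex) \<Rightarrow> bool" where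
  "line_poly g \<longleftrightarrow> (\<forall>z w. \<exists>P. \<forall>t. g (\<lambda>i. z i + t * w i) = poly P t)"

lemma line_poly_const [intro]: "line_poly (\<lambda>_. c)"
  unfolding line_poly_def by (intro allI exI[of _ "[:c:]"]) auto

lemma line_poly_coord [intro]: "line_poly (\<lambda>z. z i)"
  unfolding line_poly_def
proof (intro allI)
  fix z w :: "'a \<Rightarrow> complex"
  show "\<exists>P. \<forall>t. z i + t * w i = poly P t" by (intro exI[of _ "[:z i, w i:]"]) auto
qed

lemma line_poly_mult [intro]: "line_poly f \<Longrightarrow> line_poly g \<Longrightarrow> line_poly (\<lambda>z. f z * g z)"
  unfolding line_poly_def by (metis poly_mult)

lemma line_poly_diff [intro]: "line_poly f \<Longrightarrow> line_poly g \<Longrightarrow> line_poly (\<lambda>z. f z - g z)"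
  unfolding line_poly_def by (metis poly_diff)

lemma line_poly_add [intro]: "line_poly f \<Longrightarrow> line_poly g \<Longrightarrow> line_poly (\<lambda>z. f z + g z)"
  unfolding line_poly_def by (metis poly_add)

lemma line_poly_power [intro]: "line_poly f \<Longrightarrow> line_poly (\<lambda>z. f z ^ n)"
  by (induction n) (auto)

lemma line_poly_sum [intro]: "(\<And>x. x \<in> A \<Longrightarrow> line_poly (f x)) \<Longrightarrow> line_poly (\<lambda>z. \<Sum>x\<in>A. f x z)"
  by (induction A rule: infinite_finite_induct) auto

lemma line_poly_prod [intro]: "(\<And>x. x \<in> A \<Longrightarrow> line_poly (f x)) \<Longrightarrow> line_poly (\<lambda>z. \<Prod>x\<in>A. f x z)"
  by (induction A rule: infinite_finite_induct) auto

text \<open>On the line through \<open>z1\<close> and \<open>z2\<close> both functions become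
  nonzero polynomials in one variable, which together have only finitely many roots.\<close>

lemma line_poly_common_nonzero:
  assumes "line_poly f" "line_poly g" "f z1 \<noteq> 0" "g z2 \<noteq> 0"
  shows "\<exists>z. f z \<noteq> 0 \<and> g z \<noteq> 0"
proof -
  obtain P where P: "\<And>t. f (\<lambda>i. z1 i + t * (z2 i - z1 i)) = poly P t"
    using assms(1) unfolding line_poly_def by (metis (mono_tags))
  obtain Q where Q: "\<And>t. g (\<lambda>i. z1 i + t * (z2 i - z1 i)) = poly Q t"
    using assms(2) unfolding line_poly_def by (metis (mono_tags))
  have "P \<noteq> 0" using P[of 0] assms(3) by auto
  moreover have "Q \<noteq> 0" using Q[of 1] assms(4) by auto
  ultimately have "finite {t. poly (P * Q) t = 0}" by (intro poly_roots_finite) simp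
  then obtain t where "poly (P * Q) t \<noteq> 0"
    using infinite_UNIV_char_0[where 'a = complex] by (metis (mono_tags, lifting) UNIV_I finite_subset mem_Collect_eq subsetI)
  then show ?thesis using P Q by (metis mult_eq_0_iff poly_mult)
qed

text \<open>Pair the relations with the coefficients of the polynomial that vanishes at all nodes
  but one; its degree is at most \<open>card S - 1 < m\<close>.\<close>

lemma vandermonde_injective:
  fixes f :: "'s \<Rightarrow> complex"
  assumes "finite S" "inj_on f S" "card S \<le> m" and c: "\<And>i. i < m \<Longrightarrow> (\<Sum>s\<in>S. c s * f s ^ i) = 0"
  shows "\<forall>s\<in>S. c s = 0"
proof
  fix s0 assume s0: "s0 \<in> S"
  define P where "P = (\<Prod>s\<in>S - {s0}. [:- f s, 1:])"
  have "degree P \<le> (\<Sum>s\<in>S - {s0}. degree [:- f s, 1:])" unfolding P_def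
    using assms(1) by (intro order.trans[OF degree_prod_sum_le]) auto
  also have "\<dots> = card (S - {s0})" by simp
  also have "\<dots> < m" using assms s0 card_gt_0_iff[of S] by auto
  finally have deg: "degree P < m" .
  have "(\<Sum>s\<in>S. c s * poly P (f s)) = (\<Sum>s\<in>S. \<Sum>i\<le>degree P. coeff P i * (c s * f s ^ i))"
    by (simp add: poly_altdef sum_distrib_left mult_ac)
  also have "\<dots> = (\<Sum>i\<le>degree P. coeff P i * (\<Sum>s\<in>S. c s * f s ^ i))"
    by (subst sum.swap) (simp add: sum_distrib_left)
  also have "\<dots> = 0" using deg c by (intro sum.neutral) auto
  finally have "(\<Sum>s\<in>S. c s * poly P (f s)) = 0" .
  moreover have "(\<Sum>s\<in>S. c s * poly P (f s)) = c s0 * poly P (f s0)"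
  proof -
    have "poly P (f s) = 0" if "s \<in> S - {s0}" for s
      using that assms(1) by (auto simp: P_def poly_prod)
    then show ?thesis using s0 assms(1) by (simp add: sum.remove)
  qed
  moreover have "poly P (f s0) \<noteq> 0"
    using assms(1,2) s0 by (auto simp: P_def poly_prod inj_on_def)
  ultimately show "c s0 = 0" by simp
qed

text \<open>Vanishing to order \<open>m\<close> of \<open>\<Sum> c (a, b) x^a y^b\<close>, expressed by the operators \<open>x \<partial>/\<partial>x\<close> and
  \<open>y \<partial>/\<partial>y\<close>, which are diagonal on monomials.\<close>

definition euler_cond :: "(nat \<times> nat) set \<Rightarrow> nat \<Rightarrow> (nat \<times> nat \<Rightarrow> complex) \<Rightarrow> complex \<Rightarrow> complex \<Rightarrow> bool" where
  "euler_cond K m c x y \<longleftrightarrow> (\<forall>i j. i + j < m \<longrightarrow>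
     (\<Sum>\<alpha>\<in>K. c \<alpha> * (of_nat (fst \<alpha>) ^ i * of_nat (snd \<alpha>) ^ j * x ^ fst \<alpha> * y ^ snd \<alpha>)) = 0)"

text \<open>The point (1, 1) stands for all points with nonzero coordinates: moving it there merely
  rescales the columns of the matrix of conditions.\<close>

definition indep_cells :: "(nat \<times> nat) set \<Rightarrow> nat \<Rightarrow> bool" where
  "indep_cells K m \<longleftrightarrow> (\<forall>c. euler_cond K m c 1 1 \<longrightarrow> (\<forall>\<alpha>\<in>K. c \<alpha> = 0))"

definition on_line :: "int \<Rightarrow> int \<Rightarrow> int \<Rightarrow> nat \<times> nat \<Rightarrow> bool" where
  "on_line p q s \<alpha> \<longleftrightarrow> p * int (fst \<alpha>) + q * int (snd \<alpha>) = s"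

text \<open>The affine form \<open>l\<close> of the line acts as a differential operator of order
  one, so \<open>c * l\<close> satisfies the conditions of order \<open>m - 1\<close> and lives off
  the line. Once the coefficients off the line are gone, the at most \<open>m\<close> cells on it
  are separated by a Vandermonde matrix.\<close>

lemma indep_cells_line:
  assumes fin: "finite K" and pq: "p \<noteq> 0 \<or> q \<noteq> 0" and ind: "indep_cells {\<alpha>\<in>K. \<not> on_line p q s \<alpha>} (m - 1)"
    and card: "card {\<alpha>\<in>K. on_line p q s \<alpha>} \<le> m"
  shows "indep_cells K m"
  unfolding indep_cells_def
proof (intro allI impI)
  fix c assume c: "euler_cond K m c 1 1"
  let ?on = "{\<alpha>\<in>K. on_line p q s \<alpha>}" and ?off = "{\<alpha>\<in>K. \<not> on_line p q s \<alpha>}"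
  define l where "l = (\<lambda>\<alpha>. of_int p * of_nat (fst \<alpha>) + of_int q * of_nat (snd \<alpha>) - of_int s :: complex)"
  have l: "l \<alpha> = 0 \<longleftrightarrow> on_line p q s \<alpha>" for \<alpha>
  proof -
    have "l \<alpha> = of_int (p * int (fst \<alpha>) + q * int (snd \<alpha>) - s)" by (simp add: l_def)
    then show ?thesis by (auto simp: on_line_def simp del: of_int_diff of_int_add of_int_mult)
  qed
  have cE: "(\<Sum>\<alpha>\<in>K. c \<alpha> * (of_nat (fst \<alpha>) ^ i * of_nat (snd \<alpha>) ^ j)) = 0" if "i + j < m" for i j
    using c that unfolding euler_cond_def by simp
  have "euler_cond ?off (m - 1) (\<lambda>\<alpha>. c \<alpha> * l \<alpha>) 1 1"
    unfolding euler_cond_def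
  proof (intro allI impI)
    fix i j assume ij: "i + j < m - 1"
    have "(\<Sum>\<alpha>\<in>?off. c \<alpha> * l \<alpha> * (of_nat (fst \<alpha>) ^ i * of_nat (snd \<alpha>) ^ j * 1 ^ fst \<alpha> * 1 ^ snd \<alpha>))
      = (\<Sum>\<alpha>\<in>K. c \<alpha> * l \<alpha> * (of_nat (fst \<alpha>) ^ i * of_nat (snd \<alpha>) ^ j))"
      using fin l by (intro sum.mono_neutral_cong_left) auto
    also have "\<dots> = of_int p * (\<Sum>\<alpha>\<in>K. c \<alpha> * (of_nat (fst \<alpha>) ^ Suc i * of_nat (snd \<alpha>) ^ j))
        + of_int q * (\<Sum>\<alpha>\<in>K. c \<alpha> * (of_nat (fst \<alpha>) ^ i * of_nat (snd \<alpha>) ^ Suc j))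
        - of_int s * (\<Sum>\<alpha>\<in>K. c \<alpha> * (of_nat (fst \<alpha>) ^ i * of_nat (snd \<alpha>) ^ j))"
      by (simp add: l_def sum_distrib_left sum_subtractf[symmetric] sum.distrib[symmetric] algebra_simps)
    also have "\<dots> = 0" using ij by (subst (1 2 3) cE) auto
    finally show "(\<Sum>\<alpha>\<in>?off. c \<alpha> * l \<alpha> * (of_nat (fst \<alpha>) ^ i * of_nat (snd \<alpha>) ^ j * 1 ^ fst \<alpha> * 1 ^ snd \<alpha>)) = 0" .
  qed
  then have "\<forall>\<alpha>\<in>?off. c \<alpha> * l \<alpha> = 0" using ind unfolding indep_cells_def by blast
  then have off: "c \<alpha> = 0" if "\<alpha> \<in> ?off" for \<alpha> using l[of \<alpha>] that by (metis (no_types, lifting) mem_Collect_eq mult_eq_0_iff)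
  have on0: "(\<Sum>\<alpha>\<in>?on. c \<alpha> * (of_nat (fst \<alpha>) ^ i * of_nat (snd \<alpha>) ^ j)) = 0" if "i + j < m" for i j
    using cE[OF that] off fin by (subst sum.mono_neutral_left[of K ?on]) auto
  have "\<forall>\<alpha>\<in>?on. c \<alpha> = 0"
  \<comment> \<open>The first coordinate is injective on the line unless the line is a column; then
    the second one is.\<close>
  proof (cases "q = 0")
    case False
    show ?thesis
    proof (rule vandermonde_injective[of _ "\<lambda>\<alpha>. of_nat (fst \<alpha>)" m])
      show "inj_on (\<lambda>\<alpha>. of_nat (fst \<alpha>) :: complex) ?on"
        using False by (auto simp: inj_on_def on_line_def)
      show "(\<Sum>\<alpha>\<in>?on. c \<alpha> * of_nat (fst \<alpha>) ^ i) = 0" if "i < m" for i using on0[of i 0] that by simp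
    qed (use fin card in auto)
  next
    case True
    show ?thesis
    proof (rule vandermonde_injective[of _ "\<lambda>\<alpha>. of_nat (snd \<alpha>)" m])
      show "inj_on (\<lambda>\<alpha>. of_nat (snd \<alpha>) :: complex) ?on"
        using True pq by (auto simp: inj_on_def on_line_def)
      show "(\<Sum>\<alpha>\<in>?on. c \<alpha> * of_nat (snd \<alpha>) ^ i) = 0" if "i < m" for i using on0[of 0 i] that by simp
    qed (use fin card in auto)
  qed
  then show "\<forall>\<alpha>\<in>K. c \<alpha> = 0" using off by auto
qed

text \<open>Points of the affine chart are given by \<open>z\<close>, with coordinates
  \<open>x = z (i, False)\<close> and \<open>y = z (i, True)\<close>.\<close>

definition planar_inj :: "(nat \<times> nat) set \<Rightarrow> nat set \<Rightarrow> (nat \<Rightarrow> nat) \<Rightarrow> (nat \<times> bool \<Rightarrow> complex) \<Rightarrow> bool" where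
  "planar_inj K I m z \<longleftrightarrow> (\<forall>c. (\<forall>i\<in>I. euler_cond K (m i) c (z (i, False)) (z (i, True))) \<longrightarrow> (\<forall>\<alpha>\<in>K. c \<alpha> = 0))"

text \<open>The new point is \<open>(e^(2ut), e^(2vt))\<close>. After rescaling the columns, the matrix of conditions becomes
  block diagonal as \<open>t\<close> tends to infinity.\<close>

lemma planar_inj_cut:
  fixes u v s :: int
  assumes fin: "finite K" and i: "i \<notin> I"
    and K1: "K1 = {\<alpha>\<in>K. u * int (fst \<alpha>) + v * int (snd \<alpha>) \<ge> s}"
    and K2: "K2 = {\<alpha>\<in>K. \<not> u * int (fst \<alpha>) + v * int (snd \<alpha>) \<ge> s}"
    and ind: "indep_cells K1 (m i)" and inj: "planar_inj K2 I m z"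
  shows "\<exists>z. planar_inj K (insert i I) m z"
proof -
  \<comment> \<open>The factor 2, matched by the exponents \<open>2 * u\<close> and
    \<open>2 * v\<close> of the new point, and the offset 1 make \<open>l\<close> odd, so that it is
    never 0 and its sign separates \<open>K1\<close> from \<open>K2\<close>.\<close>
  define l :: "nat \<times> nat \<Rightarrow> real" where "l = (\<lambda>\<alpha>. of_int (2 * (u * int (fst \<alpha>) + v * int (snd \<alpha>) - s) + 1))"
  have l1: "l \<alpha> > 0" if "\<alpha> \<in> K1" for \<alpha> using that unfolding K1 l_def of_int_0_less_iff by simp
  have l2: "l \<alpha> < 0" if "\<alpha> \<in> K2" for \<alpha> using that unfolding K2 l_def of_int_less_0_iff by simp
  have dis: "\<alpha> \<in> K \<Longrightarrow> \<alpha> \<in> K1 \<longleftrightarrow> \<alpha> \<notin> K2" and sub: "K1 \<subseteq> K" "K2 \<subseteq> K" for \<alpha> unfolding K1 K2 by auto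
  have un: "K = K1 \<union> K2" "K1 \<inter> K2 = {}" unfolding K1 K2 by auto
  have finK: "finite K1" "finite K2" using fin sub finite_subset by auto
  define R where "R = {(k, a, b). k \<in> insert i I \<and> a + b < m k}"
  define E where "E = (\<lambda>a b \<alpha>. of_nat (fst \<alpha>) ^ a * of_nat (snd \<alpha>) ^ b :: complex)"
  define X where "X = (\<lambda>k \<alpha>. z (k, False) ^ fst \<alpha> * z (k, True) ^ snd \<alpha>)"
  \<comment> \<open>The true matrix, with the rows of point \<open>i\<close> divided by
    \<open>exp (t * (2 * s - 1))\<close> and the columns in \<open>K1\<close> divided by
    \<open>exp (t * l \<alpha>)\<close>. Every exponential that is left decays.\<close>
  define A where "A = (\<lambda>(k, a, b) \<alpha> t. if k = i then (if \<alpha> \<in> K1 then E a b \<alpha> else E a b \<alpha> * of_real (exp (t * l \<alpha>)))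
     else (if \<alpha> \<in> K1 then E a b \<alpha> * X k \<alpha> * of_real (exp (- t * l \<alpha>)) else E a b \<alpha> * X k \<alpha>))"
  \<comment> \<open>The block diagonal limit: point \<open>i\<close> sees only \<open>K1\<close>,
    the other points see only \<open>K2\<close>.\<close>
  define B where "B = (\<lambda>(k, a, b) \<alpha>. if k = i then (if \<alpha> \<in> K1 then E a b \<alpha> else 0)
     else (if \<alpha> \<in> K1 then 0 else E a b \<alpha> * X k \<alpha>))"
  have ex0: "((\<lambda>t::real. of_real (exp (t * y)) :: complex) \<longlongrightarrow> 0) at_top" if "y < 0" for y :: real
  proof -
    have "LIM t at_top. t * y :> at_bot"
      using that using filterlim_tendsto_neg_mult_at_bot[OF tendsto_const _ filterlim_ident, of y] by (simp add: mult.commute)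
    then have "((\<lambda>t. exp (t * y)) \<longlongrightarrow> 0) at_top" by (rule filterlim_compose[OF exp_at_bot])
    then show ?thesis using tendsto_of_real[of "\<lambda>t. exp (t * y)" 0 at_top, where 'a = complex] by simp
  qed
  have lim: "(A r \<alpha> \<longlongrightarrow> B r \<alpha>) at_top" if "\<alpha> \<in> K" for r \<alpha>
  proof -
    obtain k a b where r: "r = (k, a, b)" by (cases r)
    show ?thesis
    proof (cases "\<alpha> \<in> K1")
      case True
      have "((\<lambda>t. E a b \<alpha> * X k \<alpha> * of_real (exp (t * - l \<alpha>))) \<longlongrightarrow> E a b \<alpha> * X k \<alpha> * 0) at_top"
        using l1[OF True] by (intro tendsto_intros ex0) simp
      then show ?thesis using True by (auto simp: A_def B_def r)
    next
      case False
      then have "\<alpha> \<in> K2" using dis that by auto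
      then have "((\<lambda>t. E a b \<alpha> * of_real (exp (t * l \<alpha>))) \<longlongrightarrow> E a b \<alpha> * 0) at_top"
        using l2 by (intro tendsto_intros ex0) auto
      then show ?thesis using False by (auto simp: A_def B_def r)
    qed
  qed
  have injB: "\<forall>\<alpha>\<in>K. c \<alpha> = 0" if c: "\<forall>r\<in>R. (\<Sum>\<alpha>\<in>K. c \<alpha> * B r \<alpha>) = 0" for c
  proof -
    have "euler_cond K1 (m i) c 1 1" unfolding euler_cond_def
    proof (intro allI impI)
      fix a b assume "a + b < m i"
      then have "(\<Sum>\<alpha>\<in>K. c \<alpha> * B (i, a, b) \<alpha>) = 0" using c by (auto simp: R_def)
      moreover have "(\<Sum>\<alpha>\<in>K. c \<alpha> * B (i, a, b) \<alpha>) = (\<Sum>\<alpha>\<in>K1. c \<alpha> * E a b \<alpha>)"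
        using fin sub by (intro sum.mono_neutral_cong_right) (auto simp: B_def)
      ultimately show "(\<Sum>\<alpha>\<in>K1. c \<alpha> * (of_nat (fst \<alpha>) ^ a * of_nat (snd \<alpha>) ^ b * 1 ^ fst \<alpha> * 1 ^ snd \<alpha>)) = 0"
        by (simp add: E_def)
    qed
    then have "\<forall>\<alpha>\<in>K1. c \<alpha> = 0" using ind unfolding indep_cells_def by blast
    moreover have "\<forall>k\<in>I. euler_cond K2 (m k) c (z (k, False)) (z (k, True))" unfolding euler_cond_def
    proof (intro allI impI ballI)
      fix k a b assume k: "k \<in> I" and "a + b < m k"
      then have "(\<Sum>\<alpha>\<in>K. c \<alpha> * B (k, a, b) \<alpha>) = 0" using c by (auto simp: R_def)
      moreover have "(\<Sum>\<alpha>\<in>K. c \<alpha> * B (k, a, b) \<alpha>) = (\<Sum>\<alpha>\<in>K2. c \<alpha> * (E a b \<alpha> * X k \<alpha>))"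
        using fin sub k i dis by (intro sum.mono_neutral_cong_right) (auto simp: B_def)
      ultimately show "(\<Sum>\<alpha>\<in>K2. c \<alpha> * (of_nat (fst \<alpha>) ^ a * of_nat (snd \<alpha>) ^ b * z (k, False) ^ fst \<alpha> * z (k, True) ^ snd \<alpha>)) = 0"
        by (simp add: E_def X_def mult_ac)
    qed
    then have "\<forall>\<alpha>\<in>K2. c \<alpha> = 0" using inj unfolding planar_inj_def by blast
    ultimately show ?thesis using un by auto
  qed
  obtain t where t: "\<And>c. (\<forall>r\<in>R. (\<Sum>\<alpha>\<in>K. c \<alpha> * A r \<alpha> t) = 0) \<Longrightarrow> (\<forall>\<alpha>\<in>K. c \<alpha> = 0)"
    using injective_limit[of K R A B, OF fin lim injB] by blast
  define z' where "z' = z((i, False) := of_real (exp (t * of_int (2 * u))), (i, True) := of_real (exp (t * of_int (2 * v))))"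
  have zi: "z' (i, False) ^ fst \<alpha> * z' (i, True) ^ snd \<alpha> = of_real (exp (t * (l \<alpha> + of_int (2 * s) - 1)))" for \<alpha>
    by (simp add: z'_def l_def of_real_power[symmetric] exp_of_nat_mult[symmetric] of_real_mult[symmetric] exp_add[symmetric] algebra_simps
       del: of_real_power of_real_mult)
  have "planar_inj K (insert i I) m z'" unfolding planar_inj_def
  proof (intro allI impI)
    fix c assume c: "\<forall>k\<in>insert i I. euler_cond K (m k) c (z' (k, False)) (z' (k, True))"
    \<comment> \<open>Dividing a column by \<open>exp (t * l \<alpha>)\<close> multiplies its
      coefficient by the same factor.\<close>
    define c' where "c' = (\<lambda>\<alpha>. if \<alpha> \<in> K1 then c \<alpha> * of_real (exp (t * l \<alpha>)) else c \<alpha>)"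
    have "\<forall>\<alpha>\<in>K. c' \<alpha> = 0"
    proof (rule t, intro ballI)
      fix r assume "r \<in> R"
      then obtain k a b where r: "r = (k, a, b)" and k: "k \<in> insert i I" "a + b < m k" by (auto simp: R_def)
      have e: "(\<Sum>\<alpha>\<in>K. c \<alpha> * (E a b \<alpha> * (z' (k, False) ^ fst \<alpha> * z' (k, True) ^ snd \<alpha>))) = 0"
        using c k unfolding euler_cond_def E_def by (auto simp: mult_ac)
      show "(\<Sum>\<alpha>\<in>K. c' \<alpha> * A r \<alpha> t) = 0"
      proof (cases "k = i")
        case True
        have "(\<Sum>\<alpha>\<in>K. c' \<alpha> * A r \<alpha> t) = of_real (exp (- t * (of_int (2 * s) - 1))) *
           (\<Sum>\<alpha>\<in>K. c \<alpha> * (E a b \<alpha> * (z' (k, False) ^ fst \<alpha> * z' (k, True) ^ snd \<alpha>)))"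
          unfolding sum_distrib_left
        proof (intro sum.cong refl)
          fix \<alpha>
          have "exp (t * l \<alpha>) = exp (- t * (of_int (2 * s) - 1)) * exp (t * (l \<alpha> + of_int (2 * s) - 1))"
            by (simp add: exp_add[symmetric] algebra_simps)
          then have ee: "(of_real (exp (t * l \<alpha>)) :: complex) = of_real (exp (- t * (of_int (2 * s) - 1))) * of_real (exp (t * (l \<alpha> + of_int (2 * s) - 1)))"
            by (metis of_real_mult)
          show "c' \<alpha> * A r \<alpha> t = of_real (exp (- t * (of_int (2 * s) - 1))) * (c \<alpha> * (E a b \<alpha> * (z' (k, False) ^ fst \<alpha> * z' (k, True) ^ snd \<alpha>)))"
            unfolding True zi by (simp add: c'_def A_def r True ee del: of_real_mult)
        qed
        then show ?thesis using e by simp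
      next
        case False
        have "(\<Sum>\<alpha>\<in>K. c' \<alpha> * A r \<alpha> t) = (\<Sum>\<alpha>\<in>K. c \<alpha> * (E a b \<alpha> * (z' (k, False) ^ fst \<alpha> * z' (k, True) ^ snd \<alpha>)))"
        proof (intro sum.cong refl)
          fix \<alpha>
          have "of_real (exp (t * l \<alpha>)) * of_real (exp (- t * l \<alpha>)) = (1 :: complex)"
            by (metis mult_minus_left exp_minus_inverse of_real_1 of_real_mult)
          then show "c' \<alpha> * A r \<alpha> t = c \<alpha> * (E a b \<alpha> * (z' (k, False) ^ fst \<alpha> * z' (k, True) ^ snd \<alpha>))"
            using False by (simp add: c'_def A_def r z'_def X_def mult_ac)
        qed
        then show ?thesis using e by simp
      qed
    qed
    then show "\<forall>\<alpha>\<in>K. c \<alpha> = 0" by (auto simp: c'_def split: if_splits)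
  qed
  then show ?thesis by blast
qed

text \<open>The entries of the matrix are monomials in the coordinates up to constants, so the
  product of pivots is a \<open>line_poly\<close> function.\<close>

lemma planar_inj_open:
  assumes "finite K" "planar_inj K I m z0"
  shows "\<exists>g. line_poly g \<and> g z0 \<noteq> 0 \<and> (\<forall>z. g z \<noteq> 0 \<longrightarrow> planar_inj K I m z)"
proof -
  define R where "R = {(k, a, b). k \<in> I \<and> a + b < m k}"
  define A :: "nat \<times> nat \<times> nat \<Rightarrow> nat \<times> nat \<Rightarrow> (nat \<times> bool \<Rightarrow> complex) \<Rightarrow> complex"
    where "A = (\<lambda>(k, a, b) \<alpha> z. of_nat (fst \<alpha>) ^ a * of_nat (snd \<alpha>) ^ b * z (k, False) ^ fst \<alpha> * z (k, True) ^ snd \<alpha>)"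
  have eq: "planar_inj K I m z \<longleftrightarrow> (\<forall>c. (\<forall>r\<in>R. (\<Sum>\<alpha>\<in>K. c \<alpha> * A r \<alpha> z) = 0) \<longrightarrow> (\<forall>\<alpha>\<in>K. c \<alpha> = 0))" for z
    unfolding planar_inj_def euler_cond_def R_def A_def by (auto simp: Ball_def)
  have "\<exists>g (d::nat). g \<in> {g. line_poly g} \<and> g z0 \<noteq> 0 \<and>
    (\<forall>z. g z \<noteq> 0 \<longrightarrow> (\<forall>c. (\<forall>r\<in>R. (\<Sum>\<alpha>\<in>K. c \<alpha> * A r \<alpha> z) = 0) \<longrightarrow> (\<forall>\<alpha>\<in>K. c \<alpha> = 0)))"
  proof (rule elimination[where H = "\<lambda>_. {g. line_poly g}" and e = "\<lambda>_. 0"])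
    show "A r k \<in> {g. line_poly g}" for r k
      unfolding A_def by (cases r) (auto intro!: line_poly_mult line_poly_power)
    show "\<forall>\<alpha>\<in>K. c \<alpha> = 0" if "\<forall>r\<in>R. (\<Sum>k\<in>K. c k * A r k z0) = 0" for c
      using assms(2) that unfolding eq by blast
  qed (use assms in auto)
  then show ?thesis using eq by auto
qed

section \<open>Certificates for systems on the quadric\<close>

definition grid :: "int \<Rightarrow> (nat \<times> nat) set" where
  "grid d = {(a, b). int a \<le> d \<and> int b \<le> d}"

lemma finite_grid [simp]: "finite (grid d)"
  by (rule finite_subset[of _ "{..nat d} \<times> {..nat d}"]) (auto simp: grid_def)

lemma card_grid: "d \<ge> -1 \<Longrightarrow> int (card (grid d)) = (d + 1)\<^sup>2"
proof -
  assume d: "d \<ge> -1"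
  have "grid d = {..<nat (d + 1)} \<times> {..<nat (d + 1)}" by (auto simp: grid_def)
  then show ?thesis using d by (simp add: card_cartesian_product power2_eq_square)
qed

text \<open>A segment \<open>(p, l, n)\<close> consists of \<open>n\<close> consecutive cells, starting with the \<open>l\<close>-th one, of
  column \<open>p\<close> (or of row \<open>p\<close> if \<open>tr\<close> holds). In a cut \<open>(i, u, v, s, tr, S)\<close>, the segments \<open>S\<close> form the
  piece of the \<open>i\<close>-th point, separated from the later pieces by the line \<open>u a + v b = s\<close>.\<close>

type_synonym segment = "int \<times> int \<times> int"

definition segment_cells :: "bool \<Rightarrow> segment \<Rightarrow> (nat \<times> nat) set" where
  "segment_cells tr = (\<lambda>(p, l, n). {(a, b). if tr then int b = p \<and> l \<le> int a \<and> int a < l + n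
     else int a = p \<and> l \<le> int b \<and> int b < l + n})"

definition segments_cells :: "bool \<Rightarrow> segment list \<Rightarrow> (nat \<times> nat) set" where
  "segments_cells tr S = (\<Union>x\<in>set S. segment_cells tr x)"

text \<open>The segments lie on distinct parallel lines and the \<open>k\<close>-th one has at most
  \<open>m - k + 1\<close> cells. Removing the lines one by one with
  \<open>indep_cells_line\<close>, each at the cost of one order, shows that such a piece is
  independent for multiplicity \<open>m\<close>.\<close>

fun segments_check :: "int \<Rightarrow> int \<Rightarrow> segment list \<Rightarrow> bool" where
  "segments_check d m [] \<longleftrightarrow> 0 \<le> m"
| "segments_check d m ((p, l, n) # S) \<longleftrightarrow>
     0 \<le> p \<and> p \<le> d \<and> 0 \<le> l \<and> 1 \<le> n \<and> l + n \<le> d + 1 \<and> n \<le> m \<and>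
     list_all (\<lambda>(p', l', n'). p' \<noteq> p) S \<and> segments_check d (m - 1) S"

text \<open>Only the two end cells are tested, since an affine function on a segment is extremal at
  the ends.\<close>

definition above :: "int \<Rightarrow> int \<Rightarrow> int \<Rightarrow> bool \<Rightarrow> segment \<Rightarrow> bool" where
  "above u v s tr = (\<lambda>(p, l, n). if tr then s \<le> u * l + v * p \<and> s \<le> u * (l + n - 1) + v * p
      else s \<le> u * p + v * l \<and> s \<le> u * p + v * (l + n - 1))"

definition below :: "int \<Rightarrow> int \<Rightarrow> int \<Rightarrow> bool \<Rightarrow> segment \<Rightarrow> bool" where
  "below u v s tr = (\<lambda>(p, l, n). if tr then u * l + v * p < s \<and> u * (l + n - 1) + v * p < s
      else u * p + v * l < s \<and> u * p + v * (l + n - 1) < s)"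

type_synonym cut = "nat \<times> int \<times> int \<times> int \<times> bool \<times> segment list"

text \<open>All later pieces lie strictly on the other side of the current line. This makes the
  pieces disjoint and lets \<open>planar_inj_cut\<close> add the points from the last cut to the
  first. The last piece has nothing to be separated from, so its line may be the degenerate 0 =
  0.\<close>

fun cuts_check :: "int \<Rightarrow> int list \<Rightarrow> cut list \<Rightarrow> bool" where
  "cuts_check d M [] \<longleftrightarrow> True"
| "cuts_check d M ((i, u, v, s, tr, S) # C) \<longleftrightarrow>
     1 \<le> i \<and> i \<le> 9 \<and>
     segments_check d (M ! (i - 1)) S \<and> list_all (above u v s tr) S \<and>
     list_all (\<lambda>(i', u', v', s', tr', S'). i' \<noteq> i \<and> list_all (below u v s tr') S') C \<and>
     cuts_check d M C"

definition cuts_cells :: "cut list \<Rightarrow> (nat \<times> nat) set" where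
  "cuts_cells C = (\<Union>(i, u, v, s, tr, S)\<in>set C. segments_cells tr S)"

fun segments_size :: "segment list \<Rightarrow> int" where
  "segments_size [] = 0"
| "segments_size ((p, l, n) # S) = n + segments_size S"

fun cuts_size :: "cut list \<Rightarrow> int" where
  "cuts_size [] = 0"
| "cuts_size ((i, u, v, s, tr, S) # C) = segments_size S + cuts_size C"

lemma segment_cells_card:
  assumes "0 \<le> p" "0 \<le> l" "0 \<le> n"
  shows "finite (segment_cells tr (p, l, n))" "int (card (segment_cells tr (p, l, n))) = n"
proof -
  have *: "segment_cells tr (p, l, n) = (\<lambda>b. if tr then (b, nat p) else (nat p, b)) ` {nat l..<nat (l + n)}"
    using assms by (cases tr) (auto simp: segment_cells_def image_iff)
  have "inj_on (\<lambda>b. if tr then (b, nat p) else (nat p, b)) {nat l..<nat (l + n)}"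
    by (auto simp: inj_on_def)
  then show "finite (segment_cells tr (p, l, n))" "int (card (segment_cells tr (p, l, n))) = n"
    using assms unfolding * by (auto simp: card_image)
qed

lemma segments_check_card:
  assumes "segments_check d m S"
  shows "finite (segments_cells tr S) \<and> int (card (segments_cells tr S)) = segments_size S \<and> segments_cells tr S \<subseteq> grid d"
  using assms
proof (induction d m S rule: segments_check.induct)
  case (1 d m)
  then show ?case by (simp add: segments_cells_def)
next
  case (2 d m p l n S)
  have dis: "segment_cells tr (p, l, n) \<inter> segments_cells tr S = {}"
    using 2(2) by (cases tr) (auto simp: segments_cells_def segment_cells_def list_all_iff)
  have un: "segments_cells tr ((p, l, n) # S) = segment_cells tr (p, l, n) \<union> segments_cells tr S"
    by (simp add: segments_cells_def)
  have g: "segment_cells tr (p, l, n) \<subseteq> grid d"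
    using 2(2) by (cases tr) (auto simp: segment_cells_def grid_def)
  show ?case using 2 dis g segment_cells_card[of p l n tr] unfolding un
    by (simp add: card_Un_disjoint)
qed

lemma segments_check_indep:
  assumes "segments_check d m S"
  shows "indep_cells (segments_cells tr S) (nat m)"
  using assms
proof (induction d m S rule: segments_check.induct)
  case (1 d m)
  then show ?case by (simp add: segments_cells_def indep_cells_def)
next
  case (2 d m p l n S)
  let ?K = "segments_cells tr ((p, l, n) # S)"
  \<comment> \<open>The line \<open>a * x + b * y = p\<close> carries the first segment: a row if
    \<open>tr\<close> holds, a column otherwise.\<close>
  define a b :: int where "a = (if tr then 0 else 1)" and "b = (if tr then 1 else 0)"
  have un: "?K = segment_cells tr (p, l, n) \<union> segments_cells tr S"
    by (simp add: segments_cells_def)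
  have on1: "on_line a b p \<alpha>" if "\<alpha> \<in> segment_cells tr (p, l, n)" for \<alpha>
    using that by (cases tr) (auto simp: on_line_def a_def b_def segment_cells_def)
  have on2: "\<not> on_line a b p \<alpha>" if "\<alpha> \<in> segments_cells tr S" for \<alpha>
    using that 2(2) by (cases tr) (auto simp: on_line_def a_def b_def segments_cells_def segment_cells_def list_all_iff)
  have on: "{\<alpha>\<in>?K. on_line a b p \<alpha>} = segment_cells tr (p, l, n)"
    and off: "{\<alpha>\<in>?K. \<not> on_line a b p \<alpha>} = segments_cells tr S"
    using on1 on2 unfolding un by blast+
  show ?case
  proof (rule indep_cells_line[of _ a b p])
    show "finite ?K" using segments_check_card[OF 2(2)] by simp
    show "a \<noteq> 0 \<or> b \<noteq> 0" by (simp add: a_def b_def)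
    show "indep_cells {\<alpha>\<in>?K. \<not> on_line a b p \<alpha>} (nat m - 1)"
      unfolding off using 2 by (simp add: nat_diff_distrib)
    show "card {\<alpha>\<in>?K. on_line a b p \<alpha>} \<le> nat m"
      unfolding on using 2(2) segment_cells_card[of p l n tr] by auto
  qed
qed

lemma int_affine_ge:
  fixes u x y z :: int
  assumes "x \<le> y" "y \<le> z" "s \<le> u * x" "s \<le> u * z"
  shows "s \<le> u * y"
proof (cases "u \<ge> 0")
  case True
  then show ?thesis using mult_left_mono[of x y u] assms by linarith
next
  case False
  then show ?thesis using mult_left_mono_neg[of y z u] assms by linarith
qed

lemma above_cells:
  assumes "list_all (above u v s tr) S" "(a, b) \<in> segments_cells tr S"
  shows "s \<le> u * int a + v * int b"
proof -
  obtain p l n where x: "(p, l, n) \<in> set S" "(a, b) \<in> segment_cells tr (p, l, n)"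
    using assms(2) by (auto simp: segments_cells_def)
  then have ab: "above u v s tr (p, l, n)" using assms(1) by (auto simp: list_all_iff)
  show ?thesis
  proof (cases tr)
    case True
    then show ?thesis using x(2) ab int_affine_ge[of l "int a" "l + n - 1" "s - v * p" u]
      by (simp add: above_def segment_cells_def)
  next
    case False
    then show ?thesis using x(2) ab int_affine_ge[of l "int b" "l + n - 1" "s - u * p" v]
      by (simp add: above_def segment_cells_def)
  qed
qed

lemma below_cells:
  assumes "list_all (below u v s tr) S" "(a, b) \<in> segments_cells tr S"
  shows "u * int a + v * int b < s"
proof -
  \<comment> \<open>Over the integers, lying strictly below \<open>s\<close> means that the opposite
    form is at least \<open>1 - s\<close>.\<close>
  have "list_all (above (- u) (- v) (1 - s) tr) S"
    using assms(1) by (cases tr) (auto simp: list_all_iff above_def below_def algebra_simps)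
  from above_cells[OF this assms(2)] show ?thesis by simp
qed

lemma cuts_check_planar:
  assumes "cuts_check d M C"
  shows "cuts_cells C \<subseteq> grid d \<and> int (card (cuts_cells C)) = cuts_size C \<and>
    (\<exists>z. planar_inj (cuts_cells C) (fst ` set C) (\<lambda>i. nat (M ! (i - 1))) z)"
  using assms
proof (induction d M C rule: cuts_check.induct)
  case (1 d M)
  then show ?case by (simp add: cuts_cells_def planar_inj_def)
next
  case (2 d M i u v s tr S C)
  let ?K1 = "segments_cells tr S" and ?K2 = "cuts_cells C" and ?K = "cuts_cells ((i, u, v, s, tr, S) # C)"
  have un: "?K = ?K1 \<union> ?K2" by (simp add: cuts_cells_def)
  have up: "s \<le> u * int (fst \<alpha>) + v * int (snd \<alpha>)" if "\<alpha> \<in> ?K1" for \<alpha>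
    using 2 that above_cells[of u v s tr S "fst \<alpha>" "snd \<alpha>"] by simp
  have down: "u * int (fst \<alpha>) + v * int (snd \<alpha>) < s" if \<alpha>: "\<alpha> \<in> ?K2" for \<alpha>
  proof -
    obtain i' u' v' s' tr' S' where x: "(i', u', v', s', tr', S') \<in> set C" "\<alpha> \<in> segments_cells tr' S'"
      using \<alpha> unfolding cuts_cells_def by fast
    then have "list_all (below u v s tr') S'" using 2(2) by (auto simp: list_all_iff)
    then show ?thesis using x(2) below_cells[of u v s tr' S' "fst \<alpha>" "snd \<alpha>"] by simp
  qed
  have K1: "finite ?K1" "int (card ?K1) = segments_size S" "?K1 \<subseteq> grid d"
    using segments_check_card[of d _ S tr] 2(2) by auto
  have K2: "?K2 \<subseteq> grid d" "int (card ?K2) = cuts_size C" and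
    z: "\<exists>z. planar_inj ?K2 (fst ` set C) (\<lambda>i. nat (M ! (i - 1))) z"
    using 2 by auto
  have fin2: "finite ?K2" by (rule finite_subset[OF K2(1)]) simp
  have dis: "?K1 \<inter> ?K2 = {}" using up down by force
  have K1': "?K1 = {\<alpha>\<in>?K. u * int (fst \<alpha>) + v * int (snd \<alpha>) \<ge> s}"
    and K2': "?K2 = {\<alpha>\<in>?K. \<not> u * int (fst \<alpha>) + v * int (snd \<alpha>) \<ge> s}"
    unfolding un using up down by (fastforce, fastforce)
  have i: "i \<notin> fst ` set C" using 2(2) by (auto simp: list_all_iff)
  have ind: "indep_cells ?K1 (nat (M ! (i - 1)))" using 2(2) segments_check_indep by auto
  have fin: "finite ?K" using K1 fin2 un by simp
  obtain z where "planar_inj ?K2 (fst ` set C) (\<lambda>i. nat (M ! (i - 1))) z" using z by blast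
  from planar_inj_cut[where m = "\<lambda>i. nat (M ! (i - 1))", OF fin i K1' K2' ind this]
  have "\<exists>z. planar_inj ?K (insert i (fst ` set C)) (\<lambda>i. nat (M ! (i - 1))) z" .
  then show ?case using K1 K2 dis fin2 un by (simp add: card_Un_disjoint)
qed

text \<open>The two kinds of certificates: the conditions of a system with multiplicities \<open>M\<close> are independent
  (all segments have full length), or they exclude every nonzero form (all cells of the square are used).\<close>

definition indep_cert :: "int \<Rightarrow> int list \<Rightarrow> cut list \<Rightarrow> bool" where
  "indep_cert d M C \<longleftrightarrow> length M = 9 \<and> list_all (\<lambda>x. 0 \<le> x) M \<and> cuts_check d M C \<and>
     2 * cuts_size C = (\<Sum>x\<leftarrow>M. x * (x + 1))"

definition empty_cert :: "int \<Rightarrow> int list \<Rightarrow> cut list \<Rightarrow> bool" where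
  "empty_cert d M C \<longleftrightarrow> 0 \<le> d \<and> cuts_check d M C \<and> cuts_size C = (d + 1) * (d + 1)"

text \<open>The forms of bidegree \<open>(d, d)\<close> with multiplicities \<open>m\<close> at nine general points of the
  quadric form a space of dimension at most \<open>max 0 (q_char d m)\<close>.\<close>

definition planar_nonspecial :: "int \<Rightarrow> (nat \<Rightarrow> int) \<Rightarrow> bool" where
  "planar_nonspecial d m \<longleftrightarrow> (\<exists>g z0. line_poly g \<and> g z0 \<noteq> 0 \<and> (\<forall>z. g z \<noteq> 0 \<longrightarrow>
     (\<exists>\<Phi>. finite \<Phi> \<and> int (card \<Phi>) \<le> max 0 (q_char d m) \<and>
       (\<forall>c. (\<forall>i\<in>{1..9}. euler_cond (grid d) (nat (m i)) c (z (i, False)) (z (i, True))) \<and>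
         (\<forall>w\<in>\<Phi>. (\<Sum>\<alpha>\<in>grid d. c \<alpha> * w \<alpha>) = 0) \<longrightarrow> (\<forall>\<alpha>\<in>grid d. c \<alpha> = 0)))))"

lemma card_pairs_less: "card {(a, b). a + b < (n::nat)} = (n + 1) choose 2" "finite {(a, b). a + b < (n::nat)}"
proof -
  have *: "{(a, b). a + b < n} = (SIGMA a:{..<n}. {..<n - a})" by auto
  show "finite {(a, b). a + b < (n::nat)}" unfolding * by auto
  have "card {(a, b). a + b < n} = (\<Sum>a<n. n - a)" unfolding * by (subst card_SigmaI) auto
  also have "\<dots> = (\<Sum>a<n. Suc a)" by (subst sum.nat_diff_reindex[symmetric]) (auto intro!: sum.cong)
  also have "\<dots> = (n + 1) choose 2" by (induction n) (auto simp: numeral_2_eq_2)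
  finally show "card {(a, b). a + b < (n::nat)} = (n + 1) choose 2" .
qed

text \<open>A dissection made for other multiplicities and another degree is put to use: the
  functionals in \<open>\<Phi>\<close> read off the coefficients outside \<open>K\<close> and supply
  the derivative conditions of orders between \<open>m\<close> and \<open>M\<close>.\<close>

lemma planar_functionals:
  fixes m M :: "nat \<Rightarrow> nat"
  assumes "finite K" "planar_inj K I M z" "I \<subseteq> {1..9}"
  shows "\<exists>\<Phi>. finite \<Phi> \<and>
     card \<Phi> \<le> card (grid d - K) + (\<Sum>i=1..9. (M i + 1 choose 2) - (m i + 1 choose 2)) \<and>
     (\<forall>c. (\<forall>i\<in>{1..9}. euler_cond (grid d) (m i) c (z (i, False)) (z (i, True))) \<and>
         (\<forall>w\<in>\<Phi>. (\<Sum>\<alpha>\<in>grid d. c \<alpha> * w \<alpha>) = 0) \<longrightarrow> (\<forall>\<alpha>\<in>grid d. c \<alpha> = 0))"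
proof -
  define E :: "nat \<times> nat \<times> nat \<Rightarrow> nat \<times> nat \<Rightarrow> complex"
    where "E = (\<lambda>(i, a, b) \<alpha>. of_nat (fst \<alpha>) ^ a * of_nat (snd \<alpha>) ^ b * z (i, False) ^ fst \<alpha> * z (i, True) ^ snd \<alpha>)"
  define T where "T = (SIGMA i:{1..9}. {(a, b). a + b < M i} - {(a, b). a + b < m i})"
  define \<Phi> where "\<Phi> = (\<lambda>\<beta> \<alpha>. if \<alpha> = \<beta> then 1 else 0) ` (grid d - K) \<union> E ` T"
  have finT: "finite T" unfolding T_def using card_pairs_less(2) by blast
  have fin: "finite \<Phi>" using finT by (simp add: \<Phi>_def)
  have "card T = (\<Sum>i=1..9. card ({(a, b). a + b < M i} - {(a, b). a + b < m i}))"
    unfolding T_def using card_pairs_less(2) by (subst card_SigmaI) auto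
  also have "\<dots> \<le> (\<Sum>i=1..9. (M i + 1 choose 2) - (m i + 1 choose 2))"
  proof (rule sum_mono)
    fix i
    show "card ({(a, b). a + b < M i} - {(a, b). a + b < m i}) \<le> (M i + 1 choose 2) - (m i + 1 choose 2)"
    proof (cases "m i \<le> M i")
      case True
      then have "{(a, b). a + b < m i} \<subseteq> {(a, b). a + b < M i}" by auto
      then show ?thesis using card_pairs_less by (subst card_Diff_subset) auto
    next
      case False
      then have *: "{(a, b). a + b < M i} - {(a, b). a + b < m i} = {}" by auto
      show ?thesis unfolding * by simp
    qed
  qed
  finally have T: "card T \<le> (\<Sum>i=1..9. (M i + 1 choose 2) - (m i + 1 choose 2))" .
  have "card \<Phi> \<le> card (grid d - K) + card T" unfolding \<Phi>_def
    using finT by (intro order.trans[OF card_Un_le] add_mono card_image_le) auto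
  then have card: "card \<Phi> \<le> card (grid d - K) + (\<Sum>i=1..9. (M i + 1 choose 2) - (m i + 1 choose 2))"
    using T by linarith
  have "\<forall>\<alpha>\<in>grid d. c \<alpha> = 0"
    if c: "\<forall>i\<in>{1..9}. euler_cond (grid d) (m i) c (z (i, False)) (z (i, True))"
      and w: "\<forall>w\<in>\<Phi>. (\<Sum>\<alpha>\<in>grid d. c \<alpha> * w \<alpha>) = 0" for c
  proof -
    have off: "c \<beta> = 0" if "\<beta> \<in> grid d - K" for \<beta>
    proof -
      have "(\<Sum>\<alpha>\<in>grid d. c \<alpha> * (if \<alpha> = \<beta> then 1 else 0)) = 0" using w that by (auto simp: \<Phi>_def)
      moreover have "(\<Sum>\<alpha>\<in>grid d. c \<alpha> * (if \<alpha> = \<beta> then 1 else 0)) = (\<Sum>\<alpha>\<in>grid d. if \<alpha> = \<beta> then c \<beta> else 0)"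
        by (intro sum.cong) auto
      ultimately show ?thesis using that by simp
    qed
    \<comment> \<open>\<open>K\<close> exceeds \<open>grid d\<close> when the certificate belongs to
      a larger degree, so the coefficients are extended by 0.\<close>
    define c' where "c' = (\<lambda>\<alpha>. if \<alpha> \<in> grid d then c \<alpha> else 0)"
    have eq: "(\<Sum>\<alpha>\<in>K. c' \<alpha> * f \<alpha>) = (\<Sum>\<alpha>\<in>grid d. c \<alpha> * f \<alpha>)" for f
    proof -
      have "(\<Sum>\<alpha>\<in>K. c' \<alpha> * f \<alpha>) = (\<Sum>\<alpha>\<in>K \<inter> grid d. c \<alpha> * f \<alpha>)"
        using assms(1) by (intro sum.mono_neutral_cong_right) (auto simp: c'_def)
      also have "\<dots> = (\<Sum>\<alpha>\<in>grid d. c \<alpha> * f \<alpha>)"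
        using off by (intro sum.mono_neutral_left) auto
      finally show ?thesis .
    qed
    have "\<forall>i\<in>I. euler_cond K (M i) c' (z (i, False)) (z (i, True))" unfolding euler_cond_def eq
    proof (intro ballI allI impI)
      fix i a b assume i: "i \<in> I" and ab: "a + b < M i"
      show "(\<Sum>\<alpha>\<in>grid d. c \<alpha> * (of_nat (fst \<alpha>) ^ a * of_nat (snd \<alpha>) ^ b * z (i, False) ^ fst \<alpha> * z (i, True) ^ snd \<alpha>)) = 0"
      proof (cases "a + b < m i")
        case True
        then show ?thesis using c i assms(3) unfolding euler_cond_def by blast
      next
        case False
        then have "E (i, a, b) \<in> \<Phi>" using i ab assms(3) by (auto simp: \<Phi>_def T_def)
        then show ?thesis using w by (auto simp: E_def)
      qed
    qed
    then have "\<forall>\<alpha>\<in>K. c' \<alpha> = 0" using assms(2) unfolding planar_inj_def by blast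
    then have "c \<alpha> = 0" if "\<alpha> \<in> K" "\<alpha> \<in> grid d" for \<alpha>
      using that unfolding c'_def by metis
    then show ?thesis using off by blast
  qed
  then show ?thesis using fin card by blast
qed

lemma planar_nonspecialI:
  assumes K: "finite K" and inj: "planar_inj K I M z0" "I \<subseteq> {1..9}"
    and le: "int (card (grid d - K) + (\<Sum>i=1..9. (M i + 1 choose 2) - (nat (m i) + 1 choose 2))) \<le> max 0 (q_char d m)"
  shows "planar_nonspecial d m"
proof -
  obtain g where g: "line_poly g" "g z0 \<noteq> 0" "\<And>z. g z \<noteq> 0 \<Longrightarrow> planar_inj K I M z"
    using planar_inj_open[OF K inj(1)] by blast
  show ?thesis unfolding planar_nonspecial_def
  proof (intro exI[of _ g] exI[of _ z0] conjI allI impI)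
    fix z assume "g z \<noteq> 0"
    then obtain \<Phi> where "finite \<Phi>"
      "card \<Phi> \<le> card (grid d - K) + (\<Sum>i=1..9. (M i + 1 choose 2) - (nat (m i) + 1 choose 2))"
      "\<forall>c. (\<forall>i\<in>{1..9}. euler_cond (grid d) (nat (m i)) c (z (i, False)) (z (i, True))) \<and>
         (\<forall>w\<in>\<Phi>. (\<Sum>\<alpha>\<in>grid d. c \<alpha> * w \<alpha>) = 0) \<longrightarrow> (\<forall>\<alpha>\<in>grid d. c \<alpha> = 0)"
      using planar_functionals[OF K g(3) inj(2), of z d "\<lambda>i. nat (m i)"] by blast
    then show "\<exists>\<Phi>. finite \<Phi> \<and> int (card \<Phi>) \<le> max 0 (q_char d m) \<and>
       (\<forall>c. (\<forall>i\<in>{1..9}. euler_cond (grid d) (nat (m i)) c (z (i, False)) (z (i, True))) \<and>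
         (\<forall>w\<in>\<Phi>. (\<Sum>\<alpha>\<in>grid d. c \<alpha> * w \<alpha>) = 0) \<longrightarrow> (\<forall>\<alpha>\<in>grid d. c \<alpha> = 0))"
      using le by (intro exI[of _ \<Phi>] conjI) (assumption | linarith)+
  qed (use g in auto)
qed

lemma cuts_check_indices: "cuts_check d M C \<Longrightarrow> fst ` set C \<subseteq> {1..9}"
  by (induction d M C rule: cuts_check.induct) auto

lemma sum_9: "(\<Sum>i=1..(9::nat). f i) = f 1 + f 2 + f 3 + f 4 + f 5 + f 6 + f 7 + f 8 + f 9"
  by (simp add: numeral_eq_Suc add.assoc)

lemma ball_9: "(\<forall>i\<in>{1..9::nat}. P i) \<longleftrightarrow> P 1 \<and> P 2 \<and> P 3 \<and> P 4 \<and> P 5 \<and> P 6 \<and> P 7 \<and> P 8 \<and> P 9"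
proof -
  have "{1..9::nat} = {1, 2, 3, 4, 5, 6, 7, 8, 9}" by auto
  then show ?thesis by simp
qed

lemma two_choose_two: "0 \<le> x \<Longrightarrow> 2 * int (nat x + 1 choose 2) = x * (x + 1)"
proof -
  assume x: "0 \<le> x"
  have "2 * (n + 1 choose 2) = n * (n + 1)" for n :: nat by (induction n) (auto simp: numeral_2_eq_2)
  then have "int (2 * (nat x + 1 choose 2)) = int (nat x * (nat x + 1))" by presburger
  then show ?thesis using x by (simp add: algebra_simps)
qed

text \<open>The certificate wastes no condition. Enlarging the square and lowering the
  multiplicities therefore change the number of functionals and \<open>q_char d m\<close> by the
  same amount, and the two agree exactly.\<close>

lemma indep_cert_nonspecial:
  assumes C: "indep_cert d' M C" and d: "d' \<le> d" "-1 \<le> d" and m: "\<forall>i\<in>{1..9}. m i \<le> M ! (i - 1)"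
  shows "planar_nonspecial d m"
proof -
  let ?M = "\<lambda>i. nat (M ! (i - 1))"
  have c: "cuts_check d' M C" "length M = 9" "list_all (\<lambda>x. 0 \<le> x) M"
      "2 * cuts_size C = (\<Sum>x\<leftarrow>M. x * (x + 1))"
    using C by (auto simp: indep_cert_def)
  obtain z where z: "planar_inj (cuts_cells C) (fst ` set C) ?M z" and
    K: "cuts_cells C \<subseteq> grid d'" "int (card (cuts_cells C)) = cuts_size C"
    using cuts_check_planar[OF c(1)] by blast
  have K': "cuts_cells C \<subseteq> grid d" using K(1) d by (force simp: grid_def)
  have fin: "finite (cuts_cells C)" by (rule finite_subset[OF K']) simp
  have pos: "0 \<le> M ! (i - 1)" if "i \<in> {1..9}" for i using c(2,3) that by (auto simp: list_all_length)
  have M: "M = [M ! 0, M ! 1, M ! 2, M ! 3, M ! 4, M ! 5, M ! 6, M ! 7, M ! 8]"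
    using c(2) by (auto intro!: nth_equalityI simp: less_Suc_eq numeral_eq_Suc)
  have "(\<Sum>x\<leftarrow>M. x * (x + 1)) = (\<Sum>i=1..9. M ! (i - 1) * (M ! (i - 1) + 1))"
    by (subst M) (simp add: sum_9 del: One_nat_def, simp)
  also have "\<dots> = (\<Sum>i=1..9. 2 * int (?M i + 1 choose 2))"
    using pos by (intro sum.cong refl two_choose_two[symmetric]) auto
  finally have size: "cuts_size C = (\<Sum>i=1..9. int (?M i + 1 choose 2))"
    using c(4) by (simp add: sum_distrib_left[symmetric])
  have le: "(nat (m i) + 1 choose 2) \<le> (?M i + 1 choose 2)" if "i \<in> {1..9}" for i
    using m that by (intro binomial_right_mono add_mono nat_mono order.refl) blast
  have choose: "int (nat x + 1 choose 2) = int (nat (x + 1) choose 2)" for x :: int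
    by (cases "x \<ge> 0") (auto simp: nat_add_distrib binomial_eq_0)
  have "int (card (grid d - cuts_cells C) + (\<Sum>i=1..9. (?M i + 1 choose 2) - (nat (m i) + 1 choose 2)))
    = (int (card (grid d)) - int (card (cuts_cells C))) + (\<Sum>i=1..9. int (?M i + 1 choose 2) - int (nat (m i) + 1 choose 2))"
    using le K' card_mono[OF finite_grid K'] by (simp add: card_Diff_subset[OF fin K'] of_nat_diff)
  also have "\<dots> = q_char d m"
    using d unfolding q_char_def sum_subtractf choose[symmetric] by (simp add: card_grid K(2) size)
  finally show ?thesis
    using planar_nonspecialI[OF fin z cuts_check_indices[OF c(1)]] by simp
qed

text \<open>A system without nonzero forms stays so when multiplicities grow or the degree drops,
  hence no functional is added. Residual systems may have negative multiplicities, which count as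
  0.\<close>

lemma empty_cert_nonspecial:
  assumes C: "empty_cert d' M C" and d: "d \<le> d'" and m: "\<forall>i\<in>{1..9}. M ! (i - 1) \<le> max 0 (m i)"
  shows "planar_nonspecial d m"
proof -
  let ?M = "\<lambda>i. nat (M ! (i - 1))"
  have c: "cuts_check d' M C" "0 \<le> d'" "cuts_size C = (d' + 1) * (d' + 1)"
    using C by (auto simp: empty_cert_def)
  obtain z where z: "planar_inj (cuts_cells C) (fst ` set C) ?M z" and
    K: "cuts_cells C \<subseteq> grid d'" "int (card (cuts_cells C)) = cuts_size C"
    using cuts_check_planar[OF c(1)] by blast
  have "int (card (cuts_cells C)) = int (card (grid d'))"
    using K(2) c card_grid[of d'] by (simp add: power2_eq_square)
  then have "cuts_cells C = grid d'" using K(1) by (intro card_subset_eq) auto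
  then have K': "grid d \<subseteq> cuts_cells C" using d by (force simp: grid_def)
  have fin: "finite (cuts_cells C)" by (rule finite_subset[OF K(1)]) simp
  have "(?M i + 1 choose 2) - (nat (m i) + 1 choose 2) = 0" if "i \<in> {1..9}" for i
  proof -
    have "?M i \<le> nat (m i)" using m that by (fastforce simp: max_def split: if_splits)
    then show ?thesis by (simp add: binomial_right_mono)
  qed
  then have "(\<Sum>i=1..9. (?M i + 1 choose 2) - (nat (m i) + 1 choose 2)) = 0" by (intro sum.neutral) blast
  moreover have "grid d - cuts_cells C = {}" using K' by auto
  ultimately have "int (card (grid d - cuts_cells C) +
      (\<Sum>i=1..9. (?M i + 1 choose 2) - (nat (m i) + 1 choose 2))) \<le> max 0 (q_char d m)"
    by (metis add.right_neutral card.empty max.cobounded1 of_nat_0)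
  then show ?thesis by (rule planar_nonspecialI[OF fin z cuts_check_indices[OF c(1)]])
qed

text \<open>\<open>Split i k l r\<close> distinguishes whether the \<open>i\<close>-th multiplicity is less than \<open>k\<close>;
  at the leaves, the remaining box of multiplicities is dominated by a certificate or is empty.
  Boxes are shrunk using that the multiplicities decrease and that the system is Cremona reduced.\<close>

datatype cover = Split nat int cover cover | Indep "int list" | Empty "int list" | Void

text \<open>In a decreasing vector an upper bound is inherited by all later entries, and, for
  \<open>run_max\<close>, a lower bound by all earlier ones.\<close>

fun run_min :: "int list \<Rightarrow> int list" where
  "run_min (x # y # xs) = x # run_min (min x y # xs)"
| "run_min xs = xs"

fun run_max :: "int list \<Rightarrow> int list" where
  "run_max [] = []"
| "run_max (x # xs) = (case run_max xs of [] \<Rightarrow> [x] | y # ys \<Rightarrow> max x y # y # ys)"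

fun cremona_bound :: "int \<Rightarrow> int list \<Rightarrow> int list \<Rightarrow> int list" where
  "cremona_bound d (l1 # l2 # l3 # l4 # ls) (h1 # h2 # h3 # h4 # hs) =
     min h1 (2 * d - l2 - l3 - l4) # min h2 (2 * d - l1 - l3 - l4) #
     min h3 (2 * d - l1 - l2 - l4) # min h4 (2 * d - l1 - l2 - l3) # hs"
| "cremona_bound d _ hs = hs"

definition upper :: "int \<Rightarrow> int list \<Rightarrow> int list \<Rightarrow> int list" where
  "upper d l h = run_min (cremona_bound d (run_max l) (run_min h))"

text \<open>List positions count from 0, so \<open>Split i\<close> concerns
  \<open>m (i + 1)\<close>.\<close>

fun cover_check :: "int \<Rightarrow> int list \<Rightarrow> int list \<Rightarrow> cover \<Rightarrow> bool" where
  "cover_check d l h (Split i k t1 t2) \<longleftrightarrow>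
     cover_check d l (h[i := min (h ! i) (k - 1)]) t1 \<and> cover_check d (l[i := max (l ! i) k]) h t2"
| "cover_check d l h (Indep M) \<longleftrightarrow> list_all2 (\<le>) (upper d l h) M"
| "cover_check d l h (Empty M) \<longleftrightarrow> list_all2 (\<le>) M (run_max l)"
| "cover_check d l h Void \<longleftrightarrow> \<not> list_all2 (\<le>) (run_max l) (upper d l h)"

fun cover_indep :: "cover \<Rightarrow> int list set" where
  "cover_indep (Split i k t1 t2) = cover_indep t1 \<union> cover_indep t2"
| "cover_indep (Indep M) = {M}"
| "cover_indep _ = {}"

fun cover_empty :: "cover \<Rightarrow> int list set" where
  "cover_empty (Split i k t1 t2) = cover_empty t1 \<union> cover_empty t2"
| "cover_empty (Empty M) = {M}"
| "cover_empty _ = {}"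

lemma run_min_bound:
  "sorted_wrt (\<ge>) xs \<Longrightarrow> list_all2 (\<le>) xs h \<Longrightarrow> list_all2 (\<le>) xs (run_min h)"
proof (induction h arbitrary: xs rule: run_min.induct)
  case (1 x y h)
  obtain a b as where xs: "xs = a # b # as" using 1(3) by (auto simp: list_all2_Cons2)
  have "list_all2 (\<le>) (b # as) (run_min (min x y # h))"
    using 1(2,3) unfolding xs by (intro 1(1)) auto
  then show ?case using 1(2,3) unfolding xs by simp
qed auto

lemma run_max_bound:
  "sorted_wrt (\<ge>) xs \<Longrightarrow> list_all2 (\<le>) l xs \<Longrightarrow> list_all2 (\<le>) (run_max l) xs"
proof (induction l arbitrary: xs)
  case (Cons x l)
  obtain a as where xs: "xs = a # as" using Cons(3) by (auto simp: list_all2_Cons1)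
  have "list_all2 (\<le>) (run_max l) as" using Cons unfolding xs by auto
  then show ?case using Cons(2,3) unfolding xs
    by (cases "run_max l") (auto simp: list_all2_Cons1)
qed auto

lemma cremona_bound_bound:
  assumes "list_all2 (\<le>) l xs" "list_all2 (\<le>) xs h" "xs ! 0 + xs ! 1 + xs ! 2 + xs ! 3 \<le> 2 * d" "length xs \<ge> 4"
  shows "list_all2 (\<le>) xs (cremona_bound d l h)"
proof -
  obtain x1 x2 x3 x4 ys where xs: "xs = x1 # x2 # x3 # x4 # ys"
    using assms(4) by (auto simp: numeral_eq_Suc Suc_le_length_iff)
  show ?thesis using assms(1-3) unfolding xs by (auto simp: list_all2_Cons1 list_all2_Cons2)
qed

lemma upper_bound:
  assumes "list_all2 (\<le>) l xs" "list_all2 (\<le>) xs h" "xs ! 0 + xs ! 1 + xs ! 2 + xs ! 3 \<le> 2 * d" "length xs \<ge> 4"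
    "sorted_wrt (\<ge>) xs"
  shows "list_all2 (\<le>) xs (upper d l h)"
  unfolding upper_def using assms by (intro run_min_bound cremona_bound_bound run_max_bound)

lemma cover_check_sound:
  assumes "cover_check d l h t" "list_all2 (\<le>) l xs" "list_all2 (\<le>) xs h"
    "xs ! 0 + xs ! 1 + xs ! 2 + xs ! 3 \<le> 2 * d" "length xs = 9" "sorted_wrt (\<ge>) xs"
  shows "(\<exists>M\<in>cover_indep t. list_all2 (\<le>) xs M) \<or> (\<exists>M\<in>cover_empty t. list_all2 (\<le>) M xs)"
  using assms(1-3)
proof (induction t arbitrary: l h)
  case (Split i k t1 t2)
  show ?case
  proof (cases "xs ! i < k")
    case True
    then have "list_all2 (\<le>) xs (h[i := min (h ! i) (k - 1)])"
      using Split.prems by (cases "i < length h") (auto simp: list_all2_conv_all_nth nth_list_update)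
    then show ?thesis using Split by fastforce
  next
    case False
    then have "list_all2 (\<le>) (l[i := max (l ! i) k]) xs"
      using Split.prems by (cases "i < length l") (auto simp: list_all2_conv_all_nth nth_list_update)
    then show ?thesis using Split by fastforce
  qed
next
  case (Indep M)
  then have "list_all2 (\<le>) xs (upper d l h)" using assms by (intro upper_bound) auto
  then have "list_all2 (\<le>) xs M"
    by (rule list_all2_trans[of "(\<le>)" "(\<le>)" "(\<le>)", rotated]) (use Indep in auto)
  then show ?case by simp
next
  case (Empty M)
  have "list_all2 (\<le>) M xs"
    by (rule list_all2_trans[of "(\<le>)" "(\<le>)" "(\<le>)" _ "run_max l"]) (use Empty assms in \<open>auto intro: run_max_bound\<close>)
  then show ?case by simp
next
  case Void
  have "list_all2 (\<le>) (run_max l) xs" using assms Void by (intro run_max_bound) auto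
  moreover have "list_all2 (\<le>) xs (upper d l h)" using assms Void by (intro upper_bound) auto
  ultimately have "list_all2 (\<le>) (run_max l) (upper d l h)"
    by (rule list_all2_trans[of "(\<le>)" "(\<le>)" "(\<le>)", rotated]) auto
  then show ?case using Void by simp
qed

text \<open>The initial box encodes \<open>m 4 \<ge> 1\<close> and \<open>m 1 \<le> min 8 d\<close>.
  With \<open>m 4 \<le> 0\<close> the system is spanned by monomials after a change of coordinates
  and never needs a dissection.\<close>

lemma cover_nonspecial:
  assumes t: "cover_check d [1, 1, 1, 1, 0, 0, 0, 0, 0] (replicate 9 (min 8 d)) t"
    and ind: "\<forall>M\<in>cover_indep t. \<exists>d' C. d' \<le> d \<and> indep_cert d' M C"
    and emp: "\<forall>M\<in>cover_empty t. \<exists>d' C. d \<le> d' \<and> empty_cert d' M C"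
    and m: "\<forall>i\<in>{1..8}. m i \<ge> m (i + 1)" "m 1 \<le> 8" "m 1 \<le> d" "m 4 \<ge> 1" "m 1 + m 2 + m 3 + m 4 \<le> 2 * d"
  shows "planar_nonspecial d m"
proof -
  \<comment> \<open>Negative entries impose no condition and are replaced by 0. The first four
    entries are positive, so the Cremona inequality is unaffected.\<close>
  define xs where "xs = map (\<lambda>i. max 0 (m i)) [1, 2, 3, 4, 5, 6, 7, 8, 9]"
  have chain: "m 1 \<ge> m 2" "m 2 \<ge> m 3" "m 3 \<ge> m 4" "m 4 \<ge> m 5" "m 5 \<ge> m 6" "m 6 \<ge> m 7" "m 7 \<ge> m 8" "m 8 \<ge> m 9"
    using m(1)[THEN bspec, of 1] m(1)[THEN bspec, of 2] m(1)[THEN bspec, of 3] m(1)[THEN bspec, of 4]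
      m(1)[THEN bspec, of 5] m(1)[THEN bspec, of 6] m(1)[THEN bspec, of 7] m(1)[THEN bspec, of 8] by (simp_all add: numeral_2_eq_2[symmetric] del: One_nat_def)
  have nth: "xs ! (i - 1) = max 0 (m i)" if "i \<in> {1..9}" for i
  proof -
    have "\<forall>i\<in>{1..9}. xs ! (i - 1) = max 0 (m i)" unfolding ball_9 by (simp add: xs_def)
    then show ?thesis using that by blast
  qed
  have len: "length xs = 9" by (simp add: xs_def)
  have rep: "replicate 9 x = [x, x, x, x, x, x, x, x, x]" for x :: int by (simp add: numeral_eq_Suc)
  have "(\<exists>M\<in>cover_indep t. list_all2 (\<le>) xs M) \<or> (\<exists>M\<in>cover_empty t. list_all2 (\<le>) M xs)"
    by (rule cover_check_sound[OF t]) (use chain m(2-) in \<open>auto simp: xs_def rep\<close>)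
  then show ?thesis
  proof
    assume "\<exists>M\<in>cover_indep t. list_all2 (\<le>) xs M"
    then obtain M d' C where M: "list_all2 (\<le>) xs M" "d' \<le> d" "indep_cert d' M C" using ind by blast
    have "m i \<le> M ! (i - 1)" if i: "i \<in> {1..9}" for i
    proof -
      have "xs ! (i - 1) \<le> M ! (i - 1)" using list_all2_nthD[OF M(1), of "i - 1"] i len by force
      then show ?thesis using nth[OF i] by simp
    qed
    then show ?thesis using indep_cert_nonspecial[OF M(3,2)] m chain by simp
  next
    assume "\<exists>M\<in>cover_empty t. list_all2 (\<le>) M xs"
    then obtain M d' C where M: "list_all2 (\<le>) M xs" "d \<le> d'" "empty_cert d' M C" using emp by blast
    have "M ! (i - 1) \<le> max 0 (m i)" if i: "i \<in> {1..9}" for i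
    proof -
      have "length M = 9" using M(1) len by (simp add: list_all2_lengthD)
      then have "M ! (i - 1) \<le> xs ! (i - 1)" using list_all2_nthD[OF M(1), of "i - 1"] i by force
      then show ?thesis using nth[OF i] by simp
    qed
    then show ?thesis using empty_cert_nonspecial[OF M(3,2)] by simp
  qed
qed

section \<open>Dissections of the squares of monomials\<close>

text \<open>The dissections were found by a randomized computer search.\<close>

lemma indep_cert_empty:
  assumes "\<exists>C. indep_cert d M C" "0 \<le> d" "(\<Sum>x\<leftarrow>M. x * (x + 1)) = 2 * ((d + 1) * (d + 1))"
  shows "\<exists>C. empty_cert d M C"
  using assms unfolding indep_cert_def empty_cert_def by auto

lemma indep_leaf: "\<exists>C. indep_cert d' M C \<Longrightarrow> d' \<le> d \<Longrightarrow> \<exists>d' C. d' \<le> d \<and> indep_cert d' M C"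
  by blast

lemma empty_leaf: "\<exists>C. empty_cert d' M C \<Longrightarrow> d \<le> d' \<Longrightarrow> \<exists>d' C. d \<le> d' \<and> empty_cert d' M C"
  by blast

lemma indep_2_1: "\<exists>C. indep_cert 2 [1, 1, 1, 1, 1, 1, 1, 1, 1] C"
  by (rule exI[of _ "[(1,-1,-1,0,False,[(0,0,1)]),
(2,1,-1,2,True,[(0,2,1)]),
(3,2,-1,3,True,[(1,2,1)]),
(4,1,0,2,True,[(2,2,1)]),
(5,1,1,3,False,[(1,2,1)]),
(6,2,1,3,True,[(1,1,1)]),
(7,-2,-1,-1,False,[(0,1,1)]),
(8,-1,0,0,False,[(0,2,1)]),
(9,0,0,0,False,[(1,0,1)])]"]) code_simp

lemma indep_3_1: "\<exists>C. indep_cert 3 [3, 2, 1, 1, 1, 1, 1, 1, 1] C"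
  by (rule exI[of _ "[(3,1,-1,3,True,[(0,3,1)]),
(1,3,-2,3,False,[(3,1,3),(2,0,2),(1,0,1)]),
(4,1,1,5,True,[(3,2,1)]),
(5,1,0,2,False,[(2,2,1)]),
(2,1,1,3,True,[(3,0,2),(2,1,1)]),
(6,-1,-1,0,False,[(0,0,1)]),
(7,-1,1,2,False,[(0,2,1)]),
(8,-1,-1,-1,False,[(0,1,1)]),
(9,0,0,0,True,[(1,1,1)])]"]) code_simp

lemma indep_4_1: "\<exists>C. indep_cert 4 [2, 2, 2, 2, 2, 2, 2, 2, 1] C"
  by (rule exI[of _ "[(1,-1,1,3,True,[(4,0,2),(3,0,1)]),
(9,-1,-1,0,False,[(0,0,1)]),
(2,-2,1,1,False,[(0,1,2),(1,3,1)]),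
(3,1,1,7,True,[(4,3,2),(3,4,1)]),
(4,1,-1,3,True,[(0,3,2),(1,4,1)]),
(5,1,-2,1,True,[(0,1,2),(1,3,1)]),
(6,1,0,3,True,[(2,3,2),(3,3,1)]),
(7,-1,1,1,False,[(2,3,2),(1,2,1)]),
(8,0,0,0,True,[(1,1,2),(2,2,1)])]"]) code_simp

lemma indep_4_2: "\<exists>C. indep_cert 4 [4, 3, 2, 1, 1, 1, 1, 1, 1] C"
  by (rule exI[of _ "[(4,1,-1,4,True,[(0,4,1)]),
(1,4,-3,4,False,[(4,1,4),(3,0,3),(2,0,2),(1,0,1)]),
(5,1,1,7,True,[(4,3,1)]),
(3,2,1,7,False,[(2,3,2),(3,3,1)]),
(2,1,1,3,False,[(1,2,3),(0,3,2),(2,2,1)]),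
(6,-1,-1,0,False,[(0,0,1)]),
(7,-1,1,2,False,[(0,2,1)]),
(8,-1,-1,-1,False,[(0,1,1)]),
(9,0,0,0,True,[(1,1,1)])]"]) code_simp

lemma indep_5_1: "\<exists>C. indep_cert 5 [3, 3, 3, 2, 2, 2, 2, 2, 2] C"
  by (rule exI[of _ "[(4,-1,-1,-1,True,[(0,0,2),(1,0,1)]),
(5,-1,1,4,False,[(0,4,2),(1,5,1)]),
(6,-1,2,7,True,[(5,2,2),(4,1,1)]),
(7,-2,1,1,False,[(0,2,2),(1,3,1)]),
(1,1,-1,3,True,[(0,3,3),(1,4,2),(2,5,1)]),
(8,1,1,9,False,[(5,4,2),(4,5,1)]),
(2,2,1,9,True,[(3,3,3),(4,3,2),(2,4,1)]),
(3,-1,2,1,False,[(2,2,3),(1,1,2),(3,2,1)]),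
(9,0,0,0,True,[(1,2,2),(0,2,1)])]"]) code_simp

lemma indep_5_2: "\<exists>C. indep_cert 5 [4, 2, 2, 2, 2, 2, 2, 2, 2] C"
  by (rule exI[of _ "[(2,-2,1,3,False,[(0,3,2),(1,5,1)]),
(3,-1,2,7,True,[(5,2,2),(4,1,1)]),
(4,-3,5,11,True,[(4,2,2),(3,1,1)]),
(5,-1,-1,-1,False,[(0,0,2),(1,0,1)]),
(6,0,1,4,True,[(4,4,2),(5,5,1)]),
(7,-1,-2,-3,True,[(0,2,2),(1,1,1)]),
(8,-1,1,1,True,[(2,0,2),(3,2,1)]),
(1,1,-2,-1,False,[(5,0,4),(4,0,3),(3,1,2),(2,1,1)]),
(9,0,0,0,True,[(3,3,2),(2,2,1)])]"]) code_simp

lemma indep_5_3: "\<exists>C. indep_cert 5 [5, 4, 2, 2, 1, 1, 1, 1, 1] C"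
  by (rule exI[of _ "[(5,-1,1,5,True,[(5,0,1)]),
(6,-2,1,4,True,[(4,0,1)]),
(7,-1,-1,0,False,[(0,0,1)]),
(8,-3,1,3,True,[(3,0,1)]),
(1,-2,3,3,True,[(5,1,5),(4,1,4),(3,1,3),(2,0,2),(1,0,1)]),
(9,0,1,4,True,[(4,5,1)]),
(3,-1,-1,-2,True,[(0,1,2),(1,1,1)]),
(2,-1,1,-3,True,[(2,2,4),(1,2,3),(3,4,2),(0,3,1)]),
(4,0,0,0,True,[(0,4,2),(1,5,1)])]"]) code_simp

lemma indep_6_1: "\<exists>C. indep_cert 6 [3, 3, 3, 3, 3, 3, 3, 2, 2] C"
  by (rule exI[of _ "[(1,1,1,10,False,[(6,4,3),(5,5,2),(4,6,1)]),
(2,5,3,33,False,[(6,1,3),(5,3,2),(3,6,1)]),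
(3,2,-1,7,True,[(0,4,3),(1,4,2),(2,5,1)]),
(4,1,2,12,True,[(6,0,3),(5,2,2),(4,4,1)]),
(5,2,-3,1,True,[(0,1,3),(1,2,2),(2,4,1)]),
(8,1,3,15,True,[(5,0,2),(4,3,1)]),
(9,1,1,6,True,[(3,3,2),(4,2,1)]),
(6,-1,-3,-8,False,[(0,0,3),(1,1,2),(2,2,1)]),
(7,0,0,0,True,[(3,0,3),(4,0,2),(2,3,1)])]"]) code_simp

lemma indep_6_2: "\<exists>C. indep_cert 6 [3, 3, 3, 3, 3, 3, 3, 3, 1] C"
  by (rule exI[of _ "[(9,-1,-1,0,True,[(0,0,1)]),
(1,-1,1,4,False,[(0,4,3),(1,5,2),(2,6,1)]),
(2,-2,1,1,False,[(0,1,3),(1,3,2),(2,5,1)]),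
(3,1,-1,4,True,[(0,4,3),(1,5,2),(2,6,1)]),
(4,1,1,10,False,[(6,4,3),(5,5,2),(4,6,1)]),
(5,-1,3,8,True,[(4,2,3),(5,3,2),(6,3,1)]),
(6,2,1,10,True,[(3,4,3),(2,4,2),(4,5,1)]),
(7,1,1,4,False,[(3,1,3),(2,2,2),(4,1,1)]),
(8,0,0,0,True,[(0,1,3),(1,1,2),(2,1,1)])]"]) code_simp

lemma indep_6_3: "\<exists>C. indep_cert 6 [5, 4, 3, 2, 2, 2, 2, 2, 2] C"
  by (rule exI[of _ "[(4,1,1,11,True,[(6,5,2),(5,6,1)]),
(5,1,-1,5,True,[(0,5,2),(1,6,1)]),
(2,3,-5,3,True,[(0,1,4),(1,3,3),(2,5,2),(3,6,1)]),
(3,2,1,13,False,[(5,3,3),(4,5,2),(6,4,1)]),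
(6,2,3,21,False,[(3,5,2),(2,6,1)]),
(7,-1,1,5,False,[(0,5,2),(1,6,1)]),
(8,3,-2,5,True,[(2,3,2),(3,4,1)]),
(9,-1,-2,-3,True,[(1,0,2),(0,0,1)]),
(1,0,0,0,True,[(4,0,5),(3,0,4),(2,0,3),(5,1,2),(1,2,1)])]"]) code_simp

lemma indep_6_4: "\<exists>C. indep_cert 6 [6, 3, 2, 2, 2, 2, 2, 2, 2] C"
  by (rule exI[of _ "[(2,1,1,10,False,[(6,4,3),(5,5,2),(4,6,1)]),
(3,3,2,22,False,[(6,2,2),(4,5,1)]),
(4,3,1,18,False,[(6,0,2),(5,3,1)]),
(5,1,-1,4,True,[(0,4,2),(1,5,1)]),
(1,3,2,10,False,[(3,1,6),(2,2,5),(4,1,4),(1,4,3),(0,5,2),(5,2,1)]),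
(6,0,1,3,True,[(3,0,2),(4,0,1)]),
(7,1,0,2,True,[(0,2,2),(1,2,1)]),
(8,-1,1,1,False,[(0,1,2),(1,2,1)]),
(9,0,0,0,True,[(0,0,2),(1,1,1)])]"]) code_simp

lemma indep_6_5: "\<exists>C. indep_cert 6 [6, 6, 1, 1, 1, 1, 1, 1, 1] C"
  by (rule exI[of _ "[(3,1,-1,6,True,[(0,6,1)]),
(4,1,1,12,True,[(6,6,1)]),
(5,2,1,17,False,[(6,5,1)]),
(6,-1,-1,0,True,[(0,0,1)]),
(7,-1,-2,-1,False,[(1,0,1)]),
(8,3,1,22,False,[(6,4,1)]),
(9,1,-2,5,False,[(5,0,1)]),
(1,3,4,22,True,[(6,0,6),(5,1,5),(4,2,4),(3,4,3),(2,5,2),(1,6,1)]),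
(2,0,0,0,True,[(1,0,6),(2,0,5),(3,0,4),(0,2,3),(4,0,2),(5,0,1)])]"]) code_simp

lemma indep_7_1: "\<exists>C. indep_cert 7 [4, 4, 3, 3, 3, 3, 3, 3, 3] C"
  by (rule exI[of _ "[(3,-3,2,8,False,[(0,4,3),(1,6,2),(2,7,1)]),
(1,-3,5,16,True,[(7,3,4),(5,1,3),(6,2,2),(4,1,1)]),
(4,-1,-1,-2,False,[(0,0,3),(1,0,2),(2,0,1)]),
(5,1,2,16,False,[(7,5,3),(6,5,2),(5,6,1)]),
(6,1,2,13,True,[(4,5,3),(5,4,2),(3,7,1)]),
(2,3,-2,12,False,[(6,0,4),(7,0,3),(5,0,2),(4,0,1)]),
(7,1,-2,0,True,[(1,2,3),(2,4,2),(0,3,1)]),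
(8,1,0,3,False,[(3,2,3),(4,3,2),(5,3,1)]),
(9,0,0,0,True,[(3,0,3),(2,1,2),(4,2,1)])]"]) code_simp

lemma indep_7_2: "\<exists>C. indep_cert 7 [5, 3, 3, 3, 3, 3, 3, 3, 3] C"
  by (rule exI[of _ "[(2,-1,1,5,False,[(0,5,3),(1,6,2),(2,7,1)]),
(3,1,1,12,True,[(7,5,3),(6,6,2),(5,7,1)]),
(4,2,1,16,False,[(7,2,3),(6,4,2),(5,6,1)]),
(5,1,2,14,True,[(6,2,3),(5,4,2),(7,4,1)]),
(1,-1,-1,-4,True,[(0,0,5),(1,0,4),(2,0,3),(3,0,2),(4,0,1)]),
(6,2,-1,10,True,[(0,5,3),(1,6,2),(2,6,1)]),
(7,1,-1,2,False,[(5,1,3),(4,1,2),(6,3,1)]),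
(8,2,-1,2,True,[(4,3,3),(3,3,2),(2,3,1)]),
(9,0,0,0,False,[(2,3,3),(1,4,2),(3,5,1)])]"]) code_simp

lemma indep_7_3: "\<exists>C. indep_cert 7 [6, 5, 4, 2, 2, 2, 2, 2, 2] C"
  by (rule exI[of _ "[(4,1,1,13,True,[(7,6,2),(6,7,1)]),
(5,1,-1,6,True,[(0,6,2),(1,7,1)]),
(6,2,1,18,False,[(7,4,2),(6,6,1)]),
(7,2,3,28,False,[(5,6,2),(4,7,1)]),
(1,-1,-1,-5,True,[(0,0,6),(1,0,5),(2,0,4),(3,0,3),(4,0,2),(5,0,1)]),
(8,-1,1,6,False,[(0,6,2),(1,7,1)]),
(2,1,-2,-4,True,[(3,3,5),(2,4,4),(4,4,3),(1,5,2),(5,6,1)]),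
(3,2,-1,-2,False,[(3,4,4),(2,4,3),(4,5,2),(5,5,1)]),
(9,0,0,0,False,[(1,5,2),(2,7,1)])]"]) code_simp

lemma indep_7_4: "\<exists>C. indep_cert 7 [7, 5, 2, 2, 2, 2, 2, 2, 2] C"
  by (rule exI[of _ "[(3,1,-1,6,True,[(0,6,2),(1,7,1)]),
(4,1,1,13,True,[(7,6,2),(6,7,1)]),
(5,2,1,18,False,[(7,4,2),(6,6,1)]),
(6,-1,1,6,False,[(0,6,2),(1,7,1)]),
(2,-1,-1,-4,False,[(0,0,5),(1,0,4),(2,0,3),(3,0,2),(4,0,1)]),
(7,1,-3,2,False,[(5,0,2),(6,1,1)]),
(8,2,3,28,False,[(5,6,2),(4,7,1)]),
(1,-1,1,-3,True,[(5,0,7),(4,1,6),(3,2,5),(6,1,4),(2,3,3),(7,2,2),(1,4,1)]),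
(9,0,0,0,False,[(7,2,2),(6,2,1)])]"]) code_simp

lemma indep_7_5: "\<exists>C. indep_cert 7 [7, 5, 3, 2, 2, 2, 2, 1, 1] C"
  by (rule exI[of _ "[(4,1,1,13,False,[(7,6,2),(6,7,1)]),
(2,3,2,23,False,[(7,1,5),(5,4,4),(6,3,3),(4,6,2),(3,7,1)]),
(1,3,1,9,False,[(3,0,7),(4,0,6),(2,3,5),(5,0,4),(6,0,3),(1,6,2),(7,0,1)]),
(8,1,-1,2,False,[(2,0,1)]),
(5,1,1,6,False,[(0,6,2),(1,5,1)]),
(9,-1,1,5,True,[(5,0,1)]),
(3,2,1,4,False,[(1,2,3),(2,1,2),(0,4,1)]),
(6,1,1,2,False,[(0,2,2),(1,1,1)]),
(7,0,0,0,True,[(0,0,2),(1,0,1)])]"]) code_simp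

lemma indep_8_1: "\<exists>C. indep_cert 8 [4, 4, 4, 4, 4, 4, 3, 3, 3] C"
  by (rule exI[of _ "[(1,2,3,31,False,[(8,5,4),(7,6,3),(5,7,2),(6,7,1)]),
(2,-1,1,5,False,[(0,5,4),(1,6,3),(2,7,2),(3,8,1)]),
(7,3,2,28,False,[(8,2,3),(6,5,2),(7,4,1)]),
(3,4,1,26,False,[(7,0,4),(6,2,3),(8,0,2),(5,6,1)]),
(8,2,-1,8,False,[(5,0,3),(6,0,2),(4,0,1)]),
(9,2,3,23,False,[(4,5,3),(3,6,2),(5,5,1)]),
(4,3,1,12,False,[(4,1,4),(3,3,3),(5,3,2),(2,6,1)]),
(5,-1,-1,-3,True,[(0,0,4),(1,0,3),(2,0,2),(3,0,1)]),
(6,0,0,0,False,[(2,2,4),(1,3,3),(3,1,2),(0,4,1)])]"]) code_simp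

lemma indep_8_2: "\<exists>C. indep_cert 8 [4, 4, 4, 4, 4, 4, 4, 3, 2] C"
  by (rule exI[of _ "[(1,4,3,44,True,[(8,5,4),(7,6,3),(6,7,2),(4,8,1)]),
(8,1,-1,6,True,[(0,6,3),(1,7,2),(2,8,1)]),
(2,1,-2,2,True,[(0,2,4),(1,4,3),(2,6,2),(3,8,1)]),
(9,-1,-2,-3,True,[(1,0,2),(0,0,1)]),
(3,-3,-2,-11,False,[(0,2,4),(1,2,3),(2,1,2),(3,1,1)]),
(4,1,2,17,True,[(8,1,4),(7,3,3),(6,5,2),(5,7,1)]),
(5,-1,1,3,True,[(6,0,4),(7,0,3),(5,1,2),(8,0,1)]),
(6,-3,2,-5,False,[(3,2,4),(4,4,3),(2,3,2),(5,5,1)]),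
(7,0,0,0,True,[(3,4,4),(4,5,3),(2,4,2),(5,6,1)])]"]) code_simp

lemma indep_8_3: "\<exists>C. indep_cert 8 [4, 4, 4, 4, 4, 4, 4, 4, 1] C"
  by (rule exI[of _ "[(9,1,-1,8,True,[(0,8,1)]),
(1,4,-3,20,False,[(8,1,4),(7,0,3),(6,0,2),(5,0,1)]),
(2,1,1,13,False,[(8,5,4),(7,6,3),(6,7,2),(5,8,1)]),
(3,-1,1,5,False,[(0,5,4),(1,6,3),(2,7,2),(3,8,1)]),
(4,-1,-1,-3,False,[(0,0,4),(1,0,3),(2,0,2),(3,0,1)]),
(5,1,-3,-3,True,[(2,3,4),(1,3,3),(3,6,2),(0,4,1)]),
(6,1,3,21,True,[(6,3,4),(7,3,3),(5,6,2),(8,4,1)]),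
(7,3,2,18,True,[(4,4,4),(5,3,3),(3,4,2),(6,2,1)]),
(8,0,0,0,True,[(4,0,4),(3,1,3),(5,1,2),(2,2,1)])]"]) code_simp

lemma indep_8_4: "\<exists>C. indep_cert 8 [5, 5, 5, 3, 3, 3, 3, 3, 3] C"
  by (rule exI[of _ "[(4,1,-1,6,True,[(0,6,3),(1,7,2),(2,8,1)]),
(5,1,1,14,True,[(8,6,3),(7,7,2),(6,8,1)]),
(6,2,1,19,False,[(8,3,3),(7,5,2),(6,7,1)]),
(7,-1,1,6,False,[(0,6,3),(1,7,2),(2,8,1)]),
(1,-1,-1,-4,False,[(0,0,5),(1,0,4),(2,0,3),(3,0,2),(4,0,1)]),
(8,1,-2,2,True,[(1,4,3),(2,6,2),(0,5,1)]),
(2,-2,1,-1,False,[(2,3,5),(3,5,4),(1,4,3),(4,7,2),(0,5,1)]),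
(3,1,-1,0,True,[(3,3,5),(4,4,4),(2,3,3),(5,5,2),(6,6,1)]),
(9,0,0,0,False,[(5,6,3),(4,5,2),(3,4,1)])]"]) code_simp

lemma indep_8_5: "\<exists>C. indep_cert 8 [7, 4, 3, 3, 3, 3, 3, 3, 3] C"
  by (rule exI[of _ "[(2,-1,-1,-3,True,[(0,0,4),(1,0,3),(2,0,2),(3,0,1)]),
(3,-1,1,6,True,[(8,0,3),(7,0,2),(6,0,1)]),
(1,5,6,52,True,[(7,2,7),(8,3,6),(6,4,5),(5,5,4),(4,6,3),(3,7,2),(2,8,1)]),
(4,2,-1,12,True,[(0,6,3),(1,7,2),(2,7,1)]),
(5,-2,3,12,True,[(6,1,3),(5,0,2),(4,0,1)]),
(6,2,-1,8,False,[(5,0,3),(6,1,2),(4,0,1)]),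
(7,-2,1,-1,False,[(2,3,3),(1,3,2),(3,5,1)]),
(8,2,-1,5,False,[(4,1,3),(5,3,2),(3,1,1)]),
(9,0,0,0,False,[(3,2,3),(4,4,2),(2,2,1)])]"]) code_simp

lemma indep_8_6: "\<exists>C. indep_cert 8 [7, 5, 4, 3, 3, 3, 3, 2, 1] C"
  by (rule exI[of _ "[(2,1,-1,4,False,[(8,0,5),(7,0,4),(6,0,3),(5,0,2),(4,0,1)]),
(4,2,-1,9,False,[(8,5,3),(7,4,2),(6,3,1)]),
(5,-1,-1,-2,True,[(0,0,3),(1,0,2),(2,0,1)]),
(6,1,-2,0,True,[(1,2,3),(2,4,2),(0,3,1)]),
(3,-1,1,5,True,[(8,0,4),(7,0,3),(6,0,2),(5,0,1)]),
(9,2,-3,1,False,[(5,3,1)]),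
(1,-3,-2,-28,True,[(4,0,7),(5,1,6),(3,0,5),(6,2,4),(2,1,3),(7,3,2),(8,4,1)]),
(7,-2,1,-6,True,[(8,5,3),(7,5,2),(6,6,1)]),
(8,0,0,0,False,[(7,6,2),(8,8,1)])]"]) code_simp

lemma indep_8_7: "\<exists>C. indep_cert 8 [8, 6, 3, 2, 2, 2, 2, 2, 2] C"
  by (rule exI[of _ "[(1,1,-1,1,False,[(8,0,8),(7,0,7),(6,0,6),(5,0,5),(4,0,4),(3,0,3),(2,0,2),(1,0,1)]),
(4,-1,1,7,False,[(0,7,2),(1,8,1)]),
(5,0,-1,-1,True,[(1,0,2),(0,0,1)]),
(3,1,0,6,False,[(6,6,3),(7,7,2),(8,8,1)]),
(6,1,-2,-3,True,[(2,1,2),(3,3,1)]),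
(7,1,-4,-11,True,[(3,1,2),(2,0,1)]),
(8,-1,2,13,True,[(8,2,2),(7,1,1)]),
(9,-3,4,21,True,[(6,0,2),(7,2,1)]),
(2,0,0,0,True,[(5,0,6),(4,0,5),(6,2,4),(7,3,3),(8,4,2),(3,0,1)])]"]) code_simp

lemma indep_8_8: "\<exists>C. indep_cert 8 [8, 8, 1, 1, 1, 1, 1, 1, 1] C"
  by (rule exI[of _ "[(3,-1,1,8,True,[(8,0,1)]),
(4,-1,-1,0,True,[(0,0,1)]),
(5,1,1,16,False,[(8,8,1)]),
(6,-1,-2,-1,True,[(0,1,1)]),
(7,1,-1,8,True,[(0,8,1)]),
(1,-5,-6,-42,True,[(1,0,8),(2,0,7),(0,2,6),(3,0,5),(4,0,4),(5,0,3),(6,0,2),(7,0,1)]),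
(8,1,2,23,False,[(7,8,1)]),
(9,1,3,30,False,[(6,8,1)]),
(2,0,0,0,True,[(7,1,8),(6,2,7),(5,3,6),(4,4,5),(8,2,4),(3,5,3),(2,7,2),(1,8,1)])]"]) code_simp

text \<open>Here 7 * 10 + 2 * 6 = 82 conditions meet 81 monomials; the piece of point 9 has only
  five cells instead of six.\<close>

lemma empty_8_1: "\<exists>C. empty_cert 8 [4, 4, 4, 4, 4, 4, 4, 3, 3] C"
  by (rule exI[of _ "[(8,1,1,14,False,[(8,6,3),(7,7,2),(6,8,1)]),
(9,-3,2,11,True,[(7,0,2),(8,0,2),(6,0,1)]),
(1,1,-1,5,False,[(8,0,4),(7,0,3),(6,0,2),(5,0,1)]),
(2,1,2,18,True,[(8,2,4),(7,4,3),(6,6,2),(5,8,1)]),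
(3,3,-1,13,False,[(6,2,4),(7,3,3),(5,1,2),(8,4,1)]),
(4,5,-3,10,False,[(4,0,4),(5,3,3),(3,0,2),(2,0,1)]),
(5,-5,3,6,False,[(0,2,4),(1,4,3),(2,6,2),(3,7,1)]),
(6,-1,-1,-5,False,[(1,0,4),(2,1,3),(0,0,2),(3,2,1)]),
(7,0,0,0,False,[(3,3,4),(4,4,3),(2,4,2),(5,6,1)])]"]) code_simp

lemma indep_9_1: "\<exists>C. indep_cert 9 [5, 5, 4, 4, 4, 4, 4, 4, 4] C"
  by (rule exI[of _ "[(1,1,1,14,True,[(9,5,5),(8,6,4),(7,7,3),(6,8,2),(5,9,1)]),
(3,-1,1,6,True,[(9,0,4),(8,0,3),(7,0,2),(6,0,1)]),
(4,1,-1,6,False,[(9,0,4),(8,0,3),(7,0,2),(6,0,1)]),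
(2,-2,1,1,False,[(0,1,5),(1,3,4),(2,5,3),(3,7,2),(4,9,1)]),
(5,-1,3,12,True,[(6,3,4),(7,4,3),(8,4,2),(5,3,1)]),
(6,1,-2,2,True,[(0,2,4),(1,4,3),(2,6,2),(3,8,1)]),
(7,-1,-2,-8,True,[(2,1,4),(1,1,3),(0,0,2),(3,2,1)]),
(8,1,-1,2,True,[(4,6,4),(3,5,3),(5,7,2),(2,5,1)]),
(9,0,0,0,True,[(4,2,4),(5,4,3),(3,3,2),(6,7,1)])]"]) code_simp

lemma indep_9_2: "\<exists>C. indep_cert 9 [6, 4, 4, 4, 4, 4, 4, 4, 3] C"
  by (rule exI[of _ "[(2,1,1,15,True,[(9,6,4),(8,7,3),(7,8,2),(6,9,1)]),
(9,-1,1,7,True,[(9,0,3),(8,0,2),(7,0,1)]),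
(3,-2,5,30,True,[(8,2,4),(9,3,3),(7,1,2),(6,0,1)]),
(4,1,-1,6,True,[(0,6,4),(1,7,3),(2,8,2),(3,9,1)]),
(1,2,3,23,True,[(5,4,6),(6,4,5),(7,3,4),(4,6,3),(3,7,2),(8,6,1)]),
(5,-1,2,6,True,[(5,0,4),(4,0,3),(6,1,2),(3,0,1)]),
(6,2,-1,7,False,[(5,0,4),(6,1,3),(4,0,2),(7,2,1)]),
(7,-3,-2,-9,True,[(0,0,4),(1,0,3),(2,0,2),(3,1,1)]),
(8,0,0,0,False,[(3,1,4),(4,2,3),(2,2,2),(5,4,1)])]"]) code_simp

lemma indep_9_3: "\<exists>C. indep_cert 9 [7, 6, 5, 3, 3, 3, 3, 3, 3] C"
  by (rule exI[of _ "[(2,-1,-1,-5,True,[(0,0,6),(1,0,5),(2,0,4),(3,0,3),(4,0,2),(5,0,1)]),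
(4,1,-1,7,False,[(9,0,3),(8,0,2),(7,0,1)]),
(5,1,-3,1,True,[(1,5,3),(2,7,2),(0,6,1)]),
(6,-2,-1,-8,False,[(0,6,3),(1,5,2),(2,4,1)]),
(7,-2,1,4,False,[(1,7,3),(2,8,2),(0,9,1)]),
(3,1,1,14,True,[(9,5,5),(8,6,4),(7,7,3),(6,8,2),(5,9,1)]),
(8,-3,2,5,False,[(3,7,3),(2,6,2),(4,9,1)]),
(9,1,-2,1,True,[(3,7,3),(2,5,2),(4,9,1)]),
(1,0,0,0,True,[(5,2,7),(4,3,6),(6,3,5),(3,3,4),(7,4,3),(8,4,2),(2,4,1)])]"]) code_simp

lemma indep_9_4: "\<exists>C. indep_cert 9 [7, 7, 3, 3, 3, 3, 3, 3, 3] C"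
  by (rule exI[of _ "[(3,3,2,38,False,[(9,7,3),(8,7,2),(7,9,1)]),
(4,1,-1,7,True,[(0,7,3),(1,8,2),(2,9,1)]),
(1,-1,1,3,False,[(0,3,7),(1,4,6),(2,5,5),(3,6,4),(4,7,3),(5,8,2),(6,9,1)]),
(5,1,-2,4,True,[(0,4,3),(1,6,2),(2,8,1)]),
(6,2,-1,12,False,[(9,3,3),(8,3,2),(7,2,1)]),
(2,1,3,12,False,[(6,2,7),(7,3,6),(5,3,5),(4,3,4),(3,3,3),(8,5,2),(2,4,1)]),
(7,1,2,7,True,[(2,3,3),(3,1,2),(1,5,1)]),
(8,1,1,3,True,[(1,2,3),(2,1,2),(0,3,1)]),
(9,0,0,0,False,[(0,0,3),(1,0,2),(2,0,1)])]"]) code_simp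

lemma indep_9_5: "\<exists>C. indep_cert 9 [8, 4, 4, 4, 4, 3, 3, 3, 3] C"
  by (rule exI[of _ "[(6,1,-1,7,False,[(9,0,3),(8,0,2),(7,0,1)]),
(2,1,1,15,True,[(9,6,4),(8,7,3),(7,8,2),(6,9,1)]),
(3,5,2,46,False,[(8,3,4),(9,3,3),(7,6,2),(6,8,1)]),
(4,-1,1,6,True,[(9,0,4),(8,0,3),(7,0,2),(6,0,1)]),
(7,1,-2,4,True,[(0,4,3),(1,6,2),(2,8,1)]),
(8,3,-2,12,False,[(7,2,3),(6,2,2),(5,1,1)]),
(5,3,-5,0,True,[(0,0,4),(1,2,3),(2,4,2),(3,5,1)]),
(9,-1,-2,-6,False,[(0,1,3),(1,1,2),(2,2,1)]),
(1,0,0,0,True,[(5,0,8),(4,0,7),(6,1,6),(7,2,5),(3,1,4),(8,3,3),(9,4,2),(2,3,1)])]"]) code_simp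

lemma indep_9_6: "\<exists>C. indep_cert 9 [8, 6, 4, 3, 3, 3, 3, 2, 2] C"
  by (rule exI[of _ "[(8,-1,-1,-1,True,[(0,0,2),(1,0,1)]),
(3,1,-1,6,True,[(0,6,4),(1,7,3),(2,8,2),(3,9,1)]),
(1,-2,-3,-21,True,[(2,0,8),(3,0,7),(1,1,6),(4,0,5),(0,2,4),(5,1,3),(6,0,2),(7,0,1)]),
(4,1,1,16,False,[(9,7,3),(8,8,2),(7,9,1)]),
(5,-1,1,6,True,[(9,1,3),(8,1,2),(7,1,1)]),
(6,1,-2,-1,True,[(4,7,3),(3,7,2),(5,9,1)]),
(2,-2,1,-6,False,[(5,4,6),(4,5,5),(6,6,4),(3,6,3),(2,6,2),(7,8,1)]),
(9,1,2,21,True,[(7,7,2),(6,9,1)]),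
(7,0,0,0,True,[(5,6,3),(6,7,2),(4,6,1)])]"]) code_simp

lemma indep_9_7: "\<exists>C. indep_cert 9 [8, 8, 3, 3, 3, 3, 1, 1, 1] C"
  by (rule exI[of _ "[(7,1,-1,9,True,[(0,9,1)]),
(8,1,1,18,True,[(9,9,1)]),
(9,1,2,26,True,[(9,8,1)]),
(3,-1,-1,-2,False,[(0,0,3),(1,0,2),(2,0,1)]),
(1,6,7,68,True,[(8,2,8),(9,1,7),(7,4,6),(6,5,5),(5,6,4),(4,7,3),(3,8,2),(2,9,1)]),
(4,2,1,16,False,[(8,0,3),(7,2,2),(6,4,1)]),
(2,4,-3,-9,False,[(3,0,8),(4,0,7),(5,0,6),(2,1,5),(6,0,4),(1,2,3),(7,0,2),(0,3,1)]),
(5,0,-1,-6,False,[(0,4,3),(1,5,2),(2,6,1)]),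
(6,0,0,0,True,[(7,0,3),(8,0,2),(9,0,1)])]"]) code_simp

lemma empty_9_1: "\<exists>C. empty_cert 9 [6, 4, 4, 4, 4, 4, 4, 4, 4] C"
  by (rule exI[of _ "[(2,-1,1,6,True,[(9,0,4),(8,0,3),(7,0,2),(6,0,1)]),
(3,-1,-1,-3,False,[(0,0,4),(1,0,3),(2,0,2),(3,0,1)]),
(4,4,-3,25,False,[(9,0,4),(8,0,3),(7,0,2)]),
(5,1,1,15,True,[(9,6,4),(8,7,3),(7,8,2),(6,9,1)]),
(6,4,-1,24,False,[(8,3,4),(7,2,3),(9,4,2),(6,0,1)]),
(1,-2,5,20,True,[(7,2,6),(6,1,5),(8,3,4),(5,0,3),(9,4,2),(4,0,1)]),
(7,-1,-3,-10,True,[(1,3,4),(2,2,3),(0,4,2),(3,1,1)]),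
(8,1,-1,1,False,[(6,2,4),(5,2,3),(7,5,2),(4,3,1)]),
(9,0,0,0,True,[(4,1,4),(5,3,3),(3,2,2),(6,6,1)])]"]) code_simp

lemma indep_10_1: "\<exists>C. indep_cert 10 [5, 5, 5, 5, 5, 5, 4, 4, 4] C"
  by (rule exI[of _ "[(1,1,-1,6,True,[(0,6,5),(1,7,4),(2,8,3),(3,9,2),(4,10,1)]),
(2,-1,-1,-4,False,[(0,0,5),(1,0,4),(2,0,3),(3,0,2),(4,0,1)]),
(3,1,-3,-4,True,[(2,3,5),(3,5,4),(1,4,3),(4,8,2),(0,5,1)]),
(7,1,1,17,False,[(10,7,4),(9,8,3),(8,9,2),(7,10,1)]),
(8,1,2,23,True,[(10,3,4),(9,5,3),(8,7,2),(7,9,1)]),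
(9,-2,3,21,True,[(9,0,4),(10,0,3),(8,0,2),(7,0,1)]),
(4,4,-3,7,True,[(5,6,5),(6,7,4),(4,5,3),(7,7,2),(3,4,1)]),
(5,3,2,21,False,[(4,5,5),(5,5,4),(3,6,3),(6,6,2),(2,8,1)]),
(6,0,0,0,False,[(2,3,5),(1,4,4),(3,3,3),(0,5,2),(4,4,1)])]"]) code_simp

lemma indep_10_2: "\<exists>C. indep_cert 10 [5, 5, 5, 5, 5, 5, 5, 4, 3] C"
  by (rule exI[of _ "[(8,-1,-1,-3,False,[(0,0,4),(1,0,3),(2,0,2),(3,0,1)]),
(9,1,1,18,True,[(10,8,3),(9,9,2),(8,10,1)]),
(1,7,4,82,False,[(10,3,5),(9,5,4),(8,7,3),(7,9,2),(6,10,1)]),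
(2,3,5,53,True,[(10,1,5),(9,3,4),(8,5,3),(7,6,2),(6,8,1)]),
(3,-1,2,11,False,[(0,6,5),(1,6,4),(2,7,3),(3,7,2),(4,8,1)]),
(4,3,-2,18,True,[(0,6,5),(1,7,4),(2,8,3),(3,8,2),(4,9,1)]),
(5,-2,3,7,True,[(5,0,5),(6,2,4),(4,0,3),(7,4,2),(3,1,1)]),
(6,2,3,19,False,[(7,2,5),(6,3,4),(5,3,3),(8,4,2),(4,4,1)]),
(7,0,0,0,True,[(2,2,5),(1,3,4),(3,2,3),(0,4,2),(4,3,1)])]"]) code_simp

lemma indep_10_3: "\<exists>C. indep_cert 10 [5, 5, 5, 5, 5, 5, 5, 5, 1] C"
  by (rule exI[of _ "[(1,-1,-1,-4,True,[(0,0,5),(1,0,4),(2,0,3),(3,0,2),(4,0,1)]),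
(9,-1,-2,-5,False,[(5,0,1)]),
(2,1,-1,6,False,[(10,0,5),(9,0,4),(8,0,3),(7,0,2),(6,0,1)]),
(3,1,1,16,True,[(10,6,5),(9,7,4),(8,8,3),(7,9,2),(6,10,1)]),
(4,3,-1,16,False,[(8,3,5),(7,2,4),(9,4,3),(6,1,2),(10,5,1)]),
(5,4,-3,5,False,[(5,1,5),(6,3,4),(4,1,3),(7,6,2),(3,2,1)]),
(6,3,-1,5,False,[(5,6,5),(4,4,4),(6,7,3),(3,3,2),(7,8,1)]),
(7,1,-1,-5,False,[(2,3,5),(3,5,4),(1,4,3),(4,8,2),(0,5,1)]),
(8,0,0,0,True,[(10,0,5),(9,0,4),(8,0,3),(7,0,2),(6,0,1)])]"]) code_simp

lemma indep_10_4: "\<exists>C. indep_cert 10 [6, 5, 5, 5, 5, 4, 4, 4, 4] C"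
  by (rule exI[of _ "[(2,1,1,16,True,[(10,6,5),(9,7,4),(8,8,3),(7,9,2),(6,10,1)]),
(3,-1,1,6,True,[(10,0,5),(9,0,4),(8,0,3),(7,0,2),(6,0,1)]),
(4,1,-1,6,False,[(10,0,5),(9,0,4),(8,0,3),(7,0,2),(6,0,1)]),
(1,-2,1,0,False,[(0,0,6),(1,2,5),(2,4,4),(3,6,3),(4,8,2),(5,10,1)]),
(5,-2,-1,-10,True,[(0,1,5),(1,1,4),(2,2,3),(3,2,2),(4,3,1)]),
(6,-1,3,14,True,[(7,4,4),(8,5,3),(9,5,2),(6,4,1)]),
(7,3,2,31,False,[(8,4,4),(9,4,3),(7,5,2),(10,5,1)]),
(8,1,-2,-1,True,[(3,5,4),(2,5,3),(1,5,2),(4,7,1)]),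
(9,0,0,0,True,[(5,3,4),(4,4,3),(6,5,2),(3,4,1)])]"]) code_simp

lemma indep_10_5: "\<exists>C. indep_cert 10 [6, 6, 6, 4, 4, 4, 4, 4, 3] C"
  by (rule exI[of _ "[(1,-5,-4,-25,False,[(0,0,6),(1,1,5),(2,0,4),(3,0,3),(4,0,2),(5,0,1)]),
(2,4,-5,15,True,[(1,5,6),(0,6,5),(2,7,4),(3,8,3),(4,9,2),(5,10,1)]),
(4,1,1,17,False,[(10,7,4),(9,8,3),(8,9,2),(7,10,1)]),
(9,3,-1,19,False,[(9,5,3),(8,4,2),(10,6,1)]),
(5,5,-3,17,False,[(7,3,4),(6,2,3),(8,6,2),(5,2,1)]),
(6,-1,1,7,True,[(10,0,4),(9,0,3),(8,0,2),(7,0,1)]),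
(3,1,1,11,False,[(6,5,6),(5,6,5),(4,7,4),(7,7,3),(3,8,2),(8,8,1)]),
(7,1,-2,-6,False,[(4,2,4),(5,3,3),(3,3,2),(2,4,1)]),
(8,0,0,0,False,[(2,5,4),(3,5,3),(1,6,2),(4,6,1)])]"]) code_simp

lemma indep_10_6: "\<exists>C. indep_cert 10 [7, 6, 4, 4, 4, 4, 4, 4, 4] C"
  by (rule exI[of _ "[(3,3,-2,21,False,[(10,0,4),(9,1,3),(8,0,2),(7,0,1)]),
(1,6,5,74,True,[(10,4,7),(9,5,6),(8,6,5),(7,7,4),(6,8,3),(5,9,2),(4,9,1)]),
(4,-1,-1,-3,True,[(0,0,4),(1,0,3),(2,0,2),(3,0,1)]),
(5,2,1,18,False,[(8,2,4),(7,4,3),(6,6,2),(5,8,1)]),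
(6,2,-3,5,True,[(1,4,4),(0,4,3),(2,6,2),(3,7,1)]),
(7,2,-1,5,False,[(5,2,4),(6,3,3),(4,2,2),(3,1,1)]),
(8,2,3,30,True,[(10,0,4),(9,2,3),(8,3,2),(7,5,1)]),
(9,1,-3,-11,True,[(4,1,4),(3,1,3),(2,2,2),(5,4,1)]),
(2,0,0,0,True,[(6,0,6),(7,0,5),(5,0,4),(8,0,3),(9,0,2),(4,0,1)])]"]) code_simp

lemma indep_10_7: "\<exists>C. indep_cert 10 [8, 5, 4, 4, 4, 4, 4, 4, 4] C"
  by (rule exI[of _ "[(2,-1,-1,-4,False,[(0,0,5),(1,0,4),(2,0,3),(3,0,2),(4,0,1)]),
(3,-1,-2,-8,True,[(0,5,4),(1,4,3),(2,3,2),(3,2,1)]),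
(1,1,1,13,True,[(10,3,8),(9,4,7),(8,5,6),(7,6,5),(6,7,4),(5,8,3),(4,9,2),(3,10,1)]),
(4,1,-1,6,False,[(9,0,4),(10,0,3),(8,1,2),(7,1,1)]),
(5,2,-1,8,False,[(7,2,4),(6,2,3),(8,3,2),(5,2,1)]),
(6,3,-2,2,False,[(5,3,4),(4,3,3),(6,5,2),(3,3,1)]),
(7,-2,3,21,True,[(9,0,4),(10,0,3),(8,0,2),(7,0,1)]),
(8,2,-1,-1,False,[(3,4,4),(4,6,3),(2,4,2),(5,7,1)]),
(9,0,0,0,False,[(1,4,4),(2,6,3),(0,5,2),(3,8,1)])]"]) code_simp

lemma indep_10_8: "\<exists>C. indep_cert 10 [8, 7, 5, 4, 4, 3, 3, 3, 2] C"
  by (rule exI[of _ "[(1,1,-1,3,True,[(0,3,8),(1,4,7),(2,5,6),(3,6,5),(4,7,4),(5,8,3),(6,9,2),(7,10,1)]),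
(4,-1,-2,-6,True,[(1,0,4),(2,0,3),(0,0,2),(3,0,1)]),
(3,-1,1,6,True,[(10,0,5),(9,0,4),(8,0,3),(7,0,2),(6,0,1)]),
(6,1,1,18,True,[(10,8,3),(9,9,2),(8,10,1)]),
(5,2,1,22,False,[(8,6,4),(7,8,3),(9,7,2),(6,10,1)]),
(9,-1,-3,-10,True,[(2,3,2),(3,1,1)]),
(7,1,-2,-3,True,[(3,3,3),(4,5,2),(5,7,1)]),
(2,-3,-1,-24,True,[(5,0,7),(6,1,6),(4,0,5),(7,2,4),(8,3,3),(9,4,2),(3,2,1)]),
(8,0,0,0,False,[(6,7,3),(7,6,2),(5,10,1)])]"]) code_simp

lemma indep_10_9: "\<exists>C. indep_cert 10 [8, 7, 6, 6, 4, 1, 1, 1, 1] C"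
  by (rule exI[of _ "[(6,1,1,20,False,[(10,10,1)]),
(5,1,-1,7,False,[(10,0,4),(9,0,3),(8,0,2),(7,0,1)]),
(3,4,5,65,True,[(9,5,6),(10,4,5),(8,7,4),(7,8,3),(6,9,2),(5,10,1)]),
(2,-1,-1,-6,True,[(0,0,7),(1,0,6),(2,0,5),(3,0,4),(4,0,3),(5,0,2),(6,0,1)]),
(7,-1,1,10,True,[(10,0,1)]),
(8,-2,1,9,False,[(0,9,1)]),
(9,-1,1,9,False,[(1,10,1)]),
(4,3,8,65,True,[(8,1,6),(7,3,5),(9,1,4),(6,6,3),(10,2,2),(5,9,1)]),
(1,0,0,0,True,[(4,3,8),(5,2,7),(3,4,6),(6,1,5),(2,5,4),(7,0,3),(1,6,2),(8,0,1)])]"]) code_simp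

lemma indep_10_10: "\<exists>C. indep_cert 10 [8, 8, 4, 3, 3, 3, 3, 3, 3] C"
  by (rule exI[of _ "[(3,3,2,41,True,[(10,7,4),(9,8,3),(7,9,2),(8,10,1)]),
(1,-5,6,18,False,[(0,3,8),(1,4,7),(2,5,6),(3,6,5),(4,7,4),(5,8,3),(6,8,2),(7,9,1)]),
(4,-2,1,0,False,[(0,0,3),(1,2,2),(2,4,1)]),
(5,1,3,27,True,[(7,6,3),(8,7,2),(6,9,1)]),
(6,-2,-1,-6,False,[(2,0,3),(1,0,2),(3,0,1)]),
(7,3,4,44,True,[(5,8,3),(6,7,2),(4,10,1)]),
(8,1,-1,8,True,[(0,8,3),(1,9,2),(2,10,1)]),
(9,-5,2,-10,False,[(3,3,3),(4,5,2),(2,3,1)]),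
(2,0,0,0,False,[(5,0,8),(6,0,7),(7,0,6),(4,0,5),(8,1,4),(9,2,3),(3,1,2),(10,3,1)])]"]) code_simp

lemma indep_11_1: "\<exists>C. indep_cert 11 [6, 5, 5, 5, 5, 5, 5, 5, 5] C"
  by (rule exI[of _ "[(2,-1,-1,-4,True,[(0,0,5),(1,0,4),(2,0,3),(3,0,2),(4,0,1)]),
(3,-1,1,7,True,[(11,0,5),(10,0,4),(9,0,3),(8,0,2),(7,0,1)]),
(4,1,-1,7,True,[(0,7,5),(1,8,4),(2,9,3),(3,10,2),(4,11,1)]),
(1,1,1,17,False,[(11,6,6),(10,7,5),(9,8,4),(8,9,3),(7,10,2),(6,11,1)]),
(5,1,3,29,True,[(9,3,5),(8,5,4),(10,4,3),(7,8,2),(11,5,1)]),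
(6,4,1,34,False,[(8,2,5),(9,3,4),(10,4,3),(7,6,2),(11,5,1)]),
(7,5,3,39,False,[(6,3,5),(7,2,4),(5,5,3),(4,7,2),(3,8,1)]),
(8,-1,1,2,True,[(6,0,5),(5,0,4),(7,1,3),(4,1,2),(8,2,1)]),
(9,0,0,0,False,[(4,1,5),(5,1,4),(3,2,3),(6,1,2),(2,3,1)])]"]) code_simp

lemma indep_11_2: "\<exists>C. indep_cert 11 [6, 6, 5, 5, 5, 5, 5, 5, 4] C"
  by (rule exI[of _ "[(3,3,4,61,True,[(11,6,5),(10,8,4),(9,9,3),(8,10,2),(7,11,1)]),
(4,-1,-1,-4,True,[(0,0,5),(1,0,4),(2,0,3),(3,0,2),(4,0,1)]),
(1,-1,1,6,False,[(0,6,6),(1,7,5),(2,8,4),(3,9,3),(4,10,2),(5,11,1)]),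
(5,-2,5,27,True,[(9,4,5),(8,3,4),(7,2,3),(10,5,2),(6,1,1)]),
(2,-1,-2,-10,True,[(0,5,6),(1,4,5),(2,3,4),(3,2,3),(4,1,2),(5,0,1)]),
(6,-3,-2,-26,True,[(5,1,5),(4,3,4),(6,2,3),(3,5,2),(2,7,1)]),
(7,-3,2,-13,True,[(7,5,5),(6,5,4),(8,7,3),(5,6,2),(4,7,1)]),
(9,-1,3,3,True,[(5,8,4),(6,9,3),(4,8,2),(7,10,1)]),
(8,0,0,0,True,[(3,7,5),(2,8,4),(1,9,3),(4,10,2),(0,11,1)])]"]) code_simp

lemma indep_11_3: "\<exists>C. indep_cert 11 [7, 5, 5, 5, 5, 5, 5, 5, 4] C"
  by (rule exI[of _ "[(2,1,1,18,True,[(11,7,5),(10,8,4),(9,9,3),(8,10,2),(7,11,1)]),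
(1,-1,-1,-6,True,[(0,0,7),(1,0,6),(2,0,5),(3,0,4),(4,0,3),(5,0,2),(6,0,1)]),
(3,2,1,24,False,[(11,2,5),(10,4,4),(9,6,3),(8,8,2),(7,10,1)]),
(9,2,-1,16,False,[(10,0,4),(9,0,3),(11,0,2),(8,0,1)]),
(4,-1,1,7,False,[(0,7,5),(1,8,4),(2,9,3),(3,10,2),(4,11,1)]),
(5,1,-3,-4,True,[(3,5,5),(2,5,4),(1,6,3),(4,8,2),(0,7,1)]),
(6,1,4,36,True,[(9,3,5),(8,4,4),(10,4,3),(11,5,2),(7,8,1)]),
(7,3,-2,4,True,[(5,5,5),(4,4,4),(6,6,3),(7,6,2),(3,4,1)]),
(8,0,0,0,False,[(3,4,5),(2,5,4),(4,5,3),(5,6,2),(1,6,1)])]"]) code_simp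

lemma indep_11_4: "\<exists>C. indep_cert 11 [7, 7, 7, 4, 4, 4, 4, 4, 4] C"
  by (rule exI[of _ "[(4,1,1,19,False,[(11,8,4),(10,9,3),(9,10,2),(8,11,1)]),
(1,-1,1,5,False,[(0,5,7),(1,6,6),(2,7,5),(3,8,4),(4,9,3),(5,10,2),(6,11,1)]),
(5,-2,1,1,False,[(0,1,4),(1,3,3),(2,5,2),(3,7,1)]),
(2,-3,1,-9,False,[(3,0,7),(4,3,6),(2,0,5),(5,6,4),(1,0,3),(6,9,2),(0,0,1)]),
(6,-3,-2,-21,True,[(0,4,4),(1,4,3),(2,4,2),(3,5,1)]),
(7,-3,2,-6,False,[(7,8,4),(6,6,3),(8,9,2),(5,5,1)]),
(8,1,-1,8,False,[(11,0,4),(10,0,3),(9,0,2),(8,0,1)]),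
(9,1,2,22,True,[(7,8,4),(8,8,3),(6,10,2),(9,9,1)]),
(3,0,0,0,False,[(7,1,7),(8,1,6),(9,2,5),(6,2,4),(10,3,3),(11,4,2),(5,4,1)])]"]) code_simp

lemma indep_11_5: "\<exists>C. indep_cert 11 [8, 7, 5, 5, 4, 4, 4, 4, 4] C"
  by (rule exI[of _ "[(1,1,-1,4,True,[(0,4,8),(1,5,7),(2,6,6),(3,7,5),(4,8,4),(5,9,3),(6,10,2),(7,11,1)]),
(5,-1,1,8,True,[(11,0,4),(10,0,3),(9,0,2),(8,0,1)]),
(6,-2,1,4,False,[(0,4,4),(1,6,3),(2,8,2),(3,10,1)]),
(7,1,1,19,True,[(11,8,4),(10,9,3),(9,10,2),(8,11,1)]),
(8,3,1,32,False,[(9,6,4),(8,8,3),(10,7,2),(7,11,1)]),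
(3,3,-7,-7,True,[(1,0,5),(0,0,4),(2,3,3),(3,5,2),(4,7,1)]),
(2,2,-1,2,False,[(6,4,7),(7,5,6),(5,4,5),(4,3,4),(8,5,3),(3,3,2),(2,2,1)]),
(4,0,-1,-7,False,[(2,3,5),(1,2,4),(3,5,3),(0,2,2),(4,7,1)]),
(9,0,0,0,False,[(4,8,4),(5,9,3),(3,8,2),(6,11,1)])]"]) code_simp

lemma indep_11_6: "\<exists>C. indep_cert 11 [8, 7, 6, 5, 5, 4, 4, 3, 2] C"
  by (rule exI[of _ "[(1,1,-1,4,True,[(0,4,8),(1,5,7),(2,6,6),(3,7,5),(4,8,4),(5,9,3),(6,10,2),(7,11,1)]),
(3,-1,1,6,True,[(11,0,6),(10,0,5),(9,0,4),(8,0,3),(7,0,2),(6,0,1)]),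
(4,-1,2,12,True,[(11,6,5),(10,5,4),(9,4,3),(8,3,2),(7,2,1)]),
(2,1,1,12,True,[(8,5,7),(7,5,6),(9,7,5),(6,6,4),(10,9,3),(5,7,2),(11,11,1)]),
(8,1,3,21,True,[(6,3,3),(7,3,2),(5,6,1)]),
(6,3,1,15,True,[(4,4,4),(3,4,3),(5,4,2),(2,5,1)]),
(9,1,-2,2,True,[(0,2,2),(1,4,1)]),
(5,-1,-2,-8,False,[(0,0,5),(1,0,4),(2,1,3),(3,1,2),(4,2,1)]),
(7,0,0,0,True,[(5,0,4),(4,1,3),(6,1,2),(3,3,1)])]"]) code_simp

lemma indep_11_7: "\<exists>C. indep_cert 11 [8, 8, 5, 4, 4, 4, 4, 4, 3] C"
  by (rule exI[of _ "[(4,-3,4,32,True,[(11,1,4),(10,0,3),(9,0,2),(8,0,1)]),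
(5,-1,-1,-3,True,[(0,0,4),(1,0,3),(2,0,2),(3,0,1)]),
(1,1,-1,4,True,[(0,4,8),(1,5,7),(2,6,6),(3,7,5),(4,8,4),(5,9,3),(6,10,2),(7,11,1)]),
(2,1,-3,-13,True,[(4,0,8),(5,2,7),(3,1,6),(6,5,5),(2,2,4),(7,8,3),(1,3,2),(8,11,1)]),
(6,3,2,46,True,[(11,8,4),(10,9,3),(9,10,2),(8,10,1)]),
(3,-2,-1,-14,True,[(6,0,5),(7,0,4),(8,1,3),(5,0,2),(9,2,1)]),
(7,-4,3,6,True,[(10,3,4),(9,3,3),(11,5,2),(8,4,1)]),
(8,-3,-1,-31,False,[(7,7,4),(6,7,3),(5,7,2),(4,7,1)]),
(9,0,0,0,False,[(8,8,3),(9,8,2),(7,11,1)])]"]) code_simp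

lemma empty_11_1: "\<exists>C. empty_cert 11 [6, 6, 5, 5, 5, 5, 5, 5, 5] C"
  by (rule exI[of _ "[(3,4,5,80,False,[(10,8,4),(11,8,4),(9,9,3),(8,10,2),(7,11,1)]),
(1,-4,5,32,True,[(11,0,6),(10,0,5),(9,0,4),(8,0,3),(7,0,1)]),
(2,-9,5,2,False,[(0,1,6),(1,3,5),(2,4,4),(3,6,3),(4,8,2),(5,10,1)]),
(4,-3,-1,-13,False,[(3,0,5),(2,0,4),(1,0,3),(4,0,2),(0,0,1)]),
(5,-3,-4,-28,True,[(0,5,5),(1,5,4),(2,4,3),(3,4,2),(4,4,1)]),
(6,9,5,110,False,[(11,3,5),(10,4,4),(9,6,3),(8,8,2),(7,10,1)]),
(7,-1,1,1,False,[(6,7,5),(5,6,4),(4,5,3),(7,8,2),(3,5,1)]),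
(8,-1,2,0,True,[(5,5,5),(4,5,4),(6,6,3),(7,7,2),(3,6,1)]),
(9,0,0,0,True,[(2,7,5),(3,7,4),(1,9,3),(0,10,2),(4,9,1)])]"]) code_simp

lemma empty_11_2: "\<exists>C. empty_cert 11 [7, 5, 5, 5, 5, 5, 5, 5, 5] C"
  by (rule exI[of _ "[(1,1,1,16,True,[(11,5,7),(10,6,6),(9,7,5),(8,8,4),(7,9,3),(6,10,2),(5,11,1)]),
(2,1,-1,7,False,[(11,0,5),(10,0,4),(9,0,3),(8,0,2),(7,0,1)]),
(3,-2,3,23,True,[(11,0,5),(10,0,4),(9,0,3),(8,0,1)]),
(4,5,-2,30,False,[(8,2,4),(9,3,4),(7,1,2),(10,4,2),(6,0,1)]),
(5,2,5,46,True,[(8,3,5),(9,3,4),(7,6,3),(10,4,2),(6,8,1)]),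
(6,2,-3,2,True,[(0,1,5),(1,3,4),(2,4,3),(3,6,2),(4,7,1)]),
(7,2,3,24,True,[(6,3,5),(7,2,4),(5,5,3),(8,1,2),(4,6,1)]),
(8,-1,3,9,False,[(0,3,5),(1,4,4),(2,4,3),(3,4,2),(4,5,1)]),
(9,0,0,0,True,[(3,1,5),(2,0,4),(1,0,3),(4,4,2),(0,0,1)])]"]) code_simp

lemma indep_12_1: "\<exists>C. indep_cert 12 [6, 6, 6, 6, 6, 5, 5, 5, 5] C"
  by (rule exI[of _ "[(1,1,1,19,True,[(12,7,6),(11,8,5),(10,9,4),(9,10,3),(8,11,2),(7,12,1)]),
(2,-1,-1,-5,False,[(0,0,6),(1,0,5),(2,0,4),(3,0,3),(4,0,2),(5,0,1)]),
(3,1,2,25,True,[(12,1,6),(11,3,5),(10,5,4),(9,7,3),(8,9,2),(7,11,1)]),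
(6,-1,2,15,True,[(10,0,5),(9,0,4),(11,0,3),(8,0,2),(12,0,1)]),
(4,1,-1,7,False,[(12,0,6),(11,0,5),(10,0,4),(9,0,3),(8,0,2),(7,0,1)]),
(7,1,1,14,True,[(6,8,5),(7,7,4),(8,6,3),(5,10,2),(9,5,1)]),
(5,3,-2,8,False,[(7,1,6),(6,0,5),(8,2,4),(5,1,3),(9,3,2),(4,2,1)]),
(8,-4,3,5,True,[(7,0,5),(6,0,4),(8,2,3),(5,1,2),(9,4,1)]),
(9,0,0,0,False,[(5,4,5),(4,3,4),(3,3,3),(6,6,2),(2,4,1)])]"]) code_simp

lemma indep_12_2: "\<exists>C. indep_cert 12 [6, 6, 6, 6, 6, 6, 5, 5, 4] C"
  by (rule exI[of _ "[(7,3,-4,20,True,[(0,8,5),(1,8,4),(2,10,3),(3,11,2),(4,12,1)]),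
(1,3,-7,1,True,[(0,1,6),(1,3,5),(2,6,4),(3,8,3),(4,10,2),(5,12,1)]),
(2,1,1,19,True,[(12,7,6),(11,8,5),(10,9,4),(9,10,3),(8,11,2),(7,12,1)]),
(3,4,1,38,False,[(9,4,6),(8,6,5),(10,5,4),(11,5,3),(7,10,2),(12,6,1)]),
(4,3,4,49,True,[(12,1,6),(11,2,5),(10,3,4),(9,5,3),(8,6,2),(7,7,1)]),
(5,-1,4,25,True,[(8,0,6),(9,0,5),(7,0,4),(10,0,3),(11,0,2),(12,0,1)]),
(6,-3,4,7,True,[(6,0,6),(5,0,5),(4,0,4),(7,4,3),(3,0,2),(2,0,1)]),
(8,-1,-1,-9,True,[(3,2,5),(2,1,4),(1,0,3),(4,4,2),(0,0,1)]),
(9,0,0,0,False,[(7,3,4),(6,4,3),(8,4,2),(5,5,1)])]"]) code_simp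

lemma indep_12_3: "\<exists>C. indep_cert 12 [6, 6, 6, 6, 6, 6, 6, 4, 4] C"
  by (rule exI[of _ "[(1,-1,1,7,True,[(12,0,6),(11,0,5),(10,0,4),(9,0,3),(8,0,2),(7,0,1)]),
(2,1,-1,7,True,[(0,7,6),(1,8,5),(2,9,4),(3,10,3),(4,11,2),(5,12,1)]),
(3,1,1,19,True,[(12,7,6),(11,8,5),(10,9,4),(9,10,3),(8,11,2),(7,12,1)]),
(4,1,-2,1,True,[(0,1,6),(1,3,5),(2,5,4),(3,7,3),(4,9,2),(5,11,1)]),
(8,-1,-3,-11,False,[(0,0,4),(1,1,3),(2,2,2),(3,2,1)]),
(5,-4,-3,-32,True,[(4,0,6),(5,0,5),(6,0,4),(3,3,3),(7,1,2),(8,2,1)]),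
(6,1,3,31,True,[(9,4,6),(10,4,5),(8,7,4),(11,5,3),(7,10,2),(12,6,1)]),
(7,-1,-2,-20,True,[(5,5,6),(6,4,5),(7,3,4),(4,6,3),(8,3,2),(3,6,1)]),
(9,0,0,0,True,[(6,9,4),(7,7,3),(8,5,2),(9,3,1)])]"]) code_simp

lemma indep_12_4: "\<exists>C. indep_cert 12 [6, 6, 6, 6, 6, 6, 6, 5, 3] C"
  by (rule exI[of _ "[(1,1,-1,7,True,[(0,7,6),(1,8,5),(2,9,4),(3,10,3),(4,11,2),(5,12,1)]),
(2,2,-1,13,False,[(12,6,6),(11,5,5),(10,4,4),(9,3,3),(8,2,2),(7,1,1)]),
(3,-1,1,7,True,[(12,0,6),(11,0,5),(10,0,4),(9,0,3),(8,0,2),(7,0,1)]),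
(4,-1,-1,-5,False,[(0,0,6),(1,0,5),(2,0,4),(3,0,3),(4,0,2),(5,0,1)]),
(5,2,-7,-23,True,[(4,3,6),(3,3,5),(2,4,4),(5,6,3),(1,5,2),(0,6,1)]),
(6,-1,2,13,True,[(12,6,6),(11,5,5),(10,4,4),(9,3,3),(8,2,2),(7,1,1)]),
(8,2,1,24,False,[(9,6,5),(10,8,4),(8,8,3),(11,10,2),(12,12,1)]),
(7,3,-2,-4,True,[(6,3,6),(7,4,5),(5,2,4),(8,4,3),(9,6,2),(4,2,1)]),
(9,0,0,0,True,[(6,0,3),(7,2,2),(5,1,1)])]"]) code_simp

lemma indep_12_5: "\<exists>C. indep_cert 12 [6, 6, 6, 6, 6, 6, 6, 6, 1] C"
  by (rule exI[of _ "[(1,1,-1,7,True,[(0,7,6),(1,8,5),(2,9,4),(3,10,3),(4,11,2),(5,12,1)]),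
(2,-1,-1,-5,True,[(0,0,6),(1,0,5),(2,0,4),(3,0,3),(4,0,2),(5,0,1)]),
(9,0,-1,0,False,[(6,0,1)]),
(3,-1,1,7,True,[(12,0,6),(11,0,5),(10,0,4),(9,0,3),(8,0,2),(7,0,1)]),
(4,1,1,19,False,[(12,7,6),(11,8,5),(10,9,4),(9,10,3),(8,11,2),(7,12,1)]),
(5,3,-8,-12,True,[(3,4,6),(2,4,5),(4,7,4),(1,5,3),(5,10,2),(6,12,1)]),
(6,3,-4,-6,True,[(6,6,6),(5,5,5),(7,8,4),(4,4,3),(8,9,2),(3,3,1)]),
(7,-1,-1,-12,False,[(3,4,6),(2,4,5),(4,5,4),(1,5,3),(5,6,2),(0,6,1)]),
(8,0,0,0,False,[(6,7,6),(7,7,5),(5,8,4),(8,8,3),(4,9,2),(9,9,1)])]"]) code_simp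

lemma indep_12_6: "\<exists>C. indep_cert 12 [7, 6, 6, 6, 5, 5, 5, 5, 5] C"
  by (rule exI[of _ "[(5,1,1,20,False,[(12,8,5),(11,9,4),(10,10,3),(9,11,2),(8,12,1)]),
(1,-1,1,6,False,[(0,6,7),(1,7,6),(2,8,5),(3,9,4),(4,10,3),(5,11,2),(6,12,1)]),
(2,-7,3,-5,False,[(0,0,6),(1,1,5),(2,4,4),(3,6,3),(4,8,2),(5,10,1)]),
(6,1,-1,8,True,[(0,8,5),(1,9,4),(2,10,3),(3,11,2),(4,12,1)]),
(3,1,4,39,True,[(9,5,6),(8,7,5),(10,6,4),(11,6,3),(7,11,2),(12,7,1)]),
(7,1,-2,3,True,[(0,3,5),(1,5,4),(2,7,3),(3,9,2),(4,11,1)]),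
(8,4,3,48,True,[(6,8,5),(7,7,4),(5,9,3),(4,9,2),(8,6,1)]),
(9,1,-3,-4,True,[(2,2,5),(3,5,4),(1,2,3),(0,1,2),(4,8,1)]),
(4,0,0,0,True,[(5,3,6),(4,3,5),(6,4,4),(7,4,3),(3,3,2),(8,5,1)])]"]) code_simp

lemma indep_12_7: "\<exists>C. indep_cert 12 [8, 7, 5, 5, 5, 5, 5, 5, 5] C"
  by (rule exI[of _ "[(1,1,1,17,False,[(12,5,8),(11,6,7),(10,7,6),(9,8,5),(8,9,4),(7,10,3),(6,11,2),(5,12,1)]),
(3,-1,-1,-4,True,[(0,0,5),(1,0,4),(2,0,3),(3,0,2),(4,0,1)]),
(2,-11,-6,-66,False,[(0,5,7),(1,4,6),(2,3,5),(3,2,4),(4,1,3),(5,0,2),(6,0,1)]),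
(4,1,-1,8,False,[(12,0,5),(11,0,4),(10,0,3),(9,0,2),(8,0,1)]),
(5,-2,1,3,True,[(12,0,5),(11,1,4),(10,1,3),(9,2,2),(8,2,1)]),
(6,-1,3,17,True,[(8,3,5),(9,4,4),(10,4,3),(7,3,2),(11,5,1)]),
(7,1,-3,-2,True,[(2,5,5),(3,7,4),(1,6,3),(4,10,2),(0,7,1)]),
(8,1,-1,2,True,[(5,7,5),(4,6,4),(6,8,3),(3,5,2),(7,9,1)]),
(9,0,0,0,True,[(6,3,5),(7,5,4),(5,4,3),(4,4,2),(8,8,1)])]"]) code_simp

lemma indep_12_8: "\<exists>C. indep_cert 12 [8, 8, 8, 4, 4, 4, 4, 4, 4] C"
  by (rule exI[of _ "[(1,-1,1,5,False,[(0,5,8),(1,6,7),(2,7,6),(3,8,5),(4,9,4),(5,10,3),(6,11,2),(7,12,1)]),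
(4,1,1,21,True,[(12,9,4),(11,10,3),(10,11,2),(9,12,1)]),
(5,1,3,37,True,[(10,7,4),(11,7,3),(9,10,2),(12,8,1)]),
(2,1,-1,5,True,[(0,5,8),(1,6,7),(2,7,6),(3,8,5),(4,9,4),(5,10,3),(6,11,2),(7,12,1)]),
(6,2,1,25,True,[(8,9,4),(7,9,3),(9,8,2),(6,10,1)]),
(7,2,5,49,True,[(8,5,4),(9,5,3),(7,7,2),(10,6,1)]),
(8,1,1,12,True,[(6,6,4),(5,7,3),(7,5,2),(8,4,1)]),
(9,-1,-1,-3,False,[(0,0,4),(1,0,3),(2,0,2),(3,0,1)]),
(3,0,0,0,False,[(4,0,8),(3,1,7),(5,1,6),(2,2,5),(6,2,4),(1,3,3),(7,3,2),(0,4,1)])]"]) code_simp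

lemma empty_12_1: "\<exists>C. empty_cert 12 [6, 6, 6, 6, 6, 6, 5, 5, 5] C"
  by (rule exI[of _ "[(1,1,1,19,True,[(12,7,6),(11,8,5),(10,9,4),(9,10,3),(8,11,2),(7,12,1)]),
(2,2,1,25,False,[(12,1,6),(11,3,5),(10,5,4),(9,7,3),(8,9,2),(7,11,1)]),
(7,-1,-1,-4,False,[(0,0,5),(1,0,4),(2,0,3),(3,0,2),(4,0,1)]),
(8,4,1,39,False,[(10,0,5),(9,3,4),(11,0,3),(8,7,2),(12,0,1)]),
(3,3,4,50,True,[(12,1,6),(11,2,5),(10,4,4),(9,5,3),(8,6,2)]),
(4,-1,3,19,False,[(0,7,6),(1,7,5),(2,7,4),(3,8,3),(4,8,2),(5,8,1)]),
(5,-3,1,-8,False,[(3,2,6),(2,3,4),(4,4,4),(1,4,3),(0,5,2),(5,7,1)]),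
(9,4,3,38,False,[(8,2,5),(7,4,4),(6,5,3),(9,1,2),(5,6,1)]),
(6,0,0,0,False,[(5,0,6),(6,0,5),(7,0,4),(4,1,3),(8,0,2),(9,0,1)])]"]) code_simp

lemma empty_12_2: "\<exists>C. empty_cert 12 [6, 6, 6, 6, 6, 6, 6, 5, 4] C"
  by (rule exI[of _ "[(1,1,-1,7,True,[(0,7,6),(1,8,5),(2,9,4),(3,10,3),(4,11,2),(5,12,1)]),
(2,1,1,19,True,[(12,7,6),(11,8,5),(10,9,4),(9,10,3),(8,11,2),(7,12,1)]),
(3,1,2,25,True,[(12,1,6),(11,3,5),(10,5,4),(9,7,3),(8,9,2),(7,11,1)]),
(9,4,1,41,False,[(10,4,4),(9,5,3),(11,5,2),(12,6,1)]),
(4,-1,2,13,False,[(0,7,6),(1,7,5),(2,8,4),(3,8,3),(4,9,2),(5,9,1)]),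
(8,-1,-1,-4,True,[(0,0,5),(1,0,4),(2,0,3),(3,0,2),(4,0,1)]),
(5,5,-3,19,False,[(8,2,6),(7,1,5),(6,0,4),(5,0,3),(9,3,2)]),
(6,5,-2,11,False,[(6,4,6),(5,3,5),(4,1,4),(7,6,3),(3,2,1),(8,8,1)]),
(7,0,0,0,False,[(2,3,5),(3,3,5),(4,5,4),(1,4,3),(0,5,2),(5,8,1)])]"]) code_simp

lemma indep_13_1: "\<exists>C. indep_cert 13 [7, 6, 6, 6, 6, 6, 6, 6, 6] C"
  by (rule exI[of _ "[(2,-1,-1,-5,True,[(0,0,6),(1,0,5),(2,0,4),(3,0,3),(4,0,2),(5,0,1)]),
(3,-1,1,8,False,[(0,8,6),(1,9,5),(2,10,4),(3,11,3),(4,12,2),(5,13,1)]),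
(4,-1,-2,-11,True,[(0,6,6),(1,5,5),(2,4,4),(3,3,3),(4,2,2),(5,1,1)]),
(1,-1,2,14,True,[(13,6,7),(12,5,6),(11,4,5),(10,3,4),(9,2,3),(8,1,2),(7,0,1)]),
(5,1,-2,3,True,[(2,8,6),(3,9,5),(1,10,4),(4,11,3),(0,12,2),(5,13,1)]),
(6,1,2,28,True,[(10,8,6),(11,9,5),(9,10,4),(12,11,3),(8,12,2),(13,13,1)]),
(7,-4,1,-15,True,[(6,0,6),(7,1,5),(5,2,4),(8,3,3),(9,5,2),(4,4,1)]),
(8,2,3,37,True,[(7,8,6),(8,7,5),(6,10,4),(9,7,3),(5,11,2),(10,7,1)]),
(9,0,0,0,True,[(4,5,6),(5,6,5),(6,6,4),(3,6,3),(7,6,2),(8,6,1)])]"]) code_simp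

lemma indep_13_2: "\<exists>C. indep_cert 13 [7, 7, 6, 6, 6, 6, 6, 5, 5] C"
  by (rule exI[of _ "[(1,5,4,87,False,[(13,6,7),(12,8,6),(11,8,5),(10,10,4),(9,11,3),(8,12,2),(7,13,1)]),
(8,4,7,99,True,[(13,2,5),(12,4,4),(11,6,3),(9,9,2),(10,8,1)]),
(3,1,4,42,True,[(10,2,6),(11,0,5),(12,0,4),(9,6,3),(13,0,2),(8,10,1)]),
(4,-1,-1,-5,False,[(0,0,6),(1,0,5),(2,0,4),(3,0,3),(4,0,2),(5,0,1)]),
(5,4,11,104,True,[(8,4,6),(7,7,5),(9,2,4),(6,10,3),(10,0,2),(5,13,1)]),
(6,-1,1,2,True,[(7,0,6),(6,0,5),(8,0,4),(5,1,3),(9,0,2),(4,2,1)]),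
(7,-2,-1,-16,False,[(5,1,6),(6,0,5),(4,2,4),(7,0,3),(3,3,2),(8,0,1)]),
(2,2,3,27,True,[(5,6,7),(4,8,6),(3,9,5),(6,6,4),(2,11,3),(1,12,2),(7,6,1)]),
(9,0,0,0,True,[(0,9,5),(1,8,4),(2,8,3),(3,7,2),(4,7,1)])]"]) code_simp

lemma indep_13_3: "\<exists>C. indep_cert 13 [7, 7, 6, 6, 6, 6, 6, 6, 4] C"
  by (rule exI[of _ "[(3,-1,1,8,True,[(13,0,6),(12,0,5),(11,0,4),(10,0,3),(9,0,2),(8,0,1)]),
(1,-1,2,14,True,[(13,6,7),(12,5,6),(11,4,5),(10,3,4),(9,2,3),(8,1,2),(7,0,1)]),
(2,-1,-1,-6,False,[(0,0,7),(1,0,6),(2,0,5),(3,0,4),(4,0,3),(5,0,2),(6,0,1)]),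
(4,-1,-2,-12,True,[(0,7,6),(1,6,5),(2,5,4),(3,4,3),(4,3,2),(5,2,1)]),
(5,1,-2,2,True,[(3,8,6),(2,9,5),(4,10,4),(1,11,3),(5,12,2),(0,13,1)]),
(6,-4,1,-17,True,[(7,1,6),(6,1,5),(8,3,4),(5,3,3),(9,5,2),(4,5,1)]),
(9,-1,-1,-13,False,[(7,3,4),(6,4,3),(8,4,2),(9,4,1)]),
(7,2,-3,-4,True,[(6,8,6),(7,9,5),(8,10,4),(5,9,3),(9,12,2),(10,13,1)]),
(8,0,0,0,True,[(10,7,6),(9,7,5),(11,9,4),(8,7,3),(12,12,2),(7,7,1)])]"]) code_simp

lemma indep_13_4: "\<exists>C. indep_cert 13 [8, 6, 6, 6, 6, 6, 6, 5, 5] C"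
  by (rule exI[of _ "[(1,1,1,19,True,[(13,6,8),(12,7,7),(11,8,6),(10,9,5),(9,10,4),(8,11,3),(7,12,2),(6,13,1)]),
(2,-3,4,32,True,[(12,0,6),(13,1,5),(11,0,4),(10,0,3),(9,0,2),(8,0,1)]),
(3,-1,-1,-5,True,[(0,0,6),(1,0,5),(2,0,4),(3,0,3),(4,0,2),(5,0,1)]),
(4,-1,3,20,True,[(9,2,6),(10,4,5),(8,1,4),(11,5,3),(7,0,2),(12,6,1)]),
(5,5,-6,35,False,[(13,0,6),(12,0,5),(11,0,4),(10,0,3),(9,0,2),(7,0,1)]),
(8,2,-5,0,True,[(2,5,5),(1,5,4),(3,8,3),(4,10,2),(0,6,1)]),
(6,5,-4,14,True,[(5,7,6),(6,8,5),(4,6,4),(7,9,3),(3,6,2),(8,10,1)]),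
(7,-2,-1,-15,False,[(4,2,6),(3,3,5),(2,4,4),(5,3,3),(1,5,2),(0,6,1)]),
(9,0,0,0,True,[(8,5,5),(7,5,4),(6,5,3),(9,8,2),(5,6,1)])]"]) code_simp

lemma indep_13_5: "\<exists>C. indep_cert 13 [8, 6, 6, 6, 6, 6, 6, 6, 4] C"
  by (rule exI[of _ "[(2,1,-1,8,False,[(13,0,6),(12,0,5),(11,0,4),(10,0,3),(9,0,2),(8,0,1)]),
(1,-1,1,6,False,[(0,6,8),(1,7,7),(2,8,6),(3,9,5),(4,10,4),(5,11,3),(6,12,2),(7,13,1)]),
(3,3,4,70,False,[(13,8,6),(12,9,5),(10,10,4),(11,11,3),(9,11,2),(8,12,1)]),
(4,1,3,33,True,[(9,6,6),(10,5,5),(8,9,4),(11,6,3),(7,12,2),(12,7,1)]),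
(5,5,4,62,True,[(6,8,6),(7,7,5),(5,9,4),(8,6,3),(4,10,2),(3,10,1)]),
(6,-1,-1,-5,True,[(0,0,6),(1,0,5),(2,0,4),(3,0,3),(4,0,2),(5,0,1)]),
(7,-1,-3,-16,True,[(2,4,6),(3,3,5),(1,5,4),(4,2,3),(0,6,2),(5,1,1)]),
(9,2,-1,7,True,[(4,6,4),(5,6,3),(3,8,2),(6,7,1)]),
(8,0,0,0,True,[(6,1,6),(7,2,5),(5,2,4),(8,3,3),(9,4,2),(4,5,1)])]"]) code_simp

lemma indep_13_6: "\<exists>C. indep_cert 13 [8, 8, 7, 6, 5, 5, 5, 5, 5] C"
  by (rule exI[of _ "[(1,-1,-1,-7,True,[(0,0,8),(1,0,7),(2,0,6),(3,0,5),(4,0,4),(5,0,3),(6,0,2),(7,0,1)]),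
(2,1,1,19,False,[(13,6,8),(12,7,7),(11,8,6),(10,9,5),(9,10,4),(8,11,3),(7,12,2),(6,13,1)]),
(5,-1,-2,-12,True,[(0,8,5),(1,7,4),(2,6,3),(3,5,2),(4,4,1)]),
(6,-1,1,9,False,[(0,9,5),(1,10,4),(2,11,3),(3,12,2),(4,13,1)]),
(7,2,1,27,False,[(13,1,5),(12,3,4),(11,5,3),(10,7,2),(9,9,1)]),
(8,1,-2,1,True,[(3,7,5),(2,9,4),(4,9,3),(1,11,2),(0,13,1)]),
(9,-1,3,25,True,[(11,3,5),(10,2,4),(12,4,3),(9,1,2),(13,5,1)]),
(3,3,-2,2,False,[(8,4,7),(7,4,6),(6,4,5),(9,5,4),(5,4,3),(10,5,2),(4,5,1)]),
(4,0,0,0,True,[(8,0,6),(7,1,5),(9,3,4),(6,2,3),(10,6,2),(5,3,1)])]"]) code_simp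

lemma empty_13_1: "\<exists>C. empty_cert 13 [7, 7, 6, 6, 6, 6, 6, 6, 5] C"
  by (rule exI[of _ "[(1,1,1,20,True,[(13,7,7),(12,8,6),(11,9,5),(10,10,4),(9,11,3),(8,12,2),(7,13,1)]),
(3,1,-1,8,True,[(0,8,6),(1,9,5),(2,10,4),(3,11,3),(4,12,2),(5,13,1)]),
(4,-1,1,8,True,[(13,0,6),(12,0,5),(11,0,4),(10,0,3),(9,0,2),(8,0,1)]),
(5,-1,-1,-5,False,[(0,0,6),(1,0,5),(2,0,4),(3,0,3),(4,0,2),(5,0,1)]),
(2,1,3,32,True,[(10,3,7),(9,5,6),(11,4,5),(8,8,4),(12,5,3),(7,11,2),(13,6,1)]),
(6,3,4,46,True,[(6,8,6),(7,6,5),(5,9,4),(8,5,3),(4,10,2),(9,4,1)]),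
(7,-1,1,2,False,[(2,4,6),(3,5,5),(1,5,4),(4,6,3),(0,6,2),(5,7,1)]),
(9,2,1,17,False,[(8,1,5),(7,3,4),(9,2,3),(6,5,2),(10,3,1)]),
(8,0,0,0,False,[(5,1,6),(6,0,5),(4,2,4),(7,0,3),(3,3,2)])]"]) code_simp

lemma empty_13_2: "\<exists>C. empty_cert 13 [8, 6, 6, 6, 6, 6, 6, 6, 5] C"
  by (rule exI[of _ "[(2,-1,1,8,False,[(0,8,6),(1,9,5),(2,10,4),(3,11,3),(4,12,2),(5,13,1)]),
(3,-1,-1,-5,True,[(0,0,6),(1,0,5),(2,0,4),(3,0,3),(4,0,2),(5,0,1)]),
(4,-1,2,15,True,[(13,6,6),(12,5,5),(11,4,4),(10,3,3),(9,2,2),(8,1,1)]),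
(1,-1,-2,-13,True,[(0,6,8),(1,5,7),(2,4,6),(3,3,5),(4,2,4),(5,1,3),(6,0,2)]),
(5,-1,4,30,True,[(11,8,6),(10,6,5),(12,10,4),(9,4,3),(13,12,2),(8,2,1)]),
(6,3,4,58,False,[(13,5,6),(12,6,5),(11,7,4),(10,7,3),(9,8,2),(8,9,1)]),
(7,1,-1,5,True,[(3,8,6),(4,9,5),(2,10,4),(5,10,3),(1,12,2),(6,11,1)]),
(8,2,1,17,False,[(7,4,6),(8,4,5),(6,5,4),(9,5,3),(5,7,2),(10,6,1)]),
(9,0,0,0,True,[(7,0,5),(6,2,4),(5,4,2),(8,3,2),(4,6,1)])]"]) code_simp

lemma indep_14_1: "\<exists>C. indep_cert 14 [7, 7, 7, 7, 7, 6, 6, 6, 6] C"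
  by (rule exI[of _ "[(1,-1,1,8,False,[(0,8,7),(1,9,6),(2,10,5),(3,11,4),(4,12,3),(5,13,2),(6,14,1)]),
(6,1,1,23,False,[(14,9,6),(13,10,5),(12,11,4),(11,12,3),(10,13,2),(9,14,1)]),
(2,-2,1,1,False,[(0,1,7),(1,3,6),(2,5,5),(3,7,4),(4,9,3),(5,11,2),(6,13,1)]),
(3,1,-1,8,False,[(14,0,7),(13,0,6),(12,0,5),(11,0,4),(10,0,3),(9,0,2),(8,0,1)]),
(4,3,-1,23,False,[(11,4,7),(12,5,6),(10,3,5),(13,6,4),(9,2,3),(14,7,2),(8,1,1)]),
(7,-2,5,33,True,[(11,6,6),(12,6,5),(10,5,4),(13,7,3),(9,5,2),(14,8,1)]),
(5,2,3,28,True,[(8,4,7),(7,4,6),(6,5,5),(9,7,4),(5,7,3),(10,9,2),(4,8,1)]),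
(8,3,-2,8,False,[(6,0,6),(7,0,5),(5,0,4),(4,0,3),(8,2,2),(3,0,1)]),
(9,0,0,0,False,[(3,1,6),(2,0,5),(4,3,4),(1,0,3),(5,4,2),(0,0,1)])]"]) code_simp

lemma indep_14_2: "\<exists>C. indep_cert 14 [7, 7, 7, 7, 7, 7, 6, 6, 5] C"
  by (rule exI[of _ "[(1,1,-1,8,True,[(0,8,7),(1,9,6),(2,10,5),(3,11,4),(4,12,3),(5,13,2),(6,14,1)]),
(2,1,1,22,False,[(14,8,7),(13,9,6),(12,10,5),(11,11,4),(10,12,3),(9,13,2),(8,14,1)]),
(3,1,-2,1,True,[(0,1,7),(1,3,6),(2,5,5),(3,7,4),(4,9,3),(5,11,2),(6,13,1)]),
(4,1,-4,-13,True,[(3,0,7),(4,3,6),(2,0,5),(5,7,4),(1,0,3),(6,11,2),(0,0,1)]),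
(5,5,-1,30,False,[(9,6,7),(10,6,6),(8,6,5),(11,7,4),(12,7,3),(13,7,2),(14,7,1)]),
(9,2,-3,-11,True,[(5,2,5),(6,4,4),(7,5,3),(4,1,2),(8,7,1)]),
(7,-1,1,9,True,[(14,0,6),(13,0,5),(12,0,4),(11,0,3),(10,0,2),(9,0,1)]),
(6,1,2,22,False,[(6,8,7),(7,9,6),(5,9,5),(4,9,4),(8,11,3),(3,10,2),(2,10,1)]),
(8,0,0,0,True,[(8,0,6),(7,0,5),(6,0,4),(9,1,3),(5,0,2),(4,0,1)])]"]) code_simp

lemma indep_14_3: "\<exists>C. indep_cert 14 [7, 7, 7, 7, 7, 7, 7, 5, 4] C"
  by (rule exI[of _ "[(1,1,-1,8,True,[(0,8,7),(1,9,6),(2,10,5),(3,11,4),(4,12,3),(5,13,2),(6,14,1)]),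
(2,2,-1,15,False,[(14,7,7),(13,6,6),(12,5,5),(11,4,4),(10,3,3),(9,2,2),(8,1,1)]),
(3,2,-3,1,True,[(0,1,7),(1,2,6),(2,4,5),(3,5,4),(4,7,3),(5,8,2),(6,10,1)]),
(4,-1,1,8,False,[(0,8,7),(1,9,6),(2,10,5),(3,11,4),(4,12,3),(5,13,2),(6,14,1)]),
(9,-2,1,4,False,[(0,4,4),(1,6,3),(2,8,2),(3,10,1)]),
(8,-1,-3,-15,True,[(3,0,5),(2,0,4),(4,1,3),(1,0,2),(0,0,1)]),
(5,-8,3,-19,False,[(4,5,7),(5,7,6),(3,5,5),(6,10,4),(2,5,3),(7,13,2),(1,5,1)]),
(6,2,1,29,True,[(14,8,7),(13,8,6),(12,9,5),(11,9,4),(10,10,3),(9,10,2),(8,11,1)]),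
(7,0,0,0,False,[(7,6,7),(8,7,6),(6,4,5),(9,7,4),(5,4,3),(10,7,2),(4,4,1)])]"]) code_simp

lemma indep_14_4: "\<exists>C. indep_cert 14 [7, 7, 7, 7, 7, 7, 7, 6, 3] C"
  by (rule exI[of _ "[(1,1,1,22,True,[(14,8,7),(13,9,6),(12,10,5),(11,11,4),(10,12,3),(9,13,2),(8,14,1)]),
(8,1,2,30,True,[(14,2,6),(13,4,5),(12,6,4),(11,8,3),(10,10,2),(9,12,1)]),
(9,-1,2,24,True,[(13,0,3),(14,0,2),(12,0,1)]),
(2,1,-1,8,False,[(14,0,7),(13,0,6),(12,0,5),(11,0,4),(10,0,3),(9,0,2),(8,0,1)]),
(3,1,-2,1,True,[(0,1,7),(1,3,6),(2,5,5),(3,7,4),(4,9,3),(5,11,2),(6,13,1)]),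
(4,-3,4,25,True,[(11,0,7),(10,0,6),(12,1,5),(9,0,4),(8,0,3),(7,0,2),(13,3,1)]),
(5,3,-1,16,True,[(7,8,7),(8,8,6),(6,8,5),(5,7,4),(9,9,3),(4,7,2),(10,9,1)]),
(6,2,3,24,False,[(6,4,7),(7,6,6),(5,5,5),(4,6,4),(3,6,3),(8,9,2),(2,7,1)]),
(7,0,0,0,True,[(3,0,7),(4,0,6),(2,0,5),(5,0,4),(1,0,3),(6,1,2),(0,0,1)])]"]) code_simp

lemma indep_14_5: "\<exists>C. indep_cert 14 [7, 7, 7, 7, 7, 7, 7, 7, 1] C"
  by (rule exI[of _ "[(1,-1,1,8,False,[(0,8,7),(1,9,6),(2,10,5),(3,11,4),(4,12,3),(5,13,2),(6,14,1)]),
(2,1,-1,8,True,[(0,8,7),(1,9,6),(2,10,5),(3,11,4),(4,12,3),(5,13,2),(6,14,1)]),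
(3,-1,2,15,True,[(14,7,7),(13,6,6),(12,5,5),(11,4,4),(10,3,3),(9,2,2),(8,1,1)]),
(9,-1,-1,0,False,[(0,0,1)]),
(4,1,-2,1,True,[(0,1,7),(1,3,6),(2,5,5),(3,7,4),(4,9,3),(5,11,2),(6,13,1)]),
(5,-3,-5,-35,False,[(0,1,7),(1,1,6),(2,1,5),(3,2,4),(4,2,3),(5,3,2),(6,3,1)]),
(6,1,2,29,False,[(14,8,7),(13,8,6),(12,9,5),(11,9,4),(10,10,3),(9,10,2),(8,11,1)]),
(7,4,1,36,True,[(7,8,7),(8,7,6),(6,8,5),(9,7,4),(5,8,3),(10,7,2),(4,8,1)]),
(8,0,0,0,True,[(7,1,7),(6,2,6),(8,2,5),(5,4,4),(9,4,3),(4,6,2),(10,6,1)])]"]) code_simp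

lemma indep_14_6: "\<exists>C. indep_cert 14 [8, 7, 7, 7, 6, 6, 6, 6, 6] C"
  by (rule exI[of _ "[(5,-1,1,9,False,[(0,9,6),(1,10,5),(2,11,4),(3,12,3),(4,13,2),(5,14,1)]),
(2,-1,-1,-6,True,[(0,0,7),(1,0,6),(2,0,5),(3,0,4),(4,0,3),(5,0,2),(6,0,1)]),
(6,1,-1,9,False,[(14,0,6),(13,0,5),(12,0,4),(11,0,3),(10,0,2),(9,0,1)]),
(7,1,-3,-2,True,[(2,5,6),(3,7,5),(1,6,4),(4,10,3),(0,7,2),(5,13,1)]),
(3,-1,2,16,True,[(14,6,7),(13,5,6),(12,4,5),(11,3,4),(10,2,3),(9,1,2),(8,0,1)]),
(1,-3,11,77,True,[(11,7,8),(10,5,7),(12,9,6),(9,3,5),(13,11,4),(8,1,3),(14,13,2),(7,0,1)]),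
(8,-4,1,-16,False,[(4,3,6),(5,4,5),(3,4,4),(2,5,3),(1,6,2),(6,8,1)]),
(9,-4,7,11,True,[(9,8,6),(8,7,5),(7,6,4),(10,12,3),(6,6,2),(5,6,1)]),
(4,0,0,0,True,[(6,8,7),(5,7,6),(7,10,5),(4,6,4),(8,12,3),(3,5,2),(9,14,1)])]"]) code_simp

lemma indep_14_7: "\<exists>C. indep_cert 14 [8, 8, 6, 6, 6, 6, 6, 6, 6] C"
  by (rule exI[of _ "[(3,-1,1,9,True,[(14,0,6),(13,0,5),(12,0,4),(11,0,3),(10,0,2),(9,0,1)]),
(1,-7,13,91,True,[(14,6,8),(13,5,7),(12,4,6),(11,3,5),(10,2,4),(9,1,3),(8,0,2),(7,0,1)]),
(4,4,-5,31,False,[(14,0,6),(13,0,5),(12,0,4),(11,0,3),(9,0,2),(10,0,1)]),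
(2,9,-5,61,False,[(14,6,8),(13,5,7),(12,4,6),(11,3,5),(10,2,4),(9,2,3),(8,1,2),(7,0,1)]),
(5,-7,4,1,False,[(0,1,6),(1,2,5),(2,5,4),(3,6,3),(4,8,2),(5,9,1)]),
(6,9,-2,67,False,[(10,6,6),(11,8,5),(12,10,4),(9,5,3),(13,12,2),(14,14,1)]),
(7,1,2,19,False,[(8,6,6),(7,6,5),(6,7,4),(9,9,3),(5,7,2),(10,12,1)]),
(8,-5,3,-14,False,[(4,2,6),(3,1,5),(2,0,4),(5,4,3),(1,0,2),(6,6,1)]),
(9,0,0,0,False,[(6,0,6),(7,1,5),(5,0,4),(8,3,3),(4,0,2),(3,0,1)])]"]) code_simp

lemma empty_14_1: "\<exists>C. empty_cert 14 [7, 7, 7, 7, 7, 7, 7, 5, 5] C"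
  by (rule exI[of _ "[(1,1,-1,8,False,[(14,0,7),(13,0,6),(12,0,5),(11,0,4),(10,0,3),(9,0,2),(8,0,1)]),
(2,-6,-7,-41,True,[(0,0,7),(1,0,6),(2,0,5),(3,0,4),(4,0,3),(5,0,2)]),
(3,1,-3,-6,True,[(3,4,7),(4,6,6),(2,5,5),(5,9,4),(1,6,3),(6,12,2),(0,7,1)]),
(4,-1,1,8,False,[(0,8,7),(1,9,6),(2,10,5),(3,11,4),(4,12,3),(5,13,2),(6,14,1)]),
(5,1,1,22,False,[(14,8,7),(13,9,6),(12,10,5),(11,11,4),(10,12,3),(9,13,2),(8,14,1)]),
(6,4,-3,8,True,[(7,8,7),(8,8,6),(6,7,5),(9,9,4),(5,6,3),(10,10,2),(4,5,1)]),
(7,3,4,50,False,[(7,8,7),(6,8,6),(8,9,5),(5,9,4),(9,10,3),(4,10,2),(10,11,1)]),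
(8,2,3,27,True,[(7,3,5),(8,2,4),(9,2,3),(6,5,2),(10,3,1)]),
(9,0,0,0,True,[(6,0,5),(5,2,4),(7,0,3),(4,3,2),(8,1,1)])]"]) code_simp

lemma empty_14_2: "\<exists>C. empty_cert 14 [7, 7, 7, 7, 7, 7, 7, 6, 4] C"
  by (rule exI[of _ "[(1,-1,-1,-6,True,[(0,0,7),(1,0,6),(2,0,5),(3,0,4),(4,0,3),(5,0,2),(6,0,1)]),
(2,6,5,120,False,[(14,8,7),(13,9,6),(12,10,5),(11,11,4),(10,12,3),(9,14,1)]),
(3,11,5,155,False,[(14,1,7),(13,3,6),(12,5,5),(11,7,4),(10,9,3),(9,12,2),(8,14,1)]),
(8,-1,-2,-12,True,[(0,7,6),(1,6,5),(2,5,4),(3,4,3),(4,3,2),(5,2,1)]),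
(4,-1,1,8,True,[(14,0,7),(13,0,6),(12,0,5),(11,0,4),(10,0,3),(9,0,2),(8,0,1)]),
(5,2,-1,12,False,[(10,2,7),(11,1,6),(9,2,5),(12,1,4),(13,0,3),(8,3,2),(14,0,1)]),
(6,-1,4,30,True,[(10,3,7),(11,4,6),(9,2,5),(12,5,4),(13,6,3),(8,1,2),(14,7,1)]),
(7,3,2,24,True,[(8,3,7),(7,4,6),(6,4,5),(5,5,4),(9,7,3),(4,6,2),(3,7,1)]),
(9,0,0,0,True,[(7,0,4),(6,1,3),(5,3,2),(4,5,1)])]"]) code_simp

lemma indep_15_1: "\<exists>C. indep_cert 15 [7, 7, 7, 7, 7, 7, 7, 7, 7] C"
  by (rule exI[of _ "[(1,-1,1,9,False,[(0,9,7),(1,10,6),(2,11,5),(3,12,4),(4,13,3),(5,14,2),(6,15,1)]),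
(2,1,-1,9,False,[(15,0,7),(14,0,6),(13,0,5),(12,0,4),(11,0,3),(10,0,2),(9,0,1)]),
(3,-2,1,2,False,[(0,2,7),(1,4,6),(2,6,5),(3,8,4),(4,10,3),(5,12,2),(6,14,1)]),
(4,-2,3,18,True,[(15,7,7),(14,7,6),(13,6,5),(12,6,4),(11,5,3),(10,5,2),(9,4,1)]),
(5,-2,7,49,True,[(11,8,7),(12,10,6),(13,11,5),(10,7,4),(9,5,3),(14,13,2),(15,15,1)]),
(6,1,-2,2,True,[(0,2,7),(1,4,6),(2,6,5),(3,8,4),(4,10,3),(5,12,2),(6,14,1)]),
(7,-7,13,33,True,[(8,4,7),(7,3,6),(9,8,5),(6,3,4),(5,2,3),(10,11,2),(4,2,1)]),
(8,-2,-1,-20,True,[(3,1,7),(4,3,6),(2,1,5),(1,0,4),(5,5,3),(0,0,2),(6,7,1)]),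
(9,0,0,0,True,[(7,9,7),(6,8,6),(8,11,5),(5,8,4),(9,13,3),(10,14,2),(4,9,1)])]"]) code_simp

lemma indep_15_2: "\<exists>C. indep_cert 15 [8, 7, 7, 7, 7, 7, 7, 7, 6] C"
  by (rule exI[of _ "[(2,1,-1,9,False,[(15,0,7),(14,0,6),(13,0,5),(12,0,4),(11,0,3),(10,0,2),(9,0,1)]),
(9,1,-2,3,True,[(0,3,6),(1,5,5),(2,7,4),(3,9,3),(4,11,2),(5,13,1)]),
(3,8,-5,52,False,[(14,6,7),(15,8,6),(13,6,5),(12,5,4),(11,5,3),(10,4,2),(9,4,1)]),
(4,5,2,74,True,[(15,9,7),(14,10,6),(13,10,5),(12,10,4),(11,11,3),(10,11,2),(9,12,1)]),
(1,-1,1,8,False,[(0,8,8),(1,9,7),(2,10,6),(3,11,5),(4,12,4),(5,13,3),(6,14,2),(7,15,1)]),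
(5,-2,1,1,False,[(0,1,7),(1,3,6),(2,5,5),(3,7,4),(4,9,3),(5,11,2),(6,13,1)]),
(6,-4,7,31,False,[(8,9,7),(7,9,6),(6,8,5),(9,11,4),(5,8,3),(4,7,2),(10,11,1)]),
(7,1,-3,-8,True,[(3,2,7),(2,1,6),(4,4,5),(1,1,4),(0,0,3),(5,7,2),(6,10,1)]),
(8,0,0,0,True,[(6,3,7),(7,5,6),(8,7,5),(5,3,4),(9,9,3),(4,2,2),(10,10,1)])]"]) code_simp

lemma indep_15_3: "\<exists>C. indep_cert 15 [8, 8, 7, 7, 7, 7, 7, 6, 6] C"
  by (rule exI[of _ "[(1,1,-1,8,False,[(15,0,8),(14,0,7),(13,0,6),(12,0,5),(11,0,4),(10,0,3),(9,0,2),(8,0,1)]),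
(3,1,1,24,False,[(15,9,7),(14,10,6),(13,11,5),(12,12,4),(11,13,3),(10,14,2),(9,15,1)]),
(4,7,2,89,False,[(11,6,7),(12,6,6),(13,6,5),(10,10,4),(14,7,3),(9,13,2),(15,8,1)]),
(5,-1,1,9,True,[(15,0,7),(14,0,6),(13,0,5),(12,0,4),(11,0,3),(10,0,2),(9,0,1)]),
(2,-1,4,31,True,[(10,2,8),(11,3,7),(12,4,6),(9,1,5),(13,5,4),(14,6,3),(8,0,2),(15,8,1)]),
(6,-1,-1,-6,False,[(0,0,7),(1,0,6),(2,0,5),(3,0,4),(4,0,3),(5,0,2),(6,0,1)]),
(8,-4,3,-1,True,[(7,0,6),(8,2,5),(6,1,4),(5,2,3),(9,6,2),(4,3,1)]),
(9,2,3,32,False,[(10,4,6),(9,5,5),(8,6,4),(7,6,3),(11,4,2),(6,7,1)]),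
(7,0,0,0,True,[(3,4,7),(4,4,6),(2,5,5),(5,5,4),(1,6,3),(6,5,2),(0,7,1)])]"]) code_simp

lemma indep_15_4: "\<exists>C. indep_cert 15 [8, 8, 7, 7, 7, 7, 7, 7, 5] C"
  by (rule exI[of _ "[(3,1,-1,9,True,[(0,9,7),(1,10,6),(2,11,5),(3,12,4),(4,13,3),(5,14,2),(6,15,1)]),
(1,-1,1,8,True,[(15,0,8),(14,0,7),(13,0,6),(12,0,5),(11,0,4),(10,0,3),(9,0,2),(8,0,1)]),
(4,-1,-1,-6,False,[(0,0,7),(1,0,6),(2,0,5),(3,0,4),(4,0,3),(5,0,2),(6,0,1)]),
(5,1,1,24,False,[(15,9,7),(14,10,6),(13,11,5),(12,12,4),(11,13,3),(10,14,2),(9,15,1)]),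
(6,-1,3,24,True,[(12,5,7),(11,4,6),(13,6,5),(10,3,4),(14,7,3),(9,2,2),(15,8,1)]),
(2,-4,3,-7,True,[(7,0,8),(8,1,7),(6,1,6),(9,4,5),(5,2,4),(10,7,3),(4,3,2),(3,4,1)]),
(7,3,-1,26,False,[(12,4,7),(13,5,6),(11,3,5),(14,6,4),(10,2,3),(15,7,2),(9,1,1)]),
(8,1,3,18,False,[(9,3,7),(10,5,6),(8,4,5),(11,8,4),(7,4,3),(6,4,2),(12,11,1)]),
(9,0,0,0,True,[(2,5,5),(3,5,4),(1,6,3),(0,7,2),(4,5,1)])]"]) code_simp

lemma indep_15_5: "\<exists>C. indep_cert 15 [8, 8, 8, 8, 7, 6, 6, 6, 6] C"
  by (rule exI[of _ "[(1,1,-1,8,True,[(0,8,8),(1,9,7),(2,10,6),(3,11,5),(4,12,4),(5,13,3),(6,14,2),(7,15,1)]),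
(6,1,1,25,False,[(15,10,6),(14,11,5),(13,12,4),(12,13,3),(11,14,2),(10,15,1)]),
(2,3,-1,23,False,[(12,5,8),(11,4,7),(13,6,6),(10,3,5),(14,7,4),(9,2,3),(15,8,2),(8,1,1)]),
(3,-1,1,8,True,[(15,0,8),(14,0,7),(13,0,6),(12,0,5),(11,0,4),(10,0,3),(9,0,2),(8,0,1)]),
(5,-1,-1,-6,True,[(0,0,7),(1,0,6),(2,0,5),(3,0,4),(4,0,3),(5,0,2),(6,0,1)]),
(7,2,-3,-2,False,[(7,0,6),(8,2,5),(6,1,4),(5,2,3),(9,5,2),(4,3,1)]),
(4,1,2,26,True,[(11,4,8),(12,5,7),(13,6,6),(10,6,5),(14,7,4),(9,8,3),(15,8,2),(8,10,1)]),
(8,-3,-2,-27,False,[(3,4,6),(2,5,5),(4,4,4),(1,6,3),(5,5,2),(0,7,1)]),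
(9,0,0,0,True,[(8,4,6),(7,5,5),(9,4,4),(10,3,3),(6,6,2),(5,6,1)])]"]) code_simp

lemma empty_15_1: "\<exists>C. empty_cert 15 [8, 7, 7, 7, 7, 7, 7, 7, 7] C"
  by (rule exI[of _ "[(2,1,1,24,True,[(15,9,7),(14,10,6),(13,11,5),(12,12,4),(11,13,3),(10,14,2),(9,15,1)]),
(1,-1,-1,-7,True,[(0,0,8),(1,0,7),(2,0,6),(3,0,5),(4,0,4),(5,0,3),(6,0,2),(7,0,1)]),
(3,1,-1,9,True,[(0,9,7),(1,10,6),(2,11,5),(3,12,4),(4,13,3),(5,14,2),(6,15,1)]),
(4,1,2,32,True,[(15,2,7),(14,4,6),(13,6,5),(12,8,4),(11,10,3),(10,12,2),(9,14,1)]),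
(5,7,2,85,False,[(11,4,7),(12,4,6),(13,5,5),(10,8,3),(14,6,3),(15,7,2),(9,11,1)]),
(6,-1,2,18,True,[(12,0,7),(13,0,6),(11,0,5),(14,0,4),(10,0,3),(15,0,2),(9,0,1)]),
(7,3,-5,-4,True,[(3,5,7),(2,6,5),(4,6,5),(5,7,4),(1,7,3),(6,9,2),(0,8,1)]),
(8,-3,1,-8,False,[(4,4,7),(3,5,6),(5,7,5),(2,6,4),(1,7,3),(6,10,2),(0,8,1)]),
(9,0,0,0,False,[(7,6,7),(8,6,6),(6,5,5),(9,7,4),(5,4,3),(10,7,1)])]"]) code_simp

lemma empty_15_2: "\<exists>C. empty_cert 15 [8, 8, 7, 7, 7, 7, 7, 7, 6] C"
  by (rule exI[of _ "[(1,7,-6,58,False,[(15,0,8),(14,0,7),(13,0,6),(12,0,5),(11,0,4),(10,0,3),(9,0,1)]),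
(3,1,1,24,True,[(15,9,7),(14,10,6),(13,11,5),(12,12,4),(11,13,3),(10,14,2),(9,15,1)]),
(2,1,2,31,True,[(15,1,8),(14,3,7),(13,5,6),(12,7,5),(11,9,4),(10,11,3),(9,13,2),(8,15,1)]),
(4,6,-11,8,True,[(0,2,7),(1,4,6),(2,5,5),(3,7,4),(4,9,3),(5,11,2),(6,13,1)]),
(5,5,-2,27,True,[(7,9,6),(8,9,6),(6,8,5),(9,9,4),(5,8,3),(4,7,2),(10,10,1)]),
(9,1,-3,-8,True,[(3,1,6),(2,0,5),(1,0,4),(4,4,3),(0,0,2),(5,7,1)]),
(6,-3,-5,-47,True,[(5,0,7),(6,0,6),(7,0,5),(4,0,4),(8,0,3),(3,0,1),(9,0,1)]),
(7,-2,3,23,True,[(12,0,7),(11,0,6),(13,0,5),(10,0,4),(14,0,3),(9,1,2),(15,0,1)]),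
(8,0,0,0,False,[(6,6,6),(7,6,6),(8,7,5),(5,7,4),(4,8,3),(3,8,2),(9,10,1)])]"]) code_simp

lemma indep_16_1: "\<exists>C. indep_cert 16 [8, 8, 8, 8, 7, 7, 7, 7, 7] C"
  by (rule exI[of _ "[(5,1,1,26,True,[(16,10,7),(15,11,6),(14,12,5),(13,13,4),(12,14,3),(11,15,2),(10,16,1)]),
(1,-1,1,9,False,[(0,9,8),(1,10,7),(2,11,6),(3,12,5),(4,13,4),(5,14,3),(6,15,2),(7,16,1)]),
(6,-1,3,27,True,[(13,5,7),(12,4,6),(14,6,5),(11,3,4),(15,7,3),(10,2,2),(16,8,1)]),
(2,-1,-1,-7,True,[(0,0,8),(1,0,7),(2,0,6),(3,0,5),(4,0,4),(5,0,3),(6,0,2),(7,0,1)]),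
(7,1,-1,10,True,[(0,10,7),(1,11,6),(2,12,5),(3,13,4),(4,14,3),(5,15,2),(6,16,1)]),
(8,-5,3,-6,True,[(8,0,7),(9,1,6),(7,1,5),(10,4,4),(6,2,3),(5,3,2),(11,7,1)]),
(9,-1,2,7,True,[(11,8,7),(10,8,6),(9,7,5),(12,10,4),(8,7,3),(7,6,2),(6,5,1)]),
(3,3,2,41,True,[(7,9,8),(8,10,7),(6,10,6),(9,12,5),(5,11,4),(4,11,3),(10,14,2),(3,12,1)]),
(4,0,0,0,False,[(8,0,8),(9,0,7),(7,1,6),(6,2,5),(10,1,4),(5,3,3),(11,2,2),(4,4,1)])]"]) code_simp

lemma indep_16_2: "\<exists>C. indep_cert 16 [8, 8, 8, 8, 8, 7, 7, 7, 6] C"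
  by (rule exI[of _ "[(1,1,-1,9,False,[(16,0,8),(15,0,7),(14,0,6),(13,0,5),(12,0,4),(11,0,3),(10,0,2),(9,0,1)]),
(2,6,5,134,True,[(16,9,8),(15,10,7),(14,11,6),(13,12,5),(12,13,4),(10,14,3),(11,14,2),(9,16,1)]),
(3,1,-2,1,True,[(0,1,8),(1,3,7),(2,5,6),(3,7,5),(4,9,4),(5,11,3),(6,13,2),(7,15,1)]),
(4,7,2,86,False,[(11,6,8),(10,8,7),(12,6,6),(13,7,5),(9,12,4),(14,7,3),(8,15,2),(15,8,1)]),
(9,1,-4,-11,True,[(3,1,6),(2,0,5),(4,5,4),(1,0,3),(5,9,2),(0,0,1)]),
(6,-1,1,10,False,[(0,10,7),(1,11,6),(2,12,5),(3,13,4),(4,14,3),(5,15,2),(6,16,1)]),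
(7,5,-7,-23,True,[(6,4,7),(5,3,6),(7,6,5),(4,1,4),(8,7,3),(9,8,2),(3,0,1)]),
(5,-1,5,43,True,[(11,2,8),(10,1,7),(12,3,6),(13,4,5),(14,5,4),(9,0,3),(15,6,2),(16,7,1)]),
(8,0,0,0,True,[(8,0,7),(7,0,6),(9,3,5),(6,0,4),(5,0,3),(10,8,2),(4,0,1)])]"]) code_simp

lemma indep_16_3: "\<exists>C. indep_cert 16 [8, 8, 8, 8, 8, 8, 7, 6, 6] C"
  by (rule exI[of _ "[(1,1,1,25,True,[(16,9,8),(15,10,7),(14,11,6),(13,12,5),(12,13,4),(11,14,3),(10,15,2),(9,16,1)]),
(2,1,2,33,True,[(16,1,8),(15,3,7),(14,5,6),(13,7,5),(12,9,4),(11,11,3),(10,13,2),(9,15,1)]),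
(3,1,-1,9,False,[(16,0,8),(15,0,7),(14,0,6),(13,0,5),(12,0,4),(11,0,3),(10,0,2),(9,0,1)]),
(4,1,4,49,True,[(12,1,8),(13,0,7),(11,5,6),(14,0,5),(10,9,4),(15,0,3),(9,13,2),(16,0,1)]),
(5,1,-2,1,True,[(0,1,8),(1,3,7),(2,5,6),(3,7,5),(4,9,4),(5,11,3),(6,13,2),(7,15,1)]),
(8,3,-2,14,True,[(8,11,6),(7,10,5),(6,9,4),(5,8,3),(9,11,2),(4,8,1)]),
(6,-3,4,17,False,[(0,5,8),(1,5,7),(2,6,6),(3,7,5),(4,8,4),(5,8,3),(6,9,2),(7,10,1)]),
(9,1,1,11,False,[(7,4,6),(8,6,5),(6,5,4),(9,7,3),(5,6,2),(10,9,1)]),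
(7,0,0,0,True,[(3,0,7),(4,1,6),(2,0,5),(5,2,4),(1,0,3),(6,3,2),(0,0,1)])]"]) code_simp

lemma indep_16_4: "\<exists>C. indep_cert 16 [8, 8, 8, 8, 8, 8, 7, 7, 5] C"
  by (rule exI[of _ "[(1,1,-1,9,True,[(0,9,8),(1,10,7),(2,11,6),(3,12,5),(4,13,4),(5,14,3),(6,15,2),(7,16,1)]),
(2,-1,1,9,True,[(16,0,8),(15,0,7),(14,0,6),(13,0,5),(12,0,4),(11,0,3),(10,0,2),(9,0,1)]),
(3,1,1,25,True,[(16,9,8),(15,10,7),(14,11,6),(13,12,5),(12,13,4),(11,14,3),(10,15,2),(9,16,1)]),
(4,-1,-1,-7,True,[(0,0,8),(1,0,7),(2,0,6),(3,0,5),(4,0,4),(5,0,3),(6,0,2),(7,0,1)]),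
(5,3,1,41,False,[(12,5,8),(13,5,7),(11,8,6),(14,6,5),(10,11,4),(15,7,3),(9,14,2),(16,8,1)]),
(7,3,-5,-1,True,[(3,5,7),(4,7,6),(2,6,5),(5,8,4),(1,7,3),(6,10,2),(0,8,1)]),
(6,2,7,76,True,[(10,3,8),(11,3,7),(12,4,6),(13,5,5),(9,7,4),(14,6,3),(15,7,2),(8,10,1)]),
(9,3,-1,12,True,[(7,7,5),(6,6,4),(8,7,3),(5,6,2),(4,6,1)]),
(8,0,0,0,True,[(8,0,7),(7,1,6),(9,1,5),(6,2,4),(5,3,3),(4,4,2),(10,2,1)])]"]) code_simp

lemma indep_16_5: "\<exists>C. indep_cert 16 [8, 8, 8, 8, 8, 8, 8, 6, 5] C"
  by (rule exI[of _ "[(1,1,-1,9,True,[(0,9,8),(1,10,7),(2,11,6),(3,12,5),(4,13,4),(5,14,3),(6,15,2),(7,16,1)]),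
(2,-1,1,9,False,[(0,9,8),(1,10,7),(2,11,6),(3,12,5),(4,13,4),(5,14,3),(6,15,2),(7,16,1)]),
(3,1,-2,1,True,[(0,1,8),(1,3,7),(2,5,6),(3,7,5),(4,9,4),(5,11,3),(6,13,2),(7,15,1)]),
(4,1,1,25,False,[(16,9,8),(15,10,7),(14,11,6),(13,12,5),(12,13,4),(11,14,3),(10,15,2),(9,16,1)]),
(5,7,2,88,False,[(11,6,8),(12,6,7),(10,9,6),(13,7,5),(14,7,4),(9,13,3),(15,8,2),(8,16,1)]),
(8,-1,5,48,True,[(12,4,6),(11,3,5),(13,5,4),(14,6,3),(15,7,2),(10,2,1)]),
(6,4,3,42,False,[(8,4,8),(9,5,7),(7,5,6),(6,6,5),(10,5,4),(5,8,3),(4,9,2),(3,10,1)]),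
(7,-1,-2,-15,True,[(4,0,8),(3,0,7),(5,0,6),(2,0,5),(6,0,4),(1,0,3),(7,0,2),(0,0,1)]),
(9,0,0,0,True,[(8,0,5),(7,2,4),(9,1,3),(6,4,2),(5,6,1)])]"]) code_simp

lemma indep_16_6: "\<exists>C. indep_cert 16 [8, 8, 8, 8, 8, 8, 8, 7, 3] C"
  by (rule exI[of _ "[(1,1,-1,9,True,[(0,9,8),(1,10,7),(2,11,6),(3,12,5),(4,13,4),(5,14,3),(6,15,2),(7,16,1)]),
(2,2,-1,17,False,[(16,8,8),(15,7,7),(14,6,6),(13,5,5),(12,4,4),(11,3,3),(10,2,2),(9,1,1)]),
(3,-1,-1,-7,True,[(0,0,8),(1,0,7),(2,0,6),(3,0,5),(4,0,4),(5,0,3),(6,0,2),(7,0,1)]),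
(4,-2,-1,-15,False,[(0,8,8),(1,7,7),(2,6,6),(3,5,5),(4,4,4),(5,3,3),(6,2,2),(7,1,1)]),
(9,2,1,43,True,[(16,14,3),(15,14,2),(14,15,1)]),
(8,1,-3,-12,False,[(8,0,7),(9,2,6),(7,2,5),(10,4,4),(6,4,3),(11,6,2),(12,8,1)]),
(5,-5,-2,-51,False,[(4,8,8),(5,7,7),(3,10,6),(2,12,5),(6,7,4),(1,14,3),(7,7,2),(0,16,1)]),
(6,3,2,53,False,[(12,9,8),(13,10,7),(11,11,6),(10,12,5),(9,13,4),(14,12,3),(8,15,2),(7,16,1)]),
(7,0,0,0,False,[(8,7,8),(7,9,7),(6,11,6),(9,8,5),(10,8,4),(5,14,3),(11,8,2),(4,16,1)])]"]) code_simp

lemma indep_16_7: "\<exists>C. indep_cert 16 [8, 8, 8, 8, 8, 8, 8, 8, 1] C"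
  by (rule exI[of _ "[(1,1,-1,9,False,[(16,0,8),(15,0,7),(14,0,6),(13,0,5),(12,0,4),(11,0,3),(10,0,2),(9,0,1)]),
(2,1,1,25,True,[(16,9,8),(15,10,7),(14,11,6),(13,12,5),(12,13,4),(11,14,3),(10,15,2),(9,16,1)]),
(3,-1,1,9,False,[(0,9,8),(1,10,7),(2,11,6),(3,12,5),(4,13,4),(5,14,3),(6,15,2),(7,16,1)]),
(4,3,-1,25,False,[(12,4,8),(13,5,7),(11,3,6),(14,6,5),(10,2,4),(15,7,3),(9,1,2),(16,8,1)]),
(5,-1,-1,-7,False,[(0,0,8),(1,0,7),(2,0,6),(3,0,5),(4,0,4),(5,0,3),(6,0,2),(7,0,1)]),
(9,0,-1,0,True,[(0,8,1)]),
(6,-3,1,-7,False,[(4,5,8),(3,5,7),(5,8,6),(2,6,5),(6,11,4),(1,7,3),(7,14,2),(0,8,1)]),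
(7,-5,4,-7,False,[(8,9,8),(7,7,7),(9,10,6),(6,6,5),(10,11,4),(5,5,3),(11,12,2),(4,4,1)]),
(8,0,0,0,False,[(8,1,8),(9,3,7),(7,1,6),(10,6,5),(6,2,4),(11,9,3),(5,3,2),(12,12,1)])]"]) code_simp

lemma empty_16_1: "\<exists>C. empty_cert 16 [8, 8, 8, 8, 8, 7, 7, 7, 7] C"
  by (rule exI[of _ "[(1,1,-1,9,False,[(16,0,8),(15,0,7),(14,0,6),(13,0,5),(12,0,4),(11,0,3),(10,0,2),(9,0,1)]),
(6,-1,1,10,False,[(0,10,7),(1,11,6),(2,12,5),(3,13,4),(4,14,3),(5,15,2),(6,16,1)]),
(7,-1,-1,-6,True,[(0,0,7),(1,0,6),(2,0,5),(3,0,4),(4,0,3),(5,0,2),(6,0,1)]),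
(2,1,1,25,False,[(16,9,8),(15,10,7),(14,11,6),(13,12,5),(12,13,4),(11,14,3),(10,15,2),(9,16,1)]),
(3,1,3,42,True,[(13,4,8),(12,6,7),(14,5,6),(11,9,5),(15,6,4),(10,12,3),(16,7,2),(9,15,1)]),
(8,3,2,45,True,[(8,10,7),(9,9,6),(7,11,5),(6,11,4),(10,9,3),(5,12,2),(11,8,1)]),
(4,3,8,78,True,[(10,1,8),(9,2,7),(11,2,6),(8,5,5),(7,8,3),(12,3,3),(6,10,1)]),
(9,-2,1,-6,True,[(7,0,7),(6,1,6),(8,0,5),(5,2,4),(4,3,3),(9,0,2),(3,4,1)]),
(5,0,0,0,False,[(7,0,8),(8,0,7),(9,1,6),(6,1,5),(10,2,4),(11,3,3),(5,2,2),(12,4,1)])]"]) code_simp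

lemma empty_16_2: "\<exists>C. empty_cert 16 [8, 8, 8, 8, 8, 8, 7, 7, 6] C"
  by (rule exI[of _ "[(7,1,1,26,False,[(16,10,7),(15,11,6),(14,12,5),(13,13,4),(12,14,3),(11,15,2),(10,16,1)]),
(1,-1,1,9,False,[(0,9,8),(1,10,7),(2,11,6),(3,12,5),(4,13,4),(5,14,3),(6,15,2),(7,16,1)]),
(2,1,3,43,True,[(13,5,8),(12,7,7),(14,6,6),(11,10,5),(15,7,4),(10,13,3),(16,8,2),(9,16,1)]),
(3,1,-1,9,False,[(16,0,8),(15,0,7),(14,0,6),(13,0,5),(12,0,4),(11,0,3),(10,0,2),(9,0,1)]),
(8,4,3,64,True,[(8,10,7),(9,10,6),(7,11,5),(10,9,4),(6,12,3),(11,8,2),(5,13,1)]),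
(4,2,-1,10,False,[(9,1,8),(8,0,7),(10,2,6),(7,0,5),(11,3,4),(6,0,3),(12,4,2),(5,0,1)]),
(5,3,4,41,True,[(9,2,8),(10,2,7),(8,3,6),(11,3,5),(7,5,4),(12,4,3),(6,6,2),(5,7,1)]),
(9,2,-5,-7,True,[(1,0,6),(0,0,5),(2,2,4),(3,4,3)]),
(6,0,0,0,False,[(1,2,8),(0,2,7),(2,3,6),(3,3,5),(4,4,4),(5,4,3),(6,4,2)])]"]) code_simp

lemma empty_16_3: "\<exists>C. empty_cert 16 [8, 8, 8, 8, 8, 8, 8, 6, 6] C"
  by (rule exI[of _ "[(1,-1,-1,-7,True,[(0,0,8),(1,0,7),(2,0,6),(3,0,5),(4,0,4),(5,0,3),(6,0,2),(7,0,1)]),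
(2,1,1,25,True,[(16,9,8),(15,10,7),(14,11,6),(13,12,5),(12,13,4),(11,14,3),(10,15,2),(9,16,1)]),
(3,1,-1,9,True,[(0,9,8),(1,10,7),(2,11,6),(3,12,5),(4,13,4),(5,14,3),(6,15,2),(7,16,1)]),
(4,-15,-8,-119,False,[(0,8,7),(1,7,7),(2,6,6),(3,5,5),(4,4,4),(5,3,3),(6,2,2),(7,1,1)]),
(8,3,1,45,False,[(13,6,6),(14,6,5),(12,9,4),(15,7,3),(11,12,2),(16,8,1)]),
(5,1,-3,-11,True,[(5,6,8),(4,6,7),(6,7,6),(3,7,5),(2,7,4),(7,10,3),(1,8,2),(0,8,1)]),
(6,7,-4,7,False,[(9,7,8),(10,8,7),(8,7,6),(7,7,4),(11,8,4),(6,6,3),(5,6,2),(12,8,1)]),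
(7,-3,-2,-41,False,[(3,10,7),(4,8,7),(5,8,6),(2,12,5),(1,14,3),(6,9,3),(0,15,2)]),
(9,0,0,0,False,[(7,11,6),(6,12,5),(8,13,4),(5,14,3),(4,15,2),(9,15,1)])]"]) code_simp

lemma empty_16_4: "\<exists>C. empty_cert 16 [8, 8, 8, 8, 8, 8, 8, 7, 4] C"
  by (rule exI[of _ "[(1,1,-1,9,True,[(0,9,8),(1,10,7),(2,11,6),(3,12,5),(4,13,4),(5,14,3),(6,15,2),(7,16,1)]),
(2,-1,1,9,True,[(16,0,8),(15,0,7),(14,0,6),(13,0,5),(12,0,4),(11,0,3),(10,0,2),(9,0,1)]),
(3,-1,-1,-7,False,[(0,0,8),(1,0,7),(2,0,6),(3,0,5),(4,0,4),(5,0,3),(6,0,2),(7,0,1)]),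
(4,1,1,25,False,[(16,9,8),(15,10,7),(14,11,6),(13,12,5),(12,13,4),(11,14,3),(10,15,2),(9,16,1)]),
(5,-1,3,25,True,[(12,4,8),(13,5,7),(11,3,6),(14,6,5),(10,2,4),(15,7,3),(9,1,2),(16,8,1)]),
(6,-4,3,-7,True,[(8,0,8),(7,1,7),(9,3,6),(6,2,5),(10,6,4),(5,3,3),(11,9,2),(4,4,1)]),
(8,4,3,67,False,[(13,5,7),(12,7,6),(14,6,5),(11,8,4),(15,7,3),(10,9,2),(16,8,1)]),
(7,1,3,16,False,[(9,3,7),(10,2,7),(8,3,6),(11,3,5),(7,3,4),(12,4,3),(6,4,2),(5,4,1)]),
(9,0,0,0,True,[(2,6,4),(1,7,3),(3,5,2),(0,8,1)])]"]) code_simp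

text \<open>The 9 * 36 = 324 conditions of nine points of multiplicity 8 fill the 18 by 18 square
  exactly. This certificate serves every degree from 17 on.\<close>

lemma indep_17_1: "\<exists>C. indep_cert 17 [8, 8, 8, 8, 8, 8, 8, 8, 8] C"
  by (rule exI[of _ "[(1,-1,-1,-7,False,[(0,0,8),(1,0,7),(2,0,6),(3,0,5),(4,0,4),(5,0,3),(6,0,2),(7,0,1)]),
(2,1,1,27,False,[(17,10,8),(16,11,7),(15,12,6),(14,13,5),(13,14,4),(12,15,3),(11,16,2),(10,17,1)]),
(3,1,-1,10,True,[(0,10,8),(1,11,7),(2,12,6),(3,13,5),(4,14,4),(5,15,3),(6,16,2),(7,17,1)]),
(4,-1,1,10,True,[(17,0,8),(16,0,7),(15,0,6),(14,0,5),(13,0,4),(12,0,3),(11,0,2),(10,0,1)]),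
(5,-1,3,29,True,[(14,5,8),(13,4,7),(15,6,6),(12,3,5),(16,7,4),(11,2,3),(17,8,2),(10,1,1)]),
(6,-5,6,19,True,[(9,0,8),(10,2,7),(8,0,6),(11,5,5),(7,1,4),(12,8,3),(6,2,2),(13,11,1)]),
(7,-3,10,48,True,[(10,9,8),(9,8,7),(11,10,6),(8,6,5),(12,11,4),(7,5,3),(13,12,2),(6,4,1)]),
(8,3,1,34,True,[(7,9,8),(8,11,7),(6,10,6),(5,10,5),(4,10,4),(9,15,3),(3,11,2),(2,11,1)]),
(9,0,0,0,False,[(8,0,8),(9,0,7),(7,1,6),(6,2,5),(5,3,4),(10,1,3),(4,4,2),(3,5,1)])]"]) code_simp

section \<open>Systems with exactly as many conditions as monomials\<close>

lemma empty_4_1': "\<exists>C. empty_cert 4 [2, 2, 2, 2, 2, 2, 2, 2, 1] C"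
  by (rule indep_cert_empty[OF indep_4_1]) simp_all

lemma empty_6_2': "\<exists>C. empty_cert 6 [3, 3, 3, 3, 3, 3, 3, 3, 1] C"
  by (rule indep_cert_empty[OF indep_6_2]) simp_all

lemma empty_8_3': "\<exists>C. empty_cert 8 [4, 4, 4, 4, 4, 4, 4, 4, 1] C"
  by (rule indep_cert_empty[OF indep_8_3]) simp_all

lemma empty_10_2': "\<exists>C. empty_cert 10 [5, 5, 5, 5, 5, 5, 5, 4, 3] C"
  by (rule indep_cert_empty[OF indep_10_2]) simp_all

lemma empty_10_3': "\<exists>C. empty_cert 10 [5, 5, 5, 5, 5, 5, 5, 5, 1] C"
  by (rule indep_cert_empty[OF indep_10_3]) simp_all

lemma empty_12_5': "\<exists>C. empty_cert 12 [6, 6, 6, 6, 6, 6, 6, 6, 1] C"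
  by (rule indep_cert_empty[OF indep_12_5]) simp_all

lemma empty_14_2': "\<exists>C. empty_cert 14 [7, 7, 7, 7, 7, 7, 6, 6, 5] C"
  by (rule indep_cert_empty[OF indep_14_2]) simp_all

lemma empty_14_5': "\<exists>C. empty_cert 14 [7, 7, 7, 7, 7, 7, 7, 7, 1] C"
  by (rule indep_cert_empty[OF indep_14_5]) simp_all

lemma empty_16_7': "\<exists>C. empty_cert 16 [8, 8, 8, 8, 8, 8, 8, 8, 1] C"
  by (rule indep_cert_empty[OF indep_16_7]) simp_all

lemmas indep_certs =
  indep_2_1 indep_3_1 indep_4_1 indep_4_2 indep_5_1 indep_5_2 indep_5_3 indep_6_1
  indep_6_2 indep_6_3 indep_6_4 indep_6_5 indep_7_1 indep_7_2 indep_7_3 indep_7_4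
  indep_7_5 indep_8_1 indep_8_2 indep_8_3 indep_8_4 indep_8_5 indep_8_6 indep_8_7
  indep_8_8 indep_9_1 indep_9_2 indep_9_3 indep_9_4 indep_9_5 indep_9_6 indep_9_7
  indep_10_1 indep_10_2 indep_10_3 indep_10_4 indep_10_5 indep_10_6 indep_10_7 indep_10_8
  indep_10_9 indep_10_10 indep_11_1 indep_11_2 indep_11_3 indep_11_4 indep_11_5 indep_11_6
  indep_11_7 indep_12_1 indep_12_2 indep_12_3 indep_12_4 indep_12_5 indep_12_6 indep_12_7
  indep_12_8 indep_13_1 indep_13_2 indep_13_3 indep_13_4 indep_13_5 indep_13_6 indep_14_1
  indep_14_2 indep_14_3 indep_14_4 indep_14_5 indep_14_6 indep_14_7 indep_15_1 indep_15_2
  indep_15_3 indep_15_4 indep_15_5 indep_16_1 indep_16_2 indep_16_3 indep_16_4 indep_16_5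
  indep_16_6 indep_16_7

lemmas empty_certs =
  empty_8_1 empty_9_1 empty_11_1 empty_11_2 empty_12_1 empty_12_2 empty_13_1 empty_13_2
  empty_14_1 empty_14_2 empty_15_1 empty_15_2 empty_16_1 empty_16_2 empty_16_3 empty_16_4
  empty_4_1' empty_6_2' empty_8_3' empty_10_2' empty_10_3' empty_12_5' empty_14_2' empty_14_5'
  empty_16_7'

section \<open>Covering the Cremona reduced multiplicity vectors with \<open>m 4 \<ge> 1\<close>,
  degree by degree\<close>

lemma planar_nonspecial_1:
  assumes "\<forall>i\<in>{1..8}. m i \<ge> m (i + 1)" "m 1 \<le> 8" "m 1 \<le> 1" "m 4 \<ge> 1" "m 1 + m 2 + m 3 + m 4 \<le> 2 * 1"
  shows "planar_nonspecial 1 m"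
proof (rule cover_nonspecial[OF _ _ _ assms])
  \<comment> \<open>Four positive multiplicities have sum at least 4 > 2 * 1, so the box is
    empty.\<close>
  let ?t = "Void"
  show "cover_check 1 [1, 1, 1, 1, 0, 0, 0, 0, 0] (replicate 9 (min 8 1)) ?t" by code_simp
  show "\<forall>M\<in>cover_indep ?t. \<exists>d' C. d' \<le> 1 \<and> indep_cert d' M C"
    unfolding cover_indep.simps ball_Un ball_simps
    by ((intro conjI TrueI)?; (rule indep_leaf, rule indep_certs, simp))
  show "\<forall>M\<in>cover_empty ?t. \<exists>d' C. 1 \<le> d' \<and> empty_cert d' M C"
    unfolding cover_empty.simps ball_Un ball_simps
    by ((intro conjI TrueI)?; (rule empty_leaf, rule empty_certs, simp))
qed

lemma planar_nonspecial_2: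
  assumes "\<forall>i\<in>{1..8}. m i \<ge> m (i + 1)" "m 1 \<le> 8" "m 1 \<le> 2" "m 4 \<ge> 1" "m 1 + m 2 + m 3 + m 4 \<le> 2 * 2"
  shows "planar_nonspecial 2 m"
proof (rule cover_nonspecial[OF _ _ _ assms])
  \<comment> \<open>The Cremona inequality forces the first four multiplicities to be 1, and the
    others are at most 1.\<close>
  let ?t = "(Indep [1,1,1,1,1,1,1,1,1])"
  show "cover_check 2 [1, 1, 1, 1, 0, 0, 0, 0, 0] (replicate 9 (min 8 2)) ?t" by code_simp
  show "\<forall>M\<in>cover_indep ?t. \<exists>d' C. d' \<le> 2 \<and> indep_cert d' M C"
    unfolding cover_indep.simps ball_Un ball_simps
    by ((intro conjI TrueI)?; (rule indep_leaf, rule indep_certs, simp))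
  show "\<forall>M\<in>cover_empty ?t. \<exists>d' C. 2 \<le> d' \<and> empty_cert d' M C"
    unfolding cover_empty.simps ball_Un ball_simps
    by ((intro conjI TrueI)?; (rule empty_leaf, rule empty_certs, simp))
qed

lemma planar_nonspecial_3:
  assumes "\<forall>i\<in>{1..8}. m i \<ge> m (i + 1)" "m 1 \<le> 8" "m 1 \<le> 3" "m 4 \<ge> 1" "m 1 + m 2 + m 3 + m 4 \<le> 2 * 3"
  shows "planar_nonspecial 3 m"
proof (rule cover_nonspecial[OF _ _ _ assms])
  \<comment> \<open>Four positive entries with sum at most 6 lie below (3, 1, 1, 1) or (2, 2, 1, 1),
    hence below (3, 2, 1, 1), and the later entries are at most 1. The dominating vector has 6 + 3 +
    7 = 16 conditions and fills the 4 by 4 square.\<close>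
  let ?t = "(Split 0 3 (Split 2 2 (Indep [3,2,1,1,1,1,1,1,1]) Void) (Indep [3,2,1,1,1,1,1,1,1]))"
  show "cover_check 3 [1, 1, 1, 1, 0, 0, 0, 0, 0] (replicate 9 (min 8 3)) ?t" by code_simp
  show "\<forall>M\<in>cover_indep ?t. \<exists>d' C. d' \<le> 3 \<and> indep_cert d' M C"
    unfolding cover_indep.simps ball_Un ball_simps
    by ((intro conjI TrueI)?; (rule indep_leaf, rule indep_certs, simp))
  show "\<forall>M\<in>cover_empty ?t. \<exists>d' C. 3 \<le> d' \<and> empty_cert d' M C"
    unfolding cover_empty.simps ball_Un ball_simps
    by ((intro conjI TrueI)?; (rule empty_leaf, rule empty_certs, simp))
qed

lemma planar_nonspecial_4:
  assumes "\<forall>i\<in>{1..8}. m i \<ge> m (i + 1)" "m 1 \<le> 8" "m 1 \<le> 4" "m 4 \<ge> 1" "m 1 + m 2 + m 3 + m 4 \<le> 2 * 4"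
  shows "planar_nonspecial 4 m"
proof (rule cover_nonspecial[OF _ _ _ assms])
  \<comment> \<open>If \<open>m 5 \<ge> 2\<close>, the Cremona inequality makes the first five
    multiplicities equal to 2. Eight double points and a simple one fill the 5 by 5 square exactly,
    so that certificate works as \<open>Indep\<close> up to \<open>m 9 = 1\<close> and as
    \<open>Empty\<close> beyond.\<close>
  let ?t = "(Split 4 2 (Split 3 2 (Split 2 3 (Split 1 4 (Indep [4,3,2,1,1,1,1,1,1]) Void) Void) (Indep
    [2,2,2,2,2,2,2,2,1])) (Split 8 2 (Indep [2,2,2,2,2,2,2,2,1]) (Empty [2,2,2,2,2,2,2,2,1])))"
  show "cover_check 4 [1, 1, 1, 1, 0, 0, 0, 0, 0] (replicate 9 (min 8 4)) ?t" by code_simp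
  show "\<forall>M\<in>cover_indep ?t. \<exists>d' C. d' \<le> 4 \<and> indep_cert d' M C"
    unfolding cover_indep.simps ball_Un ball_simps
    by ((intro conjI TrueI)?; (rule indep_leaf, rule indep_certs, simp))
  show "\<forall>M\<in>cover_empty ?t. \<exists>d' C. 4 \<le> d' \<and> empty_cert d' M C"
    unfolding cover_empty.simps ball_Un ball_simps
    by ((intro conjI TrueI)?; (rule empty_leaf, rule empty_certs, simp))
qed

lemma planar_nonspecial_5:
  assumes "\<forall>i\<in>{1..8}. m i \<ge> m (i + 1)" "m 1 \<le> 8" "m 1 \<le> 5" "m 4 \<ge> 1" "m 1 + m 2 + m 3 + m 4 \<le> 2 * 5"
  shows "planar_nonspecial 5 m"
proof (rule cover_nonspecial[OF _ _ _ assms])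
  let ?t = "(Split 0 3 (Indep [3,3,3,2,2,2,2,2,2]) (Split 1 3 (Split 0 5 (Indep [4,2,2,2,2,2,2,2,2]) (Split
    4 2 (Indep [5,4,2,2,1,1,1,1,1]) Void)) (Split 0 5 (Split 0 4 (Split 3 3 (Indep
    [3,3,3,2,2,2,2,2,2]) Void) (Split 4 2 (Indep [5,4,2,2,1,1,1,1,1]) Void)) (Indep
    [5,4,2,2,1,1,1,1,1]))))"
  show "cover_check 5 [1, 1, 1, 1, 0, 0, 0, 0, 0] (replicate 9 (min 8 5)) ?t" by code_simp
  show "\<forall>M\<in>cover_indep ?t. \<exists>d' C. d' \<le> 5 \<and> indep_cert d' M C"
    unfolding cover_indep.simps ball_Un ball_simps
    by ((intro conjI TrueI)?; (rule indep_leaf, rule indep_certs, simp))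
  show "\<forall>M\<in>cover_empty ?t. \<exists>d' C. 5 \<le> d' \<and> empty_cert d' M C"
    unfolding cover_empty.simps ball_Un ball_simps
    by ((intro conjI TrueI)?; (rule empty_leaf, rule empty_certs, simp))
qed

lemma planar_nonspecial_6:
  assumes "\<forall>i\<in>{1..8}. m i \<ge> m (i + 1)" "m 1 \<le> 8" "m 1 \<le> 6" "m 4 \<ge> 1" "m 1 + m 2 + m 3 + m 4 \<le> 2 * 6"
  shows "planar_nonspecial 6 m"
proof (rule cover_nonspecial[OF _ _ _ assms])
  let ?t = "(Split 4 3 (Split 3 3 (Split 2 4 (Split 1 5 (Split 0 6 (Indep [5,4,3,2,2,2,2,2,2]) (Split 2 3
    (Split 1 4 (Indep [6,3,2,2,2,2,2,2,2]) (Indep [6,6,1,1,1,1,1,1,1])) Void)) (Indep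
    [6,6,1,1,1,1,1,1,1])) Void) (Indep [3,3,3,3,3,3,3,2,2])) (Split 7 3 (Indep [3,3,3,3,3,3,3,2,2])
    (Split 8 1 (Indep [3,3,3,3,3,3,3,3,1]) (Empty [3,3,3,3,3,3,3,3,1]))))"
  show "cover_check 6 [1, 1, 1, 1, 0, 0, 0, 0, 0] (replicate 9 (min 8 6)) ?t" by code_simp
  show "\<forall>M\<in>cover_indep ?t. \<exists>d' C. d' \<le> 6 \<and> indep_cert d' M C"
    unfolding cover_indep.simps ball_Un ball_simps
    by ((intro conjI TrueI)?; (rule indep_leaf, rule indep_certs, simp))
  show "\<forall>M\<in>cover_empty ?t. \<exists>d' C. 6 \<le> d' \<and> empty_cert d' M C"
    unfolding cover_empty.simps ball_Un ball_simps
    by ((intro conjI TrueI)?; (rule empty_leaf, rule empty_certs, simp))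
qed

lemma planar_nonspecial_7:
  assumes "\<forall>i\<in>{1..8}. m i \<ge> m (i + 1)" "m 1 \<le> 8" "m 1 \<le> 7" "m 4 \<ge> 1" "m 1 + m 2 + m 3 + m 4 \<le> 2 * 7"
  shows "planar_nonspecial 7 m"
proof (rule cover_nonspecial[OF _ _ _ assms])
  let ?t = "(Split 0 6 (Split 2 4 (Split 0 5 (Indep [4,4,3,3,3,3,3,3,3]) (Split 1 4 (Indep
    [5,3,3,3,3,3,3,3,3]) (Split 3 3 (Indep [6,5,4,2,2,2,2,2,2]) Void))) (Split 2 5 (Indep
    [6,5,4,2,2,2,2,2,2]) Void)) (Split 1 5 (Split 2 3 (Indep [7,5,2,2,2,2,2,2,2]) (Split 0 7 (Indep
    [6,5,4,2,2,2,2,2,2]) (Indep [7,5,3,2,2,2,2,1,1]))) (Split 1 6 (Indep [7,5,2,2,2,2,2,2,2])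
    (Indep [6,6,1,1,1,1,1,1,1]))))"
  show "cover_check 7 [1, 1, 1, 1, 0, 0, 0, 0, 0] (replicate 9 (min 8 7)) ?t" by code_simp
  show "\<forall>M\<in>cover_indep ?t. \<exists>d' C. d' \<le> 7 \<and> indep_cert d' M C"
    unfolding cover_indep.simps ball_Un ball_simps
    by ((intro conjI TrueI)?; (rule indep_leaf, rule indep_certs, simp))
  show "\<forall>M\<in>cover_empty ?t. \<exists>d' C. 7 \<le> d' \<and> empty_cert d' M C"
    unfolding cover_empty.simps ball_Un ball_simps
    by ((intro conjI TrueI)?; (rule empty_leaf, rule empty_certs, simp))
qed

lemma planar_nonspecial_8:
  assumes "\<forall>i\<in>{1..8}. m i \<ge> m (i + 1)" "m 1 \<le> 8" "m 1 \<le> 8" "m 4 \<ge> 1" "m 1 + m 2 + m 3 + m 4 \<le> 2 * 8"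
  shows "planar_nonspecial 8 m"
proof (rule cover_nonspecial[OF _ _ _ assms])
  let ?t = "(Split 4 4 (Split 3 4 (Split 0 6 (Indep [5,5,5,3,3,3,3,3,3]) (Split 2 4 (Split 1 5 (Split 0 8
    (Indep [7,4,3,3,3,3,3,3,3]) (Split 3 3 (Indep [8,6,3,2,2,2,2,2,2]) Void)) (Split 1 7 (Split 3 3
    (Indep [8,6,3,2,2,2,2,2,2]) Void) (Indep [8,8,1,1,1,1,1,1,1]))) (Split 2 5 (Split 8 2 (Indep
    [7,5,4,3,3,3,3,2,1]) (Indep [6,5,4,2,2,2,2,2,2])) Void))) (Indep [4,4,4,4,4,4,3,3,3])) (Split 6
    4 (Indep [4,4,4,4,4,4,3,3,3]) (Split 8 3 (Split 7 4 (Indep [4,4,4,4,4,4,4,3,2]) (Split 8 2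
    (Indep [4,4,4,4,4,4,4,4,1]) (Empty [4,4,4,4,4,4,4,4,1]))) (Empty [4,4,4,4,4,4,4,3,3]))))"
  show "cover_check 8 [1, 1, 1, 1, 0, 0, 0, 0, 0] (replicate 9 (min 8 8)) ?t" by code_simp
  show "\<forall>M\<in>cover_indep ?t. \<exists>d' C. d' \<le> 8 \<and> indep_cert d' M C"
    unfolding cover_indep.simps ball_Un ball_simps
    by ((intro conjI TrueI)?; (rule indep_leaf, rule indep_certs, simp))
  show "\<forall>M\<in>cover_empty ?t. \<exists>d' C. 8 \<le> d' \<and> empty_cert d' M C"
    unfolding cover_empty.simps ball_Un ball_simps
    by ((intro conjI TrueI)?; (rule empty_leaf, rule empty_certs, simp))
qed

lemma planar_nonspecial_9:
  assumes "\<forall>i\<in>{1..8}. m i \<ge> m (i + 1)" "m 1 \<le> 8" "m 1 \<le> 9" "m 4 \<ge> 1" "m 1 + m 2 + m 3 + m 4 \<le> 2 * 9"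
  shows "planar_nonspecial 9 m"
proof (rule cover_nonspecial[OF _ _ _ assms])
  let ?t = "(Split 2 5 (Split 0 6 (Indep [5,5,4,4,4,4,4,4,4]) (Split 1 5 (Split 5 4 (Indep
    [8,4,4,4,4,3,3,3,3]) (Split 8 4 (Indep [6,4,4,4,4,4,4,4,3]) (Empty [6,4,4,4,4,4,4,4,4])))
    (Split 0 8 (Split 2 4 (Indep [7,7,3,3,3,3,3,3,3]) (Split 1 7 (Indep [7,6,5,3,3,3,3,3,3]) Void))
    (Split 1 7 (Split 7 3 (Split 3 4 (Indep [8,6,4,3,3,3,3,2,2]) Void) Void) (Split 6 2 (Indep
    [8,8,3,3,3,3,1,1,1]) Void))))) (Split 2 6 (Split 1 7 (Indep [7,6,5,3,3,3,3,3,3]) Void) Void))"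
  show "cover_check 9 [1, 1, 1, 1, 0, 0, 0, 0, 0] (replicate 9 (min 8 9)) ?t" by code_simp
  show "\<forall>M\<in>cover_indep ?t. \<exists>d' C. d' \<le> 9 \<and> indep_cert d' M C"
    unfolding cover_indep.simps ball_Un ball_simps
    by ((intro conjI TrueI)?; (rule indep_leaf, rule indep_certs, simp))
  show "\<forall>M\<in>cover_empty ?t. \<exists>d' C. 9 \<le> d' \<and> empty_cert d' M C"
    unfolding cover_empty.simps ball_Un ball_simps
    by ((intro conjI TrueI)?; (rule empty_leaf, rule empty_certs, simp))
qed

lemma planar_nonspecial_10:
  assumes "\<forall>i\<in>{1..8}. m i \<ge> m (i + 1)" "m 1 \<le> 8" "m 1 \<le> 10" "m 4 \<ge> 1" "m 1 + m 2 + m 3 + m 4 \<le> 2 * 10"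
  shows "planar_nonspecial 10 m"
proof (rule cover_nonspecial[OF _ _ _ assms])
  let ?t = "(Split 5 5 (Split 1 6 (Split 0 7 (Indep [6,5,5,5,5,4,4,4,4]) (Split 2 5 (Indep
    [8,5,4,4,4,4,4,4,4]) (Split 8 3 (Indep [8,7,5,4,4,3,3,3,2]) (Indep [7,6,5,3,3,3,3,3,3]))))
    (Split 3 5 (Split 8 3 (Split 1 8 (Split 2 6 (Split 5 4 (Indep [8,7,5,4,4,3,3,3,2]) (Indep
    [6,6,6,4,4,4,4,4,3])) (Split 0 7 (Indep [6,6,6,4,4,4,4,4,3]) (Indep [8,7,6,6,4,1,1,1,1])))
    (Indep [8,8,4,3,3,3,3,3,3])) (Split 1 7 (Split 0 8 (Split 2 5 (Indep [7,6,4,4,4,4,4,4,4])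
    (Indep [7,6,5,3,3,3,3,3,3])) (Indep [8,8,4,3,3,3,3,3,3])) (Indep [7,7,3,3,3,3,3,3,3]))) Void))
    (Split 6 5 (Indep [5,5,5,5,5,5,4,4,4]) (Split 8 4 (Split 7 5 (Indep [5,5,5,5,5,5,5,4,3]) (Split
    8 1 (Indep [5,5,5,5,5,5,5,5,1]) (Empty [5,5,5,5,5,5,5,5,1]))) (Empty [5,5,5,5,5,5,5,4,3]))))"
  show "cover_check 10 [1, 1, 1, 1, 0, 0, 0, 0, 0] (replicate 9 (min 8 10)) ?t" by code_simp
  show "\<forall>M\<in>cover_indep ?t. \<exists>d' C. d' \<le> 10 \<and> indep_cert d' M C"
    unfolding cover_indep.simps ball_Un ball_simps
    by ((intro conjI TrueI)?; (rule indep_leaf, rule indep_certs, simp))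
  show "\<forall>M\<in>cover_empty ?t. \<exists>d' C. 10 \<le> d' \<and> empty_cert d' M C"
    unfolding cover_empty.simps ball_Un ball_simps
    by ((intro conjI TrueI)?; (rule empty_leaf, rule empty_certs, simp))
qed

lemma planar_nonspecial_11:
  assumes "\<forall>i\<in>{1..8}. m i \<ge> m (i + 1)" "m 1 \<le> 8" "m 1 \<le> 11" "m 4 \<ge> 1" "m 1 + m 2 + m 3 + m 4 \<le> 2 * 11"
  shows "planar_nonspecial 11 m"
proof (rule cover_nonspecial[OF _ _ _ assms])
  let ?t = "(Split 8 5 (Split 2 6 (Split 0 7 (Indep [6,6,5,5,5,5,5,5,4]) (Split 4 5 (Split 1 8 (Indep
    [8,7,5,5,4,4,4,4,4]) (Split 3 5 (Split 8 4 (Indep [8,8,5,4,4,4,4,4,3]) Void) Void)) (Indep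
    [7,5,5,5,5,5,5,5,4]))) (Split 0 8 (Indep [7,7,7,4,4,4,4,4,4]) (Split 2 7 (Indep
    [8,7,6,5,5,4,4,3,2]) Void))) (Split 0 6 (Indep [6,5,5,5,5,5,5,5,5]) (Split 0 7 (Split 1 6
    (Indep [6,5,5,5,5,5,5,5,5]) (Empty [6,6,5,5,5,5,5,5,5])) (Empty [7,5,5,5,5,5,5,5,5]))))"
  show "cover_check 11 [1, 1, 1, 1, 0, 0, 0, 0, 0] (replicate 9 (min 8 11)) ?t" by code_simp
  show "\<forall>M\<in>cover_indep ?t. \<exists>d' C. d' \<le> 11 \<and> indep_cert d' M C"
    unfolding cover_indep.simps ball_Un ball_simps
    by ((intro conjI TrueI)?; (rule indep_leaf, rule indep_certs, simp))
  show "\<forall>M\<in>cover_empty ?t. \<exists>d' C. 11 \<le> d' \<and> empty_cert d' M C"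
    unfolding cover_empty.simps ball_Un ball_simps
    by ((intro conjI TrueI)?; (rule empty_leaf, rule empty_certs, simp))
qed

lemma planar_nonspecial_12:
  assumes "\<forall>i\<in>{1..8}. m i \<ge> m (i + 1)" "m 1 \<le> 8" "m 1 \<le> 12" "m 4 \<ge> 1" "m 1 + m 2 + m 3 + m 4 \<le> 2 * 12"
  shows "planar_nonspecial 12 m"
proof (rule cover_nonspecial[OF _ _ _ assms])
  let ?t = "(Split 4 6 (Split 1 7 (Split 0 8 (Indep [7,6,6,6,5,5,5,5,5]) (Split 2 6 (Indep
    [8,7,5,5,5,5,5,5,5]) (Indep [8,8,8,4,4,4,4,4,4]))) (Split 3 5 (Indep [8,8,8,4,4,4,4,4,4])
    (Indep [8,7,5,5,5,5,5,5,5]))) (Split 5 6 (Indep [6,6,6,6,6,5,5,5,5]) (Split 8 5 (Split 6 6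
    (Indep [6,6,6,6,6,6,5,5,4]) (Split 7 5 (Indep [6,6,6,6,6,6,6,4,4]) (Split 8 2 (Indep
    [6,6,6,6,6,6,6,6,1]) (Split 7 6 (Split 8 4 (Indep [6,6,6,6,6,6,6,5,3]) (Empty
    [6,6,6,6,6,6,6,5,4])) (Empty [6,6,6,6,6,6,6,6,1]))))) (Empty [6,6,6,6,6,6,5,5,5]))))"
  show "cover_check 12 [1, 1, 1, 1, 0, 0, 0, 0, 0] (replicate 9 (min 8 12)) ?t" by code_simp
  show "\<forall>M\<in>cover_indep ?t. \<exists>d' C. d' \<le> 12 \<and> indep_cert d' M C"
    unfolding cover_indep.simps ball_Un ball_simps
    by ((intro conjI TrueI)?; (rule indep_leaf, rule indep_certs, simp))
  show "\<forall>M\<in>cover_empty ?t. \<exists>d' C. 12 \<le> d' \<and> empty_cert d' M C"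
    unfolding cover_empty.simps ball_Un ball_simps
    by ((intro conjI TrueI)?; (rule empty_leaf, rule empty_certs, simp))
qed

lemma planar_nonspecial_13:
  assumes "\<forall>i\<in>{1..8}. m i \<ge> m (i + 1)" "m 1 \<le> 8" "m 1 \<le> 13" "m 4 \<ge> 1" "m 1 + m 2 + m 3 + m 4 \<le> 2 * 13"
  shows "planar_nonspecial 13 m"
proof (rule cover_nonspecial[OF _ _ _ assms])
  let ?t = "(Split 1 7 (Split 0 8 (Indep [7,6,6,6,6,6,6,6,6]) (Split 7 6 (Indep [8,6,6,6,6,6,6,5,5]) (Split
    8 5 (Indep [8,6,6,6,6,6,6,6,4]) (Empty [8,6,6,6,6,6,6,6,5])))) (Split 4 6 (Split 3 7 (Split 2 8
    (Indep [8,8,7,6,5,5,5,5,5]) (Indep [8,8,8,4,4,4,4,4,4])) Void) (Split 7 6 (Indep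
    [7,7,6,6,6,6,6,5,5]) (Split 8 5 (Indep [7,7,6,6,6,6,6,6,4]) (Empty [7,7,6,6,6,6,6,6,5])))))"
  show "cover_check 13 [1, 1, 1, 1, 0, 0, 0, 0, 0] (replicate 9 (min 8 13)) ?t" by code_simp
  show "\<forall>M\<in>cover_indep ?t. \<exists>d' C. d' \<le> 13 \<and> indep_cert d' M C"
    unfolding cover_indep.simps ball_Un ball_simps
    by ((intro conjI TrueI)?; (rule indep_leaf, rule indep_certs, simp))
  show "\<forall>M\<in>cover_empty ?t. \<exists>d' C. 13 \<le> d' \<and> empty_cert d' M C"
    unfolding cover_empty.simps ball_Un ball_simps
    by ((intro conjI TrueI)?; (rule empty_leaf, rule empty_certs, simp))
qed

lemma planar_nonspecial_14:
  assumes "\<forall>i\<in>{1..8}. m i \<ge> m (i + 1)" "m 1 \<le> 8" "m 1 \<le> 14" "m 4 \<ge> 1" "m 1 + m 2 + m 3 + m 4 \<le> 2 * 14"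
  shows "planar_nonspecial 14 m"
proof (rule cover_nonspecial[OF _ _ _ assms])
  let ?t = "(Split 4 7 (Split 1 8 (Indep [8,7,7,7,6,6,6,6,6]) (Split 2 7 (Indep [8,8,6,6,6,6,6,6,6]) (Split
    2 8 (Indep [8,8,7,6,5,5,5,5,5]) (Indep [8,8,8,4,4,4,4,4,4])))) (Split 5 7 (Indep
    [7,7,7,7,7,6,6,6,6]) (Split 8 6 (Split 6 7 (Indep [7,7,7,7,7,7,6,6,5]) (Split 7 6 (Split 8 5
    (Indep [7,7,7,7,7,7,7,5,4]) (Empty [7,7,7,7,7,7,7,5,5])) (Split 7 7 (Split 8 4 (Indep
    [7,7,7,7,7,7,7,6,3]) (Empty [7,7,7,7,7,7,7,6,4])) (Split 8 1 (Indep [7,7,7,7,7,7,7,7,1]) (Empty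
    [7,7,7,7,7,7,7,7,1]))))) (Empty [7,7,7,7,7,7,6,6,5]))))"
  show "cover_check 14 [1, 1, 1, 1, 0, 0, 0, 0, 0] (replicate 9 (min 8 14)) ?t" by code_simp
  show "\<forall>M\<in>cover_indep ?t. \<exists>d' C. d' \<le> 14 \<and> indep_cert d' M C"
    unfolding cover_indep.simps ball_Un ball_simps
    by ((intro conjI TrueI)?; (rule indep_leaf, rule indep_certs, simp))
  show "\<forall>M\<in>cover_empty ?t. \<exists>d' C. 14 \<le> d' \<and> empty_cert d' M C"
    unfolding cover_empty.simps ball_Un ball_simps
    by ((intro conjI TrueI)?; (rule empty_leaf, rule empty_certs, simp))
qed

lemma planar_nonspecial_15:
  assumes "\<forall>i\<in>{1..8}. m i \<ge> m (i + 1)" "m 1 \<le> 8" "m 1 \<le> 15" "m 4 \<ge> 1" "m 1 + m 2 + m 3 + m 4 \<le> 2 * 15"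
  shows "planar_nonspecial 15 m"
proof (rule cover_nonspecial[OF _ _ _ assms])
  let ?t = "(Split 5 7 (Split 4 8 (Indep [8,8,8,8,7,6,6,6,6]) Void) (Split 2 8 (Split 7 7 (Indep
    [8,8,7,7,7,7,7,6,6]) (Split 8 6 (Indep [8,8,7,7,7,7,7,7,5]) (Split 1 8 (Split 8 7 (Indep
    [8,7,7,7,7,7,7,7,6]) (Split 0 8 (Indep [7,7,7,7,7,7,7,7,7]) (Empty [8,7,7,7,7,7,7,7,7])))
    (Empty [8,8,7,7,7,7,7,7,6])))) Void))"
  show "cover_check 15 [1, 1, 1, 1, 0, 0, 0, 0, 0] (replicate 9 (min 8 15)) ?t" by code_simp
  show "\<forall>M\<in>cover_indep ?t. \<exists>d' C. d' \<le> 15 \<and> indep_cert d' M C"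
    unfolding cover_indep.simps ball_Un ball_simps
    by ((intro conjI TrueI)?; (rule indep_leaf, rule indep_certs, simp))
  show "\<forall>M\<in>cover_empty ?t. \<exists>d' C. 15 \<le> d' \<and> empty_cert d' M C"
    unfolding cover_empty.simps ball_Un ball_simps
    by ((intro conjI TrueI)?; (rule empty_leaf, rule empty_certs, simp))
qed

lemma planar_nonspecial_16:
  assumes "\<forall>i\<in>{1..8}. m i \<ge> m (i + 1)" "m 1 \<le> 8" "m 1 \<le> 16" "m 4 \<ge> 1" "m 1 + m 2 + m 3 + m 4 \<le> 2 * 16"
  shows "planar_nonspecial 16 m"
proof (rule cover_nonspecial[OF _ _ _ assms])
  \<comment> \<open>As in every degree, an \<open>Indep\<close> leaf holds vectors with at most as
    many conditions as monomials, here 17 * 17 = 289, and an \<open>Empty\<close> leaf vectors with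
    at least as many.\<close>
  let ?t = "(Split 4 8 (Indep [8,8,8,8,7,7,7,7,7]) (Split 8 7 (Split 5 8 (Indep [8,8,8,8,8,7,7,7,6]) (Split
    7 7 (Split 6 8 (Indep [8,8,8,8,8,8,7,6,6]) (Split 8 6 (Indep [8,8,8,8,8,8,8,6,5]) (Empty
    [8,8,8,8,8,8,8,6,6]))) (Split 8 2 (Indep [8,8,8,8,8,8,8,8,1]) (Split 6 8 (Split 8 6 (Indep
    [8,8,8,8,8,8,7,7,5]) (Empty [8,8,8,8,8,8,7,7,6])) (Split 8 4 (Split 7 8 (Indep
    [8,8,8,8,8,8,8,7,3]) (Empty [8,8,8,8,8,8,8,8,1])) (Empty [8,8,8,8,8,8,8,7,4])))))) (Empty
    [8,8,8,8,8,7,7,7,7])))"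
  show "cover_check 16 [1, 1, 1, 1, 0, 0, 0, 0, 0] (replicate 9 (min 8 16)) ?t" by code_simp
  show "\<forall>M\<in>cover_indep ?t. \<exists>d' C. d' \<le> 16 \<and> indep_cert d' M C"
    unfolding cover_indep.simps ball_Un ball_simps
    by ((intro conjI TrueI)?; (rule indep_leaf, rule indep_certs, simp))
  show "\<forall>M\<in>cover_empty ?t. \<exists>d' C. 16 \<le> d' \<and> empty_cert d' M C"
    unfolding cover_empty.simps ball_Un ball_simps
    by ((intro conjI TrueI)?; (rule empty_leaf, rule empty_certs, simp))
qed

section \<open>Evaluation and substitution\<close>

abbreviation "lookup \<equiv> Poly_Mapping.lookup"
abbreviation "keys \<equiv> Poly_Mapping.keys"
abbreviation "single \<equiv> Poly_Mapping.single"

lemma cpoly_sum_single: "F = (\<Sum>\<alpha>\<in>keys F. single \<alpha> (lookup F \<alpha>))"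
  by (rule poly_mapping_eqI) (auto simp: lookup_sum lookup_single when_def in_keys_iff)

lemma cpoly_induct [case_names zero add single]:
  fixes F :: "'k \<Rightarrow>\<^sub>0 'a::comm_monoid_add"
  assumes "P 0" "\<And>F G. P F \<Longrightarrow> P G \<Longrightarrow> P (F + G)" "\<And>\<alpha> c. P (single \<alpha> c)"
  shows "P F"
proof -
  have "P (\<Sum>\<alpha>\<in>A. single \<alpha> (lookup F \<alpha>))" for A
    using assms by (induction A rule: infinite_finite_induct) auto
  then show ?thesis using cpoly_sum_single[of F] by metis
qed

definition monom_eval :: "('v \<Rightarrow> 'a::comm_ring_1) \<Rightarrow> ('v \<Rightarrow>\<^sub>0 nat) \<Rightarrow> 'a" where
  "monom_eval h \<alpha> = (\<Prod>v\<in>keys \<alpha>. h v ^ lookup \<alpha> v)"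

lemma monom_eval_superset: "finite S \<Longrightarrow> keys \<alpha> \<subseteq> S \<Longrightarrow> monom_eval h \<alpha> = (\<Prod>v\<in>S. h v ^ lookup \<alpha> v)"
  unfolding monom_eval_def by (intro prod.mono_neutral_left) (auto simp: in_keys_iff)

lemma monom_eval_UNIV: "monom_eval h (\<alpha> :: 'v::finite \<Rightarrow>\<^sub>0 nat) = (\<Prod>v\<in>UNIV. h v ^ lookup \<alpha> v)"
  by (rule monom_eval_superset) auto

lemma monom_eval_0 [simp]: "monom_eval h 0 = 1"
  by (simp add: monom_eval_def)

lemma monom_eval_add: "monom_eval h (\<alpha> + \<beta>) = monom_eval h \<alpha> * monom_eval h \<beta>"
proof -
  let ?S = "keys \<alpha> \<union> keys \<beta>"
  have "monom_eval h (\<alpha> + \<beta>) = (\<Prod>v\<in>?S. h v ^ lookup (\<alpha> + \<beta>) v)"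
    by (rule monom_eval_superset) (use keys_add[of \<alpha> \<beta>] in auto)
  also have "\<dots> = (\<Prod>v\<in>?S. h v ^ lookup \<alpha> v) * (\<Prod>v\<in>?S. h v ^ lookup \<beta> v)"
    by (simp add: lookup_add power_add prod.distrib)
  also have "\<dots> = monom_eval h \<alpha> * monom_eval h \<beta>"
    using monom_eval_superset[of ?S \<alpha> h] monom_eval_superset[of ?S \<beta> h] by simp
  finally show ?thesis .
qed

lemma monom_eval_single [simp]: "monom_eval h (single v n) = h v ^ n"
  by (simp add: monom_eval_def)

text \<open>With the identity for \<open>\<phi>\<close>, \<open>ev\<close> is numerical evaluation;
  with the embedding of constants it is substitution of polynomials. Both are treated at
  once.\<close>

locale ring_hom_map =
  fixes \<phi> :: "'a::comm_ring_1 \<Rightarrow> 'b::comm_ring_1"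
  assumes map_add: "\<phi> (a + b) = \<phi> a + \<phi> b" and map_mult: "\<phi> (a * b) = \<phi> a * \<phi> b" and map_1: "\<phi> 1 = 1"
begin

lemma map_0: "\<phi> 0 = 0"
  using map_add[of 0 0] by simp

lemma map_sum: "\<phi> (sum f A) = (\<Sum>x\<in>A. \<phi> (f x))"
  by (induction A rule: infinite_finite_induct) (auto simp: map_0 map_add)

lemma map_power: "\<phi> (a ^ n) = \<phi> a ^ n"
  by (induction n) (auto simp: map_1 map_mult)

lemma map_prod: "\<phi> (prod f A) = (\<Prod>x\<in>A. \<phi> (f x))"
  by (induction A rule: infinite_finite_induct) (auto simp: map_1 map_mult)

lemma map_monom_eval: "\<phi> (monom_eval h \<alpha>) = monom_eval (\<lambda>v. \<phi> (h v)) \<alpha>"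
  by (simp add: monom_eval_def map_prod map_power)

definition ev :: "('v \<Rightarrow> 'b) \<Rightarrow> (('v \<Rightarrow>\<^sub>0 nat) \<Rightarrow>\<^sub>0 'a) \<Rightarrow> 'b" where
  "ev h F = (\<Sum>\<alpha>\<in>keys F. \<phi> (lookup F \<alpha>) * monom_eval h \<alpha>)"

lemma ev_superset: "finite S \<Longrightarrow> keys F \<subseteq> S \<Longrightarrow> ev h F = (\<Sum>\<alpha>\<in>S. \<phi> (lookup F \<alpha>) * monom_eval h \<alpha>)"
  unfolding ev_def by (intro sum.mono_neutral_left) (auto simp: in_keys_iff map_0)

lemma ev_single: "ev h (single \<alpha> c) = \<phi> c * monom_eval h \<alpha>"
  by (cases "c = 0") (auto simp: ev_def map_0)

lemma ev_0: "ev h 0 = 0"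
  by (simp add: ev_def)

lemma ev_add: "ev h (F + G) = ev h F + ev h G"
proof -
  let ?S = "keys F \<union> keys G"
  have "ev h (F + G) = (\<Sum>\<alpha>\<in>?S. \<phi> (lookup (F + G) \<alpha>) * monom_eval h \<alpha>)"
    by (rule ev_superset) (use keys_add[of F G] in auto)
  also have "\<dots> = ev h F + ev h G"
    using ev_superset[of ?S F h] ev_superset[of ?S G h]
    by (simp add: lookup_add map_add distrib_right sum.distrib)
  finally show ?thesis .
qed

lemma ev_mult: "ev h (F * G) = ev h F * ev h G"
proof (induction F rule: cpoly_induct)
  case (single \<alpha> c)
  show ?case
  proof (induction G rule: cpoly_induct)
    case (single \<beta> d)
    show ?case by (simp add: mult_single ev_single map_mult monom_eval_add mult_ac)
  qed (auto simp: ev_0 ev_add distrib_left)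
qed (auto simp: ev_0 ev_add distrib_right)

lemma ev_1: "ev h 1 = 1"
  using ev_single[of h 0 1] by (simp add: map_1)

lemma ring_hom_ev: "ring_hom_map (ev h)"
  by unfold_locales (auto simp: ev_add ev_mult ev_1)

end

definition var :: "'v \<Rightarrow> 'v cpoly" where
  "var v = single (single v 1) 1"

text \<open>Constants and variables generate the polynomial ring. All compatibilities between
  substitutions and evaluations are checked on these generators.\<close>

lemma ring_hom_eqI:
  fixes \<phi> \<psi> :: "(('v \<Rightarrow>\<^sub>0 nat) \<Rightarrow>\<^sub>0 complex) \<Rightarrow> 'b::comm_ring_1"
  assumes "ring_hom_map \<phi>" "ring_hom_map \<psi>"
    and c: "\<And>c. \<phi> (single 0 c) = \<psi> (single 0 c)" and v: "\<And>v. \<phi> (var v) = \<psi> (var v)"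
  shows "\<phi> F = \<psi> F"
proof -
  interpret f: ring_hom_map \<phi> by fact
  interpret g: ring_hom_map \<psi> by fact
  have m: "single \<alpha> (1::complex) = monom_eval var \<alpha>" for \<alpha> :: "'v \<Rightarrow>\<^sub>0 nat"
  proof (induction \<alpha> rule: cpoly_induct)
    case (add F G)
    have "single (F + G) (1::complex) = single F 1 * single G 1" by (simp add: mult_single)
    then show ?case using add by (simp add: monom_eval_add)
  next
    case (single v n)
    have "single (single v n) (1::complex) = var v ^ n"
    proof (induction n)
      case (Suc n)
      have "single (single v (Suc n)) (1::complex) = single (single v 1 + single v n) (1 * 1)"
        by (simp add: single_add[symmetric])
      also have "\<dots> = var v ^ Suc n" by (simp only: mult_single[symmetric] Suc power_Suc var_def)
      finally show ?case .
    qed auto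
    then show ?case by simp
  qed simp
  show ?thesis
  proof (induction F rule: cpoly_induct)
    case (single \<alpha> c)
    have "single \<alpha> c = single 0 c * single \<alpha> 1" by (simp add: mult_single)
    moreover have "\<phi> (monom_eval var \<alpha>) = \<psi> (monom_eval var \<alpha>)"
      unfolding f.map_monom_eval g.map_monom_eval v ..
    ultimately show ?case unfolding m[symmetric] by (simp add: f.map_mult g.map_mult c)
  qed (auto simp: f.map_0 g.map_0 f.map_add g.map_add)
qed

interpretation ev_id: ring_hom_map "\<lambda>c::complex. c"
  by unfold_locales auto

interpretation ev_C: ring_hom_map "single 0 :: complex \<Rightarrow> 'w cpoly"
  by unfold_locales (auto simp: single_add mult_single)

lemma poly_eval_ev: "poly_eval x F = ev_id.ev x F"
  by (simp add: poly_eval_def ev_id.ev_def monom_eval_def)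

lemma poly_eval_add: "poly_eval x (F + G) = poly_eval x F + poly_eval x G"
  and poly_eval_mult: "poly_eval x (F * G) = poly_eval x F * poly_eval x G"
  and poly_eval_single: "poly_eval x (single \<alpha> c) = c * monom_eval x \<alpha>"
  and poly_eval_0 [simp]: "poly_eval x 0 = 0"
  and poly_eval_1 [simp]: "poly_eval x 1 = 1"
  and poly_eval_const [simp]: "poly_eval x (single 0 c) = c"
  and poly_eval_var [simp]: "poly_eval x (var v) = x v"
  by (simp_all add: poly_eval_ev ev_id.ev_add ev_id.ev_mult ev_id.ev_single ev_id.ev_0 ev_id.ev_1 var_def)

lemma poly_eval_sum: "poly_eval x (sum f A) = (\<Sum>a\<in>A. poly_eval x (f a))"
  by (induction A rule: infinite_finite_induct) (auto simp: poly_eval_add)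

lemma poly_eval_diff: "poly_eval x (F - G) = poly_eval x F - poly_eval x G"
  using poly_eval_add[of x "F - G" G] by simp

definition psubst :: "('v \<Rightarrow> 'w cpoly) \<Rightarrow> 'v cpoly \<Rightarrow> 'w cpoly" where
  "psubst = ev_C.ev"

lemma psubst_add: "psubst h (F + G) = psubst h F + psubst h G"
  and psubst_mult: "psubst h (F * G) = psubst h F * psubst h G"
  and psubst_const [simp]: "psubst h (single 0 c) = single 0 c"
  and psubst_var [simp]: "psubst h (var v) = h v"
  and psubst_0 [simp]: "psubst h 0 = 0"
  by (simp_all add: psubst_def var_def ev_C.ev_add ev_C.ev_mult ev_C.ev_single ev_C.ev_0)

lemma ring_hom_psubst: "ring_hom_map (psubst h)"
  unfolding psubst_def by (rule ev_C.ring_hom_ev)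

lemma psubst_sum: "psubst h (sum f A) = (\<Sum>a\<in>A. psubst h (f a))"
  by (induction A rule: infinite_finite_induct) (auto simp: psubst_add)

lemma psubst_psubst: "psubst g (psubst h F) = psubst (\<lambda>v. psubst g (h v)) F"
proof -
  have 1: "ring_hom_map (\<lambda>F. psubst g (psubst h F))"
    using ring_hom_psubst[of g] ring_hom_psubst[of h] by (simp add: ring_hom_map_def)
  show ?thesis
    by (rule ring_hom_eqI[OF 1 ring_hom_psubst]) auto
qed

lemma psubst_var_id: "psubst var F = F"
proof -
  have "ring_hom_map (\<lambda>F :: 'a cpoly. F)" by unfold_locales auto
  from ring_hom_eqI[OF ring_hom_psubst this] show ?thesis by auto
qed

lemma poly_eval_psubst: "poly_eval x (psubst h F) = poly_eval (\<lambda>v. poly_eval x (h v)) F"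
proof -
  have "ring_hom_map (\<lambda>F. poly_eval x (psubst h F))"
    using ring_hom_psubst[of h] by (simp add: ring_hom_map_def poly_eval_add poly_eval_mult)
  moreover have "ring_hom_map (\<lambda>F. poly_eval (\<lambda>v. poly_eval x (h v)) F)"
    by unfold_locales (auto simp: poly_eval_add poly_eval_mult)
  ultimately show ?thesis
    by (rule ring_hom_eqI) auto
qed

section \<open>Partial derivatives and multiplicities\<close>

text \<open>Adding to the exponent on the right replaces the truncated subtraction in
  \<open>partial_deriv\<close>, so linearity becomes a coefficientwise triviality.\<close>

lemma lookup_partial_deriv: "lookup (partial_deriv v F) \<beta> = of_nat (lookup \<beta> v + 1) * lookup F (\<beta> + single v 1)"
proof -
  have iff: "\<alpha> - single v 1 = \<beta> \<longleftrightarrow> \<alpha> = \<beta> + single v 1" if "lookup \<alpha> v \<noteq> 0" for \<alpha> :: "'a \<Rightarrow>\<^sub>0 nat"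
  proof
    assume "\<alpha> - single v 1 = \<beta>"
    then show "\<alpha> = \<beta> + single v 1"
      using that by (intro poly_mapping_eqI) (auto simp: lookup_add lookup_minus lookup_single when_def)
  qed simp
  have "lookup (partial_deriv v F) \<beta> =
      (\<Sum>\<alpha>\<in>keys F. of_nat (lookup \<alpha> v) * lookup F \<alpha> when \<alpha> - single v 1 = \<beta>)"
    by (simp add: partial_deriv_def lookup_sum lookup_single)
  also have "\<dots> = (\<Sum>\<alpha>\<in>keys F. if \<alpha> = \<beta> + single v 1 then of_nat (lookup \<beta> v + 1) * lookup F (\<beta> + single v 1) else 0)"
  proof (intro sum.cong refl)
    fix \<alpha> assume "\<alpha> \<in> keys F"
    show "(of_nat (lookup \<alpha> v) * lookup F \<alpha> when \<alpha> - single v 1 = \<beta>) =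
      (if \<alpha> = \<beta> + single v 1 then of_nat (lookup \<beta> v + 1) * lookup F (\<beta> + single v 1) else 0)"
      using iff[of \<alpha>] by (cases "lookup \<alpha> v = 0") (auto simp: when_def lookup_add)
  qed
  also have "\<dots> = of_nat (lookup \<beta> v + 1) * lookup F (\<beta> + single v 1)"
    by (auto simp: in_keys_iff)
  finally show ?thesis .
qed

lemma partial_deriv_add: "partial_deriv v (F + G) = partial_deriv v F + partial_deriv v G"
  by (rule poly_mapping_eqI) (simp add: lookup_partial_deriv lookup_add distrib_left)

lemma partial_deriv_0 [simp]: "partial_deriv v 0 = 0"
  by (rule poly_mapping_eqI) (simp add: lookup_partial_deriv)

lemma partial_deriv_single: "partial_deriv v (single \<alpha> c) = single (\<alpha> - single v 1) (of_nat (lookup \<alpha> v) * c)"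
  by (cases "c = 0") (auto simp: partial_deriv_def)

lemma partial_deriv_mult: "partial_deriv v (F * G) = partial_deriv v F * G + F * partial_deriv v G"
proof (induction F rule: cpoly_induct)
  case (single \<alpha> c)
  show ?case
  proof (induction G rule: cpoly_induct)
    case (single \<beta> d)
    \<comment> \<open>If the variable does not occur, truncation may make the two exponents differ,
      but then the coefficient is 0.\<close>
    have 1: "single (\<alpha> - single v 1 + \<beta>) (of_nat (lookup \<alpha> v) * c * d) = single (\<alpha> + \<beta> - single v 1) (of_nat (lookup \<alpha> v) * c * d)"
    proof (cases "lookup \<alpha> v = 0")
      case False
      then have "\<alpha> - single v 1 + \<beta> = \<alpha> + \<beta> - single v 1"
        by (intro poly_mapping_eqI) (auto simp: lookup_add lookup_minus lookup_single when_def)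
      then show ?thesis by simp
    qed simp
    have 2: "single (\<alpha> + (\<beta> - single v 1)) (of_nat (lookup \<beta> v) * c * d) = single (\<alpha> + \<beta> - single v 1) (of_nat (lookup \<beta> v) * c * d)"
    proof (cases "lookup \<beta> v = 0")
      case False
      then have "\<alpha> + (\<beta> - single v 1) = \<alpha> + \<beta> - single v 1"
        by (intro poly_mapping_eqI) (auto simp: lookup_add lookup_minus lookup_single when_def)
      then show ?thesis by simp
    qed simp
    have "partial_deriv v (single \<alpha> c * single \<beta> d) =
        single (\<alpha> + \<beta> - single v 1) (of_nat (lookup \<alpha> v) * c * d) + single (\<alpha> + \<beta> - single v 1) (of_nat (lookup \<beta> v) * c * d)"
      by (simp add: mult_single partial_deriv_single lookup_add flip: single_add) (simp add: algebra_simps)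
    also have "\<dots> = partial_deriv v (single \<alpha> c) * single \<beta> d + single \<alpha> c * partial_deriv v (single \<beta> d)"
      unfolding 1[symmetric] 2[symmetric] by (simp add: mult_single partial_deriv_single mult_ac add_ac)
    finally show ?case .
  qed (auto simp: partial_deriv_add distrib_left)
qed (auto simp: partial_deriv_add distrib_right)

lemma cpoly_ring_induct [case_names const var add mult]:
  fixes F :: "'v cpoly"
  assumes c: "\<And>c. P (single 0 c)" and v: "\<And>v. P (var v)"
    and a: "\<And>F G. P F \<Longrightarrow> P G \<Longrightarrow> P (F + G)" and m: "\<And>F G. P F \<Longrightarrow> P G \<Longrightarrow> P (F * G)"
  shows "P F"
proof -
  have pow: "P (var v ^ n)" for v n
    using c[of 1] v m by (induction n) auto
  have mon: "P (single \<alpha> 1)" for \<alpha> :: "'v \<Rightarrow>\<^sub>0 nat"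
  proof (induction \<alpha> rule: cpoly_induct)
    case zero
    show ?case using c[of 1] by simp
  next
    case (add \<alpha> \<beta>)
    have "single (\<alpha> + \<beta>) (1::complex) = single \<alpha> 1 * single \<beta> 1" by (simp add: mult_single)
    then show ?case using add m by metis
  next
    case (single v n)
    have "single (single v n) (1::complex) = var v ^ n"
    proof (induction n)
      case (Suc n)
      have "single (single v (Suc n)) (1::complex) = single (single v 1 + single v n) (1 * 1)"
        by (simp add: single_add[symmetric])
      also have "\<dots> = var v ^ Suc n" by (simp only: mult_single[symmetric] Suc power_Suc var_def)
      finally show ?case .
    qed auto
    then show ?case using pow by metis
  qed
  show ?thesis
  proof (induction F rule: cpoly_induct)
    case zero
    show ?case using c[of 0] by simp
  next
    case (single \<alpha> c)
    have "single \<alpha> c = single 0 c * single \<alpha> 1" by (simp add: mult_single)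
    then show ?case using assms(1) mon m by metis
  qed (use a in auto)
qed

section \<open>Degrees of monomials and of polynomials\<close>

definition deg :: "('v::finite \<Rightarrow>\<^sub>0 nat) \<Rightarrow> nat" where
  "deg \<alpha> = (\<Sum>v\<in>UNIV. lookup \<alpha> v)"

lemma deg_0 [simp]: "deg 0 = 0" and deg_add: "deg (\<alpha> + \<beta>) = deg \<alpha> + deg \<beta>"
  by (simp_all add: deg_def lookup_add sum.distrib)

lemma deg_single [simp]: "deg (single v n) = n"
  by (simp add: deg_def lookup_single when_def)

text \<open>One predicate covers both uses of degrees: forms of degree \<open>d\<close> for
  \<open>S = {d}\<close>, and vanishing to order \<open>m\<close> at the origin for
  \<open>S = {m..}\<close>.\<close>

definition deg_in :: "int set \<Rightarrow> 'v::finite cpoly \<Rightarrow> bool" where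
  "deg_in S F \<longleftrightarrow> (\<forall>\<alpha>\<in>keys F. int (deg \<alpha>) \<in> S)"

lemma homogeneous_deg_in: "homogeneous d F \<longleftrightarrow> deg_in {d} F"
  by (simp add: homogeneous_def deg_in_def deg_def)

lemma deg_in_0 [simp]: "deg_in S 0"
  by (simp add: deg_in_def)

lemma deg_in_add: "deg_in S F \<Longrightarrow> deg_in S G \<Longrightarrow> deg_in S (F + G)"
  using keys_add[of F G] by (auto simp: deg_in_def)

lemma deg_in_uminus [simp]: "deg_in S (- F) \<longleftrightarrow> deg_in S F"
  by (simp add: deg_in_def in_keys_iff)

lemma deg_in_diff: "deg_in S F \<Longrightarrow> deg_in S G \<Longrightarrow> deg_in S (F - G)"
  using deg_in_add[of S F "- G"] by simp

lemma deg_in_sum: "(\<And>x. x \<in> A \<Longrightarrow> deg_in S (f x)) \<Longrightarrow> deg_in S (sum f A)"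
  by (induction A rule: infinite_finite_induct) (auto intro: deg_in_add)

lemma deg_in_single: "int (deg \<alpha>) \<in> S \<Longrightarrow> deg_in S (single \<alpha> c)"
  by (auto simp: deg_in_def)

lemma deg_in_const: "0 \<in> S \<Longrightarrow> deg_in S (single 0 c)"
  by (rule deg_in_single) simp

lemma deg_in_1: "0 \<in> S \<Longrightarrow> deg_in S 1"
  using deg_in_const[of S 1] by simp

lemma deg_in_mult:
  assumes "deg_in S F" "deg_in T G" "\<And>s t. s \<in> S \<Longrightarrow> t \<in> T \<Longrightarrow> s + t \<in> U"
  shows "deg_in U (F * G)"
  using keys_mult[of F G] assms by (force simp: deg_in_def deg_add)

lemma deg_in_mono: "deg_in S F \<Longrightarrow> S \<subseteq> T \<Longrightarrow> deg_in T F"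
  by (auto simp: deg_in_def)

lemma deg_in_power: "deg_in {k} F \<Longrightarrow> deg_in {int n * k} (F ^ n)" "deg_in {1..} F \<Longrightarrow> deg_in {int n..} (F ^ n)"
  by (induction n) (auto intro!: deg_in_1 simp: algebra_simps elim!: deg_in_mult)

lemma deg_in_monom_eval:
  assumes "\<And>v. deg_in {1..} (h v)"
  shows "deg_in {int (deg \<alpha>)..} (monom_eval h \<alpha>)"
proof -
  have "deg_in {int (\<Sum>v\<in>A. lookup \<alpha> v)..} (\<Prod>v\<in>A. h v ^ lookup \<alpha> v)" if "finite A" for A
    using that
  proof (induction A)
    case (insert v A)
    then show ?case using deg_in_power(2)[OF assms]
      by (auto intro!: deg_in_mult[of "{int (lookup \<alpha> v)..}" _ "{int (\<Sum>v\<in>A. lookup \<alpha> v)..}"])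
  qed (simp add: deg_in_1)
  from this[of UNIV] show ?thesis by (simp add: monom_eval_UNIV deg_def)
qed

lemma deg_in_monom_eval_homog:
  assumes "\<And>v. deg_in {1} (h v)"
  shows "deg_in {int (deg \<alpha>)} (monom_eval h \<alpha>)"
proof -
  have "deg_in {int (\<Sum>v\<in>A. lookup \<alpha> v)} (\<Prod>v\<in>A. h v ^ lookup \<alpha> v)" if "finite A" for A
    using that
  proof (induction A)
    case (insert v A)
    then show ?case using deg_in_power(1)[OF assms, of "lookup \<alpha> v"]
      by (auto intro!: deg_in_mult[of "{int (lookup \<alpha> v)}" _ "{int (\<Sum>v\<in>A. lookup \<alpha> v)}"])
  qed (simp add: deg_in_1)
  from this[of UNIV] show ?thesis by (simp add: monom_eval_UNIV deg_def)
qed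

lemma psubst_eq: "psubst h F = (\<Sum>\<alpha>\<in>keys F. single 0 (lookup F \<alpha>) * monom_eval h \<alpha>)"
  by (simp add: psubst_def ev_C.ev_def)

lemma deg_in_psubst:
  assumes "\<And>v. deg_in {1..} (h v)" "deg_in {m..} F"
  shows "deg_in {m..} (psubst h F)"
  unfolding psubst_eq
proof (rule deg_in_sum)
  fix \<alpha> assume "\<alpha> \<in> keys F"
  then have "m \<le> int (deg \<alpha>)" using assms(2) by (auto simp: deg_in_def)
  then show "deg_in {m..} (single 0 (lookup F \<alpha>) * monom_eval h \<alpha>)"
    by (intro deg_in_mult[OF deg_in_single[of 0 "{0}"] deg_in_monom_eval[OF assms(1)]]) auto
qed

lemma homogeneous_psubst:
  assumes "\<And>v. deg_in {1} (h v)" "homogeneous d F"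
  shows "homogeneous d (psubst h F)"
  unfolding psubst_eq homogeneous_deg_in
proof (rule deg_in_sum)
  fix \<alpha> assume "\<alpha> \<in> keys F"
  then have "d = int (deg \<alpha>)" using assms(2) by (auto simp: deg_in_def homogeneous_deg_in)
  then show "deg_in {d} (single 0 (lookup F \<alpha>) * monom_eval h \<alpha>)"
    by (intro deg_in_mult[OF deg_in_single[of 0 "{0}"] deg_in_monom_eval_homog[OF assms(1)]]) auto
qed

lemma partial_deriv_const [simp]: "partial_deriv v (single 0 c) = 0"
  by (simp add: partial_deriv_single)

lemma partial_deriv_var: "partial_deriv v (var w) = (if v = w then 1 else 0)"
  by (auto simp: partial_deriv_single var_def lookup_single when_def)

text \<open>The coefficients of \<open>shift p F\<close> are the Taylor coefficients of
  \<open>F\<close> at \<open>p\<close>.\<close>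

definition shift :: "complex ^ 'n \<Rightarrow> 'n::finite cpoly \<Rightarrow> 'n cpoly" where
  "shift p = psubst (\<lambda>v. single 0 (p $ v) + var v)"

lemma shift_add: "shift p (F + G) = shift p F + shift p G"
  and shift_mult: "shift p (F * G) = shift p F * shift p G"
  and shift_0 [simp]: "shift p 0 = 0"
  and shift_const [simp]: "shift p (single 0 c) = single 0 c"
  and shift_var [simp]: "shift p (var v) = single 0 (p $ v) + var v"
  by (simp_all add: shift_def psubst_add psubst_mult)

lemma partial_deriv_shift: "partial_deriv v (shift p F) = shift p (partial_deriv v F)"
proof (induction F rule: cpoly_ring_induct)
  case (var w)
  have "shift p 1 = 1" using shift_const[of p 1] by simp
  then show ?case by (auto simp: partial_deriv_add partial_deriv_var)
qed (auto simp: shift_add shift_mult partial_deriv_add partial_deriv_mult)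

lemma poly_eval_at_0: "poly_eval (\<lambda>_. 0) F = lookup F 0"
proof (induction F rule: cpoly_induct)
  case (single \<alpha> c)
  show ?case
  proof (cases "\<alpha> = 0")
    case False
    then obtain v where "v \<in> keys \<alpha>" using keys_eq_empty[of \<alpha>] by (metis ex_in_conv)
    then have "monom_eval (\<lambda>_. 0::complex) \<alpha> = 0" by (auto simp: monom_eval_def in_keys_iff)
    then show ?thesis using False by (simp add: poly_eval_single lookup_single)
  qed simp
qed (auto simp: poly_eval_add lookup_add)

lemma poly_eval_shift: "poly_eval (\<lambda>v. p $ v) F = lookup (shift p F) 0"
  unfolding poly_eval_at_0[symmetric] shift_def poly_eval_psubst by (simp add: poly_eval_add)

text \<open>Translates the lists of directions in \<open>vanishes_to_order\<close> into exponent
  vectors.\<close>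

definition exps :: "'v list \<Rightarrow> ('v \<Rightarrow>\<^sub>0 nat)" where
  "exps vs = (\<Sum>v\<leftarrow>vs. single v 1)"

lemma exps_Cons: "exps (v # vs) = single v 1 + exps vs"
  by (simp add: exps_def)

lemma deg_exps [simp]: "deg (exps vs) = length vs"
  by (induction vs) (auto simp: exps_def deg_add)

lemma ex_exps: "\<exists>vs. exps vs = \<beta>"
proof (induction \<beta> rule: cpoly_induct)
  case zero
  show ?case by (intro exI[of _ "[]"]) (simp add: exps_def)
next
  case (add F G)
  then obtain vs ws where "exps vs = F" "exps ws = G" by blast
  then have "exps (vs @ ws) = F + G" by (simp add: exps_def)
  then show ?case by blast
next
  case (single v n)
  have "exps (replicate n v) = single v n"
    by (induction n) (auto simp: exps_def single_add[symmetric])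
  then show ?case by blast
qed

text \<open>\<open>N\<close> is a product of positive integers, one for each derivation. In
  characteristic 0 it is invertible, and its value never matters.\<close>

lemma lookup_fold_partial_deriv:
  "\<exists>N>0. lookup (fold partial_deriv vs F) \<beta> = of_nat N * lookup F (\<beta> + exps vs)"
proof (induction vs arbitrary: F)
  case Nil
  show ?case by (intro exI[of _ 1]) (simp add: exps_def)
next
  case (Cons v vs)
  obtain N where "N > 0" "lookup (fold partial_deriv vs (partial_deriv v F)) \<beta> = of_nat N * lookup (partial_deriv v F) (\<beta> + exps vs)"
    using Cons by blast
  then show ?case
    by (intro exI[of _ "N * (lookup (\<beta> + exps vs) v + 1)"] conjI)
      (simp_all only: lookup_partial_deriv exps_Cons fold_simps of_nat_mult mult.assoc add.assoc
        zero_less_mult_iff add.commute[of "exps vs"], simp)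
qed

lemma fold_partial_deriv_shift: "fold partial_deriv vs (shift p F) = shift p (fold partial_deriv vs F)"
  by (induction vs arbitrary: F) (auto simp: partial_deriv_shift)

text \<open>Up to nonzero factors, the derivatives of order \<open>k\<close> at \<open>p\<close> are
  the coefficients of degree \<open>k\<close> of the Taylor expansion. In this form multiplicities
  visibly add up in products.\<close>

lemma vanishes_iff: "vanishes_to_order m F p \<longleftrightarrow> deg_in {m..} (shift p F)"
proof
  assume v: "vanishes_to_order m F p"
  show "deg_in {m..} (shift p F)" unfolding deg_in_def
  proof (intro ballI, rule ccontr)
    fix \<beta> assume \<beta>: "\<beta> \<in> keys (shift p F)" "int (deg \<beta>) \<notin> {m..}"
    obtain vs where vs: "exps vs = \<beta>" using ex_exps by blast
    then have "int (length vs) < m" using \<beta>(2) deg_exps[of vs] by simp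
    then have "lookup (fold partial_deriv vs (shift p F)) 0 = 0"
      using v by (simp add: vanishes_to_order_def poly_eval_shift fold_partial_deriv_shift)
    then show False using lookup_fold_partial_deriv[of vs "shift p F" 0] vs \<beta>(1) by (auto simp: in_keys_iff)
  qed
next
  assume d: "deg_in {m..} (shift p F)"
  show "vanishes_to_order m F p" unfolding vanishes_to_order_def
  proof (intro allI impI)
    fix vs :: "4 list" assume "int (length vs) < m"
    then have "exps vs \<notin> keys (shift p F)" using d deg_exps[of vs] unfolding deg_in_def by force
    then show "poly_eval (\<lambda>v. p $ v) (fold partial_deriv vs F) = 0"
      using lookup_fold_partial_deriv[of vs "shift p F" 0]
      by (auto simp: poly_eval_shift fold_partial_deriv_shift[symmetric] in_keys_iff)
  qed
qed

lemma vanishes_partial_deriv: "vanishes_to_order m F p \<Longrightarrow> vanishes_to_order (m - 1) (partial_deriv v F) p"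
  unfolding vanishes_to_order_def
proof (intro allI impI)
  fix vs :: "4 list" assume "\<forall>vs. int (length vs) < m \<longrightarrow> poly_eval (\<lambda>v. p $ v) (fold partial_deriv vs F) = 0"
    "int (length vs) < m - 1"
  then show "poly_eval (\<lambda>v. p $ v) (fold partial_deriv vs (partial_deriv v F)) = 0"
    by (metis fold_simps(2) length_Cons less_diff_eq of_nat_Suc add.commute)
qed

lemma vanishes_mult:
  "vanishes_to_order m F p \<Longrightarrow> vanishes_to_order n G p \<Longrightarrow> vanishes_to_order (m + n) (F * G) p"
  unfolding vanishes_iff shift_mult by (erule deg_in_mult) auto

lemma vanishes_nonpos: "m \<le> 0 \<Longrightarrow> vanishes_to_order m F p"
  by (simp add: vanishes_to_order_def)

lemma vanishes_times: "vanishes_to_order m F p \<Longrightarrow> vanishes_to_order m (G * F) p"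
  using vanishes_mult[of 0 G p m F] by (simp add: vanishes_nonpos)

lemma vanishes_add: "vanishes_to_order m F p \<Longrightarrow> vanishes_to_order m G p \<Longrightarrow> vanishes_to_order m (F + G) p"
  by (simp add: vanishes_iff shift_add deg_in_add)

lemma vanishes_0 [simp]: "vanishes_to_order m 0 p"
  by (simp add: vanishes_iff)

lemma vanishes_poly_eval: "vanishes_to_order m F p \<Longrightarrow> m \<ge> 1 \<Longrightarrow> poly_eval (\<lambda>v. p $ v) F = 0"
  unfolding vanishes_to_order_def by (drule spec[of _ "[]"]) simp

section \<open>Linear changes of coordinates\<close>

text \<open>The pullback of forms along \<open>A\<close>: the value at \<open>p\<close> is the value
  of \<open>F\<close> at \<open>A *v p\<close>.\<close>

definition lin_subst :: "complex ^ 'n ^ 'n \<Rightarrow> 'n::finite cpoly \<Rightarrow> 'n cpoly" where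
  "lin_subst A = psubst (\<lambda>v. \<Sum>w\<in>UNIV. single 0 (A $ v $ w) * var w)"

lemma deg_in_linear: "deg_in {1} (\<Sum>w\<in>UNIV. single 0 (A $ v $ w) * var w)"
  unfolding var_def by (intro deg_in_sum deg_in_mult[of "{0}" _ "{1}"] deg_in_single) auto

lemma homogeneous_lin_subst: "homogeneous d F \<Longrightarrow> homogeneous d (lin_subst A F)"
  unfolding lin_subst_def by (intro homogeneous_psubst deg_in_linear)

lemma psubst_shift_lin: "shift p (lin_subst A F) = lin_subst A (shift (A *v p) F)"
proof -
  have "shift p (\<Sum>w\<in>UNIV. single 0 (A $ v $ w) * var w) = single 0 ((A *v p) $ v) + (\<Sum>w\<in>UNIV. single 0 (A $ v $ w) * var w)" for v
  proof -
    have "shift p (\<Sum>w\<in>UNIV. single 0 (A $ v $ w) * var w) = (\<Sum>w\<in>UNIV. single 0 (A $ v $ w) * (single 0 (p $ w) + var w))"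
      unfolding shift_def psubst_sum by (simp add: psubst_mult)
    also have "\<dots> = single 0 (\<Sum>w\<in>UNIV. A $ v $ w * p $ w) + (\<Sum>w\<in>UNIV. single 0 (A $ v $ w) * var w)"
      by (simp add: distrib_left sum.distrib mult_single ev_C.map_sum)
    finally show ?thesis by (simp add: matrix_vector_mult_def)
  qed
  then show ?thesis unfolding lin_subst_def by (simp add: shift_def psubst_psubst psubst_add psubst_sum psubst_mult)
qed

lemma vanishes_lin_subst: "vanishes_to_order m F (A *v p) \<Longrightarrow> vanishes_to_order m (lin_subst A F) p"
  unfolding vanishes_iff psubst_shift_lin unfolding lin_subst_def
  by (rule deg_in_psubst) (auto intro: deg_in_mono[OF deg_in_linear])

lemma lin_subst_compose: "lin_subst B (lin_subst A F) = lin_subst (A ** B) F"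
proof -
  have "psubst (\<lambda>v. \<Sum>w\<in>UNIV. single 0 (B $ v $ w) * var w) (\<Sum>w\<in>UNIV. single 0 (A $ v $ w) * var w)
     = (\<Sum>w\<in>UNIV. single 0 ((A ** B) $ v $ w) * var w)" for v
  proof -
    have "psubst (\<lambda>v. \<Sum>w\<in>UNIV. single 0 (B $ v $ w) * var w) (\<Sum>w\<in>UNIV. single 0 (A $ v $ w) * var w)
      = (\<Sum>u\<in>UNIV. \<Sum>w\<in>UNIV. single 0 (A $ v $ u * B $ u $ w) * var w)"
      by (simp add: psubst_sum psubst_mult sum_distrib_left mult_single mult.assoc[symmetric])
    also have "\<dots> = (\<Sum>w\<in>UNIV. single 0 (\<Sum>u\<in>UNIV. A $ v $ u * B $ u $ w) * var w)"
      by (subst sum.swap) (simp add: ev_C.map_sum sum_distrib_right)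
    finally show ?thesis by (simp add: matrix_matrix_mult_def)
  qed
  then show ?thesis unfolding lin_subst_def psubst_psubst by simp
qed

lemma lin_subst_mat_1: "lin_subst (mat 1) F = F"
proof -
  have "(\<Sum>w\<in>UNIV. single 0 (mat 1 $ v $ w) * var w) = (var v :: 'a cpoly)" for v
  proof -
    have "(\<Sum>w\<in>UNIV. single 0 (mat 1 $ v $ w) * var w) = (\<Sum>w\<in>UNIV. if w = v then var v else (0 :: 'a cpoly))"
      by (intro sum.cong) (auto simp: mat_def)
    then show ?thesis by simp
  qed
  then show ?thesis unfolding lin_subst_def by (simp add: psubst_var_id)
qed

lemma homogeneous_partial_deriv: "homogeneous d F \<Longrightarrow> homogeneous (d - 1) (partial_deriv v F)"
  unfolding homogeneous_deg_in deg_in_def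
proof
  fix \<alpha> assume F: "\<forall>\<alpha>\<in>keys F. int (deg \<alpha>) \<in> {d}" and "\<alpha> \<in> keys (partial_deriv v F)"
  then have "\<alpha> + single v 1 \<in> keys F" by (auto simp: in_keys_iff lookup_partial_deriv)
  then show "int (deg \<alpha>) \<in> {d - 1}" using F by (force simp: deg_add)
qed

lemma poly_eval_axis:
  assumes "homogeneous d F" "d \<ge> 0"
  shows "poly_eval (\<lambda>v. axis k 1 $ v) F = lookup F (single k (nat d))"
proof -
  have "monom_eval (\<lambda>v. axis k 1 $ v :: complex) \<alpha> = (if \<alpha> = single k (nat d) then 1 else 0)" if "\<alpha> \<in> keys F" for \<alpha>
  proof (cases "\<exists>v\<in>keys \<alpha>. v \<noteq> k")
    case True
    then obtain v where v: "v \<in> keys \<alpha>" "v \<noteq> k" by blast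
    then have "monom_eval (\<lambda>v. axis k 1 $ v :: complex) \<alpha> = 0"
      unfolding monom_eval_def by (intro prod_zero) (auto simp: axis_def in_keys_iff)
    moreover have "\<alpha> \<noteq> single k (nat d)" using v by (auto simp: split: if_splits)
    ultimately show ?thesis by simp
  next
    case False
    then have a: "\<alpha> = single k (lookup \<alpha> k)"
      by (intro poly_mapping_eqI) (auto simp: lookup_single when_def in_keys_iff)
    have "int (deg \<alpha>) = d" using that assms(1) by (auto simp: homogeneous_deg_in deg_in_def)
    then have "lookup \<alpha> k = nat d" using a by (metis deg_single nat_int)
    then show ?thesis using a by (metis axis_nth monom_eval_single power_one)
  qed
  then have "poly_eval (\<lambda>v. axis k 1 $ v) F = (\<Sum>\<alpha>\<in>keys F. if \<alpha> = single k (nat d) then lookup F \<alpha> else 0)"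
    unfolding poly_eval_ev ev_id.ev_def by (intro sum.cong) auto
  then show ?thesis by (auto simp: in_keys_iff)
qed

text \<open>At the \<open>k\<close>-th coordinate point a monomial of degree \<open>d\<close>
  vanishes to order exactly \<open>d - lookup \<alpha> k\<close>, and the lowest terms of different
  monomials cannot cancel. Multiplicities at coordinate points thus become conditions on single
  monomials.\<close>

lemma vanishes_axis:
  assumes F: "homogeneous d F"
  shows "vanishes_to_order m F (axis k 1) \<longleftrightarrow> (\<forall>\<alpha>\<in>keys F. int (lookup \<alpha> k) \<le> d - m)"
proof -
  have hom: "homogeneous (d - int (length vs)) (fold partial_deriv vs F)" for vs
    using F
  proof (induction vs arbitrary: F d)
    case (Cons v vs)
    from Cons.IH[OF homogeneous_partial_deriv[OF Cons.prems]] show ?case by (simp add: algebra_simps)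
  qed simp
  show ?thesis
  proof
    assume v: "vanishes_to_order m F (axis k 1)"
    show "\<forall>\<alpha>\<in>keys F. int (lookup \<alpha> k) \<le> d - m"
    proof (intro ballI, rule ccontr)
      fix \<alpha> assume \<alpha>: "\<alpha> \<in> keys F" "\<not> int (lookup \<alpha> k) \<le> d - m"
      have d: "int (deg \<alpha>) = d" using F \<alpha> by (auto simp: homogeneous_deg_in deg_in_def)
      \<comment> \<open>Deriving by the part of \<open>\<alpha>\<close> away from \<open>k\<close>
        leaves a pure power of variable \<open>k\<close>, the only kind of monomial that is nonzero
        at the coordinate point.\<close>
      define \<beta> where "\<beta> = \<alpha> - single k (lookup \<alpha> k)"
      have ab: "\<alpha> = single k (lookup \<alpha> k) + \<beta>"
        by (intro poly_mapping_eqI) (auto simp: \<beta>_def lookup_add lookup_minus lookup_single when_def)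
      obtain vs where vs: "exps vs = \<beta>" using ex_exps by blast
      have len: "length vs + lookup \<alpha> k = deg \<alpha>"
        using vs deg_exps[of vs] ab by (metis add.commute deg_add deg_single)
      then have "int (length vs) < m" using \<alpha>(2) d by linarith
      then have "poly_eval (\<lambda>v. axis k 1 $ v) (fold partial_deriv vs F) = 0"
        using v unfolding vanishes_to_order_def by blast
      moreover have "nat (d - int (length vs)) = lookup \<alpha> k" using len d by simp
      ultimately have "lookup (fold partial_deriv vs F) (single k (lookup \<alpha> k)) = 0"
        using poly_eval_axis[OF hom, of vs k] len d by (metis diff_ge_0_iff_ge le_add1 of_nat_le_iff)
      moreover obtain N where "N > 0" "lookup (fold partial_deriv vs F) (single k (lookup \<alpha> k)) = of_nat N * lookup F \<alpha>"
        using lookup_fold_partial_deriv[of vs F "single k (lookup \<alpha> k)"] unfolding vs ab[symmetric] by blast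
      ultimately show False using \<alpha>(1) by (simp add: in_keys_iff)
    qed
  next
    assume a: "\<forall>\<alpha>\<in>keys F. int (lookup \<alpha> k) \<le> d - m"
    show "vanishes_to_order m F (axis k 1)" unfolding vanishes_to_order_def
    proof (intro allI impI)
      fix vs :: "4 list" assume len: "int (length vs) < m"
      show "poly_eval (\<lambda>v. axis k 1 $ v) (fold partial_deriv vs F) = 0"
      proof (cases "d - int (length vs) \<ge> 0")
        case True
        let ?\<alpha> = "single k (nat (d - int (length vs))) + exps vs"
        have "lookup ?\<alpha> k \<ge> nat (d - int (length vs))" by (simp add: lookup_add)
        then have "?\<alpha> \<notin> keys F" using a len by force
        then show ?thesis using poly_eval_axis[OF hom True, of k] lookup_fold_partial_deriv[of vs F "single k (nat (d - int (length vs)))"]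
          by (auto simp: in_keys_iff)
      next
        case False
        then have "fold partial_deriv vs F = 0" using hom[of vs]
          by (auto simp: homogeneous_deg_in deg_in_def intro!: keys_eq_empty[THEN iffD1])
        then show ?thesis by simp
      qed
    qed
  qed
qed

section \<open>Dimensions of spaces of polynomials\<close>

lemma lookup_cpoly_scale [simp]: "lookup (cpoly_scale c F) \<alpha> = c * lookup F \<alpha>"
  unfolding cpoly_scale_def mult_map_scale_conv_mult[symmetric] by (simp add: Poly_Mapping.map.rep_eq when_def)

lemma keys_cpoly_scale: "keys (cpoly_scale c F) \<subseteq> keys F"
  by (auto simp: in_keys_iff)

text \<open>The dimension is monotone only for finite dimensional spaces, and the space of all
  polynomials is not one of these; finiteness is therefore carried along.\<close>

definition fin_space :: "'v cpoly set \<Rightarrow> bool" where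
  "fin_space W \<longleftrightarrow> cpoly.subspace W \<and> (\<exists>B. finite B \<and> W \<subseteq> cpoly_span B)"

lemma fin_space_basis:
  assumes "fin_space W"
  obtains B where "finite B" "B \<subseteq> W" "\<not> cpoly.dependent B" "W \<subseteq> cpoly_span B" "card B = cpoly_dim W"
proof -
  obtain B where B: "B \<subseteq> W" "\<not> cpoly.dependent B" "W \<subseteq> cpoly_span B" "card B = cpoly_dim W"
    using cpoly.basis_exists[of W] by blast
  obtain C where C: "finite C" "W \<subseteq> cpoly_span C" using assms by (auto simp: fin_space_def)
  have "finite B" using cpoly.independent_span_bound[OF C(1) B(2)] B(1) C(2) by blast
  then show ?thesis using B that by blast
qed

lemma fin_space_subset: "fin_space W \<Longrightarrow> V \<subseteq> W \<Longrightarrow> cpoly.subspace V \<Longrightarrow> fin_space V"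
  unfolding fin_space_def by blast

lemma dim_subset_le:
  assumes "fin_space W" "V \<subseteq> W"
  shows "cpoly_dim V \<le> cpoly_dim W"
proof -
  obtain B where "finite B" "W \<subseteq> cpoly_span B" "card B = cpoly_dim W"
    by (rule fin_space_basis[OF assms(1)]) blast
  then show ?thesis using cpoly.dim_le_card[of V B] assms(2) by fastforce
qed

lemma dim_psubset_less:
  assumes W: "fin_space W" and V: "fin_space V" "V \<subseteq> W" "F \<in> W" "F \<notin> V"
  shows "cpoly_dim V < cpoly_dim W"
proof -
  obtain B where B: "finite B" "B \<subseteq> V" "\<not> cpoly.dependent B" "V \<subseteq> cpoly_span B" "card B = cpoly_dim V"
    by (rule fin_space_basis[OF V(1)]) blast
  have "cpoly_span B \<subseteq> V" using B(2) V(1) by (simp add: cpoly.span_minimal fin_space_def)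
  then have F: "F \<notin> cpoly_span B" using V(4) by blast
  then have ind: "\<not> cpoly.dependent (insert F B)" using B(3) cpoly.independent_insertI by blast
  have "F \<notin> B" using F cpoly.span_base by blast
  obtain C where C: "finite C" "W \<subseteq> cpoly_span C" "card C = cpoly_dim W"
    by (rule fin_space_basis[OF W]) blast
  have "card (insert F B) \<le> card C"
    using cpoly.independent_span_bound[OF C(1) ind] B(2) C(2) V(2,3) by blast
  then show ?thesis using B C \<open>F \<notin> B\<close> by simp
qed

definition functional :: "('v cpoly \<Rightarrow> complex) \<Rightarrow> bool" where
  "functional \<phi> \<longleftrightarrow> (\<forall>F G. \<phi> (F + G) = \<phi> F + \<phi> G) \<and> (\<forall>c F. \<phi> (cpoly_scale c F) = c * \<phi> F)"

lemma functional_add: "functional \<phi> \<Longrightarrow> \<phi> (F + G) = \<phi> F + \<phi> G"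
  and functional_scale: "functional \<phi> \<Longrightarrow> \<phi> (cpoly_scale c F) = c * \<phi> F"
  unfolding functional_def by blast+

lemma functional_0: "functional \<phi> \<Longrightarrow> \<phi> 0 = 0"
  using functional_scale[of \<phi> 0 0] by simp

lemma functional_lookup [simp]: "functional (\<lambda>F. lookup F \<alpha>)"
  by (simp add: functional_def lookup_add)

lemma subspace_kernel:
  assumes "cpoly.subspace W" "\<And>\<phi>. \<phi> \<in> \<Phi> \<Longrightarrow> functional \<phi>"
  shows "cpoly.subspace {F\<in>W. \<forall>\<phi>\<in>\<Phi>. \<phi> F = 0}"
  using assms(1) unfolding cpoly.subspace_def
  by (auto simp: functional_0 functional_add functional_scale assms(2))

lemma fin_space_kernel:
  assumes "fin_space W" "\<And>\<phi>. \<phi> \<in> \<Phi> \<Longrightarrow> functional \<phi>"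
  shows "fin_space {F\<in>W. \<forall>\<phi>\<in>\<Phi>. \<phi> F = 0}"
proof (rule fin_space_subset[OF assms(1)])
  have "cpoly.subspace W" using assms(1) by (simp add: fin_space_def)
  then show "cpoly.subspace {F\<in>W. \<forall>\<phi>\<in>\<Phi>. \<phi> F = 0}" using assms(2) by (rule subspace_kernel)
qed blast

lemma dim_kernel_functional:
  assumes W: "fin_space W" and \<phi>: "functional \<phi>"
  shows "cpoly_dim W \<le> cpoly_dim {F\<in>W. \<phi> F = 0} + 1"
proof (cases "\<forall>F\<in>W. \<phi> F = 0")
  case True
  then have "{F\<in>W. \<phi> F = 0} = W" by blast
  then show ?thesis by simp
next
  case False
  then obtain F0 where F0: "F0 \<in> W" "\<phi> F0 \<noteq> 0" by blast
  have "fin_space {F\<in>W. \<forall>\<psi>\<in>{\<phi>}. \<psi> F = 0}" by (rule fin_space_kernel[OF W]) (use \<phi> in blast)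
  then have fin: "fin_space {F\<in>W. \<phi> F = 0}" by simp
  obtain B where B: "finite B" "{F\<in>W. \<phi> F = 0} \<subseteq> cpoly_span B" "card B = cpoly_dim {F\<in>W. \<phi> F = 0}"
    by (rule fin_space_basis[OF fin]) blast
  have "W \<subseteq> cpoly_span (insert F0 B)"
  proof
    fix F assume F: "F \<in> W"
    \<comment> \<open>With this factor \<open>F\<close> is projected to the kernel along
      \<open>F0\<close>.\<close>
    let ?c = "\<phi> F / \<phi> F0"
    have sub: "cpoly.subspace W" using W by (simp add: fin_space_def)
    have "\<phi> (F + cpoly_scale (- ?c) F0) = \<phi> F + - ?c * \<phi> F0"
      by (simp only: functional_add[OF \<phi>] functional_scale[OF \<phi>])
    also have "\<dots> = 0" using F0 by simp
    finally have "\<phi> (F + cpoly_scale (- ?c) F0) = 0" .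
    moreover have "F + cpoly_scale (- ?c) F0 \<in> W"
      by (intro cpoly.subspace_add[OF sub] cpoly.subspace_scale[OF sub] F F0)
    ultimately have "F + cpoly_scale (- ?c) F0 \<in> cpoly_span B" using B(2) by blast
    then have 1: "F + cpoly_scale (- ?c) F0 \<in> cpoly_span (insert F0 B)"
      using cpoly.span_mono[of B "insert F0 B"] by blast
    have 2: "cpoly_scale ?c F0 \<in> cpoly_span (insert F0 B)"
      by (intro cpoly.span_scale cpoly.span_base) simp
    have "(F + cpoly_scale (- ?c) F0) + cpoly_scale ?c F0 = F"
      by (simp only: cpoly.scale_minus_left add.assoc left_minus add_0_right)
    then show "F \<in> cpoly_span (insert F0 B)" using cpoly.span_add[OF 1 2] by simp
  qed
  then have "cpoly_dim W \<le> card (insert F0 B)" using B(1) by (intro cpoly.dim_le_card) auto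
  also have "\<dots> \<le> card B + 1" by (simp add: B(1) card_insert_if)
  finally show ?thesis using B(3) by simp
qed

lemma dim_kernel:
  assumes "finite \<Phi>" "fin_space W" "\<And>\<phi>. \<phi> \<in> \<Phi> \<Longrightarrow> functional \<phi>"
  shows "cpoly_dim W \<le> cpoly_dim {F\<in>W. \<forall>\<phi>\<in>\<Phi>. \<phi> F = 0} + card \<Phi>"
  using assms
proof (induction \<Phi> rule: finite_induct)
  case (insert \<phi> \<Phi>)
  let ?V = "{F\<in>W. \<forall>\<phi>\<in>\<Phi>. \<phi> F = 0}"
  have "fin_space ?V" using insert.prems by (intro fin_space_kernel) auto
  from dim_kernel_functional[OF this, of \<phi>]
  have "cpoly_dim ?V \<le> cpoly_dim {F\<in>?V. \<phi> F = 0} + 1" using insert.prems by simp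
  moreover have "{F\<in>?V. \<phi> F = 0} = {F\<in>W. \<forall>\<phi>\<in>insert \<phi> \<Phi>. \<phi> F = 0}" by auto
  ultimately show ?case using insert by simp
qed simp

definition linear_map :: "('v cpoly \<Rightarrow> 'w cpoly) \<Rightarrow> bool" where
  "linear_map f \<longleftrightarrow> Vector_Spaces.linear cpoly_scale cpoly_scale f"

lemma linear_mapI:
  assumes "\<And>F G. f (F + G) = f F + f G" "\<And>c F. f (cpoly_scale c F) = cpoly_scale c (f F)"
  shows "linear_map f"
  unfolding linear_map_def Vector_Spaces.linear_iff
  by (intro conjI cpoly.vector_space_axioms allI assms)

lemma linear_map_module_hom: "linear_map f \<Longrightarrow> module_hom cpoly_scale cpoly_scale f"
  unfolding linear_map_def Vector_Spaces.linear_def by blast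

lemma linear_map_span: "linear_map f \<Longrightarrow> f ` cpoly_span B = cpoly_span (f ` B)"
  unfolding cpoly_span_def by (rule module_hom.span_image[OF linear_map_module_hom, symmetric])

lemma dim_image_le:
  assumes f: "linear_map f" and W: "fin_space W"
  shows "cpoly_dim (f ` W) \<le> cpoly_dim W"
proof -
  obtain B where B: "finite B" "W \<subseteq> cpoly_span B" "card B = cpoly_dim W"
    by (rule fin_space_basis[OF W]) blast
  have "f ` W \<subseteq> cpoly_span (f ` B)" using B(2) linear_map_span[OF f, of B] by blast
  then have "cpoly_dim (f ` W) \<le> card (f ` B)" using B(1) by (intro cpoly.dim_le_card) auto
  also have "\<dots> \<le> card B" using B(1) by (rule card_image_le)
  finally show ?thesis using B(3) by simp
qed

lemma fin_space_image:
  assumes f: "linear_map f" and W: "fin_space W"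
  shows "fin_space (f ` W)"
proof -
  obtain B where B: "finite B" "W \<subseteq> cpoly_span B" using W by (auto simp: fin_space_def)
  have "cpoly.subspace (f ` W)"
    by (rule module_hom.subspace_image[OF linear_map_module_hom[OF f]]) (use W in \<open>simp add: fin_space_def\<close>)
  moreover have "f ` W \<subseteq> cpoly_span (f ` B)" using B(2) linear_map_span[OF f, of B] by blast
  ultimately show ?thesis using B(1) by (auto simp: fin_space_def)
qed

lemma dim_inj_image_ge:
  fixes f :: "'v cpoly \<Rightarrow> 'w cpoly"
  assumes f: "linear_map f" and W: "fin_space W" and inj: "inj_on f W" and V: "f ` W \<subseteq> V" "fin_space V"
  shows "cpoly_dim W \<le> cpoly_dim V"
proof -
  have "cpoly_span W = W" using W by (simp add: fin_space_def cpoly.span_eq_iff)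
  interpret vp: vector_space_pair "cpoly_scale :: complex \<Rightarrow> 'v cpoly \<Rightarrow> _" "cpoly_scale :: complex \<Rightarrow> 'w cpoly \<Rightarrow> _"
    by unfold_locales
  have "\<exists>g. range g \<subseteq> cpoly_span W \<and> Vector_Spaces.linear cpoly_scale cpoly_scale g \<and> (\<forall>x\<in>cpoly_span W. g (f x) = x)"
    unfolding cpoly_span_def
    by (rule vp.linear_inj_on_left_inverse[OF f[unfolded linear_map_def]])
      (simp add: \<open>cpoly_span W = W\<close>[unfolded cpoly_span_def] inj)
  then obtain g where g: "linear_map g" "\<forall>x\<in>W. g (f x) = x"
    unfolding \<open>cpoly_span W = W\<close> linear_map_def by blast
  have "g ` f ` W = W" unfolding image_image using g(2) by simp
  then have "cpoly_dim W \<le> cpoly_dim (f ` W)"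
    using dim_image_le[OF g(1) fin_space_image[OF f W]] by simp
  also have "\<dots> \<le> cpoly_dim V" by (rule dim_subset_le[OF V(2,1)])
  finally show ?thesis .
qed

lemma monomial_space:
  assumes "finite S"
  shows "fin_space {F :: 'v cpoly. keys F \<subseteq> S}" "cpoly_dim {F :: 'v cpoly. keys F \<subseteq> S} = card S"
proof -
  let ?X = "\<lambda>\<alpha>. single \<alpha> (1::complex)" and ?W = "{F :: 'v cpoly. keys F \<subseteq> S}"
  have inj: "inj_on ?X S" by (intro inj_onI) (metis lookup_single_eq lookup_single_not_eq zero_neq_one)
  have sub: "cpoly.subspace ?W"
  proof (rule cpoly.subspaceI)
    show "F + G \<in> ?W" if "F \<in> ?W" "G \<in> ?W" for F G using that keys_add[of F G] by blast
    show "cpoly_scale c F \<in> ?W" if "F \<in> ?W" for c F using that keys_cpoly_scale[of c F] by blast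
  qed simp
  have span: "?W \<subseteq> cpoly_span (?X ` S)"
  proof
    fix F assume F: "F \<in> ?W"
    have "(\<Sum>\<alpha>\<in>keys F. cpoly_scale (lookup F \<alpha>) (?X \<alpha>)) = F"
      by (simp add: cpoly_scale_def mult_single cpoly_sum_single[symmetric])
    moreover have "(\<Sum>\<alpha>\<in>keys F. cpoly_scale (lookup F \<alpha>) (?X \<alpha>)) \<in> cpoly_span (?X ` S)"
      using F by (intro cpoly.span_sum cpoly.span_scale cpoly.span_base) auto
    ultimately show "F \<in> cpoly_span (?X ` S)" by simp
  qed
  show "fin_space ?W" unfolding fin_space_def using sub span assms by blast
  have ind: "\<not> cpoly.dependent (?X ` S)"
  proof (rule cpoly.independent_if_scalars_zero)
    fix f x assume 0: "(\<Sum>x\<in>?X ` S. cpoly_scale (f x) x) = 0" and x: "x \<in> ?X ` S"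
    obtain \<beta> where \<beta>: "\<beta> \<in> S" "x = ?X \<beta>" using x by blast
    have "0 = lookup (\<Sum>x\<in>?X ` S. cpoly_scale (f x) x) \<beta>" unfolding 0 by simp
    also have "\<dots> = (\<Sum>\<alpha>\<in>S. lookup (cpoly_scale (f (?X \<alpha>)) (?X \<alpha>)) \<beta>)"
      unfolding lookup_sum sum.reindex[OF inj] by simp
    also have "\<dots> = (\<Sum>\<alpha>\<in>S. if \<alpha> = \<beta> then f x else 0)"
      using \<beta> by (intro sum.cong) (auto simp: lookup_single when_def)
    finally show "f x = 0" using \<beta> assms by simp
  qed (use assms in auto)
  have "cpoly_dim ?W = card (?X ` S)"
    by (rule cpoly.dim_unique[OF _ span ind]) auto
  then show "cpoly_dim ?W = card S" using inj by (simp add: card_image)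
qed

definition monomials :: "int \<Rightarrow> ('v::finite \<Rightarrow>\<^sub>0 nat) set" where
  "monomials d = {\<alpha>. int (deg \<alpha>) = d}"

lemma finite_monomials [simp]: "finite (monomials d)"
proof -
  have "monomials d \<subseteq> exps ` {vs. set vs \<subseteq> UNIV \<and> length vs = nat d}"
  proof
    fix \<alpha> assume "\<alpha> \<in> monomials d"
    then have d: "deg \<alpha> = nat d" by (simp add: monomials_def)
    obtain vs where "\<alpha> = exps vs" using ex_exps[of \<alpha>] by blast
    then show "\<alpha> \<in> exps ` {vs. set vs \<subseteq> UNIV \<and> length vs = nat d}" using d by simp
  qed
  then show ?thesis by (rule finite_subset) (intro finite_imageI finite_lists_length_eq, simp)
qed

lemma homogeneous_keys: "homogeneous d F \<longleftrightarrow> keys F \<subseteq> monomials d"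
  by (auto simp: homogeneous_deg_in deg_in_def monomials_def)

lemma vanishes_scale: "vanishes_to_order m F p \<Longrightarrow> vanishes_to_order m (cpoly_scale c F) p"
  unfolding cpoly_scale_def by (rule vanishes_times)

lemma fin_space_linear_system: "fin_space (linear_system d m p)"
proof (rule fin_space_subset[OF monomial_space(1)[OF finite_monomials]])
  show "linear_system d m p \<subseteq> {F. keys F \<subseteq> monomials d}"
    by (auto simp: linear_system_def homogeneous_keys)
  show "cpoly.subspace (linear_system d m p)"
  proof (rule cpoly.subspaceI)
    show "0 \<in> linear_system d m p" by (simp add: linear_system_def homogeneous_deg_in)
    show "F + G \<in> linear_system d m p" if "F \<in> linear_system d m p" "G \<in> linear_system d m p" for F G
      using that by (simp add: linear_system_def homogeneous_deg_in deg_in_add vanishes_add)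
    show "cpoly_scale c F \<in> linear_system d m p" if "F \<in> linear_system d m p" for c F
      using that keys_cpoly_scale[of c F] by (auto simp: linear_system_def homogeneous_keys vanishes_scale)
  qed
qed

text \<open>As in an echelon form: while the space is nonzero, some coefficient does not vanish
  identically on it, and fixing that coefficient to be 0 lowers the dimension.\<close>

lemma separating_coefficients:
  assumes "fin_space W" "cpoly_dim W = n" "\<And>F. F \<in> W \<Longrightarrow> keys F \<subseteq> S"
  shows "\<exists>J. finite J \<and> J \<subseteq> S \<and> card J \<le> n \<and> (\<forall>F\<in>W. (\<forall>\<alpha>\<in>J. lookup F \<alpha> = 0) \<longrightarrow> F = 0)"
  using assms
proof (induction n arbitrary: W rule: less_induct)
  case (less n W)
  show ?case
  proof (cases "\<forall>F\<in>W. F = 0")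
    case True
    then show ?thesis by (intro exI[of _ "{}"]) auto
  next
    case False
    then obtain F where F: "F \<in> W" "F \<noteq> 0" by blast
    then obtain \<alpha> where \<alpha>: "\<alpha> \<in> keys F" using keys_eq_empty[of F] by blast
    let ?V = "{F\<in>W. lookup F \<alpha> = 0}"
    have "fin_space {F\<in>W. \<forall>\<psi>\<in>{\<lambda>F. lookup F \<alpha>}. \<psi> F = 0}"
      by (rule fin_space_kernel[OF less.prems(1)]) simp
    then have V: "fin_space ?V" by simp
    have "F \<notin> ?V" using \<alpha> by (simp add: in_keys_iff)
    then have lt: "cpoly_dim ?V < n"
      using dim_psubset_less[OF less.prems(1) V _ F(1)] less.prems(2) by blast
    have keysV: "keys G \<subseteq> S" if "G \<in> ?V" for G using that less.prems(3) by blast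
    obtain J where J: "finite J" "J \<subseteq> S" "card J \<le> cpoly_dim ?V" and
      sep: "\<And>G. G \<in> ?V \<Longrightarrow> (\<forall>\<alpha>\<in>J. lookup G \<alpha> = 0) \<Longrightarrow> G = 0"
      using less.IH[OF lt V refl keysV] by blast
    show ?thesis
    proof (intro exI[of _ "insert \<alpha> J"] conjI ballI impI)
      show "card (insert \<alpha> J) \<le> n" using J lt by (simp add: card_insert_if)
      show "insert \<alpha> J \<subseteq> S" using J \<alpha> less.prems(3)[OF F(1)] by blast
      show "G = 0" if "G \<in> W" "\<forall>\<alpha>\<in>insert \<alpha> J. lookup G \<alpha> = 0" for G
        using sep[of G] that by simp
    qed (use J in simp)
  qed
qed

section \<open>Generic conditions and semicontinuity\<close>

text \<open>Multihomogeneous polynomial functions of nine points; the degree vectors are finitely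
  supported so that they form a commutative monoid.\<close>

definition multihom :: "(nat \<Rightarrow>\<^sub>0 nat) \<Rightarrow> ((nat \<Rightarrow> complex ^ 4) \<Rightarrow> complex) set" where
  "multihom e = {f. \<exists>G. (\<forall>\<alpha>\<in>keys G. keys \<alpha> \<subseteq> {1..9} \<times> UNIV \<and>
        (\<forall>i\<in>{1..9}. (\<Sum>v\<in>UNIV. lookup \<alpha> (i, v)) = lookup e i)) \<and>
      f = (\<lambda>p. poly_eval (\<lambda>(i, v). p i $ v) G)}"

lemma multihom_0: "(\<lambda>_. 0) \<in> multihom e"
  unfolding multihom_def by (auto intro!: exI[of _ 0])

lemma multihom_const: "(\<lambda>_. c) \<in> multihom 0"
  unfolding multihom_def by (auto intro!: exI[of _ "single 0 c"] split: if_splits)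

lemma multihom_coord: "i \<in> {1..9} \<Longrightarrow> (\<lambda>p. p i $ v) \<in> multihom (single i 1)"
  unfolding multihom_def by (auto intro!: exI[of _ "var (i, v)"]) (auto simp: var_def lookup_single when_def)

lemma multihom_mult:
  assumes "f \<in> multihom e" "g \<in> multihom e'"
  shows "(\<lambda>p. f p * g p) \<in> multihom (e + e')"
proof -
  obtain F where F: "\<forall>\<alpha>\<in>keys F. keys \<alpha> \<subseteq> {1..9} \<times> UNIV \<and> (\<forall>i\<in>{1..9}. (\<Sum>v\<in>UNIV. lookup \<alpha> (i, v)) = lookup e i)"
    "f = (\<lambda>p. poly_eval (\<lambda>(i, v). p i $ v) F)" using assms(1) by (auto simp: multihom_def)
  obtain G where G: "\<forall>\<alpha>\<in>keys G. keys \<alpha> \<subseteq> {1..9} \<times> UNIV \<and> (\<forall>i\<in>{1..9}. (\<Sum>v\<in>UNIV. lookup \<alpha> (i, v)) = lookup e' i)"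
    "g = (\<lambda>p. poly_eval (\<lambda>(i, v). p i $ v) G)" using assms(2) by (auto simp: multihom_def)
  have "keys \<gamma> \<subseteq> {1..9} \<times> UNIV \<and> (\<forall>i\<in>{1..9}. (\<Sum>v\<in>UNIV. lookup \<gamma> (i, v)) = lookup (e + e') i)"
    if \<gamma>: "\<gamma> \<in> keys (F * G)" for \<gamma>
  proof -
    obtain \<alpha> \<beta> where "\<alpha> \<in> keys F" "\<beta> \<in> keys G" "\<gamma> = \<alpha> + \<beta>" using keys_mult[of F G] \<gamma> by blast
    then show ?thesis using F(1) G(1) keys_add[of \<alpha> \<beta>] by (fastforce simp: lookup_add sum.distrib)
  qed
  then show ?thesis unfolding multihom_def F(2) G(2)
    by (auto intro!: exI[of _ "F * G"] simp: poly_eval_mult)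
qed

lemma multihom_diff:
  assumes "f \<in> multihom e" "g \<in> multihom e"
  shows "(\<lambda>p. f p - g p) \<in> multihom e"
proof -
  obtain F where F: "\<forall>\<alpha>\<in>keys F. keys \<alpha> \<subseteq> {1..9} \<times> UNIV \<and> (\<forall>i\<in>{1..9}. (\<Sum>v\<in>UNIV. lookup \<alpha> (i, v)) = lookup e i)"
    "f = (\<lambda>p. poly_eval (\<lambda>(i, v). p i $ v) F)" using assms(1) by (auto simp: multihom_def)
  obtain G where G: "\<forall>\<alpha>\<in>keys G. keys \<alpha> \<subseteq> {1..9} \<times> UNIV \<and> (\<forall>i\<in>{1..9}. (\<Sum>v\<in>UNIV. lookup \<alpha> (i, v)) = lookup e i)"
    "g = (\<lambda>p. poly_eval (\<lambda>(i, v). p i $ v) G)" using assms(2) by (auto simp: multihom_def)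
  have "keys (F - G) \<subseteq> keys F \<union> keys G" by (auto simp: in_keys_iff lookup_minus)
  then have "\<forall>\<alpha>\<in>keys (F - G). keys \<alpha> \<subseteq> {1..9} \<times> UNIV \<and> (\<forall>i\<in>{1..9}. (\<Sum>v\<in>UNIV. lookup \<alpha> (i, v)) = lookup e i)"
    using F(1) G(1) by blast
  then show ?thesis unfolding multihom_def F(2) G(2)
    by (auto intro!: exI[of _ "F - G"] simp: poly_eval_diff)
qed

lemma multihom_add:
  assumes "f \<in> multihom e" "g \<in> multihom e"
  shows "(\<lambda>p. f p + g p) \<in> multihom e"
proof -
  have "(\<lambda>p. f p - (0 - g p)) \<in> multihom e" by (intro multihom_diff multihom_0 assms)
  then show ?thesis by simp
qed

lemma multihom_sum: "(\<And>x. x \<in> A \<Longrightarrow> f x \<in> multihom e) \<Longrightarrow> (\<lambda>p. \<Sum>x\<in>A. f x p) \<in> multihom e"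
  by (induction A rule: infinite_finite_induct) (auto intro: multihom_0 multihom_add)

lemma multihom_power: "f \<in> multihom (single i 1) \<Longrightarrow> (\<lambda>p. f p ^ n) \<in> multihom (single i n)"
proof (induction n)
  case 0
  then show ?case using multihom_const[of 1] by simp
next
  case (Suc n)
  then have "(\<lambda>p. f p * f p ^ n) \<in> multihom (single i 1 + single i n)" by (intro multihom_mult) auto
  then show ?case by (simp add: single_add[symmetric])
qed

lemma multihom_poly_eval:
  assumes i: "i \<in> {1..9}" and F: "homogeneous d F"
  shows "(\<lambda>p. poly_eval (\<lambda>v. p i $ v) F) \<in> multihom (single i (nat d))"
proof -
  have mon: "(\<lambda>p. \<Prod>v\<in>A. p i $ v ^ lookup \<alpha> v) \<in> multihom (single i (\<Sum>v\<in>A. lookup \<alpha> v))"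
    if "finite A" for A and \<alpha> :: "4 \<Rightarrow>\<^sub>0 nat"
    using that
  proof (induction A)
    case empty
    then show ?case using multihom_const[of 1] by simp
  next
    case (insert v A)
    then show ?case using multihom_mult[OF multihom_power[OF multihom_coord[OF i, of v], of "lookup \<alpha> v"]]
      by (simp add: single_add)
  qed
  have "(\<lambda>p. lookup F \<alpha> * monom_eval (\<lambda>v. p i $ v) \<alpha>) \<in> multihom (single i (nat d))" if "\<alpha> \<in> keys F" for \<alpha>
  proof -
    have "nat d = (\<Sum>v\<in>UNIV. lookup \<alpha> v)" using F that unfolding homogeneous_def by (metis nat_int)
    then show ?thesis using multihom_mult[OF multihom_const mon[of UNIV \<alpha>], of "lookup F \<alpha>"]
      by (simp add: monom_eval_UNIV)
  qed
  then show ?thesis unfolding poly_eval_ev ev_id.ev_def by (rule multihom_sum)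
qed

lemma line_poly_poly_eval: "line_poly (\<lambda>z. poly_eval z G)"
  unfolding poly_eval_def by (intro line_poly_sum line_poly_mult line_poly_prod line_poly_power) auto

definition generic :: "((nat \<Rightarrow> complex ^ 4) \<Rightarrow> bool) \<Rightarrow> bool" where
  "generic P \<longleftrightarrow> (\<exists>f e p0. f \<in> multihom e \<and> f p0 \<noteq> 0 \<and> (\<forall>p. f p \<noteq> 0 \<longrightarrow> P p))"

lemma generic_mono: "generic P \<Longrightarrow> (\<And>p. P p \<Longrightarrow> Q p) \<Longrightarrow> generic Q"
  unfolding generic_def by metis

text \<open>Two nonempty open sets meet, because the space of point configurations is irreducible;
  \<open>line_poly_common_nonzero\<close> provides the common point.\<close>

lemma generic_conj:
  assumes "generic P" "generic Q"
  shows "generic (\<lambda>p. P p \<and> Q p)"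
proof -
  obtain f e p1 where f: "f \<in> multihom e" "f p1 \<noteq> 0" "\<And>p. f p \<noteq> 0 \<Longrightarrow> P p" using assms(1) by (auto simp: generic_def)
  obtain g e' p2 where g: "g \<in> multihom e'" "g p2 \<noteq> 0" "\<And>p. g p \<noteq> 0 \<Longrightarrow> Q p" using assms(2) by (auto simp: generic_def)
  obtain F where F: "f = (\<lambda>p. poly_eval (\<lambda>(i, v). p i $ v) F)" using f(1) by (auto simp: multihom_def)
  obtain G where G: "g = (\<lambda>p. poly_eval (\<lambda>(i, v). p i $ v) G)" using g(1) by (auto simp: multihom_def)
  obtain z where z: "poly_eval z F \<noteq> 0" "poly_eval z G \<noteq> 0"
    using line_poly_common_nonzero[OF line_poly_poly_eval line_poly_poly_eval] f(2) g(2) unfolding F G by blast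
  define p where "p = (\<lambda>i. \<chi> v. z (i, v))"
  have "(\<lambda>(i, v). p i $ v) = z" by (auto simp: p_def)
  then have "f p * g p \<noteq> 0" using z unfolding F G by simp
  then show ?thesis unfolding generic_def
    using multihom_mult[OF f(1) g(1)] f(3) g(3) by (intro exI[of _ "\<lambda>p. f p * g p"]) auto
qed

lemma generic_ball:
  assumes "finite A" "\<And>x. x \<in> A \<Longrightarrow> generic (P x)"
  shows "generic (\<lambda>p. \<forall>x\<in>A. P x p)"
  using assms
proof (induction A)
  case empty
  then show ?case unfolding generic_def using multihom_const[of 1] by (intro exI[of _ "\<lambda>_. 1"]) auto
next
  case (insert x A)
  then show ?case using generic_conj[of "P x" "\<lambda>p. \<forall>x\<in>A. P x p"] by simp
qed

lemma generic_for_general_points: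
  assumes "generic P"
  shows "for_general_points P"
proof -
  obtain f e p0 where f: "f \<in> multihom e" "f p0 \<noteq> 0" "\<And>p. f p \<noteq> 0 \<Longrightarrow> P p" using assms by (auto simp: generic_def)
  obtain G where G: "\<forall>\<alpha>\<in>keys G. keys \<alpha> \<subseteq> {1..9} \<times> UNIV \<and> (\<forall>i\<in>{1..9}. (\<Sum>v\<in>UNIV. lookup \<alpha> (i, v)) = lookup e i)"
    "f = (\<lambda>p. poly_eval (\<lambda>(i, v). p i $ v) G)" using f(1) by (auto simp: multihom_def)
  have "G \<noteq> 0" using f(2) unfolding G(2) by auto
  then show ?thesis unfolding for_general_points_def using G f(3)
    by (intro exI[of _ G] exI[of _ "lookup e"]) auto
qed

lemma partial_deriv_sum: "partial_deriv v (sum f A) = (\<Sum>a\<in>A. partial_deriv v (f a))"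
  by (induction A rule: infinite_finite_induct) (auto simp: partial_deriv_add)

lemma fold_partial_deriv_sum: "fold partial_deriv vs (sum f A) = (\<Sum>a\<in>A. fold partial_deriv vs (f a))"
  by (induction vs arbitrary: f) (auto simp: partial_deriv_sum)

lemma partial_deriv_const_mult: "partial_deriv v (single 0 c * F) = single 0 c * partial_deriv v F"
  by (simp add: partial_deriv_mult)

lemma fold_partial_deriv_const_mult: "fold partial_deriv vs (single 0 c * F) = single 0 c * fold partial_deriv vs F"
  by (induction vs arbitrary: F) (auto simp: partial_deriv_const_mult)

lemma homogeneous_fold_partial_deriv: "homogeneous d F \<Longrightarrow> homogeneous (d - int (length vs)) (fold partial_deriv vs F)"
proof (induction vs arbitrary: F d)
  case (Cons v vs)
  from Cons.IH[OF homogeneous_partial_deriv[OF Cons.prems]] show ?case by (simp add: algebra_simps)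
qed simp

text \<open>Choose coefficients \<open>J\<close>, as many as the dimension at \<open>p0\<close>,
  that separate the system there. Then the conditions at \<open>p0\<close> are injective on forms
  without monomials in \<open>J\<close>. By \<open>elimination\<close> this stays true on an open
  set, where \<open>J\<close> therefore still separates the system.\<close>

lemma dim_upper_semicontinuous: "generic (\<lambda>p. cpoly_dim (linear_system d m p) \<le> cpoly_dim (linear_system d m p0))"
proof -
  let ?W = "linear_system d m p0"
  have keysd: "keys F \<subseteq> monomials d" if "F \<in> linear_system d m p" for F p
    using that by (simp add: linear_system_def homogeneous_keys)
  have "\<exists>J. finite J \<and> J \<subseteq> monomials d \<and> card J \<le> cpoly_dim ?W \<and>
      (\<forall>F\<in>?W. (\<forall>\<alpha>\<in>J. lookup F \<alpha> = 0) \<longrightarrow> F = 0)"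
    by (rule separating_coefficients[OF fin_space_linear_system refl keysd])
  then obtain J where J: "finite J" "J \<subseteq> monomials d" "card J \<le> cpoly_dim ?W"
    "\<forall>F\<in>?W. (\<forall>\<alpha>\<in>J. lookup F \<alpha> = 0) \<longrightarrow> F = 0"
    by (elim exE conjE)
  define K where "K = monomials d - J"
  define R where "R = {(i, vs :: 4 list). i \<in> {1..9::nat} \<and> int (length vs) < m i}"
  define a where "a = (\<lambda>(i :: nat, vs :: 4 list) \<alpha> (p :: nat \<Rightarrow> complex ^ 4).
     poly_eval (\<lambda>v. p i $ v) (fold partial_deriv vs (single \<alpha> 1)))"
  define F where "F = (\<lambda>c. \<Sum>\<alpha>\<in>K. single \<alpha> (c \<alpha> :: complex))"
  have finK: "finite K" by (simp add: K_def)
  have lookF: "lookup (F c) \<alpha> = (if \<alpha> \<in> K then c \<alpha> else 0)" for c \<alpha>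
  proof -
    have "lookup (F c) \<alpha> = (\<Sum>\<beta>\<in>K. if \<beta> = \<alpha> then c \<alpha> else 0)"
      unfolding F_def lookup_sum by (intro sum.cong) (auto simp: lookup_single when_def)
    then show ?thesis using finK by simp
  qed
  have row: "(\<Sum>\<alpha>\<in>K. c \<alpha> * a (i, vs) \<alpha> p) = poly_eval (\<lambda>v. p i $ v) (fold partial_deriv vs (F c))" for c i vs p
  proof -
    have "fold partial_deriv vs (single \<alpha> (c \<alpha>)) = single 0 (c \<alpha>) * fold partial_deriv vs (single \<alpha> 1)" for \<alpha>
      using fold_partial_deriv_const_mult[of vs "c \<alpha>" "single \<alpha> 1"] by (simp add: mult_single)
    then show ?thesis by (simp add: F_def a_def fold_partial_deriv_sum poly_eval_sum poly_eval_mult)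
  qed
  have hom: "homogeneous d (F c)" for c
    unfolding homogeneous_keys using lookF by (auto simp: in_keys_iff K_def split: if_splits)
  have sys: "(\<forall>r\<in>R. (\<Sum>\<alpha>\<in>K. c \<alpha> * a r \<alpha> p) = 0) \<longleftrightarrow> F c \<in> linear_system d m p" for c p
  proof -
    have "F c \<in> linear_system d m p \<longleftrightarrow>
        (\<forall>i\<in>{1..9}. \<forall>vs. int (length vs) < m i \<longrightarrow> (\<Sum>\<alpha>\<in>K. c \<alpha> * a (i, vs) \<alpha> p) = 0)"
      unfolding row using hom by (simp add: linear_system_def vanishes_to_order_def)
    then show ?thesis unfolding R_def by blast
  qed
  have "\<exists>g e. g \<in> multihom e \<and> g p0 \<noteq> 0 \<and>
    (\<forall>p. g p \<noteq> 0 \<longrightarrow> (\<forall>c. (\<forall>r\<in>R. (\<Sum>\<alpha>\<in>K. c \<alpha> * a r \<alpha> p) = 0) \<longrightarrow> (\<forall>\<alpha>\<in>K. c \<alpha> = 0)))"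
  \<comment> \<open>A derivative of order \<open>length vs\<close> has degree
    \<open>d - length vs\<close> in the coordinates of point \<open>i\<close> and degree 0 in those
    of the other points.\<close>
  proof (rule elimination[where H = multihom and e = "\<lambda>(i, vs). single i (nat (d - int (length vs)))"])
    show "a r \<alpha> \<in> multihom (case r of (i, vs) \<Rightarrow> single i (nat (d - int (length vs))))"
      if mem: "r \<in> R" "\<alpha> \<in> K" for r \<alpha>
    proof -
      obtain i vs where r: "r = (i, vs)" "i \<in> {1..9}" using mem by (auto simp: R_def)
      have "homogeneous d (single \<alpha> 1)" using mem by (auto simp: homogeneous_keys K_def)
      from multihom_poly_eval[OF r(2) homogeneous_fold_partial_deriv[OF this, of vs]]
      show ?thesis unfolding r a_def by simp
    qed
    show "\<forall>\<alpha>\<in>K. c \<alpha> = 0" if "\<forall>r\<in>R. (\<Sum>\<alpha>\<in>K. c \<alpha> * a r \<alpha> p0) = 0" for c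
    proof -
      have "F c \<in> ?W" using that sys by blast
      moreover have "\<forall>\<alpha>\<in>J. lookup (F c) \<alpha> = 0" by (simp add: lookF K_def)
      ultimately have F0: "F c = 0" using J(4) by blast
      show ?thesis
      proof
        fix \<alpha> assume "\<alpha> \<in> K"
        then show "c \<alpha> = 0" using lookF[of c \<alpha>] F0 by simp
      qed
    qed
  qed (use finK in \<open>simp_all add: multihom_const multihom_mult multihom_diff\<close>)
  then obtain g e where g: "g \<in> multihom e" "g p0 \<noteq> 0" and
    gi: "\<And>p c. g p \<noteq> 0 \<Longrightarrow> F c \<in> linear_system d m p \<Longrightarrow> \<forall>\<alpha>\<in>K. c \<alpha> = 0"
    unfolding sys by blast
  have "cpoly_dim (linear_system d m p) \<le> cpoly_dim ?W" if "g p \<noteq> 0" for p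
  proof -
    let ?V = "{G\<in>linear_system d m p. \<forall>\<phi>\<in>(\<lambda>\<alpha> G. lookup G \<alpha>) ` J. \<phi> G = 0}"
    have "G = 0" if G: "G \<in> ?V" for G
    proof -
      have k: "\<alpha> \<in> K" if "\<alpha> \<in> keys G" for \<alpha>
      proof -
        have "\<alpha> \<in> monomials d" using G keysd[of G p] that by blast
        moreover have "\<alpha> \<notin> J" using G that by (auto simp: in_keys_iff)
        ultimately show ?thesis by (simp add: K_def)
      qed
      have FG: "F (lookup G) = G"
      proof (rule poly_mapping_eqI)
        fix \<alpha> show "lookup (F (lookup G)) \<alpha> = lookup G \<alpha>"
          unfolding lookF using k[of \<alpha>] by (auto simp: in_keys_iff)
      qed
      have "F (lookup G) \<in> linear_system d m p" unfolding FG using G by blast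
      then have z: "\<forall>\<alpha>\<in>K. lookup G \<alpha> = 0" using gi[OF \<open>g p \<noteq> 0\<close>] by blast
      show ?thesis
      proof (rule poly_mapping_eqI)
        fix \<alpha> show "lookup G \<alpha> = lookup 0 \<alpha>" using z k[of \<alpha>] by (auto simp: in_keys_iff)
      qed
    qed
    then have "?V \<subseteq> cpoly_span {}" by (simp add: cpoly.span_empty subset_iff)
    then have "cpoly_dim ?V \<le> card ({} :: 4 cpoly set)" by (rule cpoly.dim_le_card) simp
    then have "cpoly_dim ?V = 0" by simp
    moreover have "card ((\<lambda>\<alpha> G. lookup G \<alpha>) ` J :: (4 cpoly \<Rightarrow> complex) set) \<le> card J" using J(1) by (rule card_image_le)
    moreover have "cpoly_dim (linear_system d m p) \<le> cpoly_dim ?V + card ((\<lambda>\<alpha> G. lookup G \<alpha>) ` J :: (4 cpoly \<Rightarrow> complex) set)"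
      by (rule dim_kernel[OF finite_imageI[OF J(1)] fin_space_linear_system]) (use functional_lookup in blast)
    ultimately show ?thesis using J(3) by linarith
  qed
  then show ?thesis unfolding generic_def using g by blast
qed

lemma linear_map_lin_subst: "linear_map (lin_subst A)"
  by (rule linear_mapI) (simp_all add: lin_subst_def psubst_add psubst_mult cpoly_scale_def)

lemma dim_linear_system_lin:
  assumes AB: "A ** B = mat 1" "B ** A = mat 1"
  shows "cpoly_dim (linear_system d m (\<lambda>i. A *v p i)) = cpoly_dim (linear_system d m p)"
proof -
  have le: "cpoly_dim (linear_system d m (\<lambda>i. A *v p i)) \<le> cpoly_dim (linear_system d m p)"
    if AB: "A ** B = mat 1" for A B :: "complex ^ 4 ^ 4" and p
  proof (rule dim_inj_image_ge[OF linear_map_lin_subst fin_space_linear_system _ _ fin_space_linear_system])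
    show "inj_on (lin_subst A) (linear_system d m (\<lambda>i. A *v p i))"
      by (rule inj_on_inverseI[of _ "lin_subst B"]) (simp add: lin_subst_compose AB lin_subst_mat_1)
    show "lin_subst A ` linear_system d m (\<lambda>i. A *v p i) \<subseteq> linear_system d m p"
      by (auto simp: linear_system_def homogeneous_lin_subst vanishes_lin_subst)
  qed
  have "(\<lambda>i. B *v (A *v p i)) = p" using AB(2) by (simp add: matrix_vector_mul_assoc)
  then show ?thesis using le[OF AB(1), of p] le[OF AB(2), of "\<lambda>i. A *v p i"] by simp
qed

section \<open>Counting monomials\<close>

lemma card_simplex2: "card {(b, c). b + c \<le> (n::nat)} = (n + 2) choose 2"
proof -
  have "{(b, c). b + c \<le> n} = {(b, c). b + c < Suc n}" by auto
  then show ?thesis using card_pairs_less(1)[of "Suc n"] by simp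
qed

lemma finite_simplex2: "finite {(b, c). b + c \<le> (n::nat)}"
  by (rule finite_subset[of _ "{..n} \<times> {..n}"]) auto

lemma card_simplex3: "card {(a, b, c). a + b + c \<le> (n::nat)} = (n + 3) choose 3"
proof -
  have "{(a, b, c). a + b + c \<le> n} = (SIGMA a:{..n}. {(b, c). b + c \<le> n - a})" by auto
  then have "card {(a, b, c). a + b + c \<le> n} = (\<Sum>a\<le>n. card {(b, c). b + c \<le> n - a})"
    using finite_simplex2 by (simp add: card_SigmaI)
  also have "\<dots> = (\<Sum>a\<le>n. (n - a + 2) choose 2)" by (simp add: card_simplex2)
  also have "\<dots> = (\<Sum>a\<le>n. (a + 2) choose 2)"
    by (rule sum.reindex_bij_witness[of _ "\<lambda>a. n - a" "\<lambda>a. n - a"]) auto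
  also have "\<dots> = (n + 3) choose 3"
    by (induction n) (auto simp: numeral_eq_Suc)
  finally show ?thesis .
qed

lemma card_monomials: "int (card (monomials n :: (4 \<Rightarrow>\<^sub>0 nat) set)) = int (nat (n + 3) choose 3)"
proof (cases "n \<ge> 0")
  case False
  then have "monomials n = ({} :: (4 \<Rightarrow>\<^sub>0 nat) set)" by (auto simp: monomials_def)
  moreover have "nat (n + 3) choose 3 = 0" using False by (intro binomial_eq_0) auto
  ultimately show ?thesis by simp
next
  case True
  \<comment> \<open>The fourth exponent is determined by the degree.\<close>
  define f :: "(4 \<Rightarrow>\<^sub>0 nat) \<Rightarrow> nat \<times> nat \<times> nat" where "f = (\<lambda>\<alpha>. (lookup \<alpha> 1, lookup \<alpha> 2, lookup \<alpha> 3))"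
  define g :: "nat \<times> nat \<times> nat \<Rightarrow> (4 \<Rightarrow>\<^sub>0 nat)" where
    "g = (\<lambda>(a, b, c). single 1 a + single 2 b + single 3 c + single 4 (nat n - a - b - c))"
  have deg4: "deg \<alpha> = lookup \<alpha> 1 + lookup \<alpha> 2 + lookup \<alpha> 3 + lookup \<alpha> 4" for \<alpha> :: "4 \<Rightarrow>\<^sub>0 nat"
    by (simp add: deg_def sum_4)
  have "bij_betw f (monomials n) {(a, b, c). a + b + c \<le> nat n}"
  proof (rule bij_betw_byWitness[where f' = g])
    show "\<forall>\<alpha>\<in>monomials n. g (f \<alpha>) = \<alpha>"
    proof
      fix \<alpha> :: "4 \<Rightarrow>\<^sub>0 nat" assume "\<alpha> \<in> monomials n"
      then have n: "nat n = lookup \<alpha> 1 + lookup \<alpha> 2 + lookup \<alpha> 3 + lookup \<alpha> 4"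
        by (simp add: monomials_def deg4)
      have "\<forall>v. lookup (g (f \<alpha>)) v = lookup \<alpha> v"
        unfolding forall_4 by (simp add: f_def g_def lookup_add lookup_single when_def n)
      then show "g (f \<alpha>) = \<alpha>" by (intro poly_mapping_eqI) blast
    qed
    show "\<forall>t\<in>{(a, b, c). a + b + c \<le> nat n}. f (g t) = t"
      by (simp add: f_def g_def lookup_add lookup_single when_def split_beta)
    show "f ` monomials n \<subseteq> {(a, b, c). a + b + c \<le> nat n}"
    proof
      fix t assume "t \<in> f ` monomials n"
      then obtain \<alpha> where t: "t = f \<alpha>" "int (deg \<alpha>) = n" by (auto simp: monomials_def)
      then have "lookup \<alpha> 1 + lookup \<alpha> 2 + lookup \<alpha> 3 \<le> nat n" using deg4[of \<alpha>] by linarith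
      then show "t \<in> {(a, b, c). a + b + c \<le> nat n}" by (simp add: t(1) f_def)
    qed
    show "g ` {(a, b, c). a + b + c \<le> nat n} \<subseteq> monomials n"
    proof
      fix \<alpha> assume "\<alpha> \<in> g ` {(a, b, c). a + b + c \<le> nat n}"
      then obtain a b c where "\<alpha> = g (a, b, c)" "a + b + c \<le> nat n" by blast
      then have "deg \<alpha> = nat n" by (simp add: g_def deg_add)
      then show "\<alpha> \<in> monomials n" using True by (simp add: monomials_def)
    qed
  qed
  then have "card (monomials n :: (4 \<Rightarrow>\<^sub>0 nat) set) = (nat n + 3) choose 3"
    using bij_betw_same_card card_simplex3 by metis
  then show ?thesis using True by (simp add: nat_add_distrib)
qed

lemma card_monomials_ge:
  fixes \<gamma> :: "4 \<Rightarrow>\<^sub>0 nat"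
  shows "int (card {\<alpha>\<in>monomials d. \<forall>v. lookup \<gamma> v \<le> lookup \<alpha> v}) = int (nat (d - int (deg \<gamma>) + 3) choose 3)"
proof -
  have "bij_betw (\<lambda>\<alpha>. \<alpha> + \<gamma>) (monomials (d - int (deg \<gamma>))) {\<alpha>\<in>monomials d. \<forall>v. lookup \<gamma> v \<le> lookup \<alpha> v}"
  proof (rule bij_betw_byWitness[where f' = "\<lambda>\<alpha>. \<alpha> - \<gamma>"])
    show "\<forall>a\<in>monomials (d - int (deg \<gamma>)). a + \<gamma> - \<gamma> = a" by simp
    have cancel: "\<alpha> - \<gamma> + \<gamma> = \<alpha>" if "\<forall>v. lookup \<gamma> v \<le> lookup \<alpha> v" for \<alpha> :: "4 \<Rightarrow>\<^sub>0 nat"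
      using that by (intro poly_mapping_eqI) (simp add: lookup_add lookup_minus)
    then show "\<forall>a'\<in>{\<alpha>\<in>monomials d. \<forall>v. lookup \<gamma> v \<le> lookup \<alpha> v}. a' - \<gamma> + \<gamma> = a'" by blast
    show "(\<lambda>\<alpha>. \<alpha> + \<gamma>) ` monomials (d - int (deg \<gamma>)) \<subseteq> {\<alpha>\<in>monomials d. \<forall>v. lookup \<gamma> v \<le> lookup \<alpha> v}"
      by (auto simp: monomials_def deg_add lookup_add)
    show "(\<lambda>\<alpha>. \<alpha> - \<gamma>) ` {\<alpha>\<in>monomials d. \<forall>v. lookup \<gamma> v \<le> lookup \<alpha> v} \<subseteq> monomials (d - int (deg \<gamma>))"
    proof
      fix \<beta> assume "\<beta> \<in> (\<lambda>\<alpha>. \<alpha> - \<gamma>) ` {\<alpha>\<in>monomials d. \<forall>v. lookup \<gamma> v \<le> lookup \<alpha> v}"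
      then obtain \<alpha> where \<alpha>: "\<beta> = \<alpha> - \<gamma>" "\<alpha> \<in> monomials d" "\<forall>v. lookup \<gamma> v \<le> lookup \<alpha> v" by blast
      have "deg (\<alpha> - \<gamma>) + deg \<gamma> = deg \<alpha>" using cancel[OF \<alpha>(3)] deg_add[of "\<alpha> - \<gamma>" \<gamma>] by simp
      then show "\<beta> \<in> monomials (d - int (deg \<gamma>))" using \<alpha>(1,2) by (simp add: monomials_def)
    qed
  qed
  from bij_betw_same_card[OF this] show ?thesis using card_monomials[of "d - int (deg \<gamma>)"] by simp
qed

text \<open>The monomials of degree \<open>d\<close> that are forbidden by multiplicity
  \<open>m\<close> at the \<open>k\<close>-th coordinate point.\<close>

definition over :: "int \<Rightarrow> 4 \<Rightarrow> int \<Rightarrow> (4 \<Rightarrow>\<^sub>0 nat) set" where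
  "over d k m = {\<alpha>\<in>monomials d. d - m < int (lookup \<alpha> k)}"

lemma finite_over [simp]: "finite (over d k m)"
  by (rule finite_subset[OF _ finite_monomials[of d]]) (auto simp: over_def)

lemma card_over:
  assumes "m \<le> d"
  shows "int (card (over d k m)) = int (nat (m + 2) choose 3)"
proof -
  let ?\<gamma> = "single k (nat (d - m + 1)) :: 4 \<Rightarrow>\<^sub>0 nat"
  have "over d k m = {\<alpha>\<in>monomials d. \<forall>v. lookup ?\<gamma> v \<le> lookup \<alpha> v}"
    using assms by (auto simp: over_def lookup_single when_def)
  then show ?thesis using card_monomials_ge[of d ?\<gamma>] assms by (simp add: algebra_simps)
qed

text \<open>These monomials are forbidden by both points. They account for the conditions shared
  along the joining line, and so for the correction terms of the linear expected dimension.\<close>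

lemma card_over_Int:
  assumes "m \<le> d" "n \<le> d" "k \<noteq> l"
  shows "int (card (over d k m \<inter> over d l n)) = int (nat (m + n - d + 1) choose 3)"
proof -
  let ?\<gamma> = "single k (nat (d - m + 1)) + single l (nat (d - n + 1)) :: 4 \<Rightarrow>\<^sub>0 nat"
  have "over d k m \<inter> over d l n = {\<alpha>\<in>monomials d. \<forall>v. lookup ?\<gamma> v \<le> lookup \<alpha> v}"
    using assms by (auto simp: over_def lookup_add lookup_single when_def split: if_splits)
  then show ?thesis using card_monomials_ge[of d ?\<gamma>] assms by (simp add: deg_add algebra_simps)
qed

lemma vanishes_axis_over:
  assumes "homogeneous d F"
  shows "vanishes_to_order m F (axis k 1) \<longleftrightarrow> keys F \<inter> over d k m = {}"
  using assms unfolding vanishes_axis[OF assms] homogeneous_keys over_def by force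

text \<open>Inclusion and exclusion. A monomial forbidden by all three points would have degree
  above \<open>3 * d - a - b - c \<ge> d\<close>, so the triple intersection is empty.\<close>

lemma toric3_card:
  assumes "a \<le> d" "b \<le> d" "c \<le> d" "a + b + c \<le> 2 * d"
  shows "int (card (monomials d - (over d 1 a \<union> over d 2 b \<union> over d 3 c))) =
     int (nat (d + 3) choose 3) - int (nat (a + 2) choose 3) - int (nat (b + 2) choose 3) - int (nat (c + 2) choose 3)
     + int (nat (a + b - d + 1) choose 3) + int (nat (a + c - d + 1) choose 3) + int (nat (b + c - d + 1) choose 3)"
proof -
  let ?A = "over d 1 a" and ?B = "over d 2 b" and ?C = "over d 3 c"
  have neq: "(1::4) \<noteq> 2" "(1::4) \<noteq> 3" "(2::4) \<noteq> 3" by simp_all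
  have "\<alpha> \<notin> ?C" if "\<alpha> \<in> ?A" "\<alpha> \<in> ?B" for \<alpha>
  proof
    assume "\<alpha> \<in> ?C"
    then have "3 * d - a - b - c < int (deg \<alpha>)" using that by (simp add: over_def deg_def sum_4)
    then show False using that assms by (simp add: over_def monomials_def)
  qed
  then have ABC: "?A \<inter> ?C \<inter> (?B \<inter> ?C) = {}" by blast
  have sub: "?A \<union> ?B \<union> ?C \<subseteq> monomials d" by (auto simp: over_def)
  have 1: "card (?A \<union> ?B) + card (?A \<inter> ?B) = card ?A + card ?B" by (rule card_Un_Int[symmetric]) auto
  have 2: "card (?A \<union> ?B \<union> ?C) + card ((?A \<union> ?B) \<inter> ?C) = card (?A \<union> ?B) + card ?C"
    by (rule card_Un_Int[symmetric]) auto
  have 3: "card ((?A \<union> ?B) \<inter> ?C) = card (?A \<inter> ?C) + card (?B \<inter> ?C)"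
    unfolding Int_Un_distrib2 by (rule card_Un_disjoint) (use ABC in auto)
  have 4: "card (monomials d - (?A \<union> ?B \<union> ?C)) + card (?A \<union> ?B \<union> ?C) = card (monomials d :: (4 \<Rightarrow>\<^sub>0 nat) set)"
    using card_mono[OF finite_monomials sub] card_Diff_subset[OF _ sub] by auto
  show ?thesis
    using 1 2 3 4 card_monomials[of d] card_over[OF assms(1), of 1] card_over[OF assms(2), of 2] card_over[OF assms(3), of 3]
      card_over_Int[OF assms(1,2) neq(1)] card_over_Int[OF assms(1,3) neq(2)] card_over_Int[OF assms(2,3) neq(3)]
    by linarith
qed

section \<open>Moving points to coordinate points\<close>

text \<open>If this determinant, or \<open>minor2\<close> for two points, is nonzero, standard basis
  vectors complete the points to a basis, and an invertible matrix carries coordinate points to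
  them.\<close>

definition minor3 :: "(nat \<Rightarrow> complex ^ 4) \<Rightarrow> complex" where
  "minor3 p = p 1 $ 1 * (p 2 $ 2 * p 3 $ 3) - p 1 $ 1 * (p 2 $ 3 * p 3 $ 2)
     - (p 1 $ 2 * (p 2 $ 1 * p 3 $ 3) - p 1 $ 2 * (p 2 $ 3 * p 3 $ 1))
     + (p 1 $ 3 * (p 2 $ 1 * p 3 $ 2) - p 1 $ 3 * (p 2 $ 2 * p 3 $ 1))"

definition minor2 :: "nat \<Rightarrow> (nat \<Rightarrow> complex ^ 4) \<Rightarrow> complex" where
  "minor2 j p = p 1 $ 1 * p j $ 2 - p 1 $ 2 * p j $ 1"

lemma generic_minor3: "generic (\<lambda>p. minor3 p \<noteq> 0)"
  unfolding generic_def
proof (intro exI conjI allI impI)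
  have "(\<lambda>p. p 1 $ u * (p 2 $ v * p 3 $ w)) \<in> multihom (single 1 1 + (single 2 1 + single 3 1))" for u v w
    by (intro multihom_mult multihom_coord) auto
  then show "minor3 \<in> multihom (single 1 1 + (single 2 1 + single 3 1))"
    unfolding minor3_def by (intro multihom_add multihom_diff)
  show "minor3 (\<lambda>i. axis (of_nat i) 1) \<noteq> 0" by (simp add: minor3_def axis_def)
qed

lemma generic_minor2: "j \<in> {2..9} \<Longrightarrow> generic (\<lambda>p. minor2 j p \<noteq> 0)"
  unfolding generic_def
proof (intro exI conjI allI impI)
  assume j: "j \<in> {2..9}"
  then have "(\<lambda>p. p 1 $ u * p j $ v) \<in> multihom (single 1 1 + single j 1)" for u v
    by (intro multihom_mult multihom_coord) auto
  then show "minor2 j \<in> multihom (single 1 1 + single j 1)"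
    unfolding minor2_def by (intro multihom_diff)
  show "minor2 j (\<lambda>i. if i = 1 then axis 1 1 else axis 2 1) \<noteq> 0" using j by (simp add: minor2_def axis_def)
qed

lemma invertible_4:
  fixes A :: "complex ^ 4 ^ 4"
  assumes "\<And>x. A *v x = 0 \<Longrightarrow> x = 0"
  shows "\<exists>B. A ** B = mat 1 \<and> B ** A = mat 1"
proof -
  have "invertible A" using assms invertible_left_inverse matrix_left_invertible_ker by metis
  then show ?thesis by (auto simp: invertible_def)
qed

lemma matrix_vector_4: "(A *v x) $ i = A $ i $ 1 * x $ 1 + A $ i $ 2 * x $ 2 + A $ i $ 3 * x $ 3 + A $ i $ 4 * x $ 4"
  for A :: "complex ^ 4 ^ 4"
  by (simp add: matrix_vector_mult_def sum_4)

lemma frame3: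
  assumes "minor3 p \<noteq> 0"
  shows "\<exists>A B :: complex ^ 4 ^ 4. A ** B = mat 1 \<and> B ** A = mat 1 \<and> A *v axis 1 1 = p 1 \<and> A *v axis 2 1 = p 2 \<and> A *v axis 3 1 = p 3"
proof -
  define A :: "complex ^ 4 ^ 4" where
    "A = (\<chi> i j. if j = 1 then p 1 $ i else if j = 2 then p 2 $ i else if j = 3 then p 3 $ i else if i = 4 then 1 else 0)"
  have "x = 0" if x: "A *v x = 0" for x
  proof -
    have r: "(A *v x) $ i = 0" for i using x by simp
    have e1: "p 1 $ 1 * x $ 1 + p 2 $ 1 * x $ 2 + p 3 $ 1 * x $ 3 = 0" using r[of 1] by (simp add: matrix_vector_4 A_def)
    have e2: "p 1 $ 2 * x $ 1 + p 2 $ 2 * x $ 2 + p 3 $ 2 * x $ 3 = 0" using r[of 2] by (simp add: matrix_vector_4 A_def)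
    have e3: "p 1 $ 3 * x $ 1 + p 2 $ 3 * x $ 2 + p 3 $ 3 * x $ 3 = 0" using r[of 3] by (simp add: matrix_vector_4 A_def)
    have "minor3 p * x $ 1 = 0" using e1 e2 e3 unfolding minor3_def by algebra
    moreover have "minor3 p * x $ 2 = 0" using e1 e2 e3 unfolding minor3_def by algebra
    moreover have "minor3 p * x $ 3 = 0" using e1 e2 e3 unfolding minor3_def by algebra
    ultimately have x123: "x $ 1 = 0" "x $ 2 = 0" "x $ 3 = 0" using assms by simp_all
    moreover have "x $ 4 = 0" using r[of 4] x123 by (simp add: matrix_vector_4 A_def)
    ultimately show "x = 0" unfolding vec_eq_iff forall_4 by simp
  qed
  then obtain B where "A ** B = mat 1" "B ** A = mat 1" using invertible_4 by blast
  moreover have "A *v axis 1 1 = p 1" "A *v axis 2 1 = p 2" "A *v axis 3 1 = p 3"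
    unfolding vec_eq_iff forall_4 by (simp_all add: matrix_vector_4 A_def axis_def)
  ultimately show ?thesis by blast
qed

lemma frame2:
  assumes "minor2 j p \<noteq> 0"
  shows "\<exists>A B :: complex ^ 4 ^ 4. A ** B = mat 1 \<and> B ** A = mat 1 \<and> A *v axis 1 1 = p 1 \<and> A *v axis 2 1 = p j"
proof -
  define A :: "complex ^ 4 ^ 4" where
    "A = (\<chi> i k. if k = 1 then p 1 $ i else if k = 2 then p j $ i else if i = k then 1 else 0)"
  have "x = 0" if x: "A *v x = 0" for x
  proof -
    have r: "(A *v x) $ i = 0" for i using x by simp
    have e1: "p 1 $ 1 * x $ 1 + p j $ 1 * x $ 2 = 0" using r[of 1] by (simp add: matrix_vector_4 A_def)
    have e2: "p 1 $ 2 * x $ 1 + p j $ 2 * x $ 2 = 0" using r[of 2] by (simp add: matrix_vector_4 A_def)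
    have "minor2 j p * x $ 1 = 0" using e1 e2 unfolding minor2_def by algebra
    moreover have "minor2 j p * x $ 2 = 0" using e1 e2 unfolding minor2_def by algebra
    ultimately have x12: "x $ 1 = 0" "x $ 2 = 0" using assms by simp_all
    moreover have "x $ 3 = 0" "x $ 4 = 0" using r[of 3] r[of 4] x12 by (simp_all add: matrix_vector_4 A_def)
    ultimately show "x = 0" unfolding vec_eq_iff forall_4 by simp
  qed
  then obtain B where "A ** B = mat 1" "B ** A = mat 1" using invertible_4 by blast
  moreover have "A *v axis 1 1 = p 1" "A *v axis 2 1 = p j"
    unfolding vec_eq_iff forall_4 by (simp_all add: matrix_vector_4 A_def axis_def)
  ultimately show ?thesis by blast
qed

lemma lin_subst_add: "lin_subst A (F + G) = lin_subst A F + lin_subst A G"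
  by (simp add: lin_subst_def psubst_add)

lemma lin_subst_scale: "lin_subst A (cpoly_scale c F) = cpoly_scale c (lin_subst A F)"
  by (simp add: lin_subst_def psubst_mult cpoly_scale_def)

lemma matrix_inverse_apply: "B ** A = mat 1 \<Longrightarrow> B *v (A *v x) = x"
  by (simp add: matrix_vector_mul_assoc)

text \<open>Once the points are coordinate points, every condition concerns a single
  monomial.\<close>

lemma dim_three_points:
  assumes p: "minor3 p \<noteq> 0" and m: "\<forall>i\<in>{4..9}. m i \<le> 0"
  shows "cpoly_dim (linear_system d m p) =
    card (monomials d - (over d 1 (m 1) \<union> over d 2 (m 2) \<union> over d 3 (m 3)))"
proof -
  obtain A B :: "complex ^ 4 ^ 4" where AB: "A ** B = mat 1" "B ** A = mat 1"
    and A: "A *v axis 1 1 = p 1" "A *v axis 2 1 = p 2" "A *v axis 3 1 = p 3"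
    using frame3[OF p] by blast
  define q where "q = (\<lambda>i. B *v p i)"
  have q: "q 1 = axis 1 1" "q 2 = axis 2 1" "q 3 = axis 3 1"
    unfolding q_def A[symmetric] matrix_inverse_apply[OF AB(2)] by simp_all
  have "(\<lambda>i. A *v q i) = p" by (simp add: q_def matrix_inverse_apply[OF AB(1)])
  then have "cpoly_dim (linear_system d m p) = cpoly_dim (linear_system d m q)"
    using dim_linear_system_lin[OF AB, of d m q] by simp
  moreover have "linear_system d m q = {F. keys F \<subseteq> monomials d - (over d 1 (m 1) \<union> over d 2 (m 2) \<union> over d 3 (m 3))}"
  proof (intro set_eqI)
    fix F
    have "F \<in> linear_system d m q \<longleftrightarrow> homogeneous d F \<and> vanishes_to_order (m 1) F (axis 1 1) \<and>
        vanishes_to_order (m 2) F (axis 2 1) \<and> vanishes_to_order (m 3) F (axis 3 1)"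
      using m unfolding linear_system_def ball_9 by (simp add: q vanishes_nonpos del: One_nat_def)
    also have "\<dots> \<longleftrightarrow> keys F \<subseteq> monomials d - (over d 1 (m 1) \<union> over d 2 (m 2) \<union> over d 3 (m 3))"
    proof (cases "homogeneous d F")
      case True
      show ?thesis unfolding vanishes_axis_over[OF True] using True[unfolded homogeneous_keys] homogeneous_keys[of d F] by blast
    next
      case False
      then show ?thesis by (auto simp: homogeneous_keys)
    qed
    finally show "F \<in> linear_system d m q \<longleftrightarrow>
        F \<in> {F. keys F \<subseteq> monomials d - (over d 1 (m 1) \<union> over d 2 (m 2) \<union> over d 3 (m 3))}"
      by simp
  qed
  ultimately show ?thesis using monomial_space(2)[of "monomials d - (over d 1 (m 1) \<union> over d 2 (m 2) \<union> over d 3 (m 3))"]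
    by simp
qed

text \<open>With the first point at a coordinate point, \<open>d - m 1 < 0\<close> forbids every
  monomial.\<close>

lemma no_form_of_large_multiplicity:
  assumes "minor2 2 p \<noteq> 0" "m 1 > d" "F \<in> linear_system d m p"
  shows "F = 0"
proof -
  obtain A B :: "complex ^ 4 ^ 4" where AB: "A ** B = mat 1" "B ** A = mat 1" and A: "A *v axis 1 1 = p 1"
    using frame2[OF assms(1)] by blast
  have F: "homogeneous d F" "vanishes_to_order (m 1) F (A *v axis 1 1)"
    using assms(3) unfolding linear_system_def A by auto
  then have "keys (lin_subst A F) \<inter> over d 1 (m 1) = {}"
    using vanishes_axis_over[OF homogeneous_lin_subst[OF F(1)]] vanishes_lin_subst by blast
  moreover have "keys (lin_subst A F) \<subseteq> monomials d" using homogeneous_lin_subst[OF F(1)] homogeneous_keys by blast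
  moreover have "over d 1 (m 1) = monomials d" using assms(2) by (auto simp: over_def)
  ultimately have "keys (lin_subst A F) = {}" by blast
  then have "lin_subst A F = 0" using keys_eq_empty by blast
  then have "lin_subst B (lin_subst A F) = 0" by (simp add: lin_subst_def)
  then show ?thesis by (simp add: lin_subst_compose AB lin_subst_mat_1)
qed

text \<open>Imposing the \<open>j\<close>-th point on surfaces with the given multiplicity at the first point: along
  the line through the two points \<open>m 1 + m j - d + 1 choose 3\<close> of the conditions are redundant.\<close>

lemma second_point_conditions:
  assumes p: "minor2 j p \<noteq> 0" and m: "m 1 \<le> d" "m j \<le> d"
  shows "\<exists>\<Phi>. finite \<Phi> \<and> (\<forall>\<phi>\<in>\<Phi>. functional \<phi>) \<and>
    int (card \<Phi>) \<le> int (nat (m j + 2) choose 3) - int (nat (m 1 + m j - d + 1) choose 3) \<and>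
    (\<forall>F. homogeneous d F \<and> vanishes_to_order (m 1) F (p 1) \<and> (\<forall>\<phi>\<in>\<Phi>. \<phi> F = 0) \<longrightarrow> vanishes_to_order (m j) F (p j))"
proof -
  obtain A B :: "complex ^ 4 ^ 4" where AB: "A ** B = mat 1" "B ** A = mat 1" and A: "A *v axis 1 1 = p 1" "A *v axis 2 1 = p j"
    using frame2[OF p] by blast
  \<comment> \<open>Monomials in the overlap are already excluded by the first point; leaving them
    out gives the saving along the line.\<close>
  let ?S = "over d 2 (m j) - over d 1 (m 1)"
  define \<Phi> where "\<Phi> = (\<lambda>\<alpha> F. lookup (lin_subst A F) \<alpha>) ` ?S"
  have neq: "(1::4) \<noteq> 2" by simp
  have "card ?S + card (over d 1 (m 1) \<inter> over d 2 (m j)) = card (over d 2 (m j))"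
    using card_Int_Diff[of "over d 2 (m j)" "over d 1 (m 1)"] by (simp add: Int_commute)
  then have S: "int (card ?S) = int (nat (m j + 2) choose 3) - int (nat (m 1 + m j - d + 1) choose 3)"
    using card_over[OF m(2), of 2] card_over_Int[OF m neq] by linarith
  have "card \<Phi> \<le> card ?S" unfolding \<Phi>_def by (rule card_image_le) simp
  moreover have "functional (\<lambda>F. lookup (lin_subst A F) \<alpha>)" for \<alpha>
    unfolding functional_def by (simp add: lin_subst_add lin_subst_scale lookup_add)
  moreover have "vanishes_to_order (m j) F (p j)"
    if F: "homogeneous d F" "vanishes_to_order (m 1) F (p 1)" "\<forall>\<phi>\<in>\<Phi>. \<phi> F = 0" for F
  proof -
    let ?G = "lin_subst A F"
    have G: "homogeneous d ?G" using F(1) by (rule homogeneous_lin_subst)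
    have "keys ?G \<inter> over d 1 (m 1) = {}"
      using F(2) vanishes_axis_over[OF G] vanishes_lin_subst A(1) by metis
    moreover have "\<alpha> \<notin> ?S" if "\<alpha> \<in> keys ?G" for \<alpha>
      using F(3) that by (auto simp: \<Phi>_def in_keys_iff)
    ultimately have "keys ?G \<inter> over d 2 (m j) = {}" by blast
    then have "vanishes_to_order (m j) ?G (axis 2 1)" using vanishes_axis_over[OF G] by blast
    moreover have "B *v p j = axis 2 1" unfolding A(2)[symmetric] by (rule matrix_inverse_apply[OF AB(2)])
    ultimately have "vanishes_to_order (m j) ?G (B *v p j)" by (simp only:)
    then have "vanishes_to_order (m j) (lin_subst B ?G) (p j)" by (rule vanishes_lin_subst)
    then show ?thesis by (simp add: lin_subst_compose AB lin_subst_mat_1)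
  qed
  ultimately show ?thesis using S by (intro exI[of _ \<Phi>]) (auto simp: \<Phi>_def)
qed

text \<open>The dimension for three points is known exactly. The other six points are imposed on
  that system, saving only the conditions along their lines to the first point. This keeps all line
  corrections of a Cremona reduced system: the line through points 2 and 3 is part of the
  three-point count.\<close>

lemma dim_lower_bound:
  assumes p: "minor3 p \<noteq> 0" "\<forall>j\<in>{4..9}. minor2 j p \<noteq> 0" and m: "\<forall>i\<in>{1..9}. m i \<le> d" "m 1 + m 2 + m 3 \<le> 2 * d"
  shows "int (cpoly_dim (linear_system d m p)) \<ge>
     int (card (monomials d - (over d 1 (m 1) \<union> over d 2 (m 2) \<union> over d 3 (m 3))))
     - (\<Sum>j=4..9. int (nat (m j + 2) choose 3) - int (nat (m 1 + m j - d + 1) choose 3))"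
proof -
  have "\<forall>j\<in>{4..9}. \<exists>\<Phi>. finite \<Phi> \<and> (\<forall>\<phi>\<in>\<Phi>. functional \<phi>) \<and>
    int (card \<Phi>) \<le> int (nat (m j + 2) choose 3) - int (nat (m 1 + m j - d + 1) choose 3) \<and>
    (\<forall>F. homogeneous d F \<and> vanishes_to_order (m 1) F (p 1) \<and> (\<forall>\<phi>\<in>\<Phi>. \<phi> F = 0) \<longrightarrow> vanishes_to_order (m j) F (p j))"
    using p(2) m(1) by (intro ballI second_point_conditions) auto
  from bchoice[OF this] obtain \<Phi> where \<Phi>': "\<forall>j\<in>{4..9}. finite (\<Phi> j) \<and> (\<forall>\<phi>\<in>\<Phi> j. functional \<phi>) \<and>
    int (card (\<Phi> j)) \<le> int (nat (m j + 2) choose 3) - int (nat (m 1 + m j - d + 1) choose 3) \<and>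
    (\<forall>F. homogeneous d F \<and> vanishes_to_order (m 1) F (p 1) \<and> (\<forall>\<phi>\<in>\<Phi> j. \<phi> F = 0) \<longrightarrow> vanishes_to_order (m j) F (p j))"
    by (elim exE)
  note \<Phi> = \<Phi>'[THEN bspec, THEN conjunct1] \<Phi>'[THEN bspec, THEN conjunct2, THEN conjunct1]
    \<Phi>'[THEN bspec, THEN conjunct2, THEN conjunct2, THEN conjunct1]
    \<Phi>'[THEN bspec, THEN conjunct2, THEN conjunct2, THEN conjunct2, rule_format]
  define m' where "m' = (\<lambda>i. if i \<le> 3 then m i else 0)"
  let ?V = "linear_system d m' p" and ?\<Phi> = "\<Union>j\<in>{4..9}. \<Phi> j"
  have "cpoly_dim ?V = card (monomials d - (over d 1 (m' 1) \<union> over d 2 (m' 2) \<union> over d 3 (m' 3)))"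
    by (rule dim_three_points[OF p(1)]) (simp add: m'_def)
  then have V: "cpoly_dim ?V = card (monomials d - (over d 1 (m 1) \<union> over d 2 (m 2) \<union> over d 3 (m 3)))"
    by (simp add: m'_def)
  have "cpoly_dim ?V \<le> cpoly_dim {F\<in>?V. \<forall>\<phi>\<in>?\<Phi>. \<phi> F = 0} + card ?\<Phi>"
  proof (rule dim_kernel[OF _ fin_space_linear_system])
    show "finite ?\<Phi>" by (rule finite_UN_I) (simp, rule \<Phi>(1))
    show "functional \<phi>" if "\<phi> \<in> ?\<Phi>" for \<phi> using that \<Phi>(2) by blast
  qed
  moreover have "cpoly_dim {F\<in>?V. \<forall>\<phi>\<in>?\<Phi>. \<phi> F = 0} \<le> cpoly_dim (linear_system d m p)"
  proof (rule dim_subset_le[OF fin_space_linear_system], rule subsetI)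
    fix F assume F: "F \<in> {F\<in>?V. \<forall>\<phi>\<in>?\<Phi>. \<phi> F = 0}"
    then have h: "homogeneous d F" and v: "\<And>i. i \<in> {1..9} \<Longrightarrow> vanishes_to_order (m' i) F (p i)"
      unfolding linear_system_def by blast+
    have "vanishes_to_order (m i) F (p i)" if i: "i \<in> {1..9}" for i
    proof (cases "i \<le> 3")
      case True
      then show ?thesis using v[OF i] by (simp add: m'_def)
    next
      case False
      then have i4: "i \<in> {4..9}" using i by simp
      have "vanishes_to_order (m 1) F (p 1)" using v[of 1] by (simp add: m'_def)
      moreover have "\<phi> F = 0" if "\<phi> \<in> \<Phi> i" for \<phi> using F i4 that by blast
      ultimately show ?thesis using h by (intro \<Phi>(4)[OF i4]) blast
    qed
    then show "F \<in> linear_system d m p" using h by (simp add: linear_system_def)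
  qed
  moreover have "int (card ?\<Phi>) \<le> (\<Sum>j=4..9. int (nat (m j + 2) choose 3) - int (nat (m 1 + m j - d + 1) choose 3))"
  proof -
    have "int (card ?\<Phi>) \<le> int (\<Sum>j=4..9. card (\<Phi> j))" 
      unfolding of_nat_le_iff by (rule card_UN_le) simp
    also have "\<dots> \<le> (\<Sum>j=4..9. int (nat (m j + 2) choose 3) - int (nat (m 1 + m j - d + 1) choose 3))"
      unfolding of_nat_sum by (rule sum_mono) (rule \<Phi>(3))
    finally show ?thesis .
  qed
  ultimately show ?thesis using V by linarith
qed

section \<open>Quadrics through nine points and the residual system\<close>

lemma ex_quadric: "\<exists>Q. Q \<noteq> 0 \<and> Q \<in> linear_system 2 (\<lambda>_. 1) p"
proof -
  let ?W = "{F :: 4 cpoly. keys F \<subseteq> monomials 2}"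
  let ?\<Phi> = "(\<lambda>i F. poly_eval (\<lambda>v. p i $ v) F) ` {1..9}"
  have ev: "functional (\<lambda>F. poly_eval x F)" for x :: "4 \<Rightarrow> complex"
    unfolding functional_def cpoly_scale_def by (simp add: poly_eval_add poly_eval_mult)
  have "card (monomials 2 :: (4 \<Rightarrow>\<^sub>0 nat) set) = 10"
    using card_monomials[of 2] by (simp add: numeral_eq_Suc)
  then have "cpoly_dim ?W = 10" using monomial_space(2)[OF finite_monomials] by metis
  moreover have "cpoly_dim ?W \<le> cpoly_dim {F\<in>?W. \<forall>\<phi>\<in>?\<Phi>. \<phi> F = 0} + card ?\<Phi>"
    by (rule dim_kernel[OF _ monomial_space(1)]) (use ev in auto)
  moreover have "card ?\<Phi> \<le> 9" using card_image_le[of "{1..9}" "\<lambda>i F. poly_eval (\<lambda>v. p i $ v) F"] by simp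
  ultimately have "cpoly_dim {F\<in>?W. \<forall>\<phi>\<in>?\<Phi>. \<phi> F = 0} \<ge> 1" by linarith
  moreover have "{F\<in>?W. \<forall>\<phi>\<in>?\<Phi>. \<phi> F = 0} \<subseteq> linear_system 2 (\<lambda>_. 1) p"
    unfolding linear_system_def vanishes_to_order_def homogeneous_keys by auto
  then have "cpoly_dim {F\<in>?W. \<forall>\<phi>\<in>?\<Phi>. \<phi> F = 0} \<le> cpoly_dim (linear_system 2 (\<lambda>_. 1) p)"
    by (rule dim_subset_le[OF fin_space_linear_system])
  ultimately have d: "cpoly_dim (linear_system 2 (\<lambda>_. 1) p) \<ge> 1" by linarith
  show ?thesis
  proof (rule ccontr)
    assume "\<not> ?thesis"
    then have "linear_system 2 (\<lambda>_. 1) p \<subseteq> cpoly_span {}" by auto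
    then have "cpoly_dim (linear_system 2 (\<lambda>_. 1) p) \<le> card ({} :: 4 cpoly set)" by (rule cpoly.dim_le_card) simp
    then show False using d by simp
  qed
qed

text \<open>Ten monomials of degree 2 against nine conditions give a quadric through any nine
  points. Multiplication by it is injective and raises each multiplicity by at least one, so no
  generality is required.\<close>

lemma dim_residual_le: "cpoly_dim (linear_system (d - 2) (\<lambda>i. m i - 1) p) \<le> cpoly_dim (linear_system d m p)"
proof -
  obtain Q where Q: "Q \<noteq> 0" "Q \<in> linear_system 2 (\<lambda>_. 1) p" using ex_quadric by blast
  show ?thesis
  proof (rule dim_inj_image_ge[where f = "\<lambda>F. Q * F", OF _ fin_space_linear_system _ _ fin_space_linear_system])
    show "linear_map ((*) Q)"
      by (rule linear_mapI) (simp_all add: cpoly_scale_def distrib_left mult.left_commute)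
    show "inj_on ((*) Q) (linear_system (d - 2) (\<lambda>i. m i - 1) p)"
      using Q(1) by (auto intro!: inj_onI)
    show "(*) Q ` linear_system (d - 2) (\<lambda>i. m i - 1) p \<subseteq> linear_system d m p"
    proof
      fix G assume "G \<in> (*) Q ` linear_system (d - 2) (\<lambda>i. m i - 1) p"
      then obtain F where G: "G = Q * F" "F \<in> linear_system (d - 2) (\<lambda>i. m i - 1) p" by blast
      have "homogeneous d G" using G Q(2) unfolding linear_system_def homogeneous_deg_in
        by (auto intro: deg_in_mult[of "{2}" Q "{d - 2}"])
      moreover have "vanishes_to_order (m i) G (p i)" if "i \<in> {1..9}" for i
        using vanishes_mult[of 1 Q "p i" "m i - 1" F] G Q(2) that by (simp add: linear_system_def)
      ultimately show "G \<in> linear_system d m p" by (simp add: linear_system_def)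
    qed
  qed
qed

section \<open>Restriction to the quadric\<close>

definition segre :: "complex \<Rightarrow> complex \<Rightarrow> complex ^ 4" where
  "segre x y = (\<chi> v. if v = 1 then 1 else if v = 2 then x else if v = 3 then y else x * y)"

lemma segre_nth [simp]: "segre x y $ 1 = 1" "segre x y $ 2 = x" "segre x y $ 3 = y" "segre x y $ 4 = x * y"
  by (simp_all add: segre_def)

definition segre_quadric :: "4 cpoly" where
  "segre_quadric = var 1 * var 4 - var 2 * var 3"

lemma homogeneous_deg: "homogeneous d F \<Longrightarrow> \<alpha> \<in> keys F \<Longrightarrow> int (deg \<alpha>) = d"
  by (simp add: homogeneous_deg_in deg_in_def)

text \<open>The exponents of \<open>x\<close> and \<open>y\<close> in the restriction of a monomial
  to \<open>segre x y\<close>.\<close>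

definition bideg :: "(4 \<Rightarrow>\<^sub>0 nat) \<Rightarrow> nat \<times> nat" where
  "bideg \<alpha> = (lookup \<alpha> 2 + lookup \<alpha> 4, lookup \<alpha> 3 + lookup \<alpha> 4)"

text \<open>The coefficients of the form of bidegree \<open>(d, d)\<close> obtained by restricting to the quadric.\<close>

definition restrict_coeff :: "4 cpoly \<Rightarrow> nat \<times> nat \<Rightarrow> complex" where
  "restrict_coeff F \<beta> = (\<Sum>\<alpha>\<in>keys F. if bideg \<alpha> = \<beta> then lookup F \<alpha> else 0)"

lemma restrict_coeff_superset:
  "finite S \<Longrightarrow> keys F \<subseteq> S \<Longrightarrow> restrict_coeff F \<beta> = (\<Sum>\<alpha>\<in>S. if bideg \<alpha> = \<beta> then lookup F \<alpha> else 0)"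
  unfolding restrict_coeff_def by (rule sum.mono_neutral_left) (auto simp: in_keys_iff)

lemma restrict_coeff_add: "restrict_coeff (F + G) \<beta> = restrict_coeff F \<beta> + restrict_coeff G \<beta>"
proof -
  let ?S = "keys F \<union> keys G"
  have "restrict_coeff (F + G) \<beta> = (\<Sum>\<alpha>\<in>?S. if bideg \<alpha> = \<beta> then lookup (F + G) \<alpha> else 0)"
    by (rule restrict_coeff_superset) (use keys_add[of F G] in auto)
  also have "\<dots> = (\<Sum>\<alpha>\<in>?S. (if bideg \<alpha> = \<beta> then lookup F \<alpha> else 0) + (if bideg \<alpha> = \<beta> then lookup G \<alpha> else 0))"
    by (rule sum.cong) (simp_all add: lookup_add)
  also have "\<dots> = restrict_coeff F \<beta> + restrict_coeff G \<beta>"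
    using restrict_coeff_superset[of ?S F \<beta>] restrict_coeff_superset[of ?S G \<beta>] by (simp add: sum.distrib)
  finally show ?thesis .
qed

lemma restrict_coeff_0 [simp]: "restrict_coeff 0 \<beta> = 0"
  by (simp add: restrict_coeff_def)

lemma restrict_coeff_single: "restrict_coeff (single \<alpha> c) \<beta> = (if bideg \<alpha> = \<beta> then c else 0)"
  by (cases "c = 0") (simp_all add: restrict_coeff_def)

lemma restrict_coeff_uminus: "restrict_coeff (- F) \<beta> = - restrict_coeff F \<beta>"
  using restrict_coeff_add[of F "- F" \<beta>] by (simp add: add_eq_0_iff)

lemma restrict_coeff_scale: "restrict_coeff (cpoly_scale c F) \<beta> = c * restrict_coeff F \<beta>"
proof -
  have "restrict_coeff (cpoly_scale c F) \<beta> = (\<Sum>\<alpha>\<in>keys F. if bideg \<alpha> = \<beta> then c * lookup F \<alpha> else 0)"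
    using restrict_coeff_superset[OF finite_keys keys_cpoly_scale[of c F], of \<beta>] unfolding lookup_cpoly_scale .
  also have "\<dots> = (\<Sum>\<alpha>\<in>keys F. c * (if bideg \<alpha> = \<beta> then lookup F \<alpha> else 0))"
    by (rule sum.cong) simp_all
  finally show ?thesis by (simp add: restrict_coeff_def sum_distrib_left)
qed

lemma segre_quadric_single:
  "segre_quadric * single \<alpha> c = single (\<alpha> + single 1 1 + single 4 1) c - single (\<alpha> + single 2 1 + single 3 1) c"
  by (simp add: segre_quadric_def var_def mult_single left_diff_distrib add_ac)

lemma restrict_coeff_quadric: "restrict_coeff (segre_quadric * G) \<beta> = 0"
proof (induction G rule: cpoly_induct)
  case (single \<alpha> c)
  have "bideg (\<alpha> + single 1 1 + single 4 1) = bideg (\<alpha> + single 2 1 + single 3 1)"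
    by (simp add: bideg_def lookup_add lookup_single when_def)
  then show ?case unfolding segre_quadric_single diff_conv_add_uminus restrict_coeff_add restrict_coeff_uminus
    by (simp add: restrict_coeff_single)
qed (simp_all add: distrib_left restrict_coeff_add)

text \<open>Rewriting the product of variables 2 and 3 as the product of variables 1 and 4 lowers
  the exponent of variable 2. It stops when variable 2 or 3 is absent.\<close>

lemma monomial_division:
  "int (deg \<alpha>) = d \<Longrightarrow> \<exists>G N. single \<alpha> c = segre_quadric * G + N \<and> homogeneous (d - 2) G \<and>
     homogeneous d N \<and> (\<forall>\<beta>\<in>keys N. lookup \<beta> 2 = 0 \<or> lookup \<beta> 3 = 0)"
proof (induction "lookup \<alpha> 2" arbitrary: \<alpha>)
  case 0
  then show ?case by (intro exI[of _ 0] exI[of _ "single \<alpha> c"]) (auto simp: homogeneous_deg_in deg_in_single split: if_splits)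
next
  case (Suc n)
  show ?case
  proof (cases "lookup \<alpha> 3 = 0")
    case True
    then show ?thesis using Suc.prems
      by (intro exI[of _ 0] exI[of _ "single \<alpha> c"]) (auto simp: homogeneous_deg_in deg_in_single split: if_splits)
  next
    case False
    define \<gamma> where "\<gamma> = \<alpha> - single 2 1 - single 3 1"
    have pos: "lookup \<alpha> 2 > 0" "lookup \<alpha> 3 > 0" using Suc.hyps(2) False by linarith+
    have \<alpha>: "\<alpha> = \<gamma> + single 2 1 + single 3 1"
    proof (rule poly_mapping_eqI)
      fix v show "lookup \<alpha> v = lookup (\<gamma> + single 2 1 + single 3 1) v"
        using pos by (auto simp: \<gamma>_def lookup_add lookup_minus lookup_single when_def)
    qed
    let ?\<beta> = "\<gamma> + single 1 1 + single 4 1"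
    have deg\<gamma>: "int (deg \<gamma>) = d - 2" using Suc.prems unfolding \<alpha> by (simp add: deg_add)
    then have "int (deg ?\<beta>) = d" by (simp add: deg_add)
    moreover have "n = lookup ?\<beta> 2" using Suc.hyps(2) by (simp add: \<gamma>_def lookup_add lookup_minus lookup_single when_def)
    ultimately obtain G N where GN: "single ?\<beta> c = segre_quadric * G + N" "homogeneous (d - 2) G"
      "homogeneous d N" "\<forall>\<beta>\<in>keys N. lookup \<beta> 2 = 0 \<or> lookup \<beta> 3 = 0"
      using Suc.hyps(1) by blast
    have "single \<alpha> c = single ?\<beta> c - segre_quadric * single \<gamma> c"
      unfolding segre_quadric_single using \<alpha> by simp
    also have "\<dots> = segre_quadric * (G - single \<gamma> c) + N" unfolding GN(1) by (simp add: right_diff_distrib)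
    finally have "single \<alpha> c = segre_quadric * (G - single \<gamma> c) + N" .
    moreover have "homogeneous (d - 2) (G - single \<gamma> c)"
      using GN(2) deg\<gamma> unfolding homogeneous_deg_in by (intro deg_in_diff deg_in_single) simp_all
    ultimately show ?thesis using GN(3,4) by blast
  qed
qed

lemma quadric_division:
  assumes "homogeneous d F"
  shows "\<exists>G N. F = segre_quadric * G + N \<and> homogeneous (d - 2) G \<and>
     homogeneous d N \<and> (\<forall>\<beta>\<in>keys N. lookup \<beta> 2 = 0 \<or> lookup \<beta> 3 = 0)"
proof -
  define P where "P F \<longleftrightarrow> (\<exists>G N. F = segre_quadric * G + N \<and> homogeneous (d - 2) G \<and>
     homogeneous d N \<and> (\<forall>\<beta>\<in>keys N. lookup \<beta> 2 = 0 \<or> lookup \<beta> 3 = 0))" for F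
  have PI: "P F" if "F = segre_quadric * G + N" "homogeneous (d - 2) G" "homogeneous d N"
    "\<forall>\<beta>\<in>keys N. lookup \<beta> 2 = 0 \<or> lookup \<beta> 3 = 0" for F G N
    unfolding P_def by (rule exI[of _ G], rule exI[of _ N]) (intro conjI that)
  have 0: "P 0" by (rule PI[where G = 0 and N = 0]) (simp_all add: homogeneous_deg_in)
  have add: "P (F + G)" if F: "P F" and G: "P G" for F G
  proof -
    obtain G1 N1 where 1: "F = segre_quadric * G1 + N1" "homogeneous (d - 2) G1"
      "homogeneous d N1" "\<forall>\<beta>\<in>keys N1. lookup \<beta> 2 = 0 \<or> lookup \<beta> 3 = 0"
      using F[unfolded P_def] by (elim exE conjE) (rule that)
    obtain G2 N2 where 2: "G = segre_quadric * G2 + N2" "homogeneous (d - 2) G2"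
      "homogeneous d N2" "\<forall>\<beta>\<in>keys N2. lookup \<beta> 2 = 0 \<or> lookup \<beta> 3 = 0"
      using G[unfolded P_def] by (elim exE conjE) (rule that)
    show ?thesis
    proof (rule PI)
      show "F + G = segre_quadric * (G1 + G2) + (N1 + N2)"
        unfolding 1(1) 2(1) distrib_left by (simp only: ac_simps)
      show "homogeneous (d - 2) (G1 + G2)" "homogeneous d (N1 + N2)"
        using 1(2,3) 2(2,3) unfolding homogeneous_deg_in by (simp_all add: deg_in_add)
      show "\<forall>\<beta>\<in>keys (N1 + N2). lookup \<beta> 2 = 0 \<or> lookup \<beta> 3 = 0"
      proof
        fix \<beta> assume "\<beta> \<in> keys (N1 + N2)"
        then have "\<beta> \<in> keys N1 \<or> \<beta> \<in> keys N2" using keys_add[of N1 N2] by blast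
        then show "lookup \<beta> 2 = 0 \<or> lookup \<beta> 3 = 0" using 1(4) 2(4) by (elim disjE) simp_all
      qed
    qed
  qed
  have "P (\<Sum>\<alpha>\<in>A. single \<alpha> (lookup F \<alpha>))" if "finite A" "A \<subseteq> keys F" for A
    using that
  proof (induction A)
    case empty
    then show ?case using 0 by simp
  next
    case (insert \<alpha> A)
    have "\<alpha> \<in> keys F" using insert.prems by blast
    then have "int (deg \<alpha>) = d" using assms unfolding homogeneous_deg_in deg_in_def by blast
    then have "P (single \<alpha> (lookup F \<alpha>))" unfolding P_def by (rule monomial_division)
    moreover have "P (\<Sum>\<alpha>\<in>A. single \<alpha> (lookup F \<alpha>))" using insert.prems by (intro insert.IH) blast
    ultimately show ?case unfolding sum.insert[OF insert.hyps] by (rule add)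
  qed
  from this[OF finite_keys subset_refl] have "P F" unfolding cpoly_sum_single[symmetric] .
  then show ?thesis unfolding P_def .
qed

text \<open>The quadric generates the ideal of forms vanishing on it. Among monomials of equal
  degree without variable 2 or without variable 3, \<open>bideg\<close> is injective, so a remainder
  of the division with zero restriction is itself zero.\<close>

lemma restrict_coeff_eq_0:
  assumes F: "homogeneous d F" and z: "\<And>\<beta>. restrict_coeff F \<beta> = 0"
  shows "\<exists>G. F = segre_quadric * G \<and> homogeneous (d - 2) G"
proof -
  obtain G N where GN: "F = segre_quadric * G + N" "homogeneous (d - 2) G"
      "homogeneous d N" "\<forall>\<beta>\<in>keys N. lookup \<beta> 2 = 0 \<or> lookup \<beta> 3 = 0"
    using quadric_division[OF F] by blast
  have rN: "restrict_coeff N \<beta> = 0" for \<beta>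
    using z[of \<beta>] unfolding GN(1) restrict_coeff_add restrict_coeff_quadric by simp
  have inj: "\<alpha> = \<beta>" if k: "\<alpha> \<in> keys N" "\<beta> \<in> keys N" "bideg \<alpha> = bideg \<beta>" for \<alpha> \<beta>
  proof -
    have "deg \<alpha> = deg \<beta>"
      using homogeneous_deg[OF GN(3) k(1)] homogeneous_deg[OF GN(3) k(2)] by simp
    then have d: "lookup \<alpha> 1 + lookup \<alpha> 2 + lookup \<alpha> 3 + lookup \<alpha> 4 = lookup \<beta> 1 + lookup \<beta> 2 + lookup \<beta> 3 + lookup \<beta> 4"
      by (simp add: deg_def sum_4)
    have b: "lookup \<alpha> 2 + lookup \<alpha> 4 = lookup \<beta> 2 + lookup \<beta> 4" "lookup \<alpha> 3 + lookup \<alpha> 4 = lookup \<beta> 3 + lookup \<beta> 4"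
      using k(3) by (simp_all add: bideg_def)
    \<comment> \<open>When variable 2 or 3 is absent, the smaller entry of \<open>bideg\<close> is
      the exponent of variable 4.\<close>
    have min4: "min (lookup \<gamma> 2 + lookup \<gamma> 4) (lookup \<gamma> 3 + lookup \<gamma> 4) = lookup \<gamma> 4" if "\<gamma> \<in> keys N" for \<gamma>
      using GN(4)[THEN bspec, OF that] by (elim disjE) simp_all
    have "lookup \<alpha> 4 = lookup \<beta> 4" using min4[OF k(1)] min4[OF k(2)] unfolding b by (rule trans[OF sym])
    then have "\<forall>v. lookup \<alpha> v = lookup \<beta> v" unfolding forall_4 using d b by simp
    then show ?thesis by (intro poly_mapping_eqI) blast
  qed
  have "lookup N \<alpha> = 0" for \<alpha>
  proof (rule ccontr)
    assume "lookup N \<alpha> \<noteq> 0"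
    then have a: "\<alpha> \<in> keys N" by (simp add: in_keys_iff)
    have "restrict_coeff N (bideg \<alpha>) = (\<Sum>\<beta>\<in>keys N. if \<beta> = \<alpha> then lookup N \<alpha> else 0)"
      unfolding restrict_coeff_def
    proof (rule sum.cong[OF refl])
      fix \<beta> assume "\<beta> \<in> keys N"
      then have "bideg \<beta> = bideg \<alpha> \<longleftrightarrow> \<beta> = \<alpha>" using inj[OF _ a] by blast
      then show "(if bideg \<beta> = bideg \<alpha> then lookup N \<beta> else 0) = (if \<beta> = \<alpha> then lookup N \<alpha> else 0)" by simp
    qed
    then have "restrict_coeff N (bideg \<alpha>) = lookup N \<alpha>" using a by simp
    then show False using rN \<open>lookup N \<alpha> \<noteq> 0\<close> by simp
  qed
  then have "N = 0" by (intro poly_mapping_eqI) simp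
  then have "F = segre_quadric * G" using GN(1) by simp
  then show ?thesis using GN(2) by (intro exI[of _ G] conjI)
qed

lemma shift_diff: "shift p (F - G) = shift p F - shift p G"
  using shift_add[of p "F - G" G] by simp

lemma partial_deriv_diff: "partial_deriv v (F - G) = partial_deriv v F - partial_deriv v G"
  using partial_deriv_add[of v "F - G" G] by simp

text \<open>The quadric is smooth, so dividing by it lowers the multiplicity by at most one: compare the
  homogeneous parts of lowest degree.\<close>

lemma vanishes_quadric_cancel:
  assumes "vanishes_to_order m (segre_quadric * G) (segre x y)"
  shows "vanishes_to_order (m - 1) G (segre x y)"
proof -
  let ?p = "segre x y"
  \<comment> \<open>The equation of the tangent plane, which is the linear part of the quadric at
    the point. In this chart the coefficient of \<open>var 4\<close> is 1, so it is nonzero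
    everywhere.\<close>
  define q1 :: "4 cpoly" where "q1 = single 0 (x * y) * var 1 + var 4 - single 0 y * var 2 - single 0 x * var 3"
  have cxy: "single 0 (x * y) = single 0 x * (single 0 y :: 4 cpoly)" by (simp add: mult_single)
  have ring_identity: "(1 + a) * (b * c + e) - (b + f) * (c + g) = b * c * a + e - c * f - b * g + (a * e - f * g)"
    for a b c e f g :: "4 cpoly"
    by (simp add: algebra_simps)
  have sQ: "shift ?p segre_quadric = q1 + segre_quadric"
  proof -
    have "shift ?p segre_quadric = shift ?p (var 1) * shift ?p (var 4) - shift ?p (var 2) * shift ?p (var 3)"
      unfolding segre_quadric_def shift_diff shift_mult ..
    also have "\<dots> = (single 0 1 + var 1) * (single 0 (x * y) + var 4) - (single 0 x + var 2) * (single 0 y + var 3)"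
      unfolding shift_var segre_nth ..
    also have "\<dots> = q1 + segre_quadric"
      unfolding q1_def segre_quadric_def cxy single_one by (rule ring_identity)
    finally show ?thesis .
  qed
  have dvar: "deg_in {1} (var v :: 4 cpoly)" for v unfolding var_def by (rule deg_in_single) simp
  have dcvar: "deg_in {1} (single 0 c * var v :: 4 cpoly)" for v c
    by (rule deg_in_mult[OF deg_in_const[of "{0}"] dvar]) simp_all
  have q1: "deg_in {1} q1" unfolding q1_def by (intro deg_in_diff deg_in_add dvar dcvar)
  have q2: "deg_in {2} segre_quadric" unfolding segre_quadric_def
    by (intro deg_in_diff deg_in_mult[OF dvar dvar]) simp_all
  have q1_nz: "q1 \<noteq> 0"
  proof
    assume "q1 = 0"
    then have "partial_deriv 4 q1 = 0" by simp
    then show False unfolding q1_def partial_deriv_diff partial_deriv_add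
      by (simp add: partial_deriv_mult partial_deriv_var)
  qed
  \<comment> \<open>With \<open>g0\<close> the part of degree \<open>k\<close>, the product with the
    quadric has \<open>q1 * g0\<close> as its part of degree \<open>k + 1\<close>, which must vanish
    as long as \<open>k + 2 \<le> m\<close>.\<close>
  have step: "deg_in {k + 1..} (shift ?p G)" if k: "deg_in {k..} (shift ?p G)" "k + 2 \<le> m" for k
  proof -
    let ?g = "shift ?p G"
    define g0 where "g0 = (\<Sum>\<alpha>\<in>{\<alpha>\<in>keys ?g. int (deg \<alpha>) = k}. single \<alpha> (lookup ?g \<alpha>))"
    have look: "lookup g0 \<alpha> = (if int (deg \<alpha>) = k then lookup ?g \<alpha> else 0)" for \<alpha>
    proof -
      have "lookup g0 \<alpha> = (\<Sum>\<beta>\<in>{\<alpha>\<in>keys ?g. int (deg \<alpha>) = k}. if \<beta> = \<alpha> then lookup ?g \<alpha> else 0)"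
        unfolding g0_def lookup_sum by (rule sum.cong) (auto simp: lookup_single when_def)
      then show ?thesis by (simp add: in_keys_iff)
    qed
    have g0: "deg_in {k} g0" unfolding deg_in_def by (auto simp: in_keys_iff look split: if_splits)
    have g1: "deg_in {k + 1..} (?g - g0)" unfolding deg_in_def
    proof
      fix \<alpha> assume "\<alpha> \<in> keys (?g - g0)"
      then have a: "lookup ?g \<alpha> \<noteq> 0" "int (deg \<alpha>) \<noteq> k" by (auto simp: in_keys_iff lookup_minus look split: if_splits)
      then have "\<alpha> \<in> keys ?g" by (simp add: in_keys_iff)
      then have "k \<le> int (deg \<alpha>)" using k(1) unfolding deg_in_def by blast
      then show "int (deg \<alpha>) \<in> {k + 1..}" using a by simp
    qed
    have "deg_in {m..} (shift ?p (segre_quadric * G))" using assms by (simp add: vanishes_iff)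
    then have "deg_in {k + 2..} ((q1 + segre_quadric) * ?g)"
      unfolding shift_mult sQ by (rule deg_in_mono) (use k(2) in auto)
    moreover have "deg_in {k + 2..} (segre_quadric * g0)"
      by (rule deg_in_mult[OF q2 g0]) simp
    moreover have "deg_in {k + 2..} ((q1 + segre_quadric) * (?g - g0))"
    proof (rule deg_in_mult[OF _ g1])
      show "deg_in {1..} (q1 + segre_quadric)"
        by (intro deg_in_add deg_in_mono[OF q1] deg_in_mono[OF q2]) auto
    qed auto
    ultimately have "deg_in {k + 2..} ((q1 + segre_quadric) * ?g - (q1 + segre_quadric) * (?g - g0) - segre_quadric * g0)"
      by (intro deg_in_diff)
    moreover have "(q1 + segre_quadric) * ?g - (q1 + segre_quadric) * (?g - g0) - segre_quadric * g0 = q1 * g0"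
      by (simp add: algebra_simps)
    ultimately have "deg_in {k + 2..} (q1 * g0)" by simp
    moreover have "deg_in {k + 1} (q1 * g0)" by (rule deg_in_mult[OF q1 g0]) simp
    ultimately have "int (deg \<alpha>) \<in> {k + 2..} \<inter> {k + 1}" if "\<alpha> \<in> keys (q1 * g0)" for \<alpha>
      using that unfolding deg_in_def by blast
    then have "keys (q1 * g0) = {}" by fastforce
    then have "q1 * g0 = 0" using keys_eq_empty by blast
    then have "g0 = 0" using q1_nz by simp
    then show ?thesis using g1 by simp
  qed
  have low: "int n \<le> m - 1 \<Longrightarrow> deg_in {int n..} (shift ?p G)" for n
  proof (induction n)
    case 0
    show ?case by (simp add: deg_in_def)
  next
    case (Suc n)
    then show ?case using step[of "int n"] by (simp add: add.commute)
  qed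
  then have "deg_in {m - 1..} (shift ?p G)" if "m \<ge> 1"
  proof -
    have "int (nat (m - 1)) = m - 1" using \<open>m \<ge> 1\<close> by simp
    then show ?thesis using low[of "nat (m - 1)"] by simp
  qed
  moreover have "deg_in {m - 1..} (shift ?p G)" if "\<not> m \<ge> 1" using that by (simp add: deg_in_def)
  ultimately show ?thesis unfolding vanishes_iff by blast
qed

text \<open>The operators \<open>x \<partial>/\<partial>x\<close> and \<open>y \<partial>/\<partial>y\<close> of the quadric, extended to the ambient space.\<close>

definition euler_x :: "4 cpoly \<Rightarrow> 4 cpoly" where
  "euler_x F = var 2 * partial_deriv 2 F + var 4 * partial_deriv 4 F"

definition euler_y :: "4 cpoly \<Rightarrow> 4 cpoly" where
  "euler_y F = var 3 * partial_deriv 3 F + var 4 * partial_deriv 4 F"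

lemma var_partial_deriv: "var v * partial_deriv v (single \<alpha> c) = single \<alpha> (of_nat (lookup \<alpha> v) * c)"
proof (cases "lookup \<alpha> v = 0")
  case False
  then have "single v 1 + (\<alpha> - single v 1) = \<alpha>"
    by (intro poly_mapping_eqI) (auto simp: lookup_add lookup_minus lookup_single when_def)
  then show ?thesis unfolding partial_deriv_single var_def mult_single by simp
qed (simp add: partial_deriv_single)

lemma lookup_var_partial_deriv: "lookup (var v * partial_deriv v F) \<alpha> = of_nat (lookup \<alpha> v) * lookup F \<alpha>"
proof (induction F rule: cpoly_induct)
  case (single \<beta> c)
  show ?case unfolding var_partial_deriv by (simp add: lookup_single when_def)
qed (simp_all add: partial_deriv_add lookup_add distrib_left)

lemma lookup_euler: "lookup (euler_x F) \<alpha> = of_nat (fst (bideg \<alpha>)) * lookup F \<alpha>"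
  "lookup (euler_y F) \<alpha> = of_nat (snd (bideg \<alpha>)) * lookup F \<alpha>"
  by (simp_all add: euler_x_def euler_y_def lookup_add lookup_var_partial_deriv bideg_def distrib_right)

lemma vanishes_euler:
  assumes "vanishes_to_order m F p"
  shows "vanishes_to_order (m - 1) (euler_x F) p" "vanishes_to_order (m - 1) (euler_y F) p"
  unfolding euler_x_def euler_y_def by (intro vanishes_add vanishes_times vanishes_partial_deriv assms)+

lemma lookup_funpow_euler:
  "lookup ((euler_x ^^ i) ((euler_y ^^ j) F)) \<alpha> = of_nat (fst (bideg \<alpha>)) ^ i * (of_nat (snd (bideg \<alpha>)) ^ j * lookup F \<alpha>)"
proof -
  have "lookup ((euler_y ^^ j) F) \<alpha> = of_nat (snd (bideg \<alpha>)) ^ j * lookup F \<alpha>"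
    by (induction j) (simp_all add: lookup_euler)
  then show ?thesis by (induction i) (simp_all add: lookup_euler)
qed

lemma vanishes_funpow_euler:
  "vanishes_to_order m F p \<Longrightarrow> vanishes_to_order (m - int j - int i) ((euler_x ^^ i) ((euler_y ^^ j) F)) p"
proof (induction i)
  case 0
  then show ?case
  proof (induction j)
    case (Suc j)
    then show ?case using vanishes_euler(2)[of "m - int j"] by (simp add: algebra_simps)
  qed simp
next
  case (Suc i)
  then show ?case using vanishes_euler(1)[of "m - int j - int i"] by (simp add: algebra_simps)
qed

text \<open>Applying the operators \<open>i + j < m\<close> times leaves a form that still vanishes
  at the point; on the restriction they multiply the coefficient of \<open>x^a y^b\<close> by
  \<open>a^i b^j\<close>.\<close>

lemma restrict_euler_cond:
  assumes F: "homogeneous d F" and v: "vanishes_to_order m F (segre x y)"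
  shows "euler_cond (grid d) (nat m) (restrict_coeff F) x y"
  unfolding euler_cond_def
proof (intro allI impI)
  fix i j assume ij: "i + j < nat m"
  let ?G = "(euler_x ^^ i) ((euler_y ^^ j) F)"
  let ?w = "\<lambda>\<beta>. of_nat (fst \<beta>) ^ i * of_nat (snd \<beta>) ^ j * x ^ fst \<beta> * y ^ snd \<beta>"
  have mon: "monom_eval (\<lambda>v. segre x y $ v) \<alpha> = x ^ fst (bideg \<alpha>) * y ^ snd (bideg \<alpha>)" for \<alpha>
    unfolding monom_eval_UNIV UNIV_4 by (simp add: bideg_def power_add power_mult_distrib)
  have g: "bideg \<alpha> \<in> grid d" if "\<alpha> \<in> keys F" for \<alpha>
  proof -
    have "int (deg \<alpha>) = d" by (rule homogeneous_deg[OF F that])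
    then show ?thesis by (simp add: grid_def bideg_def deg_def sum_4)
  qed
  have "0 = poly_eval (\<lambda>v. segre x y $ v) ?G"
    using vanishes_poly_eval[OF vanishes_funpow_euler[OF v, of j i]] ij by simp
  also have "\<dots> = (\<Sum>\<alpha>\<in>keys F. lookup ?G \<alpha> * monom_eval (\<lambda>v. segre x y $ v) \<alpha>)"
    unfolding poly_eval_ev by (rule ev_id.ev_superset) (auto simp: in_keys_iff lookup_funpow_euler)
  also have "\<dots> = (\<Sum>\<alpha>\<in>keys F. lookup F \<alpha> * ?w (bideg \<alpha>))"
    unfolding lookup_funpow_euler mon by (rule sum.cong) (simp_all add: mult_ac)
  \<comment> \<open>Monomials with the same restriction are collected.\<close>
  also have "\<dots> = (\<Sum>\<alpha>\<in>keys F. \<Sum>\<beta>\<in>grid d. if bideg \<alpha> = \<beta> then lookup F \<alpha> * ?w \<beta> else 0)"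
    by (rule sum.cong) (simp_all add: g)
  also have "\<dots> = (\<Sum>\<beta>\<in>grid d. \<Sum>\<alpha>\<in>keys F. if bideg \<alpha> = \<beta> then lookup F \<alpha> * ?w \<beta> else 0)"
    by (rule sum.swap)
  also have "\<dots> = (\<Sum>\<beta>\<in>grid d. restrict_coeff F \<beta> * ?w \<beta>)"
    unfolding restrict_coeff_def sum_distrib_right by (intro sum.cong refl) simp
  finally show "(\<Sum>\<beta>\<in>grid d. restrict_coeff F \<beta> * ?w \<beta>) = 0" by simp
qed

lemma restrict_coeff_outside:
  assumes "homogeneous d F" "\<beta> \<notin> grid d"
  shows "restrict_coeff F \<beta> = 0"
  unfolding restrict_coeff_def
proof (rule sum.neutral, rule ballI)
  fix \<alpha> assume "\<alpha> \<in> keys F"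
  then have "int (deg \<alpha>) = d" by (rule homogeneous_deg[OF assms(1)])
  then have "bideg \<alpha> \<in> grid d" by (simp add: grid_def bideg_def deg_def sum_4)
  then show "(if bideg \<alpha> = \<beta> then lookup F \<alpha> else 0) = 0" using assms(2) by auto
qed

text \<open>The forms killed by all functionals restrict to 0, hence are multiples of the quadric,
  and the cofactor lies in the residual system because division costs one order at each point. The
  functionals account for at most \<open>card \<Phi>\<close> dimensions.\<close>

lemma dim_restriction_step:
  fixes z :: "nat \<times> bool \<Rightarrow> complex"
  defines "p \<equiv> \<lambda>i. segre (z (i, False)) (z (i, True))"
  assumes \<Phi>: "finite \<Phi>" and inj: "\<And>c. \<forall>i\<in>{1..9}. euler_cond (grid d) (nat (m i)) c (z (i, False)) (z (i, True)) \<Longrightarrow>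
     \<forall>w\<in>\<Phi>. (\<Sum>\<alpha>\<in>grid d. c \<alpha> * w \<alpha>) = 0 \<Longrightarrow> \<forall>\<alpha>\<in>grid d. c \<alpha> = 0"
  shows "cpoly_dim (linear_system d m p) \<le> cpoly_dim (linear_system (d - 2) (\<lambda>i. m i - 1) p) + card \<Phi>"
proof -
  let ?\<Psi> = "(\<lambda>w F. \<Sum>\<alpha>\<in>grid d. restrict_coeff F \<alpha> * w \<alpha>) ` \<Phi>"
  let ?W = "{F\<in>linear_system d m p. \<forall>\<psi>\<in>?\<Psi>. \<psi> F = 0}" and ?V = "linear_system (d - 2) (\<lambda>i. m i - 1) p"
  have lin_w: "functional (\<lambda>F. \<Sum>\<alpha>\<in>grid d. restrict_coeff F \<alpha> * w \<alpha>)" for w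
    unfolding functional_def restrict_coeff_add restrict_coeff_scale
    by (simp add: distrib_right sum.distrib sum_distrib_left mult.assoc)
  have "functional \<psi>" if "\<psi> \<in> ?\<Psi>" for \<psi>
    using that by (rule imageE) (simp only: lin_w)
  then have "cpoly_dim (linear_system d m p) \<le> cpoly_dim ?W + card ?\<Psi>"
    by (rule dim_kernel[OF finite_imageI[OF \<Phi>] fin_space_linear_system])
  moreover have "card ?\<Psi> \<le> card \<Phi>" by (rule card_image_le[OF \<Phi>])
  moreover have "cpoly_dim ?W \<le> cpoly_dim ?V"
  proof -
    have lin: "linear_map ((*) segre_quadric)"
      by (rule linear_mapI) (simp_all add: cpoly_scale_def distrib_left mult.left_commute)
    have "?W \<subseteq> (*) segre_quadric ` ?V"
    proof
      fix F assume F: "F \<in> ?W"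
      then have FL: "F \<in> linear_system d m p" and F\<Psi>: "\<forall>\<psi>\<in>?\<Psi>. \<psi> F = 0" by simp_all
      have hom: "homogeneous d F" and v: "\<And>i. i \<in> {1..9} \<Longrightarrow> vanishes_to_order (m i) F (p i)"
        using FL unfolding linear_system_def by simp_all
      have "\<forall>i\<in>{1..9}. euler_cond (grid d) (nat (m i)) (restrict_coeff F) (z (i, False)) (z (i, True))"
        using v unfolding p_def by (intro ballI restrict_euler_cond[OF hom]) blast
      moreover have "\<forall>w\<in>\<Phi>. (\<Sum>\<alpha>\<in>grid d. restrict_coeff F \<alpha> * w \<alpha>) = 0"
        by (rule ballI) (rule F\<Psi>[rule_format, OF imageI])
      ultimately have "\<forall>\<alpha>\<in>grid d. restrict_coeff F \<alpha> = 0" by (rule inj)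
      then have "restrict_coeff F \<beta> = 0" for \<beta> using restrict_coeff_outside[OF hom, of \<beta>] by blast
      from restrict_coeff_eq_0[OF hom this] obtain G where G: "F = segre_quadric * G" "homogeneous (d - 2) G"
        by (elim exE conjE)
      have "vanishes_to_order (m i - 1) G (p i)" if "i \<in> {1..9}" for i
        unfolding p_def by (rule vanishes_quadric_cancel) (rule v[OF that, unfolded p_def G(1)])
      then have "G \<in> ?V" using G(2) by (simp add: linear_system_def)
      then show "F \<in> (*) segre_quadric ` ?V" unfolding G(1) by (rule imageI)
    qed
    then have "cpoly_dim ?W \<le> cpoly_dim ((*) segre_quadric ` ?V)"
      by (intro dim_subset_le fin_space_image[OF lin] fin_space_linear_system)
    also have "\<dots> \<le> cpoly_dim ?V" by (rule dim_image_le[OF lin fin_space_linear_system])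
    finally show ?thesis .
  qed
  ultimately show ?thesis by linarith
qed

section \<open>Numerical invariants\<close>

lemma decreasing_le:
  fixes m :: "nat \<Rightarrow> int"
  assumes "\<forall>i\<in>{1..8}. m i \<ge> m (i + 1)" "1 \<le> i" "i \<le> j" "j \<le> 9"
  shows "m j \<le> m i"
  using assms(3,4)
proof (induction j rule: dec_induct)
  case (step n)
  have "m (n + 1) \<le> m n" using assms(1,2) step by auto
  then show ?case using step by simp
qed simp

lemmas planar_nonspecial_small =
  planar_nonspecial_1 planar_nonspecial_2 planar_nonspecial_3 planar_nonspecial_4
  planar_nonspecial_5 planar_nonspecial_6 planar_nonspecial_7 planar_nonspecial_8
  planar_nonspecial_9 planar_nonspecial_10 planar_nonspecial_11 planar_nonspecial_12
  planar_nonspecial_13 planar_nonspecial_14 planar_nonspecial_15 planar_nonspecial_16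

lemma planar_nonspecial_general:
  assumes dec: "\<forall>i\<in>{1..8}. m i \<ge> m (i + 1)"
    and m: "m 1 \<le> 8" "m 1 \<le> d" "m 4 \<ge> 1" "m 1 + m 2 + m 3 + m 4 \<le> 2 * d"
  shows "planar_nonspecial d m"
proof (cases "d \<le> 16")
  case True
  have "1 \<le> d" using decreasing_le[OF dec, of 1 4] m by simp
  then have "d = 1 \<or> d = 2 \<or> d = 3 \<or> d = 4 \<or> d = 5 \<or> d = 6 \<or> d = 7 \<or> d = 8 \<or> d = 9 \<or> d = 10 \<or> d = 11 \<or> d = 12 \<or> d = 13 \<or> d = 14 \<or> d = 15 \<or> d = 16"
    using True by presburger
  then show ?thesis
    using m by (elim disjE) (simp_all only: planar_nonspecial_small[OF dec m(1)])
next
  case False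
  \<comment> \<open>The degree is at least 17 and all multiplicities are at most 8, so a single
    dissection dominates.\<close>
  obtain C where C: "indep_cert 17 [8, 8, 8, 8, 8, 8, 8, 8, 8] C" using indep_17_1 by (elim exE)
  show ?thesis
  proof (rule indep_cert_nonspecial[OF C])
    have "m i \<le> 8" if "1 \<le> i" "i \<le> 9" for i
      using decreasing_le[OF dec, of 1 i] that m(1) by simp
    then show "\<forall>i\<in>{1..9}. m i \<le> [8, 8, 8, 8, 8, 8, 8, 8, 8] ! (i - 1)"
      unfolding ball_9 by (simp add: numeral_eq_Suc)
  qed (use False in simp_all)
qed

text \<open>The linear expected dimension before truncation at 0: in a Cremona reduced system with decreasing
  multiplicities, only the lines through the first point and the line through the second and third point
  contribute.\<close>

definition ell :: "int \<Rightarrow> (nat \<Rightarrow> int) \<Rightarrow> int" where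
  "ell d m = int (nat (d + 3) choose 3) - (\<Sum>i=1..9. int (nat (m i + 2) choose 3))
     + (\<Sum>j=2..9. int (nat (m 1 + m j - d + 1) choose 3)) + int (nat (m 2 + m 3 - d + 1) choose 3)"

lemma choose3_eq_0: "x \<le> 2 \<Longrightarrow> int (nat x choose 3) = 0"
  by (simp add: binomial_eq_0)

lemma choose3_step: "int (nat (x + 1) choose 3) = int (nat x choose 3) + int (nat x choose 2)"
proof (cases "x \<ge> 0")
  case True
  then have "nat (x + 1) = Suc (nat x)" by simp
  then show ?thesis by (simp add: numeral_eq_Suc)
qed simp

lemma two_choose2: "x \<ge> 0 \<Longrightarrow> 2 * int (nat x choose 2) = x * (x - 1)"
proof (cases "x = 0")
  case False
  assume "x \<ge> 0"
  then have "nat x = nat (x - 1) + 1" using False by simp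
  then show ?thesis using two_choose_two[of "x - 1"] \<open>x \<ge> 0\<close> False by (simp add: algebra_simps)
qed simp

lemma linear_expected_dim_ell:
  assumes dec: "\<forall>i\<in>{1..8}. m i \<ge> m (i + 1)" and cr: "m 1 + m 2 + m 3 + m 4 \<le> 2 * d"
  shows "linear_expected_dim d m = max 0 (ell d m)"
proof -
  let ?f = "\<lambda>(i, j). int (nat (m i + m j - d + 1) choose 3)"
  let ?F = "{(i, j). i \<in> {1..9} \<and> j \<in> {1..9} \<and> i < j \<and> m i + m j - d \<ge> 2}"
  let ?T = "insert (2, 3) (Pair 1 ` {2..9}) :: (nat \<times> nat) set"
  have le: "m j \<le> m i" if "1 \<le> i" "i \<le> j" "j \<le> 9" for i j using decreasing_le[OF dec that] .
  have sub: "?F \<subseteq> ?T"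
  proof
    fix x assume x: "x \<in> ?F"
    obtain i j where ij: "x = (i, j)" "1 \<le> i" "i < j" "j \<le> 9" "m i + m j - d \<ge> 2" using x by auto
    \<comment> \<open>Every other pair has \<open>i \<ge> 2\<close> and \<open>j \<ge> 4\<close>,
      and \<open>2 * (m 2 + m 4) \<le> m 1 + m 2 + m 3 + m 4 \<le> 2 * d\<close>.\<close>
    have "i = 1 \<or> (i = 2 \<and> j = 3)"
    proof (rule ccontr)
      assume n: "\<not> (i = 1 \<or> (i = 2 \<and> j = 3))"
      then have "2 \<le> i" "4 \<le> j" using ij by auto
      then have "m i \<le> m 2" "m j \<le> m 4" using ij by (auto intro: le)
      moreover have "m 4 \<le> m 3" "m 2 \<le> m 1" by (auto intro: le)
      ultimately show False using ij(5) cr by linarith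
    qed
    then show "x \<in> ?T" using ij by auto
  qed
  have "(\<Sum>x\<in>?F. ?f x) = (\<Sum>x\<in>?T. ?f x)"
  proof (rule sum.mono_neutral_left)
    show "\<forall>x\<in>?T - ?F. ?f x = 0"
    proof
      fix x assume x: "x \<in> ?T - ?F"
      obtain i j where ij: "x = (i, j)" by (cases x)
      have "m i + m j - d < 2" using x unfolding ij by auto
      then show "?f x = 0" unfolding ij by (simp add: choose3_eq_0)
    qed
  qed (use sub in auto)
  also have "\<dots> = int (nat (m 2 + m 3 - d + 1) choose 3) + (\<Sum>j=2..9. int (nat (m 1 + m j - d + 1) choose 3))"
    by (subst sum.insert) (auto simp: sum.reindex inj_on_def)
  finally show ?thesis unfolding linear_expected_dim_def euler_char_def ell_def by simp
qed

text \<open>The Euler characteristic is additive along restriction to the quadric, and the line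
  corrections do not change, since \<open>m i + m j - d\<close> is the same for the residual
  system.\<close>

lemma ell_step:
  assumes "d \<ge> 0"
  shows "ell d m = q_char d m + ell (d - 2) (\<lambda>i. m i - 1)"
proof -
  have "int (nat (d + 3) choose 3) = int (nat (d + 1) choose 3) + int (nat (d + 1) choose 2) + int (nat (d + 2) choose 2)"
    using choose3_step[of "d + 2"] choose3_step[of "d + 1"] by (simp add: add.assoc)
  moreover have "2 * int (nat (d + 1) choose 2) = (d + 1) * d" "2 * int (nat (d + 2) choose 2) = (d + 2) * (d + 1)"
    using two_choose2[of "d + 1"] two_choose2[of "d + 2"] assms by simp_all
  then have "int (nat (d + 1) choose 2) + int (nat (d + 2) choose 2) = (d + 1)\<^sup>2"
    by (simp add: power2_eq_square algebra_simps)
  ultimately have d: "int (nat (d + 3) choose 3) = int (nat (d + 1) choose 3) + (d + 1)\<^sup>2" by simp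
  have m: "int (nat (m i + 2) choose 3) = int (nat (m i - 1 + 2) choose 3) + int (nat (m i + 1) choose 2)" for i
    using choose3_step[of "m i + 1"] by (simp add: ac_simps)
  show ?thesis unfolding ell_def q_char_def d m sum.distrib by (simp add: algebra_simps)
qed

lemma sum_2_9: "(\<Sum>i=2..(9::nat). f i) = f 2 + f 3 + f 4 + f 5 + f 6 + f 7 + f 8 + f 9"
  and sum_4_9: "(\<Sum>i=4..(9::nat). f i) = f 4 + f 5 + f 6 + f 7 + f 8 + f 9"
  for f :: "nat \<Rightarrow> int"
  by (simp_all add: numeral_eq_Suc add.assoc)

text \<open>In the residual system the first multiplicity exceeds the degree by one and
  \<open>ell\<close> cancels completely: the degree term against the first point, every other point
  against its line to the first one. The line through points 2 and 3 contributes 0 by the Cremona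
  inequality.\<close>

lemma ell_vertex:
  assumes "m 1 = d" "m 4 \<ge> 1" "m 1 + m 2 + m 3 + m 4 \<le> 2 * d" "d \<ge> 0"
  shows "ell d m = q_char d m"
proof -
  have "int (nat (m 2 - 1 + (m 3 - 1) - (d - 2) + 1) choose 3) = 0"
    by (rule choose3_eq_0) (use assms in linarith)
  moreover have "(\<Sum>j=2..9. int (nat (m 1 - 1 + (m j - 1) - (d - 2) + 1) choose 3)) = (\<Sum>j=2..9. int (nat (m j - 1 + 2) choose 3))"
  proof -
    have "m 1 - 1 + (m j - 1) - (d - 2) + 1 = m j - 1 + 2" for j using assms(1) by simp
    then show ?thesis by (simp only:)
  qed
  moreover have "nat (m 1 - 1 + 2) = nat (d - 2 + 3)" using assms(1) by simp
  ultimately have "ell (d - 2) (\<lambda>i. m i - 1) = 0"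
    unfolding ell_def sum_9 sum_2_9 by simp
  then show ?thesis using ell_step[OF assms(4)] by simp
qed

text \<open>\<open>q_char (d - 2) (m - 1)\<close> is the arithmetic genus of the curves in the restricted system.\<close>

lemma q_char_residual_nonneg:
  assumes dec: "\<forall>i\<in>{1..8}. m i \<ge> m (i + 1)" and cr: "m 1 + m 2 + m 3 + m 4 \<le> 2 * d"
    and d: "m 1 \<le> d - 1" and m4: "m 4 \<ge> 1" and q: "q_char d m \<ge> 0"
  shows "q_char (d - 2) (\<lambda>i. m i - 1) \<ge> 0"
proof -
  define x where "x i = max 0 (m i)" for i
  have le: "m j \<le> m i" if "1 \<le> i" "i \<le> j" "j \<le> 9" for i j using decreasing_le[OF dec that] .
  have m123: "m 4 \<le> m 3" "m 3 \<le> m 2" "m 2 \<le> m 1" by (auto intro: le)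
  have c2: "2 * int (nat (m i) choose 2) = x i * (x i - 1)" for i
    using two_choose2[of "x i"] by (cases "m i \<ge> 0") (simp_all add: x_def)
  have diff: "int (nat (m i + 1) choose 2) - int (nat (m i) choose 2) = x i" for i
  proof -
    have "2 * int (nat (m i + 1) choose 2) = (x i + 1) * x i"
      using two_choose2[of "m i + 1"] by (cases "m i \<ge> 0") (simp_all add: x_def)
    then show ?thesis using c2[of i] by (simp add: algebra_simps)
  qed
  have q1: "q_char (d - 2) (\<lambda>i. m i - 1) = (d - 1)\<^sup>2 - (\<Sum>i=1..9. int (nat (m i) choose 2))"
    by (simp add: q_char_def)
  have "q_char d m - q_char (d - 2) (\<lambda>i. m i - 1) =
      (d + 1)\<^sup>2 - (d - 1)\<^sup>2 - (\<Sum>i=1..9. int (nat (m i + 1) choose 2) - int (nat (m i) choose 2))"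
    unfolding q1 by (simp add: q_char_def sum_subtractf)
  also have "\<dots> = 4 * d - (\<Sum>i=1..9. x i)"
    unfolding diff by (simp add: power2_eq_square algebra_simps)
  finally have s: "q_char d m - q_char (d - 2) (\<lambda>i. m i - 1) = 4 * d - (\<Sum>i=1..9. x i)" .
  show ?thesis
  \<comment> \<open>By the computed difference, \<open>q_char\<close> does not decrease if the
    multiplicities sum to at least \<open>4 * d\<close>. Otherwise that sum is at most
    \<open>4 * d - 1\<close>, and the genus is estimated directly.\<close>
  proof (cases "(\<Sum>i=1..9. x i) \<ge> 4 * d")
    case True
    then show ?thesis using s q by linarith
  next
    case False
    \<comment> \<open>An entry below \<open>c\<close> contributes at most
      \<open>(c - 1) * x\<close>. For the first three entries the excess over \<open>c\<close> is
      weighted by \<open>m 1\<close>; by the Cremona inequality it is at most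
      \<open>2 * d - 4 * c\<close> in total.\<close>
    define c where "c = m 4"
    have x14: "x 1 = m 1" "x 2 = m 2" "x 3 = m 3" "x 4 = c" using m4 m123 by (simp_all add: x_def c_def)
    have tail: "x i * (x i - 1) \<le> (c - 1) * x i" if "4 \<le> i" "i \<le> 9" for i
    proof -
      have "m i \<le> c" unfolding c_def using that by (intro le) auto
      then have "0 \<le> x i" "x i - 1 \<le> c - 1" using m4 by (simp_all add: x_def c_def)
      then show ?thesis using mult_left_mono[of "x i - 1" "c - 1" "x i"] by (simp add: mult.commute)
    qed
    have head: "x i * (x i - 1) \<le> (c - 1) * x i + m 1 * (x i - c)" if "x i = m i" "m i \<ge> c" "m i \<le> m 1" for i
    proof -
      have "x i * (x i - c) \<le> m 1 * (x i - c)" using that by (intro mult_right_mono) auto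
      then show ?thesis by (simp add: algebra_simps)
    qed
    have h: "m 3 \<ge> c" "m 2 \<ge> c" "m 1 \<ge> c" using m123 by (simp_all add: c_def)
    have "(\<Sum>i=1..9. x i * (x i - 1)) \<le> (c - 1) * (\<Sum>i=1..9. x i) + m 1 * (m 1 + m 2 + m 3 - 3 * c)"
      using tail[of 4] tail[of 5] tail[of 6] tail[of 7] tail[of 8] tail[of 9]
        head[OF x14(1) h(3)] head[OF x14(2) h(2)] head[OF x14(3) h(1)] m123 x14
      unfolding sum_9 by (simp add: algebra_simps)
    also have "(c - 1) * (\<Sum>i=1..9. x i) \<le> (c - 1) * (4 * d - 1)"
      using False m4 by (intro mult_left_mono) (simp_all add: c_def)
    also have "m 1 * (m 1 + m 2 + m 3 - 3 * c) \<le> m 1 * (2 * d - 4 * c)"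
      using cr m4 h by (intro mult_left_mono) (simp_all add: c_def)
    also have "(c - 1) * (4 * d - 1) + m 1 * (2 * d - 4 * c) \<le> 2 * (d - 1)\<^sup>2"
    proof -
      have c2: "2 * c \<le> d" using cr h by (simp add: c_def)
      show ?thesis
      \<comment> \<open>\<open>m 1\<close> is at most \<open>d - 1\<close> and at most
        \<open>2 * d - 3 * c\<close>; the two bounds agree for \<open>3 * c = d + 1\<close>.\<close>
      proof (cases "3 * c \<le> d + 1")
        case True
        have "m 1 * (2 * d - 4 * c) \<le> (d - 1) * (2 * d - 4 * c)" using d c2 by (intro mult_right_mono) auto
        moreover have "(c - 1) * (4 * d - 1) + (d - 1) * (2 * d - 4 * c) = 2 * (d - 1)\<^sup>2 - (2 * d + 1 - 3 * c)"
          by (simp add: power2_eq_square algebra_simps)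
        ultimately show ?thesis using c2 h m4 True by (simp add: c_def)
      next
        case False
        have "m 1 * (2 * d - 4 * c) \<le> (2 * d - 3 * c) * (2 * d - 4 * c)"
          using cr h c2 by (intro mult_right_mono) (auto simp: c_def)
        moreover have "(c - 1) * (4 * d - 1) + (2 * d - 3 * c) * (2 * d - 4 * c) =
            2 * (d - 1)\<^sup>2 - 2 * ((d - 2 * c) * (3 * c - d)) - c - 1"
          by (simp add: power2_eq_square algebra_simps)
        moreover have "0 \<le> (d - 2 * c) * (3 * c - d)" using c2 False by (intro mult_nonneg_nonneg) auto
        ultimately show ?thesis using m4 by (simp add: c_def)
      qed
    qed
    finally have "(\<Sum>i=1..9. x i * (x i - 1)) \<le> 2 * (d - 1)\<^sup>2" by simp
    moreover have "2 * (\<Sum>i=1..9. int (nat (m i) choose 2)) = (\<Sum>i=1..9. x i * (x i - 1))"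
      unfolding sum_distrib_left c2 ..
    ultimately show ?thesis unfolding q1 by linarith
  qed
qed

text \<open>Each \<open>m i * (m i + 1)\<close> is at most \<open>(d + 1) * m i\<close>, with total
  at most \<open>(d + 1) * (2 * d)\<close>, less than twice \<open>(d + 1)^2\<close>. Consequently
  \<open>q \<le> 0\<close> forces a fourth positive multiplicity.\<close>

lemma q_char_three_points_pos:
  assumes "m 1 \<le> d" "m 2 \<le> d" "m 3 \<le> d" "m 1 + m 2 + m 3 \<le> 2 * d" "0 \<le> m 1" "0 \<le> m 2" "0 \<le> m 3"
    and m: "\<forall>i\<in>{4..9}. m i \<le> 0"
  shows "q_char d m > 0"
proof -
  have z: "nat (m i + 1) choose 2 = 0" if "i \<in> {4..9}" for i
  proof -
    have "nat (m i + 1) < 2" using m that by fastforce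
    then show ?thesis by (simp add: binomial_eq_0)
  qed
  have q: "q_char d m = (d + 1)\<^sup>2 - (int (nat (m 1 + 1) choose 2) + int (nat (m 2 + 1) choose 2) + int (nat (m 3 + 1) choose 2))"
    unfolding q_char_def sum_9 by (simp add: z del: binomial_eq_0_iff)
  have c: "2 * int (nat (m i + 1) choose 2) \<le> (d + 1) * m i" if "0 \<le> m i" "m i \<le> d" for i
    using two_choose2[of "m i + 1"] that mult_right_mono[of "m i + 1" "d + 1" "m i"] by simp
  have "2 * (int (nat (m 1 + 1) choose 2) + int (nat (m 2 + 1) choose 2) + int (nat (m 3 + 1) choose 2))
      \<le> (d + 1) * (m 1 + m 2 + m 3)"
    using c[of 1] c[of 2] c[of 3] assms by (simp add: distrib_left)
  also have "\<dots> \<le> (d + 1) * (2 * d)" using assms by (intro mult_left_mono) auto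
  also have "\<dots> < 2 * (d + 1)\<^sup>2" using assms by (simp add: power2_eq_square algebra_simps)
  finally show ?thesis unfolding q by simp
qed

lemma generic_lower_ell:
  assumes m: "\<forall>i\<in>{1..9}. m i \<le> d" "m 1 + m 2 + m 3 \<le> 2 * d"
  shows "generic (\<lambda>p. ell d m \<le> int (cpoly_dim (linear_system d m p)))"
proof (rule generic_mono)
  show "generic (\<lambda>p. minor3 p \<noteq> 0 \<and> (\<forall>j\<in>{4..9}. minor2 j p \<noteq> 0))"
    by (intro generic_conj generic_minor3 generic_ball generic_minor2) auto
  fix p assume p: "minor3 p \<noteq> 0 \<and> (\<forall>j\<in>{4..9}. minor2 j p \<noteq> 0)"
  have m123: "m 1 \<le> d" "m 2 \<le> d" "m 3 \<le> d" using m(1) by auto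
  have "ell d m = int (card (monomials d - (over d 1 (m 1) \<union> over d 2 (m 2) \<union> over d 3 (m 3))))
     - (\<Sum>j=4..9. int (nat (m j + 2) choose 3) - int (nat (m 1 + m j - d + 1) choose 3))"
    unfolding toric3_card[OF m123 m(2)] ell_def sum_9 sum_2_9 sum_4_9 by simp
  then show "ell d m \<le> int (cpoly_dim (linear_system d m p))"
    using dim_lower_bound[of p m d] p m by simp
qed

section \<open>Induction on the degree\<close>

definition segre_points :: "(nat \<times> bool \<Rightarrow> complex) \<Rightarrow> nat \<Rightarrow> complex ^ 4" where
  "segre_points z i = segre (z (i, False)) (z (i, True))"

text \<open>The bound is for general points of the fixed quadric, because
  \<open>dim_restriction_step\<close> compares two systems based at the same points of that quadric.
  Only the final bound is transferred to general points of space.\<close>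

definition bounded_on_segre :: "int \<Rightarrow> (nat \<Rightarrow> int) \<Rightarrow> nat \<Rightarrow> bool" where
  "bounded_on_segre d m u \<longleftrightarrow> (\<exists>g z0. line_poly g \<and> g z0 \<noteq> 0 \<and>
     (\<forall>z. g z \<noteq> 0 \<longrightarrow> cpoly_dim (linear_system d m (segre_points z)) \<le> u))"

text \<open>One good configuration on the quadric is enough for semicontinuity.\<close>

lemma bounded_on_segre_generic:
  assumes "bounded_on_segre d m u"
  shows "generic (\<lambda>p. cpoly_dim (linear_system d m p) \<le> u)"
proof -
  obtain z where z: "cpoly_dim (linear_system d m (segre_points z)) \<le> u"
    using assms unfolding bounded_on_segre_def by blast
  show ?thesis
    by (rule generic_mono[OF dim_upper_semicontinuous[of d m "segre_points z"]]) (use z in linarith)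
qed

lemma bounded_on_segre_step:
  assumes P: "planar_nonspecial d m" and b: "bounded_on_segre (d - 2) (\<lambda>i. m i - 1) u"
  shows "bounded_on_segre d m (u + nat (max 0 (q_char d m)))"
proof -
  obtain g z1 where g: "line_poly g" "g z1 \<noteq> 0"
    and gz: "\<forall>z. g z \<noteq> 0 \<longrightarrow> cpoly_dim (linear_system (d - 2) (\<lambda>i. m i - 1) (segre_points z)) \<le> u"
    using b unfolding bounded_on_segre_def by (elim exE conjE) (rule that)
  obtain h z2 where h: "line_poly h" "h z2 \<noteq> 0"
    and hz: "\<forall>z. h z \<noteq> 0 \<longrightarrow> (\<exists>\<Phi>. finite \<Phi> \<and> int (card \<Phi>) \<le> max 0 (q_char d m) \<and>
       (\<forall>c. (\<forall>i\<in>{1..9}. euler_cond (grid d) (nat (m i)) c (z (i, False)) (z (i, True))) \<and>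
         (\<forall>w\<in>\<Phi>. (\<Sum>\<alpha>\<in>grid d. c \<alpha> * w \<alpha>) = 0) \<longrightarrow> (\<forall>\<alpha>\<in>grid d. c \<alpha> = 0)))"
    using P unfolding planar_nonspecial_def by (elim exE conjE) (rule that)
  obtain z0 where z0: "g z0 \<noteq> 0" "h z0 \<noteq> 0" using line_poly_common_nonzero[where f = g and g = h and ?z1.0 = z1 and ?z2.0 = z2] g h by blast
  show ?thesis unfolding bounded_on_segre_def
  proof (rule exI[of _ "\<lambda>z. g z * h z"], rule exI[of _ z0], intro conjI allI impI)
    show "line_poly (\<lambda>z. g z * h z)" using g(1) h(1) by (rule line_poly_mult)
    show "g z0 * h z0 \<noteq> 0" using z0 by simp
    fix z assume nz: "g z * h z \<noteq> 0"
    then have "h z \<noteq> 0" "g z \<noteq> 0" by simp_all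
    from hz[rule_format, OF this(1)] obtain \<Phi> where \<Phi>: "finite \<Phi>" "int (card \<Phi>) \<le> max 0 (q_char d m)"
       "\<forall>c. (\<forall>i\<in>{1..9}. euler_cond (grid d) (nat (m i)) c (z (i, False)) (z (i, True))) \<and>
         (\<forall>w\<in>\<Phi>. (\<Sum>\<alpha>\<in>grid d. c \<alpha> * w \<alpha>) = 0) \<longrightarrow> (\<forall>\<alpha>\<in>grid d. c \<alpha> = 0)"
      by (elim exE conjE) (rule that)
    have inj: "\<forall>\<alpha>\<in>grid d. c \<alpha> = 0"
      if "\<forall>i\<in>{1..9}. euler_cond (grid d) (nat (m i)) c (z (i, False)) (z (i, True))"
        "\<forall>w\<in>\<Phi>. (\<Sum>\<alpha>\<in>grid d. c \<alpha> * w \<alpha>) = 0" for c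
      by (rule \<Phi>(3)[THEN spec, THEN mp]) (rule conjI[OF that])
    have sp: "segre_points z = (\<lambda>i. segre (z (i, False)) (z (i, True)))"
      by (rule ext) (simp add: segre_points_def)
    have "cpoly_dim (linear_system d m (segre_points z)) \<le>
        cpoly_dim (linear_system (d - 2) (\<lambda>i. m i - 1) (segre_points z)) + card \<Phi>"
      unfolding sp using \<Phi>(1) inj by (rule dim_restriction_step)
    also have "\<dots> \<le> u + nat (max 0 (q_char d m))"
      using gz[rule_format, OF \<open>g z \<noteq> 0\<close>] \<Phi>(2) by linarith
    finally show "cpoly_dim (linear_system d m (segre_points z)) \<le> u + nat (max 0 (q_char d m))" .
  qed
qed

lemma bounded_on_segre_zero:
  assumes "m 1 > d"
  shows "bounded_on_segre d m 0"
  unfolding bounded_on_segre_def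
\<comment> \<open>At Segre points this difference is \<open>minor2 2\<close>.\<close>
proof (rule exI[of _ "\<lambda>z. z (2, False) - z (1, False)"], rule exI[of _ "\<lambda>(i, b). if i = 1 then 0 else 1"], intro conjI allI impI)
  show "line_poly (\<lambda>z. z (2, False) - z (1, False))" by (intro line_poly_diff line_poly_coord)
  fix z :: "nat \<times> bool \<Rightarrow> complex" assume "z (2, False) - z (1, False) \<noteq> 0"
  then have "minor2 2 (segre_points z) \<noteq> 0" by (simp add: minor2_def segre_points_def)
  from no_form_of_large_multiplicity[where m = m and d = d, OF this assms]
  have "linear_system d m (segre_points z) \<subseteq> cpoly_span {}" by (simp add: cpoly.span_empty subset_iff)
  then have "cpoly_dim (linear_system d m (segre_points z)) \<le> card ({} :: 4 cpoly set)" by (rule cpoly.dim_le_card) simp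
  then show "cpoly_dim (linear_system d m (segre_points z)) \<le> 0" by simp
qed simp

lemma bounded_on_segre_three_points:
  assumes "\<forall>i\<in>{4..9}. m i \<le> 0"
  shows "bounded_on_segre d m (card (monomials d - (over d 1 (m 1) \<union> over d 2 (m 2) \<union> over d 3 (m 3))))"
  unfolding bounded_on_segre_def
proof (rule exI[of _ "\<lambda>z. minor3 (segre_points z)"],
    \<comment> \<open>The first three points are (0, 0), (1, 0) and (0, 1) in the affine
      chart.\<close>
    rule exI[of _ "\<lambda>(i, b). if i = 2 \<and> \<not> b \<or> i = 3 \<and> b then 1 else 0"], intro conjI allI impI)
  show "line_poly (\<lambda>z. minor3 (segre_points z))"
    unfolding minor3_def segre_points_def segre_nth
    by (intro line_poly_diff line_poly_add line_poly_mult line_poly_coord line_poly_const)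
  show "minor3 (segre_points (\<lambda>(i, b). if i = 2 \<and> \<not> b \<or> i = 3 \<and> b then 1 else 0)) \<noteq> 0"
    by (simp add: minor3_def segre_points_def)
  fix z assume "minor3 (segre_points z) \<noteq> 0"
  then show "cpoly_dim (linear_system d m (segre_points z)) \<le>
      card (monomials d - (over d 1 (m 1) \<union> over d 2 (m 2) \<union> over d 3 (m 3)))"
    by (simp add: dim_three_points[OF _ assms])
qed

text \<open>The two bounds together say that \<open>u\<close> is the dimension for general points.
  For \<open>q < 0\<close> it is inherited from the residual system and need not be
  \<open>ell\<close>. The condition \<open>m 4 \<ge> 0\<close> survives the descent, which happens
  only while \<open>m 4 \<ge> 1\<close>; later multiplicities may become negative.\<close>

lemma generic_dimension:
  assumes "\<forall>i\<in>{1..8}. m i \<ge> m (i + 1)" "m 1 + m 2 + m 3 + m 4 \<le> 2 * d" "m 1 \<le> d" "m 1 \<le> 8" "m 4 \<ge> 0"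
  shows "\<exists>u. bounded_on_segre d m u \<and> generic (\<lambda>p. u \<le> cpoly_dim (linear_system d m p)) \<and>
    (q_char d m \<ge> 0 \<longrightarrow> int u = ell d m)"
  using assms
proof (induction "nat d" arbitrary: d m rule: less_induct)
  case less
  note dec = less.prems(1) and cr = less.prems(2)
  have le: "m j \<le> m i" if "1 \<le> i" "i \<le> j" "j \<le> 9" for i j using decreasing_le[OF dec that] .
  have md: "\<forall>i\<in>{1..9}. m i \<le> d" using le[of 1] less.prems(3) by fastforce
  have m123: "m 1 \<le> d" "m 2 \<le> d" "m 3 \<le> d" using md by auto
  have sum3: "m 1 + m 2 + m 3 \<le> 2 * d" using cr less.prems(5) by linarith
  have lower: "generic (\<lambda>p. u \<le> cpoly_dim (linear_system d m p))" if "int u = ell d m" for u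
    by (rule generic_mono[OF generic_lower_ell[OF md sum3]]) (use that in linarith)
  show ?case
  proof (cases "m 4 \<le> 0")
    case True
    have m4: "m i \<le> 0" if "i \<in> {4..9}" for i using le[of 4 i] that True by simp
    let ?u = "card (monomials d - (over d 1 (m 1) \<union> over d 2 (m 2) \<union> over d 3 (m 3)))"
    have z: "nat (m i + 2) choose 3 = 0" "nat (m 1 + m i - d + 1) choose 3 = 0" if "i \<in> {4..9}" for i
      using m4[OF that] m123(1) by (auto intro!: binomial_eq_0)
    have "int ?u = ell d m"
      unfolding toric3_card[OF m123 sum3] ell_def sum_9 sum_2_9
      by (simp add: z del: binomial_eq_0_iff One_nat_def)
    then show ?thesis using bounded_on_segre_three_points[of m d] m4 lower[of ?u] by blast
  next
    case False
    then have m4: "m 4 \<ge> 1" by simp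
    have m1: "m 1 \<ge> 1" using m4 le[of 1 4] by simp
    have planar: "planar_nonspecial d m"
      using dec less.prems(4) m123(1) m4 cr by (rule planar_nonspecial_general)
    show ?thesis
    proof (cases "m 1 = d")
      case True
      let ?u = "nat (max 0 (q_char d m))"
      \<comment> \<open>The residual system has degree \<open>d - 2\<close> and first multiplicity
        \<open>d - 1\<close>, so it is zero.\<close>
      have "bounded_on_segre (d - 2) (\<lambda>i. m i - 1) 0" by (rule bounded_on_segre_zero) (use True in simp)
      from bounded_on_segre_step[OF planar this] have b: "bounded_on_segre d m ?u" by simp
      have ell: "ell d m = q_char d m" by (rule ell_vertex[OF True m4 cr]) (use m1 True in simp)
      show ?thesis
      proof (cases "q_char d m \<ge> 0")
        case True
        then have "int ?u = ell d m" using ell by simp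
        then show ?thesis using b lower[of ?u] by blast
      next
        case False
        then have "?u = 0" by simp
        then show ?thesis using b generic_mono[OF generic_minor3] False by (intro exI[of _ ?u]) simp
      qed
    next
      case False
      then have d: "m 1 \<le> d - 1" using m123 by simp
      let ?m = "\<lambda>i. m i - 1"
      have "nat (d - 2) < nat d" using d m1 by simp
      \<comment> \<open>The residual system is Cremona reduced again: both sides of the inequality
        drop by 4.\<close>
      moreover have "\<forall>i\<in>{1..8}. ?m i \<ge> ?m (i + 1)" by (intro ballI diff_right_mono bspec[OF dec])
      ultimately obtain u where u: "bounded_on_segre (d - 2) ?m u"
        "generic (\<lambda>p. u \<le> cpoly_dim (linear_system (d - 2) ?m p))" "q_char (d - 2) ?m \<ge> 0 \<longrightarrow> int u = ell (d - 2) ?m"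
        using less.hyps[of "d - 2" ?m] cr d less.prems(4) m4 by auto
      let ?u = "u + nat (max 0 (q_char d m))"
      have b: "bounded_on_segre d m ?u" by (rule bounded_on_segre_step[OF planar u(1)])
      show ?thesis
      proof (cases "q_char d m \<ge> 0")
        case True
        have "ell d m = q_char d m + ell (d - 2) ?m" by (rule ell_step) (use d m1 in simp)
        then have "int ?u = ell d m"
          using q_char_residual_nonneg[OF dec cr d m4 True] u(3) True by simp
        then show ?thesis using b lower[of ?u] by blast
      next
        case False
        \<comment> \<open>For \<open>q < 0\<close> the restriction adds nothing to the upper bound,
          and multiplication by the quadric gives the matching lower bound.\<close>
        have "generic (\<lambda>p. u \<le> cpoly_dim (linear_system d m p))"
        proof (rule generic_mono[OF u(2)])
          fix p assume "u \<le> cpoly_dim (linear_system (d - 2) ?m p)"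
          then show "u \<le> cpoly_dim (linear_system d m p)" using dim_residual_le[of d m p] by simp
        qed
        then show ?thesis using b False by (intro exI[of _ ?u]) simp
      qed
    qed
  qed
qed

text \<open>The case of degree 2 with all multiplicities 1, where \<open>q_char\<close> is 0 and
  \<open>ell\<close> is 1, bounds the dimension by 1. Existence of a quadric needs no
  generality.\<close>

lemma generic_unique_quadric: "generic (\<lambda>p. \<exists>Q. is_unique_quadric_through Q p)"
proof -
  have q: "q_char 2 (\<lambda>_. 1) = 0" unfolding q_char_def sum_9 by (simp add: numeral_eq_Suc)
  have ell: "ell 2 (\<lambda>_. 1) = 1" unfolding ell_def sum_9 sum_2_9 by (simp add: numeral_eq_Suc)
  obtain u where u: "bounded_on_segre 2 (\<lambda>_. 1) u" "q_char 2 (\<lambda>_. 1) \<ge> 0 \<longrightarrow> int u = ell 2 (\<lambda>_. 1)"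
    using generic_dimension[of "\<lambda>_. 1" 2] by auto
  have "u = 1" using u(2) q ell by simp
  then have "generic (\<lambda>p. cpoly_dim (linear_system 2 (\<lambda>_. 1) p) \<le> 1)"
    using bounded_on_segre_generic[OF u(1)] by simp
  then show ?thesis
  proof (rule generic_mono)
    fix p assume dim: "cpoly_dim (linear_system 2 (\<lambda>_. 1) p) \<le> 1"
    let ?W = "linear_system 2 (\<lambda>_. 1) p"
    obtain Q where Q: "Q \<noteq> 0" "Q \<in> ?W" using ex_quadric by blast
    have sub: "cpoly.subspace ?W" using fin_space_linear_system[of 2 "\<lambda>_. 1" p] unfolding fin_space_def by (rule conjunct1)
    have span: "cpoly_span {Q} \<subseteq> ?W" by (rule cpoly.span_minimal[OF _ sub]) (simp add: Q(2))
    have "?W \<subseteq> cpoly_span {Q}"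
    proof (rule ccontr)
      assume "\<not> ?W \<subseteq> cpoly_span {Q}"
      then obtain F where F: "F \<in> ?W" "F \<notin> cpoly_span {Q}" by blast
      have "fin_space (cpoly_span {Q})"
        by (rule fin_space_subset[OF fin_space_linear_system span cpoly.subspace_span])
      from dim_psubset_less[OF fin_space_linear_system this span F]
      have "cpoly_dim (cpoly_span {Q}) < 1" using dim by linarith
      moreover have "cpoly_dim (cpoly_span {Q}) = card {Q}"
        by (rule cpoly.dim_span_eq_card_independent) (use Q(1) in simp)
      ultimately show False by simp
    qed
    then have "is_unique_quadric_through Q p" unfolding is_unique_quadric_through_def using Q span by blast
    then show "\<exists>Q. is_unique_quadric_through Q p" ..
  qed
qed

theorem theorem5p8:
  fixes d :: int and m :: "nat \<Rightarrow> int"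
  assumes "d \<ge> m 1"
    and "\<forall>i\<in>{1..8}. m i \<ge> m (i + 1)"
    and "m 9 \<ge> 0"
    and "Max (m ` {1..9}) \<le> 8"
  shows "for_general_points (\<lambda>p.
    (\<exists>Q. is_unique_quadric_through Q p) \<and>
    (cremona_reduced d m \<longrightarrow>
      (q_char d m \<le> 0 \<longrightarrow>
        cpoly_dim (linear_system d m p) = cpoly_dim (residual_system d m p)) \<and>
      (q_char d m > 0 \<longrightarrow> linearly_nonspecial d m p)))"
proof (rule generic_for_general_points, rule generic_conj[OF generic_unique_quadric], cases "cremona_reduced d m")
  case False
  show "generic (\<lambda>p. cremona_reduced d m \<longrightarrow>
      (q_char d m \<le> 0 \<longrightarrow> cpoly_dim (linear_system d m p) = cpoly_dim (residual_system d m p)) \<and>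
      (q_char d m > 0 \<longrightarrow> linearly_nonspecial d m p))"
    by (rule generic_mono[OF generic_minor3]) (simp add: False)
next
  case True
  note dec = assms(2)
  have le: "m j \<le> m i" if "1 \<le> i" "i \<le> j" "j \<le> 9" for i j using decreasing_le[OF dec that] .
  have cr: "m 1 + m 2 + m 3 + m 4 \<le> 2 * d" using True by (simp add: cremona_reduced_def)
  have m8: "m 1 \<le> 8"
  proof -
    have "m 1 \<le> Max (m ` {1..9})" by (rule Max_ge) auto
    then show ?thesis using assms(4) by simp
  qed
  have nonneg: "0 \<le> m i" if "1 \<le> i" "i \<le> 9" for i using le[of i 9] that assms(3) by simp
  obtain u where u: "bounded_on_segre d m u" "generic (\<lambda>p. u \<le> cpoly_dim (linear_system d m p))"
    "q_char d m \<ge> 0 \<longrightarrow> int u = ell d m"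
    using generic_dimension[OF dec cr assms(1) m8 nonneg[of 4]] by auto
  have dim: "generic (\<lambda>p. cpoly_dim (linear_system d m p) = u)"
    by (rule generic_mono[OF generic_conj[OF u(2) bounded_on_segre_generic[OF u(1)]]]) simp
  show "generic (\<lambda>p. cremona_reduced d m \<longrightarrow>
      (q_char d m \<le> 0 \<longrightarrow> cpoly_dim (linear_system d m p) = cpoly_dim (residual_system d m p)) \<and>
      (q_char d m > 0 \<longrightarrow> linearly_nonspecial d m p))"
  proof (cases "q_char d m > 0")
    case True
    then have "linear_expected_dim d m = int u" using linear_expected_dim_ell[OF dec cr] u(3) by simp
    then show ?thesis using True by (intro generic_mono[OF dim]) (simp add: linearly_nonspecial_def)
  next
    case False
    \<comment> \<open>With at most three positive multiplicities \<open>q\<close> would be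
      positive.\<close>
    have m4: "m 4 \<ge> 1"
    proof (rule ccontr)
      assume "\<not> m 4 \<ge> 1"
      then have z: "\<forall>i\<in>{4..9}. m i \<le> 0" using le[of 4] by fastforce
      have "q_char d m > 0"
        by (rule q_char_three_points_pos) (use z le[of 1 2] le[of 1 3] assms(1) cr nonneg[of 1] nonneg[of 2] nonneg[of 3] nonneg[of 4] in auto)
      then show False using False by simp
    qed
    have m1: "m 1 \<ge> 1" using m4 le[of 1 4] by simp
    let ?m = "\<lambda>i. m i - 1"
    have planar: "planar_nonspecial d m" using dec m8 assms(1) m4 cr by (rule planar_nonspecial_general)
    \<comment> \<open>The number \<open>v\<close> is the general dimension of the residual system,
      known by induction or 0 when the first multiplicity equals the degree.\<close>
    have "\<exists>v. bounded_on_segre (d - 2) ?m v \<and> generic (\<lambda>p. v \<le> cpoly_dim (linear_system (d - 2) ?m p))"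
    proof (cases "m 1 = d")
      case True
      have "bounded_on_segre (d - 2) ?m 0" by (rule bounded_on_segre_zero) (use True in simp)
      moreover have "generic (\<lambda>p. 0 \<le> cpoly_dim (linear_system (d - 2) ?m p))"
        by (rule generic_mono[OF generic_minor3]) simp
      ultimately show ?thesis by blast
    next
      case False
      have "\<forall>i\<in>{1..8}. ?m i \<ge> ?m (i + 1)" by (intro ballI diff_right_mono bspec[OF dec])
      then show ?thesis using generic_dimension[of ?m "d - 2"] False assms(1) cr m8 m4 by auto
    qed
    then obtain v where v: "bounded_on_segre (d - 2) ?m v" "generic (\<lambda>p. v \<le> cpoly_dim (linear_system (d - 2) ?m p))"
      by blast
    \<comment> \<open>Since \<open>q \<le> 0\<close>, restriction adds nothing, so \<open>v\<close>
      also bounds the dimension of the full system; the embedding of the residual system closes the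
      circle.\<close>
    have "bounded_on_segre d m v" using bounded_on_segre_step[OF planar v(1)] False by simp
    from generic_conj[OF bounded_on_segre_generic[OF this] v(2)] show ?thesis
    proof (rule generic_mono)
      fix p assume "cpoly_dim (linear_system d m p) \<le> v \<and> v \<le> cpoly_dim (linear_system (d - 2) ?m p)"
      then have "cpoly_dim (linear_system d m p) = cpoly_dim (residual_system d m p)"
        using dim_residual_le[of d m p] unfolding residual_system_def by simp
      then show "cremona_reduced d m \<longrightarrow>
          (q_char d m \<le> 0 \<longrightarrow> cpoly_dim (linear_system d m p) = cpoly_dim (residual_system d m p)) \<and>
          (q_char d m > 0 \<longrightarrow> linearly_nonspecial d m p)"
        using False by simp
    qed
  qed
qed

end
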